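(* Let $\Phi,\Psi:\mathbb{R}\to\mathbb{R}$ be bounded (measurable) functions of compact support and let $\alpha,\beta\in\mathbb{R}$. For $\varepsilon,\nu>0$ let $$S_{\varepsilon\nu}=-\frac{d^2}{dx^2}+\frac{\alpha}{\varepsilon^2}\Phi\Bigl(\frac{x}{\varepsilon}\Bigr)+\frac{\beta}{\nu}\Psi\Bigl(\frac{x}{\nu}\Bigr),\qquad \operatorname{dom}S_{\varepsilon\nu}=W_2^2(\mathbb{R}),$$ in $L_2(\mathbb{R})$. Suppose that $\nu,\varepsilon\to0$ in such a way that the ratio $\nu/\varepsilon$ has a finite or infinite limit (i.e. $\nu/\varepsilon\to\ell$ for some $\ell\in[0,\infty]$). Then $S_{\varepsilon\nu}$ converges in the norm resolvent sense, i.e. for $z\in\mathbb{C}\setminus\mathbb{R}$ the resolvents $(S_{\varepsilon\nu}-z)^{-1}$ converge in the uniform operator topology to the resolvent of a limit operator, which is as follows. Non-resonant case. If the potential $\alpha\Phi$ does not possess a zero-energy resonance, then the limit operator is the direct sum $S_-\oplus S_+$ of the Dirichlet half-line Schrödinger operators. Resonant case. If $\alpha\Phi$ is resonant with half-bound state $u_\alpha$, then the limit operator $S$ is defined by $S\phi=-\phi''$ on the functions $\phi\in W_2^2(\mathbb{R}\setminus\{0\})$ satisfying $$\begin{pmatrix}\phi(+0)\\ \phi'(+0)\end{pmatrix}=\begin{pmatrix}\theta_\alpha(\Phi)&0\\ \beta\,\omega_\alpha(\Phi,\Psi)&\theta_\alpha(\Phi)^{-1}\end{pmatrix}\begin{pmatrix}\phi(-0)\\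 \phi'(-0)\end{pmatrix},$$ where $\theta_\alpha(\Phi)=u_\alpha^+/u_\alpha^-$, $u_\alpha^\pm=\lim_{x\to\pm\infty}u_\alpha(x)$, and (i) if $\nu/\varepsilon\to\infty$, then $$\omega_\alpha(\Phi,\Psi)=\frac{u_\alpha^+}{u_\alpha^-}\int_{0}^{\infty}\Psi(t)\,dt+\frac{u_\alpha^-}{u_\alpha^+}\int_{-\infty}^{0}\Psi(t)\,dt;$$ (ii) if $\nu/\varepsilon\to\lambda$ with $0<\lambda<\infty$, then $$\omega_\alpha(\Phi,\Psi)=\frac{1}{u_\alpha^-u_\alpha^+}\int_{\mathbb{R}}\Psi(t)\,u_\alpha^2(\lambda t)\,dt;$$ (iii) if $\nu/\varepsilon\to0$, then $$\omega_\alpha(\Phi,\Psi)=\frac{u_\alpha^2(0)}{u_\alpha^-u_\alpha^+}\int_{\mathbb{R}}\Psi(t)\,dt.$$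
   Context: The potential $\alpha\Phi$ is called resonant (equivalently, possesses a zero-energy resonance, or half-bound state) if there exists a nontrivial solution $u_\alpha$ of $-u''+\alpha\Phi u=0$ on $\mathbb{R}$ that is bounded on the whole line; $u_\alpha$ is called the half-bound state. It is unique up to a scalar factor and has nonzero limits $u_\alpha^\pm$ at $\pm\infty$ (it is real-valued up to a scalar factor and chosen real). $S_\pm=-d^2/dx^2$ in $L_2(\mathbb{R}_\pm)$, $\mathbb{R}_+=(0,\infty)$, $\mathbb{R}_-=(-\infty,0)$, with $\operatorname{dom}S_\pm=\{\phi\in W_2^2(\mathbb{R}_\pm):\phi(0)=0\}$. $W_2^2$ is the $L_2$-based Sobolev space of order 2. $\phi(\pm0)$, $\phi'(\pm0)$ denote one-sided limits at $0$. *)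

theory Defs
  imports "HOL-Analysis.Analysis"
begin

section \<open>The space \<open>L\<^sub>2\<close>\<close>

definition square_integrable_on :: "(real \<Rightarrow> complex) \<Rightarrow> real set \<Rightarrow> bool"
    (infixr "square'_integrable'_on" 46) where
  "f square_integrable_on I \<longleftrightarrow>
     set_borel_measurable lebesgue I f \<and> set_integrable lebesgue I (\<lambda>x. (norm (f x))\<^sup>2)"

lemma square_integrable_on_UNIV:
  "f square_integrable_on UNIV \<longleftrightarrow>
     f \<in> borel_measurable lebesgue \<and> integrable lebesgue (\<lambda>x. (norm (f x))\<^sup>2)"
  by (simp add: square_integrable_on_def set_borel_measurable_def set_integrable_def)

lemma square_integrable_add:
  assumes "f square_integrable_on UNIV" "g square_integrable_on UNIV"
  shows "(\<lambda>x. f x + g x) square_integrable_on UNIV"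
proof -
  have [measurable]: "f \<in> borel_measurable lebesgue" "g \<in> borel_measurable lebesgue"
    using assms by (auto simp: square_integrable_on_UNIV)
  have int: "integrable lebesgue (\<lambda>x. 2 * (norm (f x))\<^sup>2 + 2 * (norm (g x))\<^sup>2)"
    using assms by (auto simp: square_integrable_on_UNIV)
  have le: "(norm (f x + g x))\<^sup>2 \<le> 2 * (norm (f x))\<^sup>2 + 2 * (norm (g x))\<^sup>2" for x
  proof -
    have "(norm (f x + g x))\<^sup>2 \<le> (norm (f x) + norm (g x))\<^sup>2"
      by (intro power_mono norm_triangle_ineq) auto
    also have "\<dots> \<le> 2 * (norm (f x))\<^sup>2 + 2 * (norm (g x))\<^sup>2"
      using sum_squares_bound[of "norm (f x)" "norm (g x)"] by (simp add: power2_sum)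
    finally show ?thesis .
  qed
  have "integrable lebesgue (\<lambda>x. (norm (f x + g x))\<^sup>2)"
    by (rule Bochner_Integration.integrable_bound[OF int])
       (simp, rule AE_I2, simp, rule le)
  then show ?thesis by (auto simp: square_integrable_on_UNIV)
qed

lemma square_integrable_mult:
  assumes "f square_integrable_on UNIV"
  shows "(\<lambda>x. c * f x) square_integrable_on UNIV"
  using assms by (auto simp: square_integrable_on_UNIV norm_mult power_mult_distrib)

lemma square_integrable_scaleR:
  assumes "f square_integrable_on UNIV"
  shows "(\<lambda>x. r *\<^sub>R f x) square_integrable_on UNIV"
  using square_integrable_mult[OF assms, of "of_real r"] by (simp add: scaleR_conv_of_real)

lemma square_integrable_uminus:
  assumes "f square_integrable_on UNIV"
  shows "(\<lambda>x. - f x) square_integrable_on UNIV"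
  using square_integrable_mult[OF assms, of "-1"] by simp

lemma square_integrable_diff:
  assumes "f square_integrable_on UNIV" "g square_integrable_on UNIV"
  shows "(\<lambda>x. f x - g x) square_integrable_on UNIV"
  using square_integrable_add[OF assms(1) square_integrable_uminus[OF assms(2)]] by simp

lemma square_integrable_zero: "(\<lambda>x. 0) square_integrable_on UNIV"
  by (simp add: square_integrable_on_UNIV)

lemma square_integrable_inner:
  assumes "f square_integrable_on UNIV" "g square_integrable_on UNIV"
  shows "integrable lebesgue (\<lambda>x. inner (f x) (g x))"
proof -
  have [measurable]: "f \<in> borel_measurable lebesgue" "g \<in> borel_measurable lebesgue"
    using assms by (auto simp: square_integrable_on_UNIV)
  have int: "integrable lebesgue (\<lambda>x. (norm (f x))\<^sup>2 + (norm (g x))\<^sup>2)"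
    using assms by (auto simp: square_integrable_on_UNIV)
  have le: "\<bar>inner (f x) (g x)\<bar> \<le> (norm (f x))\<^sup>2 + (norm (g x))\<^sup>2" for x
  proof -
    have "\<bar>inner (f x) (g x)\<bar> \<le> norm (f x) * norm (g x)"
      by (rule Cauchy_Schwarz_ineq2)
    also have "\<dots> \<le> 2 * norm (f x) * norm (g x)" by simp
    also have "\<dots> \<le> (norm (f x))\<^sup>2 + (norm (g x))\<^sup>2" by (rule sum_squares_bound)
    finally show ?thesis .
  qed
  show ?thesis
    by (rule Bochner_Integration.integrable_bound[OF int])
       (simp, rule AE_I2, simp, rule le)
qed

quotient_type l2 = "real \<Rightarrow> complex" / partial:
  "\<lambda>f g. f square_integrable_on UNIV \<and> g square_integrable_on UNIV \<and> (AE x in lebesgue. f x = g x)"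
proof (rule part_equivpI)
  show "\<exists>f. f square_integrable_on UNIV \<and> f square_integrable_on UNIV
          \<and> (AE x in lebesgue. f x = f x)"
    using square_integrable_zero by auto
qed (auto intro!: sympI transpI)

text \<open>\<open>abs_l2 f\<close> is the almost-everywhere class of a square integrable function \<open>f\<close>. The real
  inner product below is the real part of the usual sesquilinear one; it induces the usual norm.\<close>

instantiation l2 :: real_vector
begin

lift_definition zero_l2 :: l2 is "\<lambda>x. 0"
  by (simp add: square_integrable_zero)

lift_definition plus_l2 :: "l2 \<Rightarrow> l2 \<Rightarrow> l2" is "\<lambda>f g x. f x + g x"
  by (auto intro: square_integrable_add)

lift_definition minus_l2 :: "l2 \<Rightarrow> l2 \<Rightarrow> l2" is "\<lambda>f g x. f x - g x"
  by (auto intro: square_integrable_diff)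

lift_definition uminus_l2 :: "l2 \<Rightarrow> l2" is "\<lambda>f x. - f x"
  by (auto intro: square_integrable_uminus)

lift_definition scaleR_l2 :: "real \<Rightarrow> l2 \<Rightarrow> l2" is "\<lambda>r f x. r *\<^sub>R f x"
  by (auto intro: square_integrable_scaleR)

instance
proof
  fix f g h :: l2 and r s :: real
  show "f + g + h = f + (g + h)"
    by transfer (simp add: add.assoc square_integrable_add)
  show "f + g = g + f"
    by transfer (simp add: add.commute square_integrable_add)
  show "0 + f = f"
    by transfer auto
  show "- f + f = 0"
    by transfer (auto simp: square_integrable_zero)
  show "f - g = f + - g"
    by transfer (auto intro: square_integrable_diff)
  show "r *\<^sub>R (f + g) = r *\<^sub>R f + r *\<^sub>R g"
    by transfer (simp add: scaleR_right_distrib square_integrable_add square_integrable_scaleR)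
  show "(r + s) *\<^sub>R f = r *\<^sub>R f + s *\<^sub>R f"
    by transfer (simp add: scaleR_left_distrib square_integrable_add square_integrable_scaleR)
  show "r *\<^sub>R s *\<^sub>R f = (r * s) *\<^sub>R f"
    by transfer (simp add: square_integrable_scaleR)
  show "1 *\<^sub>R f = f"
    by transfer auto
qed

end

instantiation l2 :: real_inner
begin

lift_definition inner_l2 :: "l2 \<Rightarrow> l2 \<Rightarrow> real" is
  "\<lambda>f g. LINT x|lebesgue. inner (f x) (g x)"
  by (rule integral_cong_AE)
     (auto simp: square_integrable_on_UNIV intro!: borel_measurable_inner)

lift_definition norm_l2 :: "l2 \<Rightarrow> real" is
  "\<lambda>f. sqrt (LINT x|lebesgue. (norm (f x))\<^sup>2)"
  by (rule arg_cong[where f = sqrt], rule integral_cong_AE)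
     (auto simp: square_integrable_on_UNIV)

definition dist_l2 :: "l2 \<Rightarrow> l2 \<Rightarrow> real" where
  "dist_l2 f g = norm (f - g)"

definition sgn_l2 :: "l2 \<Rightarrow> l2" where
  "sgn_l2 f = f /\<^sub>R norm f"

definition uniformity_l2 :: "(l2 \<times> l2) filter" where
  "uniformity_l2 = (INF e\<in>{0 <..}. principal {(f, g). dist f g < e})"

definition open_l2 :: "l2 set \<Rightarrow> bool" where
  "open_l2 U \<longleftrightarrow> (\<forall>x\<in>U. \<forall>\<^sub>F (x', y) in uniformity. x' = x \<longrightarrow> y \<in> U)"

instance
proof
  fix f g h :: l2 and r s :: real and U :: "l2 set"
  show "dist f g = norm (f - g)"
    by (rule dist_l2_def)
  show "sgn f = f /\<^sub>R norm f"
    by (rule sgn_l2_def)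
  show "uniformity = (INF e\<in>{0 <..}. principal {(f :: l2, g). dist f g < e})"
    by (rule uniformity_l2_def)
  show "open U \<longleftrightarrow> (\<forall>x\<in>U. \<forall>\<^sub>F (x', y) in uniformity. x' = x \<longrightarrow> y \<in> U)"
    by (rule open_l2_def)
  show "inner f g = inner g f"
    by transfer (simp add: inner_commute)
  show "inner (f + g) h = inner f h + inner g h"
    by transfer (simp add: inner_add_left square_integrable_inner)
  show "inner (r *\<^sub>R f) g = r * inner f g"
    by transfer simp
  show "0 \<le> inner f f"
    by transfer simp
  show "inner f f = 0 \<longleftrightarrow> f = 0"
    by transfer (auto simp: integral_nonneg_eq_0_iff_AE square_integrable_inner square_integrable_zero)
  show "norm f = sqrt (inner f f)"
    by transfer (simp add: power2_norm_eq_inner)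
qed

end

lift_definition scaleC_l2 :: "complex \<Rightarrow> l2 \<Rightarrow> l2" (infixr "*\<^sub>C" 75) is "\<lambda>c f x. c * f x"
  by (auto intro: square_integrable_mult)


section \<open>Resolvents and norm resolvent convergence\<close>

text \<open>An unbounded operator in \<open>L\<^sub>2(\<real>)\<close> is represented by its graph. Bounded operators are elements
  of \<^typ>\<open>l2 \<Rightarrow>\<^sub>L l2\<close>, whose norm topology is the uniform operator topology; a bounded everywhere
  defined inverse of \<open>A - z\<close> is automatically complex linear when \<open>A\<close> is.\<close>

definition is_resolvent :: "l2 rel \<Rightarrow> complex \<Rightarrow> (l2 \<Rightarrow>\<^sub>L l2) \<Rightarrow> bool" where
  "is_resolvent A z R \<longleftrightarrow>
     (\<forall>f h. blinfun_apply R f = h \<longleftrightarrow> (\<exists>g. (h, g) \<in> A \<and> g - z *\<^sub>C h = f))"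

definition resolvent_set :: "l2 rel \<Rightarrow> complex set" where
  "resolvent_set A = {z. \<exists>R. is_resolvent A z R}"

definition resolvent :: "l2 rel \<Rightarrow> complex \<Rightarrow> (l2 \<Rightarrow>\<^sub>L l2)" where
  "resolvent A z = (THE R. is_resolvent A z R)"

lemma resolvent_eq: "is_resolvent A z R \<Longrightarrow> resolvent A z = R"
  unfolding resolvent_def
  by (rule the_equality) (assumption, rule blinfun_eqI, metis is_resolvent_def)

definition norm_resolvent_convergence :: "('i \<Rightarrow> l2 rel) \<Rightarrow> l2 rel \<Rightarrow> 'i filter \<Rightarrow> bool" where
  "norm_resolvent_convergence A S F \<longleftrightarrow>
     (\<forall>z. z \<notin> \<real> \<longrightarrow>
        z \<in> resolvent_set S \<and> (\<forall>\<^sub>F i in F. z \<in> resolvent_set (A i)) \<and>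
        ((\<lambda>i. resolvent (A i) z) \<longlongrightarrow> resolvent S z) F)"


section \<open>Sobolev spaces\<close>

definition compactly_supported_in :: "(real \<Rightarrow> real) \<Rightarrow> real set \<Rightarrow> bool"
    (infix "compactly'_supported'_in" 50) where
  "f compactly_supported_in I \<longleftrightarrow>
     compact (closure {x. f x \<noteq> 0}) \<and> closure {x. f x \<noteq> 0} \<subseteq> I"

definition test_function :: "real set \<Rightarrow> (real \<Rightarrow> real) \<Rightarrow> bool" where
  "test_function I \<phi> \<longleftrightarrow>
     (\<forall>k x. (deriv ^^ k) \<phi> differentiable (at x)) \<and> \<phi> compactly_supported_in I"

definition weak_derivative :: "real set \<Rightarrow> (real \<Rightarrow> complex) \<Rightarrow> (real \<Rightarrow> complex) \<Rightarrow> bool" where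
  "weak_derivative I f g \<longleftrightarrow>
     (\<forall>\<phi>. test_function I \<phi> \<longrightarrow>
        (LINT x:I|lebesgue. deriv \<phi> x *\<^sub>R f x) = - (LINT x:I|lebesgue. \<phi> x *\<^sub>R g x))"

text \<open>\<open>f \<in> W\<^sub>2\<^sup>2(I)\<close> (\<open>I\<close> open) with second weak derivative \<open>f2\<close>:\<close>

definition W22_derivative :: "real set \<Rightarrow> (real \<Rightarrow> complex) \<Rightarrow> (real \<Rightarrow> complex) \<Rightarrow> bool" where
  "W22_derivative I f f2 \<longleftrightarrow>
     f square_integrable_on I \<and> f2 square_integrable_on I \<and>
     (\<exists>f1. f1 square_integrable_on I \<and> weak_derivative I f f1 \<and> weak_derivative I f1 f2)"


section \<open>The operators\<close>

text \<open>Passage from a set of pairs of functions to the graph of an operator in \<open>L\<^sub>2(\<real>)\<close>.\<close>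

definition l2_graph :: "(real \<Rightarrow> complex) rel \<Rightarrow> l2 rel" where
  "l2_graph G = {(abs_l2 f, abs_l2 g) | f g.
     (f, g) \<in> G \<and> f square_integrable_on UNIV \<and> g square_integrable_on UNIV}"

definition schroedinger :: "(real \<Rightarrow> real) \<Rightarrow> l2 rel" where
  "schroedinger V =
     l2_graph {(f, \<lambda>x. - f2 x + V x *\<^sub>R f x) | f f2. W22_derivative UNIV f f2}"

definition scaled_operator ::
    "(real \<Rightarrow> real) \<Rightarrow> (real \<Rightarrow> real) \<Rightarrow> real \<Rightarrow> real \<Rightarrow> real \<Rightarrow> real \<Rightarrow> l2 rel" where
  "scaled_operator \<Phi> \<Psi> \<alpha> \<beta> \<epsilon> \<nu> =
     schroedinger (\<lambda>x. \<alpha> / \<epsilon>\<^sup>2 * \<Phi> (x / \<epsilon>) + \<beta> / \<nu> * \<Psi> (x / \<nu>))"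

text \<open>Boundary values at \<open>0\<close> refer to the continuously differentiable representative of a
  \<open>W\<^sub>2\<^sup>2\<close> class; this is why the functions in the next two definitions are required to be \<open>C\<^sup>1\<close>.
  In the first one only the values on the half-line \<open>I\<close> matter: functions stand for elements of
  \<open>L\<^sub>2(I)\<close>.\<close>

definition dirichlet :: "real set \<Rightarrow> (real \<Rightarrow> complex) rel" where
  "dirichlet I = {(f, \<lambda>x. - f2 x) | f f2.
     W22_derivative I f f2 \<and> f C1_differentiable_on I \<and> (f \<longlongrightarrow> 0) (at 0 within I)}"

text \<open>The direct sum of operators in \<open>L\<^sub>2(\<real>\<^sub>-)\<close> and \<open>L\<^sub>2(\<real>\<^sub>+)\<close> under
  \<open>L\<^sub>2(\<real>\<^sub>-) \<oplus> L\<^sub>2(\<real>\<^sub>+) = L\<^sub>2(\<real>)\<close>.\<close>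

definition glue :: "(real \<Rightarrow> complex) \<Rightarrow> (real \<Rightarrow> complex) \<Rightarrow> real \<Rightarrow> complex" where
  "glue f g x = (if x < 0 then f x else if x > 0 then g x else 0)"

definition direct_sum :: "(real \<Rightarrow> complex) rel \<Rightarrow> (real \<Rightarrow> complex) rel \<Rightarrow> l2 rel" where
  "direct_sum A B =
     l2_graph {(glue f1 f2, glue g1 g2) | f1 f2 g1 g2. (f1, g1) \<in> A \<and> (f2, g2) \<in> B}"

definition point_interaction :: "real ^ 2 ^ 2 \<Rightarrow> l2 rel" where
  "point_interaction M = l2_graph {(f, \<lambda>x. - f2 x) | f f2.
     W22_derivative (- {0}) f f2 \<and> f C1_differentiable_on (- {0}) \<and>
     (\<exists>a a' b b'.
        (f \<longlongrightarrow> a) (at_left 0) \<and> ((\<lambda>x. vector_derivative f (at x)) \<longlongrightarrow> a') (at_left 0) \<and>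
        (f \<longlongrightarrow> b) (at_right 0) \<and> ((\<lambda>x. vector_derivative f (at x)) \<longlongrightarrow> b') (at_right 0) \<and>
        vector [b, b'] = map_matrix complex_of_real M *v (vector [a, a'] :: complex ^ 2))}"


section \<open>Zero-energy resonances\<close>

text \<open>Solutions of \<open>- u'' + V u = 0\<close> on \<open>\<real>\<close> for measurable \<open>V\<close>: \<open>u\<close> is \<open>C\<^sup>1\<close>, \<open>u'\<close> is locally
  absolutely continuous, and the equation holds almost everywhere.\<close>

definition zero_energy_solution ::
    "(real \<Rightarrow> real) \<Rightarrow> (real \<Rightarrow> 'a::{banach, second_countable_topology}) \<Rightarrow> bool" where
  "zero_energy_solution V u \<longleftrightarrow>
     (\<exists>u'. (\<forall>x. (u has_vector_derivative u' x) (at x)) \<and>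
       (\<forall>a b. a \<le> b \<longrightarrow>
          set_integrable lebesgue {a..b} (\<lambda>x. V x *\<^sub>R u x) \<and>
          u' b - u' a = (LINT x:{a..b}|lebesgue. V x *\<^sub>R u x)))"

definition half_bound_state ::
    "(real \<Rightarrow> real) \<Rightarrow> (real \<Rightarrow> 'a::{banach, second_countable_topology}) \<Rightarrow> bool" where
  "half_bound_state V u \<longleftrightarrow>
     zero_energy_solution V u \<and> bounded (range u) \<and> (\<exists>x. u x \<noteq> 0)"

definition resonant :: "(real \<Rightarrow> real) \<Rightarrow> bool" where
  "resonant V \<longleftrightarrow> (\<exists>u :: real \<Rightarrow> complex. half_bound_state V u)"

text \<open>The limits of a half-bound state \<open>u\<close> at plus and minus infinity.\<close>

abbreviation lim_plus :: "(real \<Rightarrow> real) \<Rightarrow> real" where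
  "lim_plus u \<equiv> Lim at_top u"

abbreviation lim_minus :: "(real \<Rightarrow> real) \<Rightarrow> real" where
  "lim_minus u \<equiv> Lim at_bot u"

definition theta :: "(real \<Rightarrow> real) \<Rightarrow> real" where
  "theta u = lim_plus u / lim_minus u"

text \<open>\<open>l \<in> [0, \<infinity>]\<close> is the limit of \<open>\<nu> / \<epsilon>\<close>.\<close>

definition omega :: "ereal \<Rightarrow> (real \<Rightarrow> real) \<Rightarrow> (real \<Rightarrow> real) \<Rightarrow> real" where
  "omega l u \<Psi> =
     (if l = \<infinity> then
        lim_plus u / lim_minus u * (LINT t:{0<..}|lebesgue. \<Psi> t)
        + lim_minus u / lim_plus u * (LINT t:{..<0}|lebesgue. \<Psi> t)
      else if l = 0 then
        (u 0)\<^sup>2 / (lim_minus u * lim_plus u) * (LINT t|lebesgue. \<Psi> t)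
      else
        1 / (lim_minus u * lim_plus u)
        * (LINT t|lebesgue. \<Psi> t * (u (real_of_ereal l * t))\<^sup>2))"

end

theory Submission
  imports Defs
begin

text \<open>
  Fix a non-real \<open>z\<close>, let \<open>k\<close> be the square root of \<open>-z\<close> with positive real part, and compare
  \<open>h = (S\<^bsub>\<epsilon>\<nu>\<^esub> - z)\<^sup>-\<^sup>1 f\<close> with \<open>\<phi> = (S - z)\<^sup>-\<^sup>1 f\<close>, where \<open>S\<close> is the proposed limit. Both potentials vanish
  outside \<open>[-a, a]\<close> with \<open>a = R (\<epsilon> + \<nu>)\<close>. There \<open>h\<close> and \<open>\<phi>\<close> solve the same equation
  \<open>y'' = k\<^sup>2 y - f\<close>, so \<open>h - \<phi>\<close> is a multiple of \<open>exp (-k \<bar>x\<bar>)\<close> on each side, and its norm is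
  controlled by its values at \<open>-a\<close> and \<open>a\<close> together with a contribution of order \<open>sqrt a\<close> from the
  short interval (lemma \<open>outer_comparison\<close>). It remains to see how boundary data are transmitted across
  \<open>[-a, a]\<close>. Write the equation there as \<open>h'' = \<epsilon>\<^sup>-\<^sup>2 \<alpha> \<Phi>(x/\<epsilon>) h + q\<close> with
  \<open>q = (\<nu>\<^sup>-\<^sup>1 \<beta> \<Psi>(x/\<nu>) - z) h - f\<close>: the integral of \<open>\<bar>q\<bar>\<close> is bounded by a multiple of
  \<open>sup \<bar>h\<bar> + \<parallel>f\<parallel>\<close> uniformly in \<open>\<epsilon>\<close> and \<open>\<nu>\<close>, and Lagrange's identity with rescaled zero-energy
  solutions of \<open>\<alpha> \<Phi>\<close> turns this into information on \<open>h\<close>.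

  Without a resonance, the solution which is constant on the right and the one which is constant on
  the left are independent; after rescaling their Wronskian is of order \<open>1/\<epsilon>\<close>, which forces
  \<open>h = O(\<epsilon> + \<nu>)\<close> on \<open>[-a, a]\<close>, that is, Dirichlet conditions in the limit
  (\<open>interior_bound_nonresonant\<close>, \<open>nonresonant_estimate\<close>).

  With a half-bound state \<open>u\<close>, \<open>h\<close> is close to a multiple of \<open>u(x/\<epsilon>)\<close>. Hence
  \<open>h(a)\<close> is close to \<open>\<theta> h(-a)\<close>, and Lagrange's identity with \<open>u(x/\<epsilon>)\<close> itself gives
  \<open>u\<^sup>+ h'(a) - u\<^sup>- h'(-a) = \<integral> q u(x/\<epsilon>) dx\<close>, which is close to
  \<open>(h(-a) / u\<^sup>-) J(\<nu>/\<epsilon>)\<close> with \<open>J(s) = \<integral> \<beta> \<Psi>(t) u(s t)\<^sup>2 dt\<close>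
  (\<open>resonant_interior\<close>). These are approximate versions of the point interaction conditions, and the
  error in them bounds \<open>h - \<phi>\<close> at \<open>-a\<close> and \<open>a\<close>, because the determinant
  \<open>k \<theta> + k / \<theta> + \<beta> \<omega>\<close> of the resulting linear system has a nonzero imaginary part
  (\<open>resonant_estimate\<close>). Up to the factor \<open>1 / (u\<^sup>- u\<^sup>+)\<close>, the three formulas for \<open>\<omega>\<close> are the
  limits of \<open>\<integral> \<Psi>(t) u(s t)\<^sup>2 dt\<close> at infinity, at a positive number and at zero, by dominated convergence (\<open>omega_limit\<close>).

  On the side of the operators, the du Bois-Reymond lemma identifies all graphs in question with
  operators of one kind: twice differentiable functions on the two half-lines, coupled by two linear
  conditions at the origin (\<open>boundary_operator\<close>). For these the resolvent exists
  (\<open>boundary_operator_resolvent\<close>): the symmetry of the coupling gives the bound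
  \<open>\<bar>Im z\<bar> \<parallel>\<phi>\<parallel> \<le> \<parallel>(S - z) \<phi>\<parallel>\<close>, and the equation is solved by fitting decaying solutions on
  the two half-lines to the two conditions.
\<close>

section \<open>Primitives of locally integrable functions\<close>

text \<open>Absolute continuity in the form in which it is used throughout: the fundamental theorem of calculus
  with an absolutely integrable derivative that is determined only up to null sets.\<close>

definition primitive :: "(real \<Rightarrow> complex) \<Rightarrow> (real \<Rightarrow> complex) \<Rightarrow> bool" where
  "primitive G g \<longleftrightarrow> (\<forall>a b. a \<le> b \<longrightarrow>
     g absolutely_integrable_on {a..b} \<and> G b - G a = integral {a..b} g)"

lemma primitiveD:
  assumes "primitive G g"
  shows "g absolutely_integrable_on {a..b}" "g integrable_on {a..b}"
    "a \<le> b \<Longrightarrow> integral {a..b} g = G b - G a"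
proof -
  show *: "g absolutely_integrable_on {a..b}"
    using assms by (cases "a \<le> b") (auto simp: primitive_def set_integrable_def)
  show "g integrable_on {a..b}" using set_lebesgue_integral_eq_integral(1)[OF *] .
  show "a \<le> b \<Longrightarrow> integral {a..b} g = G b - G a" using assms by (auto simp: primitive_def)
qed

lemma primitive_has_integral:
  assumes "primitive G g" "a \<le> b"
  shows "(g has_integral G b - G a) {a..b}"
  using integrable_integral[OF primitiveD(2)[OF assms(1), of a b]] primitiveD(3)[OF assms] by simp

lemma primitive_isCont:
  assumes "primitive G g" shows "isCont G x"
proof -
  have "continuous_on {x-1..x+1} (\<lambda>t. G (x-1) + integral {x-1..t} g)"
    by (intro continuous_intros indefinite_integral_continuous_1 primitiveD(2)[OF assms])
  moreover have "G (x-1) + integral {x-1..t} g = G t" if "t \<in> {x-1..x+1}" for t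
    using primitiveD(3)[OF assms, of "x-1" t] that by simp
  ultimately have "continuous_on {x-1..x+1} G" by (rule continuous_on_eq)
  then show ?thesis by (rule continuous_on_interior) auto
qed

lemma primitive_continuous: "primitive G g \<Longrightarrow> continuous_on A G"
  by (simp add: continuous_at_imp_continuous_on primitive_isCont)

lemma primitive_measurable: "primitive G g \<Longrightarrow> G \<in> borel_measurable lebesgue"
  using borel_measurable_continuous_onI[OF primitive_continuous[of G g UNIV]]
  by (simp add: measurable_completion)

lemma set_integrable_mult_bounded:
  fixes F g :: "real \<Rightarrow> complex"
  assumes "F \<in> borel_measurable lebesgue" "\<And>x. x \<in> S \<Longrightarrow> norm (F x) \<le> B" "g absolutely_integrable_on S"
  shows "(\<lambda>x. F x * g x) absolutely_integrable_on S"
  unfolding set_integrable_def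
proof (rule Bochner_Integration.integrable_bound)
  have i: "integrable lebesgue (\<lambda>x. indicator S x *\<^sub>R g x)"
    using assms(3) by (simp add: set_integrable_def)
  then show "integrable lebesgue (\<lambda>x. B *\<^sub>R (indicator S x *\<^sub>R g x))" by (rule integrable_scaleR_right)
  have eq: "(\<lambda>x. indicator S x *\<^sub>R (F x * g x)) = (\<lambda>x. F x * (indicator S x *\<^sub>R g x))" by auto
  show "(\<lambda>x. indicator S x *\<^sub>R (F x * g x)) \<in> borel_measurable lebesgue"
    unfolding eq by (intro borel_measurable_times assms(1) borel_measurable_integrable i)
  show "AE x in lebesgue. norm (indicator S x *\<^sub>R (F x * g x)) \<le> norm (B *\<^sub>R (indicator S x *\<^sub>R g x))"
  proof (rule AE_I2)
    fix x show "norm (indicator S x *\<^sub>R (F x * g x)) \<le> norm (B *\<^sub>R (indicator S x *\<^sub>R g x))"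
      using assms(2)[of x] by (cases "x \<in> S") (auto simp: norm_mult intro!: mult_right_mono)
  qed
qed

lemma set_integrable_mult_continuous:
  fixes F g :: "real \<Rightarrow> complex"
  assumes "continuous_on UNIV F" "g absolutely_integrable_on {a..b}"
  shows "(\<lambda>x. F x * g x) absolutely_integrable_on {a..b}"
proof -
  have "bounded (F ` {a..b})"
    by (intro compact_imp_bounded compact_continuous_image continuous_on_subset[OF assms(1)]) auto
  then obtain B where "\<And>x. x \<in> {a..b} \<Longrightarrow> norm (F x) \<le> B" by (auto simp: bounded_iff simp del: atLeastAtMost_iff)
  then show ?thesis
    using borel_measurable_continuous_onI[OF assms(1)] assms(2)
    by (intro set_integrable_mult_bounded) (auto simp: measurable_completion)
qed

lemma primitive_add:
  assumes F: "primitive F f" and G: "primitive G g"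
  shows "primitive (\<lambda>x. F x + G x) (\<lambda>x. f x + g x)"
  unfolding primitive_def
proof (intro allI impI conjI)
  fix a b :: real assume "a \<le> b"
  show "(\<lambda>x. f x + g x) absolutely_integrable_on {a..b}"
    by (intro set_integral_add(1) primitiveD(1)[OF F] primitiveD(1)[OF G])
  show "F b + G b - (F a + G a) = integral {a..b} (\<lambda>x. f x + g x)"
    using integral_add[OF primitiveD(2)[OF F, of a b] primitiveD(2)[OF G, of a b]]
      primitiveD(3)[OF F \<open>a \<le> b\<close>] primitiveD(3)[OF G \<open>a \<le> b\<close>] by simp
qed

lemma primitive_cmult:
  assumes F: "primitive F f" shows "primitive (\<lambda>x. c * F x) (\<lambda>x. c * f x)"
  unfolding primitive_def
proof (intro allI impI conjI)
  fix a b :: real assume "a \<le> b"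
  show "(\<lambda>x. c * f x) absolutely_integrable_on {a..b}"
    by (rule set_integrable_mult_continuous) (auto intro: primitiveD(1)[OF F])
  show "c * F b - c * F a = integral {a..b} (\<lambda>x. c * f x)"
    using primitiveD(3)[OF F \<open>a \<le> b\<close>] by (simp add: right_diff_distrib)
qed

lemma primitive_diff:
  assumes "primitive F f" "primitive G g" shows "primitive (\<lambda>x. F x - G x) (\<lambda>x. f x - g x)"
  using primitive_add[OF assms(1) primitive_cmult[OF assms(2), of "-1"]] by simp

lemma primitive_uminus: "primitive F f \<Longrightarrow> primitive (\<lambda>x. - F x) (\<lambda>x. - f x)"
  using primitive_cmult[of F f "-1"] by simp

lemma primitive_cong_AE:
  assumes "primitive F f" "AE x in lebesgue. f x = g x"
  shows "primitive F g"
proof -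
  obtain N where N: "negligible N" "{x. f x \<noteq> g x} \<subseteq> N"
    using assms(2) by (auto simp: eventually_ae_filter negligible_iff_null_sets)
  then have n: "negligible {x. f x \<noteq> g x}" by (rule negligible_subset)
  have "g absolutely_integrable_on {a..b}" for a b
    by (rule absolutely_integrable_spike[OF primitiveD(1)[OF assms(1)] n]) auto
  moreover have "integral {a..b} g = integral {a..b} f" for a b
    by (rule integral_spike[OF n]) auto
  ultimately show ?thesis using primitiveD[OF assms(1)] by (auto simp: primitive_def)
qed

lemma primitive_C1:
  assumes "\<And>x. (F has_vector_derivative F1 x) (at x)" "continuous_on UNIV F1"
  shows "primitive F F1"
  unfolding primitive_def
proof (intro allI impI conjI)
  fix a b :: real assume "a \<le> b"
  show "F1 absolutely_integrable_on {a..b}"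
    by (intro absolutely_integrable_continuous_real continuous_on_subset[OF assms(2)]) auto
  have "(F1 has_integral F b - F a) {a..b}"
    by (rule fundamental_theorem_of_calculus[OF \<open>a \<le> b\<close>]) (rule has_vector_derivative_at_within[OF assms(1)])
  then show "F b - F a = integral {a..b} F1" by (simp add: integral_unique)
qed

lemma primitive_has_derivative:
  assumes "primitive F F1" "continuous_on UNIV F1"
  shows "(F has_vector_derivative F1 x) (at x)"
proof -
  have "((\<lambda>t. integral {x-1..t} F1) has_vector_derivative F1 x) (at x within {x-1..x+1})"
    by (rule integral_has_vector_derivative) (auto intro: continuous_on_subset[OF assms(2)])
  from has_vector_derivative_add[OF has_vector_derivative_const[of "F (x-1)"] this]
  have "((\<lambda>t. F (x-1) + integral {x-1..t} F1) has_vector_derivative F1 x) (at x within {x-1..x+1})"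
    by simp
  then have "(F has_vector_derivative F1 x) (at x within {x-1..x+1})"
  proof (rule has_vector_derivative_transform_within[where d=1])
    fix t assume "t \<in> {x-1..x+1}"
    then show "F (x-1) + integral {x-1..t} F1 = F t"
      using primitiveD(3)[OF assms(1), of "x-1" t] by simp
  qed auto
  then show ?thesis using at_within_Icc_at[of "x-1" x "x+1"] by simp
qed

lemma primitive_ex:
  assumes "\<And>a b. g absolutely_integrable_on {a..b}"
  shows "\<exists>G. primitive G g \<and> G x0 = c"
proof -
  define G where "G x = c + (if x0 \<le> x then integral {x0..x} g else - integral {x..x0} g)" for x
  have i: "g integrable_on {a..b}" for a b
    by (rule set_lebesgue_integral_eq_integral(1)[OF assms])
  have c: "integral {a..b} g + integral {b..d} g = integral {a..d} g" if "a \<le> b" "b \<le> d" for a b d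
    using Henstock_Kurzweil_Integration.integral_combine[OF that i] .
  have "G b - G a = integral {a..b} g" if "a \<le> b" for a b
    using c[of x0 a b] c[of a x0 b] c[of a b x0] that by (auto simp: G_def algebra_simps)
  then have "primitive G g" using assms by (auto simp: primitive_def)
  moreover have "G x0 = c" by (simp add: G_def)
  ultimately show ?thesis by blast
qed

text \<open>Integration by parts with one factor continuously differentiable and the other only absolutely
  continuous. With \<open>K\<close> a bound for \<open>F1\<close>, the defect \<open>D\<close> of the formula satisfies
  \<open>\<bar>D y - D x\<bar> \<le> 2 K (y - x) \<integral> \<bar>g\<bar>\<close> with the integral taken over \<open>[x, y]\<close>. The integral tends to zero
  with the length of the interval, so \<open>D\<close> has derivative zero everywhere, although \<open>G\<close> need not be
  differentiable at any given point.\<close>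

lemma primitive_mult_C1:
  assumes F: "\<And>x. (F has_vector_derivative F1 x) (at x)" "continuous_on UNIV F1"
    and G: "primitive G g"
  shows "primitive (\<lambda>x. F x * G x) (\<lambda>x. F1 x * G x + F x * g x)"
  unfolding primitive_def
proof (intro allI impI conjI)
  fix a b :: real assume ab: "a \<le> b"
  have PF: "primitive F F1" by (rule primitive_C1[OF F])
  define p where "p x = F1 x * G x + F x * g x" for x
  have p_abs: "p absolutely_integrable_on {a..b}" for a b
  proof -
    have "(\<lambda>x. F1 x * G x) absolutely_integrable_on {a..b}"
      by (intro absolutely_integrable_continuous_real continuous_on_mult
          primitive_continuous[OF G] continuous_on_subset[OF F(2)]) auto
    moreover have "(\<lambda>x. F x * g x) absolutely_integrable_on {a..b}"
      by (intro set_integrable_mult_continuous primitiveD(1)[OF G] primitive_continuous[OF PF])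
    ultimately show ?thesis unfolding p_def by (rule set_integral_add(1))
  qed
  then show "(\<lambda>x. F1 x * G x + F x * g x) absolutely_integrable_on {a..b}" unfolding p_def .
  have p_int: "p integrable_on {a..b}" for a b
    by (rule set_lebesgue_integral_eq_integral(1)[OF p_abs])
  have "bounded (F1 ` {a..b})"
    by (intro compact_imp_bounded compact_continuous_image continuous_on_subset[OF F(2)]) auto
  then obtain K where K: "\<And>x. x \<in> {a..b} \<Longrightarrow> norm (F1 x) \<le> K" by (auto simp: bounded_iff simp del: atLeastAtMost_iff)
  have K0: "K \<ge> 0" using K[of a] ab order_trans[OF norm_ge_zero[of "F1 a"]] by auto
  have ng: "(\<lambda>x. norm (g x)) integrable_on {c..d}" for c d
    using primitiveD(1)[OF G, of c d] by (simp add: absolutely_integrable_on_def)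
  define \<gamma> where "\<gamma> t = integral {a..t} (\<lambda>x. norm (g x))" for t
  have \<gamma>: "\<gamma> y - \<gamma> x = integral {x..y} (\<lambda>x. norm (g x))" if "a \<le> x" "x \<le> y" for x y
    using Henstock_Kurzweil_Integration.integral_combine[OF that ng] by (simp add: \<gamma>_def)
  define D where "D t = F t * G t - integral {a..t} p" for t
  have DD: "norm (D y - D x) \<le> 2 * K * (y - x) * (\<gamma> y - \<gamma> x)" if xy: "a \<le> x" "x \<le> y" "y \<le> b" for x y
  proof -
    have sum_int: "(\<lambda>s. F1 s * G y + F x * g s) integrable_on {x..y}"
      by (rule integrable_add[OF integrable_on_mult_left[OF primitiveD(2)[OF PF]]
            integrable_on_mult_right[OF primitiveD(2)[OF G]]])
    have "integral {a..y} p - integral {a..x} p = integral {x..y} p"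
      using Henstock_Kurzweil_Integration.integral_combine[OF xy(1,2) p_int] by (metis add_diff_cancel_left')
    moreover have "F y * G y - F x * G x = integral {x..y} (\<lambda>s. F1 s * G y + F x * g s)"
    proof -
      have "((\<lambda>s. F1 s * G y + F x * g s) has_integral ((F y - F x) * G y + F x * (G y - G x))) {x..y}"
        by (intro has_integral_add has_integral_mult_left has_integral_mult_right primitive_has_integral PF G xy)
      then show ?thesis by (simp add: integral_unique algebra_simps)
    qed
    moreover have "D y - D x = (F y * G y - F x * G x) - (integral {a..y} p - integral {a..x} p)"
      by (simp add: D_def)
    ultimately have "D y - D x = integral {x..y} (\<lambda>s. F1 s * G y + F x * g s) - integral {x..y} p"
      by simp
    also have "\<dots> = integral {x..y} (\<lambda>s. F1 s * G y + F x * g s - p s)"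
      by (rule integral_diff[OF sum_int p_int, symmetric])
    also have "norm \<dots> \<le> integral {x..y} (\<lambda>s. K * (\<gamma> y - \<gamma> x) + K * (y - x) * norm (g s))"
    proof (rule Henstock_Kurzweil_Integration.integral_norm_bound_integral)
      show "(\<lambda>s. F1 s * G y + F x * g s - p s) integrable_on {x..y}"
        by (rule integrable_diff[OF sum_int p_int])
      show "(\<lambda>s. K * (\<gamma> y - \<gamma> x) + K * (y - x) * norm (g s)) integrable_on {x..y}"
        by (rule integrable_add[OF integrable_const_ivl integrable_on_mult_right[OF ng]])
      fix s assume s: "s \<in> {x..y}"
      have 1: "norm (G y - G s) \<le> \<gamma> y - \<gamma> x"
      proof -
        have "norm (G y - G s) = norm (integral {s..y} g)" using primitiveD(3)[OF G, of s y] s by simp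
        also have "\<dots> \<le> integral {s..y} (\<lambda>x. norm (g x))"
          by (rule Henstock_Kurzweil_Integration.integral_norm_bound_integral) (auto simp: ng primitiveD(2)[OF G])
        also have "\<dots> \<le> integral {x..y} (\<lambda>x. norm (g x))"
          using s by (intro integral_subset_le ng) auto
        finally show ?thesis using \<gamma>[of x y] xy by simp
      qed
      have 2: "norm (F x - F s) \<le> K * (y - x)"
      proof -
        have "norm (F x - F s) = norm (integral {x..s} F1)"
          using primitiveD(3)[OF PF, of x s] s by (simp add: norm_minus_commute)
        also have "\<dots> \<le> integral {x..s} (\<lambda>x. K)"
          using s xy by (intro Henstock_Kurzweil_Integration.integral_norm_bound_integral)
            (auto simp: primitiveD(2)[OF PF] intro!: K)
        also have "\<dots> = K * (s - x)" using s by simp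
        also have "\<dots> \<le> K * (y - x)" using s K0 by (intro mult_left_mono) auto
        finally show ?thesis .
      qed
      have "F1 s * G y + F x * g s - p s = F1 s * (G y - G s) + (F x - F s) * g s"
        by (simp add: p_def algebra_simps)
      also have "norm \<dots> \<le> norm (F1 s) * norm (G y - G s) + norm (F x - F s) * norm (g s)"
        by (metis norm_mult norm_triangle_ineq)
      also have "\<dots> \<le> K * (\<gamma> y - \<gamma> x) + K * (y - x) * norm (g s)"
        using s xy by (intro add_mono mult_mono 1 2 K K0 mult_nonneg_nonneg) auto
      finally show "norm (F1 s * G y + F x * g s - p s) \<le> \<dots>" .
    qed
    also have "\<dots> = 2 * K * (y - x) * (\<gamma> y - \<gamma> x)"
    proof -
      have "((\<lambda>s. norm (g s)) has_integral (\<gamma> y - \<gamma> x)) {x..y}"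
        using integrable_integral[OF ng, of x y] \<gamma>[of x y] xy by simp
      from integral_unique[OF has_integral_add[OF has_integral_const_real[of "K * (\<gamma> y - \<gamma> x)"]
            has_integral_mult_right[OF this, of "K * (y - x)"]]]
      show ?thesis using xy by (simp add: algebra_simps)
    qed
    finally show ?thesis .
  qed
  have \<gamma>c: "continuous_on {a..b} \<gamma>"
    unfolding \<gamma>_def by (intro indefinite_integral_continuous_1 ng)
  have D0: "(D has_vector_derivative 0) (at x within {a..b})" if x: "x \<in> {a..b}" for x
    unfolding has_vector_derivative_def has_derivative_within
  proof (intro conjI)
    have "((\<lambda>y. 2 * K * \<bar>\<gamma> y - \<gamma> x\<bar>) \<longlongrightarrow> 2 * K * \<bar>\<gamma> x - \<gamma> x\<bar>) (at x within {a..b})"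
      using \<gamma>c x by (intro tendsto_intros) (auto simp: continuous_on_def)
    then have l: "((\<lambda>y. 2 * K * \<bar>\<gamma> y - \<gamma> x\<bar>) \<longlongrightarrow> 0) (at x within {a..b})" by simp
    show "((\<lambda>y. (1 / norm (y - x)) *\<^sub>R (D y - (D x + (y - x) *\<^sub>R 0))) \<longlongrightarrow> 0) (at x within {a..b})"
    proof (rule Lim_null_comparison[OF _ l])
      have *: "norm (D y - D x) \<le> 2 * K * \<bar>y - x\<bar> * \<bar>\<gamma> y - \<gamma> x\<bar>" if "y \<in> {a..b}" for y
      proof -
        have "0 \<le> \<gamma> y - \<gamma> x" if "x \<le> y"
          using \<gamma>[of x y] x that by (simp add: Henstock_Kurzweil_Integration.integral_nonneg ng)
        moreover have "0 \<le> \<gamma> x - \<gamma> y" if "y \<le> x"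
          using \<gamma>[of y x] \<open>y \<in> {a..b}\<close> that by (simp add: Henstock_Kurzweil_Integration.integral_nonneg ng)
        ultimately show ?thesis
          using DD[of x y] DD[of y x] x \<open>y \<in> {a..b}\<close>
          by (cases "x \<le> y") (auto simp: norm_minus_commute abs_minus_commute)
      qed
      show "\<forall>\<^sub>F y in at x within {a..b}. norm ((1 / norm (y - x)) *\<^sub>R (D y - (D x + (y - x) *\<^sub>R 0)))
          \<le> 2 * K * \<bar>\<gamma> y - \<gamma> x\<bar>"
        unfolding eventually_at_filter
      proof (intro always_eventually allI impI)
        fix y assume y: "y \<noteq> x" "y \<in> {a..b}"
        have "norm ((1 / norm (y - x)) *\<^sub>R (D y - (D x + (y - x) *\<^sub>R 0))) = norm (D y - D x) / \<bar>y - x\<bar>"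
          by (subst norm_scaleR) simp
        also have "\<dots> \<le> (2 * K * \<bar>y - x\<bar> * \<bar>\<gamma> y - \<gamma> x\<bar>) / \<bar>y - x\<bar>"
          by (intro divide_right_mono *[OF y(2)]) auto
        also have "\<dots> = 2 * K * \<bar>\<gamma> y - \<gamma> x\<bar>" using y(1) by simp
        finally show "norm ((1 / norm (y - x)) *\<^sub>R (D y - (D x + (y - x) *\<^sub>R 0))) \<le> 2 * K * \<bar>\<gamma> y - \<gamma> x\<bar>" .
      qed
    qed
  qed simp
  obtain c where c: "\<And>x. x \<in> {a..b} \<Longrightarrow> D x = c"
  proof (rule has_vector_derivative_zero_constant[OF convex_real_interval(5) D0])
    fix c assume "\<And>x. x \<in> {a..b} \<Longrightarrow> D x = c" then show thesis by (rule that)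
  qed
  have "D b = D a" using ab c[of a] c[of b] by simp
  also have "D a = F a * G a" by (simp add: D_def)
  finally have *: "F a * G a = F b * G b - integral {a..b} p" by (simp add: D_def)
  have "F b * G b - F a * G a = integral {a..b} p" by (subst *) simp
  then show "F b * G b - F a * G a = integral {a..b} (\<lambda>x. F1 x * G x + F x * g x)"
    unfolding p_def .
qed

section \<open>Second-order functions\<close>

text \<open>The functions that have a locally absolutely continuous first derivative. The third argument may
  be changed on null sets, so it can be used as a right-hand side of a differential equation.\<close>

definition W2 :: "(real \<Rightarrow> complex) \<Rightarrow> (real \<Rightarrow> complex) \<Rightarrow> (real \<Rightarrow> complex) \<Rightarrow> bool" where
  "W2 h h1 h2 \<longleftrightarrow> (\<forall>x. (h has_vector_derivative h1 x) (at x)) \<and> primitive h1 h2"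

lemma W2D:
  assumes "W2 h h1 h2"
  shows "(h has_vector_derivative h1 x) (at x)" "primitive h1 h2" "primitive h h1"
    "continuous_on A h" "continuous_on A h1"
    "h \<in> borel_measurable lebesgue" "h1 \<in> borel_measurable lebesgue"
proof -
  show 1: "(h has_vector_derivative h1 x) (at x)" for x
    using assms by (auto simp: W2_def)
  show 2: "primitive h1 h2"
    using assms by (auto simp: W2_def)
  show c: "continuous_on A h1" for A by (rule primitive_continuous[OF 2])
  show 3: "primitive h h1" by (rule primitive_C1[OF 1 c])
  show "continuous_on A h" by (rule primitive_continuous[OF 3])
  show "h \<in> borel_measurable lebesgue" by (rule primitive_measurable[OF 3])
  show "h1 \<in> borel_measurable lebesgue" by (rule primitive_measurable[OF 2])
qed

lemma W2I: "primitive h h1 \<Longrightarrow> primitive h1 h2 \<Longrightarrow> W2 h h1 h2"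
  unfolding W2_def using primitive_has_derivative primitive_continuous by blast

lemma W2_add: "W2 f f1 f2 \<Longrightarrow> W2 g g1 g2 \<Longrightarrow> W2 (\<lambda>x. f x + g x) (\<lambda>x. f1 x + g1 x) (\<lambda>x. f2 x + g2 x)"
  by (rule W2I) (auto intro: primitive_add W2D)

lemma W2_cmult: "W2 f f1 f2 \<Longrightarrow> W2 (\<lambda>x. c * f x) (\<lambda>x. c * f1 x) (\<lambda>x. c * f2 x)"
  by (rule W2I) (auto intro: primitive_cmult W2D)

lemma W2_diff: "W2 f f1 f2 \<Longrightarrow> W2 g g1 g2 \<Longrightarrow> W2 (\<lambda>x. f x - g x) (\<lambda>x. f1 x - g1 x) (\<lambda>x. f2 x - g2 x)"
  by (rule W2I) (auto intro: primitive_diff W2D)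

lemma W2_cong_AE:
  "W2 h h1 h2 \<Longrightarrow> AE x in lebesgue. h2 x = g x \<Longrightarrow> W2 h h1 g"
  unfolding W2_def using primitive_cong_AE by blast

lemma W2_affine_function: "W2 (\<lambda>x. c + d * complex_of_real x) (\<lambda>x. d) (\<lambda>x. 0)"
proof (rule W2I)
  show "primitive (\<lambda>x. c + d * complex_of_real x) (\<lambda>x. d)"
    by (rule primitive_C1) (auto intro!: derivative_eq_intros)
  show "primitive (\<lambda>x. d) (\<lambda>x. 0)"
    by (rule primitive_C1) (auto intro!: derivative_eq_intros)
qed

lemma has_vector_derivative_exp_linear:
  "((\<lambda>x. exp (k * complex_of_real x)) has_vector_derivative k * exp (k * complex_of_real x)) (at x)"
  by (rule has_vector_derivative_real_field) (auto intro!: derivative_eq_intros)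

lemma W2_exp: "W2 (\<lambda>x. exp (k * complex_of_real x)) (\<lambda>x. k * exp (k * complex_of_real x))
    (\<lambda>x. k\<^sup>2 * exp (k * complex_of_real x))"
proof (rule W2I)
  show 1: "primitive (\<lambda>x. exp (k * complex_of_real x)) (\<lambda>x. k * exp (k * complex_of_real x))"
    by (rule primitive_C1[OF has_vector_derivative_exp_linear]) (intro continuous_intros)
  show "primitive (\<lambda>x. k * exp (k * complex_of_real x)) (\<lambda>x. k\<^sup>2 * exp (k * complex_of_real x))"
    using primitive_cmult[OF 1, of k] by (simp add: power2_eq_square mult.assoc)
qed

lemma W2_ex:
  assumes "\<And>a b. g absolutely_integrable_on {a..b}"
  shows "\<exists>h h1. W2 h h1 g \<and> h x0 = c \<and> h1 x0 = d"
proof -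
  obtain h1 where 1: "primitive h1 g" "h1 x0 = d"
    using primitive_ex[of g x0 d] assms by auto
  have "h1 absolutely_integrable_on {a..b}" for a b
    by (intro absolutely_integrable_continuous_real primitive_continuous[OF 1(1)])
  then obtain h where 2: "primitive h h1" "h x0 = c"
    using primitive_ex[of h1 x0 c] by auto
  show ?thesis using W2I[OF 2(1) 1(1)] 1(2) 2(2) by blast
qed

lemma primitive_affine:
  assumes P: "primitive G g" and m: "m \<noteq> 0"
  shows "primitive (\<lambda>x. G (t + m * x)) (\<lambda>x. complex_of_real m * g (t + m * x))"
proof -
  define gg where "gg x = complex_of_real m * g (t + m * x)" for x
  have "gg absolutely_integrable_on {a..b} \<and> G (t + m * b) - G (t + m * a) = integral {a..b} gg"
    if ab: "a \<le> b" for a b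
  proof -
    define c d where "c = min (t + m * a) (t + m * b)" and "d = max (t + m * a) (t + m * b)"
    have ind: "indicator {a..b} x = (indicator {c..d} (t + m * x) :: real)" for x
    proof (cases "m > 0")
      case True
      then have "c = t + m * a" "d = t + m * b" using ab by (auto simp: c_def d_def)
      then show ?thesis using True by (auto simp: indicator_def)
    next
      case False
      then have "m < 0" using m by simp
      then have "c = t + m * b" "d = t + m * a" using ab
        by (auto simp: c_def d_def mult_left_mono_neg)
      then show ?thesis using \<open>m < 0\<close> by (auto simp: indicator_def)
    qed
    have i: "integrable lebesgue (\<lambda>y. indicator {c..d} y *\<^sub>R g y)"
      using primitiveD(1)[OF P, of c d] by (simp add: set_integrable_def)
    have i2: "integrable lebesgue (\<lambda>x. indicator {a..b} x *\<^sub>R g (t + m * x))"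
      unfolding ind by (rule lebesgue_integrable_real_affine[OF i m])
    have abs0: "(\<lambda>x. g (t + m * x)) absolutely_integrable_on {a..b}"
      unfolding set_integrable_def by (rule i2)
    have abs: "gg absolutely_integrable_on {a..b}"
      unfolding gg_def by (rule set_integrable_mult_continuous[OF continuous_on_const abs0])
    have "(LINT y|lebesgue. indicator {c..d} y *\<^sub>R g y) = \<bar>m\<bar> *\<^sub>R (LINT x|lebesgue. indicator {a..b} x *\<^sub>R g (t + m * x))"
      unfolding ind by (rule lebesgue_integral_real_affine[OF m])
    then have "integral {c..d} g = \<bar>m\<bar> *\<^sub>R integral {a..b} (\<lambda>x. g (t + m * x))"
      using set_lebesgue_integral_eq_integral(2)[OF abs0] set_lebesgue_integral_eq_integral(2)[OF primitiveD(1)[OF P]]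
      by (simp add: set_lebesgue_integral_def)
    moreover have "integral {c..d} g = G d - G c"
      by (rule primitiveD(3)[OF P]) (simp add: c_def d_def)
    moreover have "integral {a..b} gg = complex_of_real m * integral {a..b} (\<lambda>x. g (t + m * x))"
      unfolding gg_def by simp
    moreover have "G (t + m * b) - G (t + m * a) = (if m > 0 then 1 else -1) * (G d - G c)"
      using ab m by (auto simp: c_def d_def min_def max_def)
    ultimately have "G (t + m * b) - G (t + m * a) = integral {a..b} gg"
      using m by (auto simp: scaleR_conv_of_real)
    then show ?thesis using abs by simp
  qed
  then show ?thesis unfolding primitive_def gg_def by blast
qed

lemma W2_affine:
  assumes "W2 h h1 h2" "m \<noteq> 0"
  shows "W2 (\<lambda>x. h (t + m * x)) (\<lambda>x. complex_of_real m * h1 (t + m * x)) (\<lambda>x. complex_of_real m ^ 2 * h2 (t + m * x))"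
proof (rule W2I)
  show "primitive (\<lambda>x. h (t + m * x)) (\<lambda>x. complex_of_real m * h1 (t + m * x))"
    by (rule primitive_affine[OF W2D(3)[OF assms(1)] assms(2)])
  show "primitive (\<lambda>x. complex_of_real m * h1 (t + m * x)) (\<lambda>x. complex_of_real m ^ 2 * h2 (t + m * x))"
    using primitive_cmult[OF primitive_affine[OF W2D(2)[OF assms(1)] assms(2), of t], of "complex_of_real m"]
    by (simp add: power2_eq_square mult.assoc)
qed

lemma primitive_zero_const:
  assumes "primitive F f" "\<And>x. a < x \<Longrightarrow> x < b \<Longrightarrow> f x = 0" "a \<le> b"
  shows "F b = F a"
proof -
  have "integral {a..b} f = integral {a..b} (\<lambda>x. 0::complex)"
    by (rule integral_spike[of "{a,b}"]) (auto simp: assms(2))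
  then show ?thesis using primitiveD(3)[OF assms(1,3)] by simp
qed

lemma W2_zero_right:
  assumes "W2 h h1 h2" "\<And>x. a < x \<Longrightarrow> h2 x = 0" "h a = 0" "h1 a = 0" "a \<le> x"
  shows "h x = 0" "h1 x = 0"
proof -
  have 1: "h1 y = 0" if "a \<le> y" for y
    using primitive_zero_const[OF W2D(2)[OF assms(1)], of a y] assms(2,4) that by auto
  show "h1 x = 0" using 1 assms(5) .
  show "h x = 0"
    using primitive_zero_const[OF W2D(3)[OF assms(1)], of a x] 1 assms(3,5) by auto
qed

lemma W2_zero_left:
  assumes "W2 h h1 h2" "\<And>x. x < a \<Longrightarrow> h2 x = 0" "h a = 0" "h1 a = 0" "x \<le> a"
  shows "h x = 0" "h1 x = 0"
proof -
  have 1: "h1 y = 0" if "y \<le> a" for y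
    using primitive_zero_const[OF W2D(2)[OF assms(1)], of y a] assms(2,4) that by auto
  show "h1 x = 0" using 1 assms(5) .
  show "h x = 0"
    using primitive_zero_const[OF W2D(3)[OF assms(1)], of x a] 1 assms(3,5) by auto
qed

lemma lagrange_identity:
  assumes "W2 h h1 h2" "W2 k k1 k2"
  shows "primitive (\<lambda>x. h1 x * k x - h x * k1 x) (\<lambda>x. h2 x * k x - h x * k2 x)"
proof -
  have "primitive (\<lambda>x. k x * h1 x - h x * k1 x)
      (\<lambda>x. (k1 x * h1 x + k x * h2 x) - (h1 x * k1 x + h x * k2 x))"
    by (intro primitive_diff primitive_mult_C1 W2D[OF assms(1)] W2D[OF assms(2)])
  then show ?thesis by (simp add: algebra_simps)
qed

lemma energy_identity:
  assumes "W2 h h1 h2"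
  shows "primitive (\<lambda>x. cnj (h x) * h1 x) (\<lambda>x. cnj (h1 x) * h1 x + cnj (h x) * h2 x)"
  by (intro primitive_mult_C1 W2D[OF assms] has_vector_derivative_cnj continuous_on_cnj)

text \<open>The factor \<open>exp (- k x)\<close> integrates \<open>h'' = k\<^sup>2 h - f\<close> once; letting \<open>x\<close> tend to infinity, this
  controls \<open>h' + k h\<close> by \<open>f\<close> alone.\<close>

lemma exp_identity:
  assumes "W2 h h1 h2"
  shows "primitive (\<lambda>x. exp (- (k * complex_of_real x)) * (h1 x + k * h x))
     (\<lambda>x. exp (- (k * complex_of_real x)) * (h2 x - k\<^sup>2 * h x))"
proof -
  have "primitive (\<lambda>x. exp (- k * complex_of_real x) * (h1 x + k * h x))
     (\<lambda>x. (- k * exp (- k * complex_of_real x)) * (h1 x + k * h x) + exp (- k * complex_of_real x) * (h2 x + k * h1 x))"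
    by (intro primitive_mult_C1 has_vector_derivative_exp_linear continuous_intros primitive_add primitive_cmult W2D[OF assms])
  moreover have "(- k * exp (- k * complex_of_real x)) * (h1 x + k * h x) + exp (- k * complex_of_real x) * (h2 x + k * h1 x)
     = exp (- (k * complex_of_real x)) * (h2 x - k\<^sup>2 * h x)" for x
    by (simp add: algebra_simps power2_eq_square)
  ultimately show ?thesis by simp
qed

subsection \<open>Initial value problems\<close>

lemma primitive_from_0:
  fixes g :: "real \<Rightarrow> complex"
  assumes "\<And>a b. g absolutely_integrable_on {a..b}"
  shows "primitive (\<lambda>x. integral {0..x} g) (\<lambda>x. if 0 \<le> x then g x else 0)"
proof -
  define g' where "g' x = (if 0 \<le> x then g x else 0)" for x :: real
  have "g' absolutely_integrable_on {a..b}" for a b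
  proof -
    have "g absolutely_integrable_on ({0..} \<inter> {a..b})"
      by (rule set_integrable_subset[OF assms[of a b]]) auto
    moreover have "(\<lambda>x. indicator {a..b} x *\<^sub>R g' x) = (\<lambda>x. indicator ({0..} \<inter> {a..b}) x *\<^sub>R g x)"
      by (auto simp: g'_def indicator_def)
    ultimately show ?thesis by (simp add: set_integrable_def)
  qed
  then obtain G where G: "primitive G g'" "G 0 = 0" using primitive_ex[of g' 0 0] by auto
  have "G x = integral {0..x} g" for x
  proof (cases "0 \<le> x")
    case True
    have "integral {0..x} g = integral {0..x} g'"
      by (rule integral_cong) (auto simp: g'_def)
    then show ?thesis using primitiveD(3)[OF G(1) True] G(2) by simp
  next
    case False
    then show ?thesis using primitive_zero_const[OF G(1), of x 0] G(2) by (auto simp: g'_def)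
  qed
  then have "G = (\<lambda>x. integral {0..x} g)" by auto
  then show ?thesis using G(1) unfolding g'_def by simp
qed

lemma norm_integral_exp_bound:
  fixes g :: "real \<Rightarrow> complex"
  assumes g: "g integrable_on {0..x}" and b: "\<And>s. 0 \<le> s \<Longrightarrow> norm (g s) \<le> C * exp (L * s)"
    and L: "L > 0" and C: "C \<ge> 0"
  shows "norm (integral {0..x} g) \<le> C / L * exp (L * x)"
proof (cases "0 \<le> x")
  case True
  have i: "((\<lambda>s. C * exp (L * s)) has_integral (C / L * exp (L * x) - C / L * exp (L * 0))) {0..x}"
    by (rule fundamental_theorem_of_calculus[OF True])
       (use L in \<open>auto intro!: derivative_eq_intros simp flip: has_real_derivative_iff_has_vector_derivative\<close>)
  have "norm (integral {0..x} g) \<le> integral {0..x} (\<lambda>s. C * exp (L * s))"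
    by (rule Henstock_Kurzweil_Integration.integral_norm_bound_integral[OF g]) (use i b in auto)
  also have "\<dots> = C / L * exp (L * x) - C / L" using integral_unique[OF i] by simp
  also have "\<dots> \<le> C / L * exp (L * x)" using L C by simp
  finally show ?thesis .
qed (use L C in simp)

lemma bounded_measurable_abs_integrable:
  fixes Q :: "real \<Rightarrow> complex"
  assumes "Q \<in> borel_measurable lebesgue" "\<And>x. norm (Q x) \<le> M"
  shows "Q absolutely_integrable_on {a..b}"
proof -
  have "(\<lambda>x. Q x * 1) absolutely_integrable_on {a..b}"
    by (rule set_integrable_mult_bounded[OF assms(1)])
       (auto intro: assms(2) absolutely_integrable_continuous_real)
  then show ?thesis by simp
qed

text \<open>The equation with zero data at the origin is an integral equation for \<open>v\<close>. In the weighted norm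
  \<open>sup \<bar>exp (- L x) v x\<bar>\<close> the integral operator has norm at most \<open>M / L\<^sup>2 < 1\<close> for \<open>L = M + 1\<close>, so
  that Banach's fixed point theorem yields a solution on the whole line at once.\<close>

lemma forward_initial_value_problem:
  fixes Q r :: "real \<Rightarrow> complex"
  assumes Q: "Q \<in> borel_measurable lebesgue" "\<And>x. norm (Q x) \<le> M"
    and r: "r \<in> borel_measurable lebesgue" "\<And>x. norm (r x) \<le> \<rho>"
  shows "\<exists>v v1. W2 v v1 (\<lambda>x. if 0 \<le> x then Q x * v x + r x else 0) \<and> (\<forall>x\<le>0. v x = 0 \<and> v1 x = 0)"
proof -
  have M: "0 \<le> M" using order_trans[OF norm_ge_zero Q(2)] .
  have \<rho>: "0 \<le> \<rho>" using order_trans[OF norm_ge_zero r(2)] .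
  define L where "L = M + 1"
  have L: "L > 0" "M / L / L < 1"
  proof -
    show "L > 0" using M by (simp add: L_def)
    have "M / L < 1" using M by (simp add: L_def)
    moreover have "M / L / L \<le> M / L / 1" using M by (intro divide_left_mono) (auto simp: L_def)
    ultimately show "M / L / L < 1" by simp
  qed
  \<comment> \<open>The fixed point is sought for \<open>w = exp (- L x) v\<close> among bounded continuous functions, with
    \<open>T\<close> the transformed integral operator.\<close>
  define e where "e x = exp (complex_of_real L * complex_of_real x)" for x
  have ne: "norm (e x) = exp (L * x)" for x by (simp add: e_def)
  have ce: "continuous_on A e" for A unfolding e_def by (intro continuous_intros)
  define g where "g w s = Q s * (e s * w s) + r s" for w :: "real \<Rightarrow> complex" and s
  define k where "k w t = integral {0..t} (g w)" for w t
  define T where "T w x = inverse (e x) * integral {0..x} (k w)" for w x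
  have g_abs: "g w absolutely_integrable_on {a..b}" if w: "continuous_on UNIV w" for w a b
  proof -
    have "(\<lambda>s. e s * w s) absolutely_integrable_on {a..b}"
      by (intro absolutely_integrable_continuous_real continuous_on_mult ce continuous_on_subset[OF w]) auto
    then have "(\<lambda>s. Q s * (e s * w s)) absolutely_integrable_on {a..b}"
      by (rule set_integrable_mult_bounded[OF Q])
    then show ?thesis unfolding g_def
      by (rule set_integral_add(1)) (rule bounded_measurable_abs_integrable[OF r])
  qed
  have pk: "primitive (k w) (\<lambda>x. if 0 \<le> x then g w x else 0)" if "continuous_on UNIV w" for w
    unfolding k_def by (rule primitive_from_0) (rule g_abs[OF that])
  have k_abs: "k w absolutely_integrable_on {a..b}" if "continuous_on UNIV w" for w a b
    by (intro absolutely_integrable_continuous_real primitive_continuous[OF pk[OF that]])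
  have pkk: "primitive (\<lambda>x. integral {0..x} (k w)) (\<lambda>x. if 0 \<le> x then k w x else 0)"
    if "continuous_on UNIV w" for w
    by (rule primitive_from_0) (rule k_abs[OF that])
  have T_cont: "continuous_on UNIV (T w)" if "continuous_on UNIV w" for w
    unfolding T_def[abs_def] by (intro continuous_intros ce primitive_continuous[OF pkk[OF that]]) (auto simp: e_def)
  have nie: "norm (inverse (e x)) * exp (L * x) = 1" for x
    by (simp add: norm_inverse ne)
  have key: "norm (inverse (e x) * integral {0..x} kk) \<le> C / L / L"
    if kk: "\<And>t. kk t = integral {0..t} gg" "\<And>t. kk integrable_on {0..t}"
      and gg: "\<And>t. gg integrable_on {0..t}" "\<And>s. 0 \<le> s \<Longrightarrow> norm (gg s) \<le> C * exp (L * s)"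
      and C: "C \<ge> 0" for gg kk x C
  proof -
    have "norm (kk t) \<le> C / L * exp (L * t)" for t
      unfolding kk(1) by (rule norm_integral_exp_bound[OF gg L(1) C])
    then have "norm (integral {0..x} kk) \<le> C / L / L * exp (L * x)"
      using L C by (intro norm_integral_exp_bound kk(2)) auto
    then have "norm (inverse (e x)) * norm (integral {0..x} kk) \<le> norm (inverse (e x)) * (C / L / L * exp (L * x))"
      by (rule mult_left_mono) simp
    also have "\<dots> = (norm (inverse (e x)) * exp (L * x)) * (C / L / L)" by (simp only: mult_ac)
    also have "\<dots> = C / L / L" by (simp only: nie mult_1)
    finally show ?thesis by (simp only: norm_mult)
  qed
  have T_bcont: "T (apply_bcontfun w) \<in> bcontfun" for w :: "real \<Rightarrow>\<^sub>C complex"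
  proof -
    obtain B where B: "\<And>x. norm (apply_bcontfun w x) \<le> B" 
      using bounded_apply_bcontfun[of w] by (auto simp: bounded_iff)
    have B0: "0 \<le> B" using order_trans[OF norm_ge_zero B] .
    have c: "continuous_on UNIV (apply_bcontfun w)" by simp
    have "norm (T w x) \<le> (M * B + \<rho>) / L / L" for x
      unfolding T_def
    proof (rule key[where gg="g w"])
      show "k w t = integral {0..t} (g w)" for t by (simp add: k_def)
      show "k w integrable_on {0..t}" for t by (rule set_lebesgue_integral_eq_integral(1)[OF k_abs[OF c]])
      show "g w integrable_on {0..t}" for t by (rule set_lebesgue_integral_eq_integral(1)[OF g_abs[OF c]])
      show "0 \<le> M * B + \<rho>" using M B0 \<rho> by simp
      fix s :: real assume s: "0 \<le> s"
      have "norm (g w s) \<le> norm (Q s) * (norm (e s) * norm (w s)) + norm (r s)"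
        unfolding g_def using norm_triangle_ineq[of "Q s * (e s * w s)" "r s"] by (simp add: norm_mult)
      also have "\<dots> \<le> M * (exp (L * s) * B) + \<rho> * exp (L * s)"
      proof (intro add_mono mult_mono Q(2) B)
        have "1 \<le> exp (L * s)" using s L by simp
        then have "\<rho> * 1 \<le> \<rho> * exp (L * s)" using \<rho> by (intro mult_left_mono)
        then show "norm (r s) \<le> \<rho> * exp (L * s)" using r(2)[of s] by simp
      qed (auto simp: ne M B0)
      finally show "norm (g w s) \<le> (M * B + \<rho>) * exp (L * s)" by (simp add: algebra_simps)
    qed
    then show ?thesis
      using T_cont[OF c] by (auto simp: bcontfun_def bounded_iff)
  qed
  define TT where "TT w = Bcontfun (T (apply_bcontfun w))" for w :: "real \<Rightarrow>\<^sub>C complex"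
  have TT: "apply_bcontfun (TT w) = T (apply_bcontfun w)" for w
    unfolding TT_def by (rule Bcontfun_inverse[OF T_bcont])
  have "dist (TT w) (TT w') \<le> M / L / L * dist w w'" for w w'
  proof (rule dist_bound)
    fix x
    have c: "continuous_on UNIV (apply_bcontfun w)" "continuous_on UNIV (apply_bcontfun w')" by simp_all
    have gi: "g w integrable_on {0..t}" "g w' integrable_on {0..t}" 
       and ki: "k w integrable_on {0..t}" "k w' integrable_on {0..t}" for t
      using g_abs[OF c(1)] g_abs[OF c(2)] k_abs[OF c(1)] k_abs[OF c(2)]
      by (auto intro: set_lebesgue_integral_eq_integral(1))
    have "T w x - T w' x = inverse (e x) * integral {0..x} (\<lambda>t. k w t - k w' t)"
      unfolding T_def integral_diff[OF ki] by (simp add: right_diff_distrib)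
    also have "norm \<dots> \<le> (M * dist w w') / L / L"
    proof (rule key[where gg="\<lambda>s. g w s - g w' s"])
      show "k w t - k w' t = integral {0..t} (\<lambda>s. g w s - g w' s)" for t
        unfolding k_def by (rule integral_diff[OF gi, symmetric])
      show "(\<lambda>t. k w t - k w' t) integrable_on {0..t}" for t by (rule integrable_diff[OF ki])
      show "(\<lambda>t. g w t - g w' t) integrable_on {0..t}" for t by (rule integrable_diff[OF gi])
      show "0 \<le> M * dist w w'" using M by simp
      fix s :: real assume s: "0 \<le> s"
      have "g w s - g w' s = Q s * (e s * (w s - w' s))" by (simp add: g_def algebra_simps)
      also have "norm \<dots> = norm (Q s) * (exp (L * s) * dist (w s) (w' s))" by (simp add: norm_mult ne dist_norm)
      also have "\<dots> \<le> M * (exp (L * s) * dist w w')"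
        by (intro mult_mono Q(2) dist_bounded M) auto
      finally show "norm (g w s - g w' s) \<le> M * dist w w' * exp (L * s)" by (simp add: mult_ac)
    qed
    finally show "dist (TT w x) (TT w' x) \<le> M / L / L * dist w w'" by (simp add: TT dist_norm)
  qed
  moreover have "0 \<le> M / L / L" using M L by simp
  ultimately have "\<exists>!w. TT w = w" using L(2) by (intro banach_fix_type) auto
  then obtain w where "TT w = w" by blast
  then have w: "w x = T w x" for x using TT[of w] by metis
  have c: "continuous_on UNIV (apply_bcontfun w)" by simp
  define v where "v x = integral {0..x} (k w)" for x
  have v: "v x = e x * w x" for x
    unfolding w[of x] T_def v_def by (simp add: e_def)
  have kd: "(if 0 \<le> x then k w x else 0) = k w x" for x by (auto simp: k_def)
  have gd: "g w x = Q x * v x + r x" for x by (simp add: g_def v)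
  have "W2 v (k w) (\<lambda>x. if 0 \<le> x then Q x * v x + r x else 0)"
    using pkk[OF c] pk[OF c] unfolding kd gd v_def[symmetric] by (rule W2I)
  moreover have "v x = 0 \<and> k w x = 0" if "x \<le> 0" for x
  proof (cases "x = 0")
    case False then show ?thesis using that by (simp add: v_def k_def)
  qed (simp add: v_def k_def)
  ultimately show ?thesis by blast
qed

text \<open>A solution \<open>g\<close> of the equation without the potential \<open>q\<close> is continued leftwards from \<open>a\<close> as a
  solution with potential. The correction solves an initial value problem with zero data at \<open>a\<close>, whose
  inhomogeneity \<open>q g\<close> is bounded; the possibly unbounded \<open>f\<close> does not enter it.\<close>

lemma backward_correction:
  fixes q g f :: "real \<Rightarrow> complex"
  assumes q: "q \<in> borel_measurable lebesgue" "\<And>x. norm (q x) \<le> M" "\<And>x. a \<le> \<bar>x\<bar> \<Longrightarrow> q x = 0" and a: "a > 0"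
    and g: "W2 g g1 (\<lambda>x. k * g x - f x)"
  shows "\<exists>p p1. W2 p p1 (\<lambda>x. (q x + k) * p x - f x) \<and> (\<forall>x\<ge>a. p x = g x \<and> p1 x = g1 x)"
proof -
  define Q where "Q s = q (a + (-1) * s) + k" for s
  define r where "r s = q (a + (-1) * s) * g (a + (-1) * s)" for s
  have aff: "(\<lambda>x. F (a + (-1) * x)) \<in> borel_measurable lebesgue" if "F \<in> borel_measurable lebesgue"
    for F :: "real \<Rightarrow> complex"
    using borel_measurable_affine[OF that, of "-1" a] by simp
  have qm: "(\<lambda>s. q (a + (-1) * s)) \<in> borel_measurable lebesgue" by (rule aff[OF q(1)])
  have gm: "(\<lambda>s. g (a + (-1) * s)) \<in> borel_measurable lebesgue" by (rule aff[OF W2D(6)[OF g]])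
  have "bounded (g ` {-a..a})"
    by (intro compact_imp_bounded compact_continuous_image W2D(4)[OF g]) auto
  then obtain B where "\<forall>x\<in>{-a..a}. norm (g x) \<le> B"
    by (auto simp: bounded_iff simp del: atLeastAtMost_iff)
  moreover have "x \<in> {-a..a}" if "\<bar>x\<bar> \<le> a" for x using that by (simp, linarith)
  ultimately have B: "norm (g x) \<le> B" if "\<bar>x\<bar> \<le> a" for x
    using that by blast
  have M: "0 \<le> M" using order_trans[OF norm_ge_zero q(2)] .
  have B0: "0 \<le> B" using order_trans[OF norm_ge_zero B[of 0]] a by auto
  have "\<exists>v v1. W2 v v1 (\<lambda>x. if 0 \<le> x then Q x * v x + r x else 0) \<and> (\<forall>x\<le>0. v x = 0 \<and> v1 x = 0)"
  proof (rule forward_initial_value_problem)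
    show "Q \<in> borel_measurable lebesgue" unfolding Q_def by (rule borel_measurable_add[OF qm borel_measurable_const])
    show "norm (Q x) \<le> M + norm k" for x
      unfolding Q_def using norm_triangle_ineq[of "q (a + (-1) * x)" k] q(2)[of "a + (-1) * x"] by linarith
    show "r \<in> borel_measurable lebesgue" unfolding r_def by (rule borel_measurable_times[OF qm gm])
    show "norm (r x) \<le> M * B" for x
    proof (cases "\<bar>a + (-1) * x\<bar> \<le> a")
      case True
      then show ?thesis unfolding r_def norm_mult by (intro mult_mono q(2) B M) auto
    next
      case False then show ?thesis using q(3)[of "a + (-1) * x"] M B0 by (simp add: r_def)
    qed
  qed
  then obtain v v1 where v: "W2 v v1 (\<lambda>x. if 0 \<le> x then Q x * v x + r x else 0)"
    and v0: "\<And>x. x \<le> 0 \<Longrightarrow> v x = 0 \<and> v1 x = 0" by blast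
  define V where "V x = v (a + (-1) * x)" for x
  define V1 where "V1 x = - v1 (a + (-1) * x)" for x
  have "W2 V V1 (\<lambda>x. if 0 \<le> a + (-1) * x then Q (a + (-1) * x) * v (a + (-1) * x) + r (a + (-1) * x) else 0)"
    unfolding V_def[abs_def] V1_def[abs_def] using W2_affine[OF v, of "-1" a] by simp
  from W2_add[OF g this]
  have "W2 (\<lambda>x. g x + V x) (\<lambda>x. g1 x + V1 x) (\<lambda>x. k * g x - f x +
      (if 0 \<le> a + (-1) * x then Q (a + (-1) * x) * v (a + (-1) * x) + r (a + (-1) * x) else 0))" .
  moreover have "k * g x - f x + (if 0 \<le> a + (-1) * x then Q (a + (-1) * x) * v (a + (-1) * x) + r (a + (-1) * x) else 0)
      = (q x + k) * (g x + V x) - f x" for x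
  proof (cases "x \<le> a")
    case True
    then show ?thesis by (simp add: Q_def r_def V_def algebra_simps)
  next
    case False
    then have "q x = 0" "V x = 0" using q(3)[of x] v0[of "a + (-1) * x"] by (auto simp: V_def)
    then show ?thesis using False by (simp add: algebra_simps)
  qed
  ultimately have "W2 (\<lambda>x. g x + V x) (\<lambda>x. g1 x + V1 x) (\<lambda>x. (q x + k) * (g x + V x) - f x)" by (simp only:)
  moreover have "V x = 0 \<and> V1 x = 0" if "x \<ge> a" for x
    using v0[of "a + (-1) * x"] that by (simp add: V_def V1_def)
  ultimately show ?thesis by (intro exI[of _ "\<lambda>x. g x + V x"] exI[of _ "\<lambda>x. g1 x + V1 x"]) auto
qed

lemma forward_correction:
  fixes q g f :: "real \<Rightarrow> complex"
  assumes q: "q \<in> borel_measurable lebesgue" "\<And>x. norm (q x) \<le> M" "\<And>x. a \<le> \<bar>x\<bar> \<Longrightarrow> q x = 0" and a: "a > 0"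
    and g: "W2 g g1 (\<lambda>x. k * g x - f x)"
  shows "\<exists>p p1. W2 p p1 (\<lambda>x. (q x + k) * p x - f x) \<and> (\<forall>x\<le>-a. p x = g x \<and> p1 x = g1 x)"
proof -
  have 1: "(\<lambda>x. q (- x)) \<in> borel_measurable lebesgue"
    using borel_measurable_affine[OF q(1), of "-1" 0] by simp
  have 2: "W2 (\<lambda>x. g (- x)) (\<lambda>x. - g1 (- x)) (\<lambda>x. k * g (- x) - f (- x))"
    using W2_affine[OF g, of "-1" 0] by simp
  obtain p p1 where p: "W2 p p1 (\<lambda>x. (q (- x) + k) * p x - f (- x))"
    and pa: "\<And>x. x \<ge> a \<Longrightarrow> p x = g (- x) \<and> p1 x = - g1 (- x)"
    using backward_correction[OF 1 q(2) _ a 2] q(3) by (metis abs_minus_cancel)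
  have "W2 (\<lambda>x. p (- x)) (\<lambda>x. - p1 (- x)) (\<lambda>x. (q x + k) * p (- x) - f x)"
    using W2_affine[OF p, of "-1" 0] by simp
  moreover have "p (- x) = g x \<and> - p1 (- x) = g1 x" if "x \<le> -a" for x using pa[of "-x"] that by auto
  ultimately show ?thesis by (intro exI[of _ "\<lambda>x. p (- x)"] exI[of _ "\<lambda>x. - p1 (- x)"]) auto
qed

section \<open>Square integrable functions\<close>

definition l2norm :: "real set \<Rightarrow> (real \<Rightarrow> complex) \<Rightarrow> real" where
  "l2norm S f = sqrt (LINT x:S|lebesgue. (norm (f x))\<^sup>2)"

lemma continuous_lebesgue_measurable:
  "continuous_on UNIV f \<Longrightarrow> f \<in> borel_measurable lebesgue"
  by (rule measurable_completion) (simp add: borel_measurable_continuous_onI)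

lemma sq_int_indicator:
  "f square_integrable_on S \<longleftrightarrow> (\<lambda>x. indicator S x *\<^sub>R f x) square_integrable_on UNIV"
proof -
  have "(norm (indicator S x *\<^sub>R f x))\<^sup>2 = indicator S x *\<^sub>R (norm (f x))\<^sup>2" for x
    by (cases "x \<in> S") auto
  then show ?thesis
    unfolding square_integrable_on_def set_borel_measurable_def set_integrable_def by simp
qed

lemma l2norm_indicator: "l2norm UNIV (\<lambda>x. indicator S x *\<^sub>R f x) = l2norm S f"
proof -
  have "(norm (indicator S x *\<^sub>R f x))\<^sup>2 = indicator S x *\<^sub>R (norm (f x))\<^sup>2" for x
    by (cases "x \<in> S") auto
  then show ?thesis unfolding l2norm_def set_lebesgue_integral_def by simp
qed

lemma l2norm_nonneg [simp]: "0 \<le> l2norm S f"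
proof -
  have "0 \<le> (LINT x:S|lebesgue. (norm (f x))\<^sup>2)"
    unfolding set_lebesgue_integral_def by (rule Bochner_Integration.integral_nonneg) auto
  then show ?thesis unfolding l2norm_def by simp
qed

lemma l2norm_square: "(l2norm S f)\<^sup>2 = (LINT x:S|lebesgue. (norm (f x))\<^sup>2)"
proof -
  have "0 \<le> (LINT x:S|lebesgue. (norm (f x))\<^sup>2)"
    unfolding set_lebesgue_integral_def by (rule Bochner_Integration.integral_nonneg) auto
  then show ?thesis unfolding l2norm_def by simp
qed

lemma cauchy_schwarz_integral:
  assumes f: "f square_integrable_on S" and g: "g square_integrable_on S"
  shows "(\<lambda>x. f x * g x) absolutely_integrable_on S"
    and "(LINT x:S|lebesgue. norm (f x * g x)) \<le> l2norm S f * l2norm S g"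
    and "norm (LINT x:S|lebesgue. f x * g x) \<le> l2norm S f * l2norm S g"
proof -
  define F where "F x = complex_of_real (norm (indicator S x *\<^sub>R f x))" for x
  define G where "G x = complex_of_real (norm (indicator S x *\<^sub>R g x))" for x
  have F: "F square_integrable_on UNIV" and G: "G square_integrable_on UNIV"
    using f g unfolding sq_int_indicator[of _ S] square_integrable_on_UNIV F_def G_def
    by (auto intro!: borel_measurable_of_real borel_measurable_norm simp del: norm_scaleR)
  have mf: "(\<lambda>x. indicator S x *\<^sub>R f x) \<in> borel_measurable lebesgue" and mg: "(\<lambda>x. indicator S x *\<^sub>R g x) \<in> borel_measurable lebesgue"
    using f g unfolding sq_int_indicator[of _ S] square_integrable_on_UNIV by auto
  have FG: "inner (F x) (G x) = indicator S x *\<^sub>R norm (f x * g x)" for x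
    by (cases "x \<in> S") (auto simp: F_def G_def inner_complex_def norm_mult)
  have int: "integrable lebesgue (\<lambda>x. indicator S x *\<^sub>R norm (f x * g x))"
    using square_integrable_inner[OF F G] unfolding FG .
  have eq: "indicator S x *\<^sub>R (f x * g x) = (indicator S x *\<^sub>R f x) * (indicator S x *\<^sub>R g x)" for x
    by (cases "x \<in> S") auto
  show *: "(\<lambda>x. f x * g x) absolutely_integrable_on S"
    unfolding set_integrable_def
  proof (rule Bochner_Integration.integrable_bound[OF int])
    show "(\<lambda>x. indicator S x *\<^sub>R (f x * g x)) \<in> borel_measurable lebesgue"
      unfolding eq by (rule borel_measurable_times[OF mf mg])
  qed (simp)
  have "(LINT x:S|lebesgue. norm (f x * g x)) = abs_l2 F \<bullet> abs_l2 G"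
    unfolding set_lebesgue_integral_def FG[symmetric] using inner_l2.abs_eq[of F G] F G by simp
  also have "\<dots> \<le> norm (abs_l2 F) * norm (abs_l2 G)" by (rule norm_cauchy_schwarz)
  also have "norm (abs_l2 F) = l2norm S f"
    using norm_l2.abs_eq[of F] F unfolding l2norm_indicator[symmetric, of S f]
    by (simp add: l2norm_def set_lebesgue_integral_def F_def norm_mult)
  also have "norm (abs_l2 G) = l2norm S g"
    using norm_l2.abs_eq[of G] G unfolding l2norm_indicator[symmetric, of S g]
    by (simp add: l2norm_def set_lebesgue_integral_def G_def norm_mult)
  finally show **: "(LINT x:S|lebesgue. norm (f x * g x)) \<le> l2norm S f * l2norm S g" .
  show "norm (LINT x:S|lebesgue. f x * g x) \<le> l2norm S f * l2norm S g"
    using set_integral_norm_bound[OF *] ** by linarith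
qed

lemma sq_int_subset:
  assumes "f square_integrable_on S" "T \<subseteq> S" "T \<in> sets lebesgue"
  shows "f square_integrable_on T" "l2norm T f \<le> l2norm S f"
proof -
  have 1: "set_integrable lebesgue T (\<lambda>x. (norm (f x))\<^sup>2)" and 2: "set_integrable lebesgue S (\<lambda>x. (norm (f x))\<^sup>2)"
    using assms by (auto simp: square_integrable_on_def intro: set_integrable_subset)
  have "(\<lambda>x. indicator T x *\<^sub>R (indicator S x *\<^sub>R f x)) \<in> borel_measurable lebesgue"
    using assms(1) by (intro borel_measurable_scaleR[OF borel_measurable_indicator[OF assms(3)]])
      (auto simp: square_integrable_on_def set_borel_measurable_def)
  moreover have "indicator T x *\<^sub>R (indicator S x *\<^sub>R f x) = indicator T x *\<^sub>R f x" for x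
    using assms(2) by (auto simp: indicator_def)
  ultimately have "set_borel_measurable lebesgue T f" by (simp only: set_borel_measurable_def)
  then show "f square_integrable_on T" using 1 by (simp add: square_integrable_on_def)
  have "(LINT x:T|lebesgue. (norm (f x))\<^sup>2) \<le> (LINT x:S|lebesgue. (norm (f x))\<^sup>2)"
    using 1 2 assms(2) unfolding set_lebesgue_integral_def set_integrable_def
    by (intro integral_mono) (auto simp: indicator_def)
  then show "l2norm T f \<le> l2norm S f" unfolding l2norm_def by simp
qed

lemma sq_int_bounded_interval:
  fixes f :: "real \<Rightarrow> complex"
  assumes "f \<in> borel_measurable lebesgue" "\<And>x. a \<le> x \<Longrightarrow> x \<le> b \<Longrightarrow> norm (f x) \<le> B" "a \<le> b"
  shows "f square_integrable_on {a..b}" "l2norm {a..b} f \<le> sqrt (b - a) * B"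
proof -
  have B: "0 \<le> B" using order_trans[OF norm_ge_zero assms(2)[of a]] assms(3) by simp
  have i: "integrable lebesgue (\<lambda>x. indicator {a..b} x *\<^sub>R B\<^sup>2)"
    using integrable_on_const[of "{a..b}" "B\<^sup>2"] absolutely_integrable_continuous_real[of a b "\<lambda>_. B\<^sup>2"]
    by (simp add: set_integrable_def)
  have m: "set_borel_measurable lebesgue {a..b} f"
    unfolding set_borel_measurable_def by (intro borel_measurable_scaleR borel_measurable_indicator assms(1)) auto
  have le: "norm (indicator {a..b} x *\<^sub>R (norm (f x))\<^sup>2) \<le> indicator {a..b} x *\<^sub>R B\<^sup>2" for x
    using assms(2)[of x] by (cases "x \<in> {a..b}") (auto intro: power_mono)
  have i2: "integrable lebesgue (\<lambda>x. indicator {a..b} x *\<^sub>R (norm (f x))\<^sup>2)"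
  proof (rule Bochner_Integration.integrable_bound[OF i])
    show "(\<lambda>x. indicator {a..b} x *\<^sub>R (norm (f x))\<^sup>2) \<in> borel_measurable lebesgue"
      by (rule borel_measurable_scaleR[OF borel_measurable_indicator]) (use assms(1) in \<open>simp, measurable\<close>)
    show "AE x in lebesgue. norm (indicator {a..b} x *\<^sub>R (norm (f x))\<^sup>2) \<le> norm (indicator {a..b} x *\<^sub>R B\<^sup>2)"
      using le by (intro AE_I2 order_trans[OF le]) simp
  qed
  then show "f square_integrable_on {a..b}" using m by (simp add: square_integrable_on_def set_integrable_def)
  have "(LINT x:{a..b}|lebesgue. (norm (f x))\<^sup>2) \<le> (LINT x|lebesgue. indicator {a..b} x *\<^sub>R B\<^sup>2)"
    unfolding set_lebesgue_integral_def using le by (intro integral_mono i i2) (auto intro: order_trans[OF abs_ge_self])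
  also have "\<dots> = (b - a) * B\<^sup>2" using assms(3) by simp
  finally have "l2norm {a..b} f \<le> sqrt ((b - a) * B\<^sup>2)" unfolding l2norm_def by simp
  also have "\<dots> = sqrt (b - a) * B" using B by (simp add: real_sqrt_mult)
  finally show "l2norm {a..b} f \<le> sqrt (b - a) * B" .
qed

lemma sq_int_abs_integrable:
  assumes "f square_integrable_on S" "{a..b} \<subseteq> S"
  shows "f absolutely_integrable_on {a..b}"
    "a \<le> b \<Longrightarrow> integral {a..b} (\<lambda>x. norm (f x)) \<le> sqrt (b - a) * l2norm S f"
proof -
  have *: "f absolutely_integrable_on {a..b} \<and> integral {a..b} (\<lambda>x. norm (f x)) \<le> sqrt (b - a) * l2norm S f" if "a \<le> b"
  proof -
    have f: "f square_integrable_on {a..b}" "l2norm {a..b} f \<le> l2norm S f"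
      using sq_int_subset[OF assms] by auto
    have one: "(\<lambda>x. 1) square_integrable_on {a..b}" "l2norm {a..b} (\<lambda>x. 1) \<le> sqrt (b - a) * 1"
      using sq_int_bounded_interval[of "\<lambda>x. 1" a b 1] that by simp_all
    from cauchy_schwarz_integral[OF one(1) f(1)]
    have i: "f absolutely_integrable_on {a..b}"
      and le: "(LINT x:{a..b}|lebesgue. norm (f x)) \<le> l2norm {a..b} (\<lambda>x. 1) * l2norm {a..b} f" by auto
    have "integral {a..b} (\<lambda>x. norm (f x)) = (LINT x:{a..b}|lebesgue. norm (f x))"
      by (rule set_lebesgue_integral_eq_integral(2)[OF set_integrable_norm[OF i], symmetric])
    also have "\<dots> \<le> sqrt (b - a) * l2norm S f"
      using le mult_mono[OF one(2) f(2)] that by simp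
    finally show ?thesis using i by simp
  qed
  show "f absolutely_integrable_on {a..b}"
    using * by (cases "a \<le> b") (auto simp: set_integrable_def)
  show "a \<le> b \<Longrightarrow> integral {a..b} (\<lambda>x. norm (f x)) \<le> sqrt (b - a) * l2norm S f" using * by blast
qed

lemma exp_sq_int:
  assumes "Re k > 0"
  shows "(\<lambda>x. exp (- (k * complex_of_real x))) square_integrable_on {a..}"
    "l2norm {a..} (\<lambda>x. exp (- (k * complex_of_real x))) = exp (- Re k * a) / sqrt (2 * Re k)"
proof -
  have n: "(norm (exp (- (k * complex_of_real x))))\<^sup>2 = exp (- (2 * Re k) * x)" for x
    by (simp add: power2_eq_square flip: exp_add)
  have i: "((\<lambda>x. exp (- (2 * Re k) * x)) has_integral exp (- (2 * Re k) * a) / (2 * Re k)) {a..}"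
    using has_integral_exp_minus_to_infinity[of "2 * Re k" a] assms by simp
  then have ai: "(\<lambda>x. exp (- (2 * Re k) * x)) absolutely_integrable_on {a..}"
    by (intro nonnegative_absolutely_integrable_1) auto
  have "continuous_on UNIV (\<lambda>x. exp (- (k * complex_of_real x)))" by (intro continuous_intros)
  then have m: "(\<lambda>x. exp (- (k * complex_of_real x))) \<in> borel_measurable lebesgue"
    by (rule continuous_lebesgue_measurable)
  have "set_borel_measurable lebesgue {a..} (\<lambda>x. exp (- (k * complex_of_real x)))"
    unfolding set_borel_measurable_def by (intro borel_measurable_scaleR borel_measurable_indicator m) auto
  then show "(\<lambda>x. exp (- (k * complex_of_real x))) square_integrable_on {a..}"
    using ai unfolding square_integrable_on_def n by simp
  have "(LINT x:{a..}|lebesgue. exp (- (2 * Re k) * x)) = exp (- (2 * Re k) * a) / (2 * Re k)"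
    using set_lebesgue_integral_eq_integral(2)[OF ai] integral_unique[OF i] by simp
  then have "l2norm {a..} (\<lambda>x. exp (- (k * complex_of_real x))) = sqrt ((exp (- Re k * a))\<^sup>2 / (2 * Re k))"
    unfolding l2norm_def n by (simp add: power2_eq_square flip: exp_add)
  also have "\<dots> = exp (- Re k * a) / sqrt (2 * Re k)" by (simp add: real_sqrt_divide)
  finally show "l2norm {a..} (\<lambda>x. exp (- (k * complex_of_real x))) = exp (- Re k * a) / sqrt (2 * Re k)" .
qed

subsection \<open>Functions on a half-line\<close>

text \<open>An integrable function with integrable derivative has a limit at infinity, and the limit can only
  be zero.\<close>

lemma primitive_vanishes_at_top:
  assumes P: "primitive p d" and p: "p absolutely_integrable_on {a..}" and d: "d absolutely_integrable_on {a..}"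
  shows "p a = - (LINT x:{a..}|lebesgue. d x)"
proof -
  define L where "L = p a + (LINT x:{a..}|lebesgue. d x)"
  have "((\<lambda>b. LINT x:{a..b}|lebesgue. d x) \<longlongrightarrow> (LINT x:{a..}|lebesgue. d x)) at_top"
    by (rule tendsto_set_lebesgue_integral_at_top[OF _ d]) auto
  then have "((\<lambda>b. p a + (LINT x:{a..b}|lebesgue. d x)) \<longlongrightarrow> L) at_top"
    unfolding L_def by (intro tendsto_intros)
  moreover have "p a + (LINT x:{a..b}|lebesgue. d x) = p b" if "b \<ge> a" for b
    using set_lebesgue_integral_eq_integral(2)[OF primitiveD(1)[OF P, of a b]] primitiveD(3)[OF P that] by simp
  then have "eventually (\<lambda>b. p a + (LINT x:{a..b}|lebesgue. d x) = p b) at_top"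
    using eventually_at_top_linorder by blast
  ultimately have lim: "(p \<longlongrightarrow> L) at_top"
    by (rule Lim_transform_eventually)
  have "L = 0"
  proof (rule ccontr)
    assume "L \<noteq> 0"
    then have pos: "norm L / 2 > 0" by simp
    have "eventually (\<lambda>b. norm (p b) > norm L / 2) at_top"
      using order_tendstoD(1)[OF tendsto_norm[OF lim], of "norm L / 2"] pos by auto
    then obtain B where B: "\<And>b. b \<ge> B \<Longrightarrow> norm (p b) > norm L / 2"
      by (auto simp: eventually_at_top_linorder)
    define c where "c = max a B"
    define I where "I = (LINT x:{a..}|lebesgue. norm (p x))"
    have np: "set_integrable lebesgue {a..} (\<lambda>x. norm (p x))" by (rule set_integrable_norm[OF p])
    have "(norm L / 2) * T \<le> I" if T: "T > 0" for T
    proof -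
      have "(LINT x:{c..c+T}|lebesgue. norm L / 2) \<le> I"
        unfolding I_def set_lebesgue_integral_def
      proof (rule integral_mono)
        show "integrable lebesgue (\<lambda>x. indicator {a..} x *\<^sub>R norm (p x))"
          using np by (simp add: set_integrable_def)
        show "integrable lebesgue (\<lambda>x. indicator {c..c + T} x *\<^sub>R (norm L / 2))"
          using absolutely_integrable_continuous_real[of c "c+T" "\<lambda>_. norm L / 2"] by (simp add: set_integrable_def)
        show "indicator {c..c + T} x *\<^sub>R (norm L / 2) \<le> indicator {a..} x *\<^sub>R norm (p x)" for x
          using B[of x] by (auto simp: indicator_def c_def)
      qed
      moreover have "(LINT x:{c..c+T}|lebesgue. norm L / 2) = (norm L / 2) * T"
        using T by (simp add: set_lebesgue_integral_def)
      ultimately show ?thesis by simp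
    qed
    from this[of "2 * (\<bar>I\<bar> + 1) / norm L"] \<open>L \<noteq> 0\<close>
    have "(norm L / 2) * (2 * (\<bar>I\<bar> + 1) / norm L) \<le> I" by (simp add: divide_pos_pos)
    moreover have "(norm L / 2) * (2 * (\<bar>I\<bar> + 1) / norm L) = \<bar>I\<bar> + 1"
      using \<open>L \<noteq> 0\<close> by simp
    ultimately show False by linarith
  qed
  then show ?thesis unfolding L_def by (simp add: eq_neg_iff_add_eq_0)
qed

text \<open>The identity \<open>exp_identity\<close>, integrated from \<open>a\<close> to infinity, combined with the Cauchy-Schwarz
  inequality for \<open>exp (- k x)\<close> and \<open>f\<close>.\<close>

lemma half_line_bound:
  assumes h: "W2 h h1 h2" and eq: "\<And>x. x > a \<Longrightarrow> h2 x = k\<^sup>2 * h x - f x"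
    and L2: "h square_integrable_on {a..}" "h1 square_integrable_on {a..}" "f square_integrable_on {a..}"
    and k: "Re k > 0"
  shows "norm (h1 a + k * h a) \<le> l2norm {a..} f / sqrt (2 * Re k)"
proof -
  define e where "e x = exp (- (k * complex_of_real x))" for x
  have e: "e square_integrable_on {a..}" "l2norm {a..} e = exp (- Re k * a) / sqrt (2 * Re k)"
    unfolding e_def using exp_sq_int[OF k] by auto
  have P: "primitive (\<lambda>x. e x * (h1 x + k * h x)) (\<lambda>x. e x * (h2 x - k\<^sup>2 * h x))"
    unfolding e_def by (rule exp_identity[OF h])
  have ef: "(\<lambda>x. e x * f x) absolutely_integrable_on {a..}"
    by (rule cauchy_schwarz_integral(1)[OF e(1) L2(3)])
  have neg: "negligible {a}" by simp
  have ef2: "(\<lambda>x. e x * (h2 x - k\<^sup>2 * h x)) absolutely_integrable_on {a..}"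
    by (rule absolutely_integrable_spike[OF set_integrable_mult_right[OF ef, of "-1"] neg]) (auto simp: eq)
  have "(\<lambda>x. e x * h1 x + k * (e x * h x)) absolutely_integrable_on {a..}"
    by (intro set_integral_add(1) set_integrable_mult_right cauchy_schwarz_integral(1)[OF e(1)] L2)
  then have "(\<lambda>x. e x * (h1 x + k * h x)) absolutely_integrable_on {a..}"
    by (simp add: algebra_simps)
  from primitive_vanishes_at_top[OF P this ef2]
  have "e a * (h1 a + k * h a) = - (LINT x:{a..}|lebesgue. e x * (h2 x - k\<^sup>2 * h x))" .
  also have "(LINT x:{a..}|lebesgue. e x * (h2 x - k\<^sup>2 * h x)) = (LINT x:{a..}|lebesgue. - (e x * f x))"
    unfolding set_lebesgue_integral_eq_integral(2)[OF ef2]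
    using set_lebesgue_integral_eq_integral(2)[OF set_integrable_mult_right[OF ef, of "-1"]]
      integral_spike[OF neg, of "{a..}" "\<lambda>x. e x * (h2 x - k\<^sup>2 * h x)" "\<lambda>x. - (e x * f x)"]
    by (simp add: eq)
  also have "- \<dots> = (LINT x:{a..}|lebesgue. e x * f x)" by (simp add: set_lebesgue_integral_def)
  finally have "norm (e a) * norm (h1 a + k * h a) = norm (LINT x:{a..}|lebesgue. e x * f x)"
    by (simp flip: norm_mult)
  also have "\<dots> \<le> l2norm {a..} e * l2norm {a..} f" by (rule cauchy_schwarz_integral(3)[OF e(1) L2(3)])
  also have "\<dots> = norm (e a) * (l2norm {a..} f / sqrt (2 * Re k))" unfolding e(2) by (simp add: e_def)
  finally have "norm (e a) * norm (h1 a + k * h a) \<le> norm (e a) * (l2norm {a..} f / sqrt (2 * Re k))" .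
  then show ?thesis by (rule mult_left_le_imp_le) (simp add: e_def)
qed

lemma sq_int_reflect:
  assumes "f square_integrable_on S"
  shows "(\<lambda>x. f (- x)) square_integrable_on (uminus ` S)" "l2norm (uminus ` S) (\<lambda>x. f (- x)) = l2norm S f"
proof -
  have ind: "indicator (uminus ` S) x = (indicator S (0 + (-1) * x) :: real)" for x :: real
    by (auto simp: indicator_def) (metis add.inverse_inverse imageI)
  have "(\<lambda>x. indicator S x *\<^sub>R f x) \<in> borel_measurable lebesgue"
    using assms by (simp add: square_integrable_on_def set_borel_measurable_def)
  from borel_measurable_affine[OF this, of "-1" 0]
  have m: "set_borel_measurable lebesgue (uminus ` S) (\<lambda>x. f (- x))"
    unfolding set_borel_measurable_def ind by simp
  have i: "integrable lebesgue (\<lambda>x. indicator S x *\<^sub>R (norm (f x))\<^sup>2)"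
    using assms by (simp add: square_integrable_on_def set_integrable_def)
  from lebesgue_integrable_real_affine[OF this, of "-1" 0]
  have "set_integrable lebesgue (uminus ` S) (\<lambda>x. (norm (f (-x)))\<^sup>2)"
    unfolding set_integrable_def ind by simp
  with m show "(\<lambda>x. f (- x)) square_integrable_on (uminus ` S)" by (simp add: square_integrable_on_def)
  show "l2norm (uminus ` S) (\<lambda>x. f (- x)) = l2norm S f"
    using lebesgue_integral_real_affine[of "-1" "\<lambda>x. indicator S x *\<^sub>R (norm (f x))\<^sup>2" 0]
    unfolding l2norm_def set_lebesgue_integral_def ind by simp
qed

lemma half_line_bound_left:
  assumes h: "W2 h h1 h2" and eq: "\<And>x. x < a \<Longrightarrow> h2 x = k\<^sup>2 * h x - f x"
    and L2: "h square_integrable_on {..a}" "h1 square_integrable_on {..a}" "f square_integrable_on {..a}"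
    and k: "Re k > 0"
  shows "norm (- h1 a + k * h a) \<le> l2norm {..a} f / sqrt (2 * Re k)"
proof -
  have h': "W2 (\<lambda>x. h (- x)) (\<lambda>x. - h1 (- x)) (\<lambda>x. h2 (- x))"
    using W2_affine[OF h, of "-1" 0] by simp
  have im: "uminus ` {..a} = {-a..}" by auto
  have "norm (- h1 (- (-a)) + k * h (- (-a))) \<le> l2norm {-a..} (\<lambda>x. f (- x)) / sqrt (2 * Re k)"
  proof (rule half_line_bound[OF h' _ _ _ _ k])
    show "h2 (- x) = k\<^sup>2 * h (- x) - f (- x)" if "x > -a" for x using eq[of "-x"] that by simp
    show "(\<lambda>x. h (- x)) square_integrable_on {-a..}" "(\<lambda>x. f (- x)) square_integrable_on {-a..}"
      using sq_int_reflect(1)[OF L2(1)] sq_int_reflect(1)[OF L2(3)] im by auto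
    have "(\<lambda>x. h1 (- x)) square_integrable_on {-a..}" using sq_int_reflect(1)[OF L2(2)] im by auto
    then show "(\<lambda>x. - h1 (- x)) square_integrable_on {-a..}"
      by (simp add: square_integrable_on_def set_borel_measurable_def)
  qed
  then show ?thesis using sq_int_reflect(2)[OF L2(3)] im by simp
qed

subsection \<open>The free resolvent\<close>

text \<open>One half of the convolution with \<open>exp (- k \<bar>x\<bar>)\<close>. The primitive is taken from minus infinity, which
  makes its product with \<open>exp (- k x)\<close> bounded.\<close>

lemma exp_primitive:
  assumes f: "f square_integrable_on UNIV" and k: "Re k > 0"
  shows "\<exists>P. primitive P (\<lambda>x. exp (k * complex_of_real x) * f x) \<and>
    (\<forall>x. norm (exp (- (k * complex_of_real x)) * P x) \<le> l2norm UNIV f / sqrt (2 * Re k))"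
proof -
  define g where "g x = exp (k * complex_of_real x) * f x" for x
  define P where "P x = (LINT s:{..x}|lebesgue. g s)" for x
  have e: "(\<lambda>s. exp (k * complex_of_real s)) square_integrable_on {..x}"
    "l2norm {..x} (\<lambda>s. exp (k * complex_of_real s)) = exp (Re k * x) / sqrt (2 * Re k)" for x
  proof -
    have im: "uminus ` {-x..} = {..x}"
      by (auto simp: image_def intro!: bexI[of _ "- _"])
    show "(\<lambda>s. exp (k * complex_of_real s)) square_integrable_on {..x}"
      "l2norm {..x} (\<lambda>s. exp (k * complex_of_real s)) = exp (Re k * x) / sqrt (2 * Re k)"
      using sq_int_reflect[OF exp_sq_int(1)[OF k, of "-x"]] exp_sq_int(2)[OF k, of "-x"] unfolding im by simp_all
  qed
  have fx: "f square_integrable_on {..x}" "l2norm {..x} f \<le> l2norm UNIV f" for x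
    using sq_int_subset[OF f, of "{..x}"] by auto
  have g: "g absolutely_integrable_on {..x}" for x
    unfolding g_def by (rule cauchy_schwarz_integral(1)[OF e(1) fx(1)])
  have "primitive P g"
    unfolding primitive_def
  proof (intro allI impI conjI)
    fix a b :: real assume ab: "a \<le> b"
    show gab: "g absolutely_integrable_on {a..b}" by (rule set_integrable_subset[OF g[of b]]) auto
    have g': "g absolutely_integrable_on {a<..b}" by (rule set_integrable_subset[OF g[of b]]) auto
    have "{..b} = {..a} \<union> {a<..b}" using ab by auto
    then have "P b = P a + (LINT s:{a<..b}|lebesgue. g s)"
      unfolding P_def using set_integral_Un[OF _ g[of a] g'] by fastforce
    moreover have "(LINT s:{a<..b}|lebesgue. g s) = integral {a..b} g"
      unfolding set_lebesgue_integral_eq_integral(2)[OF g']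
      by (rule integral_subset_negligible) (auto intro: negligible_subset[of "{a}"])
    ultimately show "P b - P a = integral {a..b} g" by simp
  qed
  moreover have "norm (exp (- (k * complex_of_real x)) * P x) \<le> l2norm UNIV f / sqrt (2 * Re k)" for x
  proof -
    have "norm (P x) \<le> exp (Re k * x) / sqrt (2 * Re k) * l2norm {..x} f"
      unfolding P_def g_def e(2)[symmetric] by (rule cauchy_schwarz_integral(3)[OF e(1) fx(1)])
    also have "\<dots> \<le> exp (Re k * x) / sqrt (2 * Re k) * l2norm UNIV f"
      using k by (intro mult_left_mono fx) auto
    finally have "exp (- Re k * x) * norm (P x) \<le> exp (- Re k * x) * (exp (Re k * x) / sqrt (2 * Re k) * l2norm UNIV f)"
      by (intro mult_left_mono) auto
    also have "\<dots> = l2norm UNIV f / sqrt (2 * Re k)" by (simp add: exp_minus)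
    finally show ?thesis by (simp add: norm_mult)
  qed
  ultimately show ?thesis unfolding g_def by blast
qed

lemma sq_int_of_bounded_l2norm:
  fixes f :: "real \<Rightarrow> complex"
  assumes c: "continuous_on UNIV f" and B: "\<And>N::nat. l2norm {-real N..real N} f \<le> B"
  shows "f square_integrable_on UNIV"
proof -
  have m: "f \<in> borel_measurable lebesgue"
    by (rule continuous_lebesgue_measurable[OF c])
  define F where "F N x = indicator {-real N..real N} x *\<^sub>R (norm (f x))\<^sup>2" for N :: nat and x
  have Fi: "integrable lebesgue (F N)" for N
    using absolutely_integrable_continuous_real[of "-real N" "real N" "\<lambda>x. (norm (f x))\<^sup>2"] 
      continuous_on_subset[OF c, of "{-real N..real N}"]
    unfolding F_def set_integrable_def by (simp add: continuous_on_norm continuous_on_power)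
  have le: "integral\<^sup>L lebesgue (F N) \<le> B\<^sup>2" for N
    using power_mono[OF B l2norm_nonneg, of N 2] unfolding l2norm_square by (simp add: F_def[abs_def] set_lebesgue_integral_def)
  have mono: "F N x \<le> F M x" if "N \<le> M" for N M x using that by (auto simp: F_def indicator_def)
  have "incseq (\<lambda>N. integral\<^sup>L lebesgue (F N))"
    by (intro incseq_SucI integral_mono Fi) (auto intro: mono)
  then obtain L where L: "(\<lambda>N. integral\<^sup>L lebesgue (F N)) \<longlonglongrightarrow> L"
    using incseq_convergent[of _ "B\<^sup>2"] le by blast
  have "integrable lebesgue (\<lambda>x. (norm (f x))\<^sup>2)"
  proof (rule integrable_monotone_convergence[OF Fi _ _ L])
    show "AE x in lebesgue. mono (\<lambda>n. F n x)" by (intro AE_I2) (simp add: mono_def mono)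
    show "AE x in lebesgue. (\<lambda>i. F i x) \<longlonglongrightarrow> (norm (f x))\<^sup>2"
    proof (rule AE_I2)
      fix x :: real
      have "F i x = (norm (f x))\<^sup>2" if "i \<ge> nat \<lceil>\<bar>x\<bar>\<rceil>" for i
        using that by (auto simp: F_def indicator_def abs_le_iff)
      then have "eventually (\<lambda>i. F i x = (norm (f x))\<^sup>2) sequentially"
        using eventually_sequentially by blast
      then show "(\<lambda>i. F i x) \<longlonglongrightarrow> (norm (f x))\<^sup>2" by (rule tendsto_eventually)
    qed
    show "(\<lambda>x. (norm (f x))\<^sup>2) \<in> borel_measurable lebesgue" using m by measurable
  qed
  then show ?thesis using m by (simp add: square_integrable_on_UNIV)
qed

text \<open>The solution is the convolution of \<open>f\<close> with \<open>exp (- k \<bar>x\<bar>) / (2 k)\<close>, split into its two one-sided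
  parts. The Cauchy-Schwarz inequality only shows that it is bounded. Square integrability then follows
  from the imaginary part of the energy identity on \<open>[-N, N]\<close>, in which the boundary terms are bounded
  and \<open>Im (k\<^sup>2)\<close> does not vanish; this avoids an inequality for convolutions.\<close>

lemma free_resolvent:
  assumes f: "f square_integrable_on UNIV" and k: "Re k > 0" and im: "Im (k\<^sup>2) \<noteq> 0"
  shows "\<exists>h h1. W2 h h1 (\<lambda>x. k\<^sup>2 * h x - f x) \<and> h square_integrable_on UNIV \<and> h1 square_integrable_on UNIV"
proof -
  define F where "F = l2norm UNIV f"
  define C where "C = F / sqrt (2 * Re k)"
  define e where "e c x = exp (c * complex_of_real x)" for c and x :: real
  have "(\<lambda>x. f (- x)) square_integrable_on UNIV" "l2norm UNIV (\<lambda>x. f (- x)) = F"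
    using sq_int_reflect[OF f] by (simp_all add: F_def surj_uminus)
  then obtain P R where P: "primitive P (\<lambda>x. e k x * f x)" and Pb: "\<And>x. norm (e (-k) x * P x) \<le> C"
    and R: "primitive R (\<lambda>x. e k x * f (- x))" and Rb: "\<And>x. norm (e (-k) x * R x) \<le> C"
    using exp_primitive[OF f k] exp_primitive[of "\<lambda>x. f (- x)", OF _ k] unfolding e_def C_def F_def by auto
  define Q where "Q x = R (- x)" for x
  have Q: "primitive Q (\<lambda>x. - (e (-k) x * f x))"
    using primitive_affine[OF R, of "-1" 0] by (simp add: Q_def[abs_def] e_def)
  have Qb: "norm (e k x * Q x) \<le> C" for x using Rb[of "-x"] by (simp add: Q_def e_def)
  have C0: "C \<ge> 0" using order_trans[OF norm_ge_zero Qb] .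
  have k0: "k \<noteq> 0" using k by auto
  define h where "h x = (e (-k) x * P x + e k x * Q x) * inverse (2 * k)" for x
  define h1 where "h1 x = (- (e (-k) x * P x) + e k x * Q x) * inverse 2" for x
  have ee: "e (-k) x * e k x = 1" for x by (simp add: e_def flip: exp_add)
  have eP: "primitive (\<lambda>x. e (-k) x * P x) (\<lambda>x. (-k * e (-k) x) * P x + e (-k) x * (e k x * f x))"
    unfolding e_def
    by (rule primitive_mult_C1[OF has_vector_derivative_exp_linear _ P[unfolded e_def]]) (intro continuous_intros)
  have eQ: "primitive (\<lambda>x. e k x * Q x) (\<lambda>x. (k * e k x) * Q x + e k x * (- (e (-k) x * f x)))"
    unfolding e_def
    by (rule primitive_mult_C1[OF has_vector_derivative_exp_linear _ Q[unfolded e_def]]) (intro continuous_intros)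
  have "primitive (\<lambda>x. inverse (2*k) * (e (-k) x * P x + e k x * Q x))
    (\<lambda>x. inverse (2*k) * (((-k * e (-k) x) * P x + e (-k) x * (e k x * f x)) + ((k * e k x) * Q x + e k x * (- (e (-k) x * f x)))))"
    by (intro primitive_cmult primitive_add eP eQ)
  moreover have "inverse (2*k) * (((-k * e (-k) x) * P x + e (-k) x * (e k x * f x)) + ((k * e k x) * Q x + e k x * (- (e (-k) x * f x)))) = h1 x" for x
    using k0 by (simp add: h1_def field_simps)
  ultimately have p1: "primitive h h1" by (simp add: h_def[abs_def] mult.commute)
  have "primitive (\<lambda>x. inverse 2 * (- (e (-k) x * P x) + e k x * Q x))
    (\<lambda>x. inverse 2 * (- ((-k * e (-k) x) * P x + e (-k) x * (e k x * f x)) + ((k * e k x) * Q x + e k x * (- (e (-k) x * f x)))))"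
    by (intro primitive_cmult primitive_add primitive_uminus eP eQ)
  moreover have "inverse 2 * (- ((-k * e (-k) x) * P x + e (-k) x * (e k x * f x)) + ((k * e k x) * Q x + e k x * (- (e (-k) x * f x)))) = k\<^sup>2 * h x - f x" for x
  proof -
    have "inverse 2 * (- ((-k * e (-k) x) * P x + e (-k) x * (e k x * f x)) + ((k * e k x) * Q x + e k x * (- (e (-k) x * f x))))
      = inverse 2 * k * (e (-k) x * P x + e k x * Q x) - (e (-k) x * e k x) * f x"
      by (simp add: algebra_simps)
    also have "\<dots> = k\<^sup>2 * h x - f x"
      unfolding ee using k0 by (simp add: h_def field_simps power2_eq_square)
    finally show ?thesis .
  qed
  moreover have h1eq: "h1 = (\<lambda>x. inverse 2 * (- (e (-k) x * P x) + e k x * Q x))"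
    by (simp add: h1_def fun_eq_iff mult.commute)
  ultimately have p2: "primitive h1 (\<lambda>x. k\<^sup>2 * h x - f x)" unfolding h1eq by (simp only:)
  have W: "W2 h h1 (\<lambda>x. k\<^sup>2 * h x - f x)" by (rule W2I[OF p1 p2])
  define D where "D = C * (1 + inverse (norm k))"
  have hb: "norm (h x) \<le> D" for x
  proof -
    have "norm (h x) \<le> (C + C) * inverse (2 * norm k)"
      unfolding h_def norm_mult using k0 norm_triangle_mono[OF Pb Qb, of x x]
      by (simp add: norm_inverse norm_mult mult_right_mono)
    also have "\<dots> = C * inverse (norm k)" using k0 by (simp add: field_simps)
    also have "\<dots> \<le> D" using C0 by (simp add: D_def algebra_simps)
    finally show ?thesis .
  qed
  have h1b: "norm (h1 x) \<le> D" for x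
  proof -
    have "norm (- (e (-k) x * P x) + e k x * Q x) \<le> C + C"
      by (rule norm_triangle_mono) (use Pb Qb in auto)
    then have "norm (h1 x) \<le> C" unfolding h1_def by (simp add: norm_mult)
    also have "\<dots> \<le> D" using C0 by (simp add: D_def algebra_simps)
    finally show ?thesis .
  qed
  have D0: "D \<ge> 0" using order_trans[OF norm_ge_zero hb] .
  define m where "m = \<bar>Im (k\<^sup>2)\<bar>"
  have m: "m > 0" using im by (simp add: m_def)
  define X where "X N = l2norm {-real N..real N} h" for N :: nat
  have F0: "F \<ge> 0" by (simp add: F_def)
  have en: "integral {-real N..real N} (\<lambda>x. cnj (h1 x) * h1 x + cnj (h x) * (k\<^sup>2 * h x - f x))
      = cnj (h (real N)) * h1 (real N) - cnj (h (- real N)) * h1 (- real N)" for N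
    by (rule primitiveD(3)[OF energy_identity[OF W]]) simp
  define E where "E N = cnj (h (real N)) * h1 (real N) - cnj (h (- real N)) * h1 (- real N)" for N :: nat
  have Eb: "norm (E N) \<le> 2 * D\<^sup>2" for N
  proof -
    have "norm (cnj (h x) * h1 x) \<le> D * D" for x
      unfolding norm_mult using hb[of x] h1b[of x] D0 by (intro mult_mono) auto
    then have "norm (E N) \<le> D * D + D * D"
      unfolding E_def by (intro order_trans[OF norm_triangle_ineq4] add_mono) auto
    then show ?thesis by (simp add: power2_eq_square)
  qed
  define G where "G N = (LINT x:{-real N..real N}|lebesgue. cnj (h x) * f x)" for N :: nat
  have sq: "g square_integrable_on {-real N..real N}" if "continuous_on UNIV g" for g :: "real \<Rightarrow> complex" and N :: nat
  proof -
    have "compact (g ` {-real N..real N})" by (intro compact_continuous_image continuous_on_subset[OF that]) auto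
    then obtain B where B: "\<forall>x\<in>{-real N..real N}. norm (g x) \<le> B"
      using compact_imp_bounded[of "g ` {-real N..real N}"] by (auto simp: bounded_iff simp del: atLeastAtMost_iff)
    have "g \<in> borel_measurable lebesgue"
      by (rule continuous_lebesgue_measurable[OF that])
    then show ?thesis by (rule sq_int_bounded_interval(1)) (use B in auto)
  qed
  have ch: "continuous_on UNIV h" "continuous_on UNIV h1" by (auto intro: W2D[OF W])
  have fN: "f square_integrable_on {-real N..real N}" "l2norm {-real N..real N} f \<le> F" for N
    using sq_int_subset[OF f, of "{-real N..real N}"] by (auto simp: F_def)
  have l2cnj: "l2norm S (\<lambda>x. cnj (g x)) = l2norm S g" for S g by (simp add: l2norm_def)
  have cs: "(\<lambda>x. cnj (h x) * f x) absolutely_integrable_on {-real N..real N}" "norm (G N) \<le> X N * F" for N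
  proof -
    have c: "(\<lambda>x. cnj (h x)) square_integrable_on {-real N..real N}" by (intro sq continuous_intros ch)
    show "(\<lambda>x. cnj (h x) * f x) absolutely_integrable_on {-real N..real N}"
      by (rule cauchy_schwarz_integral(1)[OF c fN(1)])
    have "norm (G N) \<le> X N * l2norm {-real N..real N} f"
      using cauchy_schwarz_integral(3)[OF c fN(1)] unfolding G_def X_def l2cnj .
    also have "\<dots> \<le> X N * F" by (intro mult_left_mono fN) (simp add: X_def)
    finally show "norm (G N) \<le> X N * F" .
  qed
  define Y where "Y N = l2norm {-real N..real N} h1" for N :: nat
  have sqi: "(\<lambda>x. cnj (g x) * g x) absolutely_integrable_on {-real N..real N}"
     "integral {-real N..real N} (\<lambda>x. cnj (g x) * g x) = complex_of_real ((l2norm {-real N..real N} g)\<^sup>2)"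
     if "continuous_on UNIV g" for g and N :: nat
  proof -
    have c: "(\<lambda>x. cnj (g x)) square_integrable_on {-real N..real N}" by (intro sq continuous_intros that)
    show i: "(\<lambda>x. cnj (g x) * g x) absolutely_integrable_on {-real N..real N}"
      by (rule cauchy_schwarz_integral(1)[OF c sq[OF that]])
    have eq: "cnj (g x) * g x = complex_of_real ((norm (g x))\<^sup>2)" for x
      using complex_norm_square[of "g x"] by (simp add: mult.commute)
    have "integral {-real N..real N} (\<lambda>x. cnj (g x) * g x) = (LINT x:{-real N..real N}|lebesgue. cnj (g x) * g x)"
      by (rule set_lebesgue_integral_eq_integral(2)[OF i, symmetric])
    also have "\<dots> = complex_of_real (LINT x:{-real N..real N}|lebesgue. (norm (g x))\<^sup>2)"
      unfolding eq by (rule set_integral_complex_of_real)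
    finally show "integral {-real N..real N} (\<lambda>x. cnj (g x) * g x) = complex_of_real ((l2norm {-real N..real N} g)\<^sup>2)"
      by (simp add: l2norm_square)
  qed
  have id: "E N = complex_of_real ((Y N)\<^sup>2) + k\<^sup>2 * complex_of_real ((X N)\<^sup>2) - G N" for N
  proof -
    have i: "((\<lambda>x. cnj (h1 x) * h1 x + (k\<^sup>2 * (cnj (h x) * h x) - cnj (h x) * f x)) has_integral
       (complex_of_real ((Y N)\<^sup>2) + (k\<^sup>2 * complex_of_real ((X N)\<^sup>2) - G N))) {-real N..real N}"
      unfolding X_def Y_def G_def set_lebesgue_integral_eq_integral(2)[OF cs(1)]
        sqi(2)[OF ch(1), symmetric] sqi(2)[OF ch(2), symmetric]
      by (intro has_integral_add has_integral_diff has_integral_mult_right integrable_integral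
          set_lebesgue_integral_eq_integral(1) sqi(1) ch cs(1))
    have fe: "(\<lambda>x. cnj (h1 x) * h1 x + cnj (h x) * (k\<^sup>2 * h x - f x))
        = (\<lambda>x. cnj (h1 x) * h1 x + (k\<^sup>2 * (cnj (h x) * h x) - cnj (h x) * f x))"
      by (simp add: fun_eq_iff algebra_simps)
    have "E N = complex_of_real ((Y N)\<^sup>2) + (k\<^sup>2 * complex_of_real ((X N)\<^sup>2) - G N)"
      unfolding E_def en[of N, symmetric] fe by (rule integral_unique[OF i])
    then show ?thesis by (simp only: add_diff_eq)
  qed
  \<comment> \<open>Any bound on \<open>X N\<close> independent of \<open>N\<close> will do. If \<open>X N > 1\<close>, the boundary terms can be
    multiplied by \<open>X N\<close>, after which one factor cancels.\<close>
  define B where "B = 1 + (2 * D\<^sup>2 + F) / m"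
  have B1: "B \<ge> 1" using m F0 by (simp add: B_def)
  have XB: "X N \<le> B" for N
  proof (cases "X N \<le> 1")
    case False
    then have X1: "X N > 1" by simp
    have "Im (k\<^sup>2) * (X N)\<^sup>2 = Im (E N + G N)" unfolding id by simp
    moreover have "m * (X N)\<^sup>2 = \<bar>Im (k\<^sup>2) * (X N)\<^sup>2\<bar>" by (simp only: m_def abs_mult abs_of_nonneg[OF zero_le_power2])
    ultimately have "m * (X N)\<^sup>2 = \<bar>Im (E N + G N)\<bar>" by (simp only:)
    also have "\<dots> \<le> norm (E N) + norm (G N)"
      by (rule order_trans[OF abs_Im_le_cmod norm_triangle_ineq])
    also have "\<dots> \<le> 2 * D\<^sup>2 * X N + X N * F"
    proof (rule add_mono[OF _ cs(2)])
      have "2 * D\<^sup>2 * 1 \<le> 2 * D\<^sup>2 * X N" using X1 by (intro mult_left_mono) auto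
      then show "norm (E N) \<le> 2 * D\<^sup>2 * X N" using Eb[of N] by simp
    qed
    finally have "(m * X N) * X N \<le> (2 * D\<^sup>2 + F) * X N" by (simp add: algebra_simps power2_eq_square)
    then have "m * X N \<le> 2 * D\<^sup>2 + F" using X1 by simp
    then have "X N \<le> (2 * D\<^sup>2 + F) / m" using m by (simp add: field_simps)
    then show ?thesis by (simp add: B_def)
  qed (use B1 in simp)
  have YB: "Y N \<le> sqrt (2 * D\<^sup>2 + (norm (k\<^sup>2) * B\<^sup>2 + B * F))" for N
  proof -
    have "complex_of_real ((Y N)\<^sup>2) = E N - k\<^sup>2 * complex_of_real ((X N)\<^sup>2) + G N" unfolding id by simp
    then have "(Y N)\<^sup>2 = norm (E N - k\<^sup>2 * complex_of_real ((X N)\<^sup>2) + G N)"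
      by (metis norm_of_real abs_of_nonneg zero_le_power2)
    also have "\<dots> \<le> norm (E N) + norm (k\<^sup>2 * complex_of_real ((X N)\<^sup>2)) + norm (G N)"
      by (intro order_trans[OF norm_triangle_ineq] add_mono norm_triangle_ineq4) auto
    also have "norm (k\<^sup>2 * complex_of_real ((X N)\<^sup>2)) = norm (k\<^sup>2) * (X N)\<^sup>2" by (simp add: norm_mult norm_power)
    also have "norm (E N) + norm (k\<^sup>2) * (X N)\<^sup>2 + norm (G N) \<le> 2 * D\<^sup>2 + norm (k\<^sup>2) * B\<^sup>2 + B * F"
      using F0 by (intro add_mono Eb mult_left_mono power_mono XB order_trans[OF cs(2)] mult_right_mono) (auto simp: X_def)
    finally show ?thesis by (intro real_le_rsqrt) simp
  qed
  have "h square_integrable_on UNIV"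
    using XB by (intro sq_int_of_bounded_l2norm[OF ch(1)]) (auto simp: X_def)
  moreover have "h1 square_integrable_on UNIV"
    using YB by (intro sq_int_of_bounded_l2norm[OF ch(2)]) (auto simp: Y_def)
  ultimately show ?thesis using W by blast
qed

section \<open>Test functions\<close>

text \<open>Smoothness by coinduction: a set of functions which contains a derivative of each of its members
  consists of smooth functions.\<close>

lemma smooth_coinduct:
  assumes "f \<in> S" "\<And>g. g \<in> S \<Longrightarrow> \<exists>g'\<in>S. \<forall>x. (g has_real_derivative g' x) (at x)"
  shows "(deriv ^^ k) f differentiable (at x)"
proof -
  have *: "deriv g \<in> S" if g: "g \<in> S" for g
  proof -
    obtain g' where g': "g' \<in> S" "\<And>x. (g has_real_derivative g' x) (at x)"
      using assms(2)[OF g] by blast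
    have "deriv g = g'" by (rule ext) (rule DERIV_imp_deriv[OF g'(2)])
    then show ?thesis using g' by simp
  qed
  have "(deriv ^^ k) f \<in> S" by (induction k) (auto simp: assms(1) *)
  from assms(2)[OF this] obtain g' where "\<And>x. ((deriv ^^ k) f has_real_derivative g' x) (at x)" by blast
  then show ?thesis by (auto simp: real_differentiable_def)
qed

text \<open>The functions \<open>x\<^sup>-\<^sup>j exp (- 1/x)\<close> on the positive half-line span a space closed under
  differentiation, which reduces smoothness of the usual cutoff function (\<open>j = 0\<close>) to one derivative at a time.\<close>

definition cutoff :: "nat \<Rightarrow> real \<Rightarrow> real" where
  "cutoff j x = (if 0 < x then inverse x ^ j * exp (- inverse x) else 0)"

lemma cutoff_has_derivative:
  "(cutoff j has_real_derivative (cutoff (j + 2) x - real j * cutoff (j + 1) x)) (at x)"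
proof -
  consider "x > 0" | "x < 0" | "x = 0" by linarith
  then show ?thesis
  proof cases
    case 1
    have "((\<lambda>x. inverse x ^ j * exp (- inverse x)) has_real_derivative
        (cutoff (j + 2) x - real j * cutoff (j + 1) x)) (at x)"
    proof -
      have 1: "(inverse has_real_derivative - (inverse x)\<^sup>2) (at x)"
        using DERIV_inverse[of x] \<open>x > 0\<close> by (simp add: power2_eq_square)
      have 2: "((\<lambda>x. exp (- inverse x)) has_real_derivative exp (- inverse x) * (inverse x)\<^sup>2) (at x)"
        using DERIV_chain2[OF DERIV_exp DERIV_minus[OF 1]] by simp
      show ?thesis
        by (rule DERIV_cong[OF DERIV_mult[OF DERIV_power[OF 1, of j] 2]])
           (use \<open>x > 0\<close> in \<open>cases j; simp add: cutoff_def power2_eq_square algebra_simps\<close>)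
    qed
    then show ?thesis
      by (rule has_field_derivative_transform_within_open[of _ _ _ "{0<..}"]) (use 1 in \<open>auto simp: cutoff_def\<close>)
  next
    case 2
    have "((\<lambda>y. 0) has_real_derivative 0) (at x)" by simp
    then have "(cutoff j has_real_derivative 0) (at x)"
      by (rule has_field_derivative_transform_within_open[of _ _ _ "{..<0}"]) (use 2 in \<open>auto simp: cutoff_def\<close>)
    then show ?thesis using 2 by (simp add: cutoff_def)
  next
    case 3
    have "((\<lambda>h. (cutoff j (0 + h) - cutoff j 0) / h) \<longlongrightarrow> 0) (at 0)"
    proof (rule filterlim_split_at)
      have "eventually (\<lambda>h. (cutoff j (0 + h) - cutoff j 0) / h = 0) (at_left 0)"
        by (auto simp: eventually_at_filter cutoff_def)
      then show "((\<lambda>h. (cutoff j (0 + h) - cutoff j 0) / h) \<longlongrightarrow> 0) (at_left 0)"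
        by (rule tendsto_eventually)
      have "((\<lambda>h. inverse h ^ (j + 1) / exp (inverse h)) \<longlongrightarrow> 0) (at_right (0::real))"
        by (rule filterlim_compose[OF tendsto_power_div_exp_0 filterlim_inverse_at_top_right])
      moreover have "eventually (\<lambda>h. inverse h ^ (j + 1) / exp (inverse h) = (cutoff j (0 + h) - cutoff j 0) / h) (at_right (0::real))"
        by (auto simp: eventually_at_filter cutoff_def exp_minus field_simps)
      ultimately show "((\<lambda>h. (cutoff j (0 + h) - cutoff j 0) / h) \<longlongrightarrow> 0) (at_right 0)"
        by (rule Lim_transform_eventually)
    qed
    then show ?thesis using 3 by (simp add: DERIV_def cutoff_def)
  qed
qed

text \<open>A set of functions closed under differentiation and containing enough compactly supported bumps.\<close>

inductive_set bumps :: "(real \<Rightarrow> real) set" where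
  base: "(\<lambda>x. c * (cutoff i (n * (x - a)) * cutoff j (n * (d - x)))) \<in> bumps"
| add: "f \<in> bumps \<Longrightarrow> g \<in> bumps \<Longrightarrow> (\<lambda>x. f x + g x) \<in> bumps"

lemma bumps_cmult: "f \<in> bumps \<Longrightarrow> (\<lambda>x. c * f x) \<in> bumps"
proof (induction rule: bumps.induct)
  case (base c' i n a j d)
  then show ?case using bumps.base[of "c * c'" i n a j d] by (simp add: mult.assoc)
next
  case (add f g)
  then show ?case using bumps.add[OF add.IH] by (simp add: distrib_left)
qed

lemma bumps_derivative:
  assumes "f \<in> bumps" shows "\<exists>f'\<in>bumps. \<forall>x. (f has_real_derivative f' x) (at x)"
  using assms
proof induction
  case (base c i n a j d)
  define f' where "f' x = (c * n) * (cutoff (i+2) (n * (x - a)) * cutoff j (n * (d - x)))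
     + (((- c * n * real i) * (cutoff (i+1) (n * (x - a)) * cutoff j (n * (d - x))))
     + (((- c * n) * (cutoff i (n * (x - a)) * cutoff (j+2) (n * (d - x))))
     + ((c * n * real j) * (cutoff i (n * (x - a)) * cutoff (j+1) (n * (d - x))))))" for x
  have "f' \<in> bumps" unfolding f'_def[abs_def] by (intro bumps.add bumps.base)
  moreover have "((\<lambda>x. c * (cutoff i (n * (x - a)) * cutoff j (n * (d - x)))) has_real_derivative f' x) (at x)" for x
  proof -
    have 1: "((\<lambda>x. cutoff i (n * (x - a))) has_real_derivative
        (cutoff (i + 2) (n * (x - a)) - real i * cutoff (i + 1) (n * (x - a))) * n) (at x)"
      by (rule DERIV_chain2[OF cutoff_has_derivative]) (auto intro!: derivative_eq_intros)
    have 2: "((\<lambda>x. cutoff j (n * (d - x))) has_real_derivative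
        (cutoff (j + 2) (n * (d - x)) - real j * cutoff (j + 1) (n * (d - x))) * (- n)) (at x)"
      by (rule DERIV_chain2[OF cutoff_has_derivative]) (auto intro!: derivative_eq_intros)
    show ?thesis
      by (rule DERIV_cong[OF DERIV_cmult[OF DERIV_mult[OF 1 2]]]) (simp add: f'_def algebra_simps)
  qed
  ultimately show ?case by blast
next
  case (add f g)
  then obtain f' g' where "f' \<in> bumps" "g' \<in> bumps" "\<And>x. (f has_real_derivative f' x) (at x)"
    "\<And>x. (g has_real_derivative g' x) (at x)" by blast
  then show ?case by (intro bexI[of _ "\<lambda>x. f' x + g' x"]) (auto intro: DERIV_add bumps.add)
qed

text \<open>Needed because the test functions in the du Bois-Reymond lemma are antiderivatives of differences
  of bumps.\<close>

lemma bumps_antiderivative_smooth: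
  assumes "g \<in> bumps" "\<And>x. (\<phi> has_real_derivative g x) (at x)"
  shows "(deriv ^^ k) \<phi> differentiable (at x)"
proof (rule smooth_coinduct[where S = "insert \<phi> bumps"])
  show "\<exists>h'\<in>insert \<phi> bumps. \<forall>x. (h has_real_derivative h' x) (at x)" if "h \<in> insert \<phi> bumps" for h
    using that assms bumps_derivative by blast
qed simp

lemma bumps_isCont:
  assumes "f \<in> bumps" shows "isCont f x"
proof -
  obtain f' where "\<And>x. (f has_real_derivative f' x) (at x)" using bumps_derivative[OF assms] by blast
  then show ?thesis by (rule DERIV_isCont)
qed

lemma compactly_supported_interval:
  fixes p q :: real
  assumes "\<And>x. x \<notin> {p..q} \<Longrightarrow> \<phi> x = 0" "{p..q} \<subseteq> J"
  shows "\<phi> compactly_supported_in J"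
proof -
  have "closure {x. \<phi> x \<noteq> 0} \<subseteq> {p..q}" by (rule closure_minimal, use assms(1) in blast, simp)
  then show ?thesis unfolding compactly_supported_in_def
    using assms(2) compact_Icc[of p q] closed_Int_compact[of "closure {x. \<phi> x \<noteq> 0}" "{p..q}"]
    by (auto simp: Int_absorb2)
qed

lemma test_functionD:
  assumes "test_function J \<phi>"
  shows "(\<phi> has_real_derivative deriv \<phi> x) (at x)" "continuous_on A (deriv \<phi>)"
    "\<exists>N>0. \<forall>x. \<bar>x\<bar> \<ge> N \<longrightarrow> \<phi> x = 0 \<and> deriv \<phi> x = 0"
    "x \<notin> J \<Longrightarrow> \<phi> x = 0" "x \<notin> J \<Longrightarrow> deriv \<phi> x = 0"
proof -
  define K where "K = closure {x. \<phi> x \<noteq> 0}"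
  have K: "compact K" "K \<subseteq> J" "\<And>x. x \<notin> K \<Longrightarrow> \<phi> x = 0"
    using assms closure_subset[of "{x. \<phi> x \<noteq> 0}"]
    by (auto simp: test_function_def compactly_supported_in_def K_def)
  have d: "(deriv ^^ k) \<phi> differentiable (at x)" for k x using assms by (simp add: test_function_def)
  show "(\<phi> has_real_derivative deriv \<phi> x) (at x)"
    using d[of 0 x] DERIV_deriv_iff_real_differentiable[of \<phi> x] by simp
  have "isCont (deriv \<phi>) x" for x
    using d[of 1 x] by (simp add: differentiable_imp_continuous_within)
  then show "continuous_on A (deriv \<phi>)" by (simp add: continuous_at_imp_continuous_on)
  have K': "deriv \<phi> x = 0" if "x \<notin> K" for x
  proof -
    have "open (- K)" using K(1) by (simp add: compact_imp_closed open_Compl)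
    then have "(\<phi> has_real_derivative 0) (at x)"
      using has_field_derivative_transform_within_open[OF DERIV_const, of "-K" x 0 \<phi>] that K(3) by simp
    then show ?thesis by (rule DERIV_imp_deriv)
  qed
  obtain N where N: "\<And>x. x \<in> K \<Longrightarrow> \<bar>x\<bar> \<le> N"
    using compact_imp_bounded[OF K(1)] by (auto simp: bounded_iff)
  have "x \<notin> K" if "\<bar>x\<bar> \<ge> \<bar>N\<bar> + 1" for x using N[of x] that by auto
  then show "\<exists>N>0. \<forall>x. \<bar>x\<bar> \<ge> N \<longrightarrow> \<phi> x = 0 \<and> deriv \<phi> x = 0"
    using K(3) K' by (intro exI[of _ "\<bar>N\<bar> + 1"]) auto
  show "x \<notin> J \<Longrightarrow> \<phi> x = 0" "x \<notin> J \<Longrightarrow> deriv \<phi> x = 0" using K K' by auto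
qed

lemma test_function_mono: "test_function I \<phi> \<Longrightarrow> I \<subseteq> J \<Longrightarrow> test_function J \<phi>"
  unfolding test_function_def compactly_supported_in_def by blast

lemma set_integral_supported:
  assumes "\<And>x. x \<notin> J \<Longrightarrow> f x = 0"
  shows "(LINT x:J|lebesgue. f x) = (LINT x:UNIV|lebesgue. f x)"
proof -
  have "indicator J x *\<^sub>R f x = indicator UNIV x *\<^sub>R f x" for x
    using assms[of x] by (cases "x \<in> J") auto
  then show ?thesis unfolding set_lebesgue_integral_def by (simp del: indicator_UNIV)
qed

text \<open>On a half-line the boundary term at the origin is removed by \<open>\<phi> 0 = 0\<close>, which holds for every test
  function supported away from the origin.\<close>

lemma test_function_by_parts:
  assumes \<phi>: "test_function UNIV \<phi>" and G: "primitive G g"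
    and I: "I = UNIV \<or> (I = {0<..} \<or> I = {..<0}) \<and> \<phi> 0 = 0"
  shows "(LINT x:I|lebesgue. deriv \<phi> x *\<^sub>R G x) = - (LINT x:I|lebesgue. \<phi> x *\<^sub>R g x)"
    and "set_integrable lebesgue I (\<lambda>x. deriv \<phi> x *\<^sub>R G x)"
    and "set_integrable lebesgue I (\<lambda>x. \<phi> x *\<^sub>R g x)"
proof -
  obtain N where N: "N > 0" "\<And>x. \<bar>x\<bar> \<ge> N \<Longrightarrow> \<phi> x = 0 \<and> deriv \<phi> x = 0"
    using test_functionD(3)[OF \<phi>] by blast
  define p where "p x = complex_of_real (deriv \<phi> x) * G x" for x
  define r where "r x = complex_of_real (\<phi> x) * g x" for x
  have "((\<lambda>x. complex_of_real (\<phi> x)) has_vector_derivative complex_of_real (deriv \<phi> x)) (at x)" for x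
    by (rule has_vector_derivative_of_real) (use test_functionD(1)[OF \<phi>] in \<open>simp add: has_real_derivative_iff_has_vector_derivative\<close>)
  note v = this
  have c: "continuous_on UNIV (\<lambda>x. complex_of_real (deriv \<phi> x))"
    by (intro continuous_intros test_functionD(2)[OF \<phi>])
  have P: "primitive (\<lambda>x. complex_of_real (\<phi> x) * G x) (\<lambda>x. p x + r x)"
    unfolding p_def r_def by (rule primitive_mult_C1[OF v c G])
  have c\<phi>: "continuous_on UNIV (\<lambda>x. complex_of_real (\<phi> x))"
    using test_functionD(1)[OF \<phi>] by (intro continuous_intros) (meson DERIV_isCont continuous_at_imp_continuous_on)
  have pa: "p absolutely_integrable_on {a..b}" for a b unfolding p_def
    by (intro set_integrable_mult_continuous c absolutely_integrable_continuous_real primitive_continuous[OF G])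
  have ra: "r absolutely_integrable_on {a..b}" for a b unfolding r_def
    by (intro set_integrable_mult_continuous c\<phi> primitiveD(1)[OF G])
  define A where "A = (if I = UNIV then -N else if I = {0<..} then 0 else -N)"
  define B where "B = (if I = UNIV then N else if I = {0<..} then N else 0)"
  have AB: "A \<le> B" using N(1) by (auto simp: A_def B_def)
  have ne: "{0<..} \<noteq> {..<(0::real)}" "UNIV \<noteq> {..<(0::real)}" "UNIV \<noteq> {(0::real)<..}"
  proof -
    have "(1::real) \<in> {0<..}" "(1::real) \<notin> {..<0}" "(-1::real) \<notin> {0<..}" by auto
    then show "{0<..} \<noteq> {..<(0::real)}" "UNIV \<noteq> {..<(0::real)}" "UNIV \<noteq> {(0::real)<..}" by blast+
  qed
  have AE: "AE x in lebesgue. x \<noteq> (0::real)"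
  proof -
    have "{0::real} \<in> null_sets lebesgue" by (simp flip: negligible_iff_null_sets)
    from AE_not_in[OF this] show ?thesis by simp
  qed
  have ind: "indicator I x *\<^sub>R F x = indicator {A..B} x *\<^sub>R F x"
    if "x \<noteq> 0" "\<And>x. \<bar>x\<bar> \<ge> N \<Longrightarrow> F x = 0" for F :: "real \<Rightarrow> complex" and x
  proof (cases "\<bar>x\<bar> \<ge> N")
    case False
    then have "-N < x" "x < N" by auto
    consider "I = UNIV" | "I = {0<..}" | "I = {..<0}" using I by blast
    then show ?thesis
    proof cases
      case 1
      then have "A = -N" "B = N" by (simp_all add: A_def B_def)
      with 1 \<open>-N < x\<close> \<open>x < N\<close> show ?thesis by (simp add: indicator_def)
    next
      case 2
      then have "A = 0" "B = N" using ne by (simp_all add: A_def B_def)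
      with 2 \<open>x < N\<close> that(1) show ?thesis by (simp add: indicator_def)
    next
      case 3
      then have "A = -N" "B = 0" using ne by (simp_all add: A_def B_def)
      with 3 \<open>-N < x\<close> that(1) show ?thesis by (simp add: indicator_def)
    qed
  qed (simp add: that(2))
  have pz: "p x = 0" "r x = 0" if "\<bar>x\<bar> \<ge> N" for x using N(2)[OF that] by (auto simp: p_def r_def)
  have meas: "(\<lambda>x. indicator I x *\<^sub>R F x) \<in> borel_measurable lebesgue"
    if "F \<in> borel_measurable lebesgue" for F :: "real \<Rightarrow> complex"
    using I by (intro borel_measurable_scaleR[OF borel_measurable_indicator] that) auto
  have tr: "set_integrable lebesgue I F \<and> (LINT x:I|lebesgue. F x) = integral {A..B} F"
    if F: "\<And>a b. F absolutely_integrable_on {a..b}" "\<And>x. \<bar>x\<bar> \<ge> N \<Longrightarrow> F x = 0" for F :: "real \<Rightarrow> complex"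
  proof -
    have ae: "AE x in lebesgue. indicator {A..B} x *\<^sub>R F x = indicator I x *\<^sub>R F x"
      using AE by eventually_elim (rule ind[OF _ F(2), symmetric], auto)
    have ae': "AE x in lebesgue. indicator I x *\<^sub>R F x = indicator {A..B} x *\<^sub>R F x"
      using AE by eventually_elim (rule ind[OF _ F(2)], auto)
    have i: "integrable lebesgue (\<lambda>x. indicator {A..B} x *\<^sub>R F x)"
      using F(1)[of A B] by (simp add: set_integrable_def)
    have "F x = indicator {-N..N} x *\<^sub>R F x" for x
      using F(2)[of x] by (cases "x \<in> {-N..N}") auto
    then have Fe: "F = (\<lambda>x. indicator {-N..N} x *\<^sub>R F x)" by auto
    have "F \<in> borel_measurable lebesgue"
      by (subst Fe) (rule borel_measurable_integrable, use F(1)[of "-N" N] in \<open>simp add: set_integrable_def\<close>)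
    then have m: "(\<lambda>x. indicator I x *\<^sub>R F x) \<in> borel_measurable lebesgue" by (rule meas)
    have "set_integrable lebesgue I F"
      unfolding set_integrable_def by (rule integrable_cong_AE_imp[OF i m ae])
    moreover have "(LINT x:I|lebesgue. F x) = (LINT x:{A..B}|lebesgue. F x)"
      unfolding set_lebesgue_integral_def
      by (rule integral_cong_AE[OF m borel_measurable_integrable[OF i] ae'])
    ultimately show ?thesis using set_lebesgue_integral_eq_integral(2)[OF F(1)[of A B]] by simp
  qed
  have z: "\<phi> A = 0" "\<phi> B = 0" using N(1) N(2)[of N] N(2)[of "-N"] I ne by (auto simp: A_def B_def)
  have "integral {A..B} p + integral {A..B} r = integral {A..B} (\<lambda>x. p x + r x)"
    by (rule integral_add[symmetric]) (auto intro: set_lebesgue_integral_eq_integral(1) pa ra)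
  also have "\<dots> = 0" using primitiveD(3)[OF P AB] z by simp
  finally have "integral {A..B} p = - integral {A..B} r" by (simp add: eq_neg_iff_add_eq_0)
  then show "(LINT x:I|lebesgue. deriv \<phi> x *\<^sub>R G x) = - (LINT x:I|lebesgue. \<phi> x *\<^sub>R g x)"
    using tr[OF pa pz(1)] tr[OF ra pz(2)] by (simp add: p_def[abs_def] r_def[abs_def] scaleR_conv_of_real)
  show "set_integrable lebesgue I (\<lambda>x. deriv \<phi> x *\<^sub>R G x)" "set_integrable lebesgue I (\<lambda>x. \<phi> x *\<^sub>R g x)"
    using tr[OF pa pz(1)] tr[OF ra pz(2)] by (simp_all add: p_def[abs_def] r_def[abs_def] scaleR_conv_of_real)
qed

section \<open>The fundamental lemma of the calculus of variations\<close>

lemma sigma_finite_lebesgue: "sigma_finite_measure (lebesgue :: real measure)"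
proof
  have "(\<Union>n::nat. {-real n..real n}) = UNIV"
  proof (intro set_eqI iffI UNIV_I)
    fix x :: real
    obtain n :: nat where "\<bar>x\<bar> \<le> real n" using real_arch_simple by blast
    then show "x \<in> (\<Union>n::nat. {-real n..real n})" by (auto simp: abs_le_iff intro!: exI[of _ n])
  qed
  then show "\<exists>A::real set set. countable A \<and> A \<subseteq> sets lebesgue \<and> \<Union>A = space lebesgue \<and> (\<forall>a\<in>A. emeasure lebesgue a \<noteq> \<infinity>)"
    by (intro exI[of _ "range (\<lambda>n::nat. {-real n..real n})"]) auto
qed

text \<open>Intervals generate the Borel sets, so the integral over every Borel set vanishes; then the same holds
  for Lebesgue sets, which differ from Borel sets by null sets.\<close>

lemma AE_zero_if_interval_integrals_zero:
  fixes f :: "real \<Rightarrow> complex"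
  assumes f: "integrable lebesgue f" and z: "\<And>a b. a \<le> b \<Longrightarrow> (LINT x:{a..b}|lebesgue. f x) = 0"
  shows "AE x in lebesgue. f x = 0"
proof -
  have si: "set_integrable lebesgue A f" if "A \<in> sets lebesgue" for A
    unfolding set_integrable_def by (rule integrable_mult_indicator[OF that f])
  have univ: "(LINT x:UNIV|lebesgue. f x) = 0"
  proof -
    have "(\<lambda>n. LINT x:{-real n..real n}|lebesgue. f x) \<longlonglongrightarrow> (LINT x|lebesgue. f x)"
      unfolding set_lebesgue_integral_def
    proof (rule integral_dominated_convergence[where w="\<lambda>x. norm (f x)"])
      show "AE x in lebesgue. (\<lambda>i. indicator {- real i..real i} x *\<^sub>R f x) \<longlonglongrightarrow> f x"
      proof (rule AE_I2)
        fix x :: real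
        have "indicator {- real i..real i} x *\<^sub>R f x = f x" if "i \<ge> nat \<lceil>\<bar>x\<bar>\<rceil>" for i
          using that by (auto simp: indicator_def abs_le_iff)
        then have "eventually (\<lambda>i. indicator {- real i..real i} x *\<^sub>R f x = f x) sequentially"
          unfolding eventually_sequentially by blast
        then show "(\<lambda>i. indicator {- real i..real i} x *\<^sub>R f x) \<longlonglongrightarrow> f x" by (rule tendsto_eventually)
      qed
      show "(\<lambda>x. indicator {- real i..real i} x *\<^sub>R f x) \<in> borel_measurable lebesgue" for i
        using si[of "{- real i..real i}"] by (simp add: set_integrable_def borel_measurable_integrable)
    qed (auto intro: f borel_measurable_integrable integrable_norm simp: indicator_def)
    moreover have "(LINT x:{-real n..real n}|lebesgue. f x) = 0" for n by (rule z) simp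
    ultimately have "(\<lambda>n::nat. 0) \<longlonglongrightarrow> (LINT x|lebesgue. f x)" by (simp only:)
    from LIMSEQ_unique[OF this tendsto_const] show ?thesis by (simp add: set_lebesgue_integral_def)
  qed
  have borel0: "(LINT x:A|lebesgue. f x) = 0" if "A \<in> sets borel" for A :: "real set"
    using that
  proof (induction rule: borel_set_induct)
    case empty then show ?case by (simp add: set_lebesgue_integral_def)
  next
    case (interval a b) then show ?case by (rule z)
  next
    case (compl A)
    have "(LINT x:A \<union> -A|lebesgue. f x) = (LINT x:A|lebesgue. f x) + (LINT x:-A|lebesgue. f x)"
      using compl by (intro set_integral_Un si) auto
    then show ?case using univ compl by simp
  next
    case (union F)
    have "(LINT x:(\<Union>i. F i)|lebesgue. f x) = (\<Sum>i. (LINT x:(F i)|lebesgue. f x))"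
      using union by (intro lebesgue_integral_countable_add si) (auto simp: disjoint_family_on_def)
    then show ?case using union by simp
  qed
  show ?thesis
  proof (rule sigma_finite_measure.density_unique_banach[OF sigma_finite_lebesgue f])
    show "integrable lebesgue (\<lambda>x. 0::complex)" by simp
    fix A :: "real set" assume A: "A \<in> sets lebesgue"
    then obtain S N N' where S: "A = S \<union> N" "N \<subseteq> N'" "N' \<in> null_sets lborel" "S \<in> sets lborel"
      by (rule sets_completionE)
    have N': "N' \<in> null_sets lebesgue" using S(3) by (rule null_sets_completionI)
    have "(LINT x:A|lebesgue. f x) = (LINT x:S|lebesgue. f x)"
      unfolding set_lebesgue_integral_def
    proof (rule integral_cong_AE)
      show "(\<lambda>x. indicator A x *\<^sub>R f x) \<in> borel_measurable lebesgue"
        using si[OF A] by (simp add: set_integrable_def borel_measurable_integrable)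
      show "(\<lambda>x. indicator S x *\<^sub>R f x) \<in> borel_measurable lebesgue"
        using si[of S] S(4) by (simp add: set_integrable_def borel_measurable_integrable)
      show "AE x in lebesgue. indicator A x *\<^sub>R f x = indicator S x *\<^sub>R f x"
        using AE_not_in[OF N'] by eventually_elim (use S in \<open>auto simp: indicator_def\<close>)
    qed
    also have "\<dots> = 0" using S(4) by (intro borel0) simp
    finally show "(LINT x:A|lebesgue. f x) = (LINT x:A|lebesgue. 0)" by simp
  qed
qed

text \<open>As \<open>n\<close> grows, the bump increases to the indicator function of the interval between \<open>p\<close> and \<open>q\<close>.\<close>

definition bump :: "real \<Rightarrow> real \<Rightarrow> real \<Rightarrow> real \<Rightarrow> real" where
  "bump n p q x = cutoff 0 (n * (x - p)) * cutoff 0 (n * (q - x))"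

lemma bump_in_bumps: "bump n p q \<in> bumps"
  using bumps.base[of 1 0 n p 0 q] by (simp add: bump_def[abs_def])

lemma bump_bounds: "0 \<le> bump n p q x" "bump n p q x \<le> 1"
proof -
  have c: "0 \<le> cutoff 0 y \<and> cutoff 0 y \<le> 1" for y by (auto simp: cutoff_def)
  show "0 \<le> bump n p q x" "bump n p q x \<le> 1"
    unfolding bump_def using c by (auto intro!: mult_nonneg_nonneg mult_le_one)
qed

lemma bump_outside: "n > 0 \<Longrightarrow> x \<notin> {p<..<q} \<Longrightarrow> bump n p q x = 0"
  by (auto simp: bump_def cutoff_def zero_less_mult_iff)

lemma bump_pos: "n > 0 \<Longrightarrow> x \<in> {p<..<q} \<Longrightarrow> bump n p q x > 0"
  by (auto simp: bump_def cutoff_def)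

lemma bump_limit:
  "(\<lambda>n. bump (real (Suc n)) p q x) \<longlonglongrightarrow> indicator {p<..<q} x"
proof (cases "x \<in> {p<..<q}")
  case True
  have *: "(\<lambda>n. exp (- inverse (real (Suc n) * y))) \<longlonglongrightarrow> exp (- (0 * inverse y))" for y
    unfolding inverse_mult_distrib
    by (intro tendsto_intros LIMSEQ_inverse_real_of_nat)
  have "(\<lambda>n. exp (- inverse (real (Suc n) * (x - p))) * exp (- inverse (real (Suc n) * (q - x)))) \<longlonglongrightarrow>
     exp (- (0 * inverse (x - p))) * exp (- (0 * inverse (q - x)))"
    by (intro tendsto_mult *)
  moreover have "bump (real (Suc n)) p q x = exp (- inverse (real (Suc n) * (x - p))) * exp (- inverse (real (Suc n) * (q - x)))" for n
  proof -
    have "0 < real (Suc n) * (x - p)" "0 < real (Suc n) * (q - x)" using True by auto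
    then show ?thesis unfolding bump_def cutoff_def by simp
  qed
  ultimately show ?thesis using True by simp
next
  case False
  then show ?thesis using bump_outside[OF _ False] by simp
qed

text \<open>The difference of a bump and a suitable multiple of a fixed reference bump has integral zero, hence
  is the derivative of a test function. So the integral of \<open>g\<close> against any bump is \<open>c\<close> times the
  integral of the bump, with \<open>c\<close> read off from the reference bump. Letting bumps tend to indicator
  functions, \<open>g - c\<close> has integral zero over every interval.\<close>

lemma du_bois_reymond:
  fixes g :: "real \<Rightarrow> complex"
  assumes J: "open J" "\<And>x y. x \<in> J \<Longrightarrow> y \<in> J \<Longrightarrow> {x..y} \<subseteq> J"
    and g: "\<And>a b. {a..b} \<subseteq> J \<Longrightarrow> g absolutely_integrable_on {a..b}"
    and w: "\<And>\<phi>. test_function J \<phi> \<Longrightarrow> (LINT x:J|lebesgue. deriv \<phi> x *\<^sub>R g x) = 0"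
  shows "\<exists>c. AE x in lebesgue. x \<in> J \<longrightarrow> g x = c"
proof (cases "J = {}")
  case False
  then obtain p0 where "p0 \<in> J" by blast
  then obtain \<delta> where \<delta>: "\<delta> > 0" "ball p0 \<delta> \<subseteq> J" using J(1) openE by blast
  define q0 where "q0 = p0 + \<delta> / 2"
  have q0: "p0 < q0" "q0 \<in> J" using \<delta> by (auto simp: q0_def dist_real_def intro!: subsetD[OF \<delta>(2)])
  have bi: "(\<lambda>x. complex_of_real (bump n p q x) * g x) absolutely_integrable_on {a..b}" if "{a..b} \<subseteq> J" for n p q a b
  proof (rule set_integrable_mult_continuous[OF _ g[OF that]])
    show "continuous_on UNIV (\<lambda>x. complex_of_real (bump n p q x))"
      using bumps_isCont[OF bump_in_bumps]
      by (intro continuous_intros) (simp add: continuous_at_imp_continuous_on)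
  qed
  have cb: "continuous_on A (bump n p q)" for A n p q
    using bumps_isCont[OF bump_in_bumps] by (simp add: continuous_at_imp_continuous_on)
  define m where "m = integral {p0..q0} (bump 1 p0 q0)"
  have m: "m > 0"
  proof -
    have "m \<ge> 0" unfolding m_def
      by (intro Henstock_Kurzweil_Integration.integral_nonneg integrable_continuous_real cb bump_bounds)
    moreover have "m \<noteq> 0"
    proof
      assume "m = 0"
      then have "((bump 1 p0 q0) has_integral 0) (cbox p0 q0)"
        using integrable_integral[OF integrable_continuous_real[OF cb[of "{p0..q0}" 1 p0 q0]]] by (simp add: m_def)
      from has_integral_0_cbox_imp_0[OF cb _ this, of "(p0+q0)/2"] bump_bounds(1)
      have "bump 1 p0 q0 ((p0+q0)/2) = 0" using q0 by auto
      moreover have "bump 1 p0 q0 ((p0+q0)/2) > 0" by (rule bump_pos) (use q0 in auto)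
      ultimately show False by simp
    qed
    ultimately show ?thesis by simp
  qed
  define c where "c = integral {p0..q0} (\<lambda>x. complex_of_real (bump 1 p0 q0 x) * g x) / complex_of_real m"
  have key: "integral {p..q} (\<lambda>x. complex_of_real (bump n p q x) * g x) = complex_of_real (integral {p..q} (bump n p q)) * c"
    if pq: "p \<in> J" "q \<in> J" "p \<le> q" and n: "n > 0" for p q n
  proof -
    define M where "M = integral {p..q} (bump n p q)"
    define A B where "A = min p p0" and "B = max q q0"
    have AB: "A \<le> B" "{p..q} \<subseteq> {A..B}" "{p0..q0} \<subseteq> {A..B}" using pq q0 by (auto simp: A_def B_def)
    have ABJ: "{A..B} \<subseteq> J" using J(2)[of A B] pq q0 \<open>p0 \<in> J\<close> by (auto simp: A_def B_def min_def max_def)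
    define \<psi> where "\<psi> x = bump n p q x + (- M / m) * bump 1 p0 q0 x" for x
    have \<psi>: "\<psi> \<in> bumps" unfolding \<psi>_def[abs_def] by (intro bumps.add bumps_cmult bump_in_bumps)
    have c\<psi>: "continuous_on S \<psi>" for S using bumps_isCont[OF \<psi>] by (simp add: continuous_at_imp_continuous_on)
    have i\<psi>: "\<psi> integrable_on {a..b}" for a b by (intro integrable_continuous_real c\<psi>)
    have out: "\<psi> x = 0" if "x \<le> A \<or> x \<ge> B" for x
      using that n by (auto simp: \<psi>_def A_def B_def bump_outside)
    have ext: "integral {A..B} (bump k s t) = integral {s..t} (bump k s t)" if "{s..t} \<subseteq> {A..B}" "k > 0" for k s t
      by (rule integral_unique[OF has_integral_on_superset[OF integrable_integral]])
         (use that bump_outside[of k] in \<open>auto intro!: integrable_continuous_real cb\<close>)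
    have tot: "integral {A..B} \<psi> = 0"
    proof -
      have "integral {A..B} \<psi> = integral {A..B} (bump n p q) + (- M / m) * integral {A..B} (bump 1 p0 q0)"
        unfolding \<psi>_def[abs_def]
        by (simp only: integral_add[OF integrable_continuous_real[OF cb] integrable_on_mult_right[OF integrable_continuous_real[OF cb]]]
            Henstock_Kurzweil_Integration.integral_mult_right)
      also have "\<dots> = 0" using ext[OF AB(2) n] ext[OF AB(3), of 1] m by (simp add: M_def m_def)
      finally show ?thesis .
    qed
    define \<phi> where "\<phi> x = integral {A - 1..x} \<psi>" for x
    have \<phi>d: "(\<phi> has_real_derivative \<psi> x) (at x)" if "x > A - 1" for x
    proof -
      have "(\<phi> has_real_derivative \<psi> x) (at x within {A - 1..x + 1})"
        unfolding \<phi>_def[abs_def] by (rule integral_has_real_derivative[OF c\<psi>]) (use that in auto)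
      then show ?thesis using at_within_Icc_at[of "A - 1" x "x + 1"] that by simp
    qed
    have \<phi>0: "\<phi> x = 0" if "x \<le> A" for x
    proof -
      have "integral {A - 1..x} \<psi> = integral {A - 1..x} (\<lambda>x. 0)"
        by (rule integral_cong) (use that out in auto)
      then show ?thesis by (simp add: \<phi>_def)
    qed
    have \<phi>1: "\<phi> x = 0" if x: "x \<ge> B" for x
    proof -
      have "\<phi> x = integral {A - 1..A} \<psi> + integral {A..x} \<psi>"
        unfolding \<phi>_def by (rule Henstock_Kurzweil_Integration.integral_combine[symmetric]) (use x AB i\<psi> in auto)
      also have "integral {A..x} \<psi> = integral {A..B} \<psi> + integral {B..x} \<psi>"
        by (rule Henstock_Kurzweil_Integration.integral_combine[symmetric]) (use x AB i\<psi> in auto)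
      also have "integral {A - 1..A} \<psi> = 0" using \<phi>0[of A] by (simp add: \<phi>_def)
      also have "integral {B..x} \<psi> = integral {B..x} (\<lambda>x. 0)"
        by (rule integral_cong) (use out in auto)
      finally show ?thesis using tot by simp
    qed
    have \<phi>': "(\<phi> has_real_derivative \<psi> x) (at x)" for x
    proof (cases "x > A - 1")
      case False
      have "(\<phi> has_real_derivative 0) (at x)"
        by (rule has_field_derivative_transform_within_open[OF DERIV_const, of "{..<A}"]) (use False \<phi>0 in auto)
      then show ?thesis using out[of x] False by simp
    qed (rule \<phi>d)
    have "test_function J \<phi>"
      unfolding test_function_def
    proof (intro conjI allI)
      show "(deriv ^^ k) \<phi> differentiable (at x)" for k x
        by (rule bumps_antiderivative_smooth[OF \<psi> \<phi>'])
      show "\<phi> compactly_supported_in J"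
        by (rule compactly_supported_interval[OF _ ABJ]) (use \<phi>0 \<phi>1 in auto)
    qed
    from w[OF this] have "(LINT x:J|lebesgue. deriv \<phi> x *\<^sub>R g x) = 0" .
    moreover have "deriv \<phi> x *\<^sub>R g x = complex_of_real (\<psi> x) * g x" for x
      using DERIV_imp_deriv[OF \<phi>'] by (simp add: scaleR_conv_of_real)
    ultimately have "(LINT x:J|lebesgue. complex_of_real (\<psi> x) * g x) = 0" by simp
    moreover have "(LINT x:J|lebesgue. complex_of_real (\<psi> x) * g x) = (LINT x:{A..B}|lebesgue. complex_of_real (\<psi> x) * g x)"
    proof -
      have "indicator J x *\<^sub>R (complex_of_real (\<psi> x) * g x) = indicator {A..B} x *\<^sub>R (complex_of_real (\<psi> x) * g x)" for x
        using out[of x] ABJ by (cases "x \<in> {A..B}") (auto simp: indicator_def)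
      then show ?thesis by (simp only: set_lebesgue_integral_def)
    qed
    moreover have ai: "(\<lambda>x. complex_of_real (\<psi> x) * g x) absolutely_integrable_on {A..B}"
      by (rule set_integrable_mult_continuous[OF _ g[OF ABJ]]) (intro continuous_intros c\<psi>)
    ultimately have 0: "integral {A..B} (\<lambda>x. complex_of_real (\<psi> x) * g x) = 0"
      using set_lebesgue_integral_eq_integral(2)[OF ai] by simp
    have ii: "(\<lambda>x. complex_of_real (bump k s t x) * g x) integrable_on {A..B}" for k s t
      by (rule set_lebesgue_integral_eq_integral(1)[OF bi[OF ABJ]])
    have ext2: "integral {A..B} (\<lambda>x. complex_of_real (bump k s t x) * g x) = integral {s..t} (\<lambda>x. complex_of_real (bump k s t x) * g x)"
      if "{s..t} \<subseteq> {A..B}" "k > 0" for k s t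
    proof (rule integral_unique[OF has_integral_on_superset[OF integrable_integral]])
      show "(\<lambda>x. complex_of_real (bump k s t x) * g x) integrable_on {s..t}"
        by (rule set_lebesgue_integral_eq_integral(1)[OF bi]) (use that ABJ in blast)
    qed (use that bump_outside[of k] in auto)
    have \<psi>eq: "(\<lambda>x. complex_of_real (\<psi> x) * g x) = (\<lambda>x. complex_of_real (bump n p q x) * g x + complex_of_real (- M / m) * (complex_of_real (bump 1 p0 q0 x) * g x))"
      by (simp add: \<psi>_def fun_eq_iff algebra_simps)
    have "0 = integral {A..B} (\<lambda>x. complex_of_real (bump n p q x) * g x) + complex_of_real (- M / m) * integral {A..B} (\<lambda>x. complex_of_real (bump 1 p0 q0 x) * g x)"
      by (simp only: 0[symmetric] \<psi>eq integral_add[OF ii integrable_on_mult_right[OF ii]] Henstock_Kurzweil_Integration.integral_mult_right)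
    also have "\<dots> = integral {p..q} (\<lambda>x. complex_of_real (bump n p q x) * g x) + complex_of_real (- M / m) * integral {p0..q0} (\<lambda>x. complex_of_real (bump 1 p0 q0 x) * g x)"
      using ext2[OF AB(2) n] ext2[OF AB(3), of 1] by simp
    finally show ?thesis using m unfolding c_def M_def[symmetric] by (simp add: field_simps)
  qed
  have int: "integral {p..q} g = complex_of_real (q - p) * c" if pq: "p \<in> J" "q \<in> J" "p \<le> q" for p q
  proof -
    have pqJ: "{p..q} \<subseteq> J" using J(2) pq by blast
    have gpq: "g absolutely_integrable_on {p..q}" by (rule g[OF pqJ])
    have gi: "integrable lebesgue (\<lambda>x. indicator {p..q} x *\<^sub>R g x)" using gpq by (simp add: set_integrable_def)
    have e: "AE x in lebesgue. indicator {p<..<q} x *\<^sub>R y x = indicator {p..q} x *\<^sub>R y x" for y :: "real \<Rightarrow> complex"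
    proof -
      have "{p,q} \<in> null_sets lebesgue" by (simp flip: negligible_iff_null_sets)
      from AE_not_in[OF this] show ?thesis by eventually_elim (auto simp: indicator_def)
    qed
    have dc: "(\<lambda>n. integral {p..q} (\<lambda>x. complex_of_real (bump (real (Suc n)) p q x) * y x)) \<longlonglongrightarrow> integral {p..q} y"
      if y: "y absolutely_integrable_on {p..q}" for y
    proof -
      have yi: "integrable lebesgue (\<lambda>x. indicator {p..q} x *\<^sub>R y x)" using y by (simp add: set_integrable_def)
      have bi': "(\<lambda>x. complex_of_real (bump n p q x) * y x) absolutely_integrable_on {p..q}" for n
        by (rule set_integrable_mult_continuous[OF _ y]) (intro continuous_intros cb)
      have "(\<lambda>n. LINT x|lebesgue. indicator {p..q} x *\<^sub>R (complex_of_real (bump (real (Suc n)) p q x) * y x)) \<longlonglongrightarrow> (LINT x|lebesgue. indicator {p..q} x *\<^sub>R y x)"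
      proof (rule integral_dominated_convergence[where w="\<lambda>x. norm (indicator {p..q} x *\<^sub>R y x)"])
        show "integrable lebesgue (\<lambda>x. norm (indicator {p..q} x *\<^sub>R y x))" by (rule integrable_norm[OF yi])
        show "(\<lambda>x. indicator {p..q} x *\<^sub>R y x) \<in> borel_measurable lebesgue" by (rule borel_measurable_integrable[OF yi])
        show "(\<lambda>x. indicator {p..q} x *\<^sub>R (complex_of_real (bump (real (Suc n)) p q x) * y x)) \<in> borel_measurable lebesgue" for n
          using bi'[of "real (Suc n)"] by (simp only: set_integrable_def borel_measurable_integrable)
        show "AE x in lebesgue. norm (indicator {p..q} x *\<^sub>R (complex_of_real (bump (real (Suc n)) p q x) * y x)) \<le> norm (indicator {p..q} x *\<^sub>R y x)" for n
        proof (rule AE_I2)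
          fix x
          have "norm (complex_of_real (bump (real (Suc n)) p q x)) \<le> 1" using bump_bounds[of "real (Suc n)" p q x] by simp
          then show "norm (indicator {p..q} x *\<^sub>R (complex_of_real (bump (real (Suc n)) p q x) * y x)) \<le> norm (indicator {p..q} x *\<^sub>R y x)"
            unfolding norm_scaleR norm_mult using mult_right_mono[of _ 1 "norm (y x)"] by (intro mult_left_mono) auto
        qed
        show "AE x in lebesgue. (\<lambda>n. indicator {p..q} x *\<^sub>R (complex_of_real (bump (real (Suc n)) p q x) * y x)) \<longlonglongrightarrow> indicator {p..q} x *\<^sub>R y x"
          using e[of y]
        proof eventually_elim
          case (elim x)
          have "(\<lambda>n. indicator {p..q} x *\<^sub>R (complex_of_real (bump (real (Suc n)) p q x) * y x)) \<longlonglongrightarrow> indicator {p..q} x *\<^sub>R (complex_of_real (indicator {p<..<q} x) * y x)"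
            by (intro tendsto_intros bump_limit)
          also have "indicator {p..q} x *\<^sub>R (complex_of_real (indicator {p<..<q} x) * y x) = indicator {p<..<q} x *\<^sub>R y x"
            by (auto simp: indicator_def)
          finally show ?case using elim by simp
        qed
      qed
      then show ?thesis
        using set_lebesgue_integral_eq_integral(2)[OF y] set_lebesgue_integral_eq_integral(2)[OF bi'] by (simp add: set_lebesgue_integral_def)
    qed
    have "(\<lambda>n. integral {p..q} (\<lambda>x. complex_of_real (bump (real (Suc n)) p q x) * 1)) \<longlonglongrightarrow> integral {p..q} (\<lambda>x. 1::complex)"
      by (rule dc) (intro absolutely_integrable_continuous_real continuous_intros)
    moreover have "integral {p..q} (\<lambda>x. complex_of_real (bump n p q x) * 1) = complex_of_real (integral {p..q} (bump n p q))" for n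
    proof -
      have "((bump n p q) has_integral (integral {p..q} (bump n p q))) {p..q}"
        by (intro integrable_integral integrable_continuous_real cb)
      then have "((\<lambda>x. complex_of_real (bump n p q x)) has_integral complex_of_real (integral {p..q} (bump n p q))) {p..q}"
        by (rule has_integral_of_real)
      then show ?thesis by (simp add: integral_unique)
    qed
    ultimately have "(\<lambda>n. complex_of_real (integral {p..q} (bump (real (Suc n)) p q)) * c) \<longlonglongrightarrow> integral {p..q} (\<lambda>x. 1::complex) * c"
      by (intro tendsto_mult tendsto_const) simp
    then have "(\<lambda>n. integral {p..q} (\<lambda>x. complex_of_real (bump (real (Suc n)) p q x) * g x)) \<longlonglongrightarrow> integral {p..q} (\<lambda>x. 1::complex) * c"
      by (simp only: key[OF pq] of_nat_0_less_iff zero_less_Suc)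
    from LIMSEQ_unique[OF dc[OF gpq] this] show ?thesis
      using pq(3) by (simp add: scaleR_conv_of_real)
  qed
  have ae: "AE x in lebesgue. x \<in> {p..q} \<longrightarrow> g x = c" if pq: "p \<in> J" "q \<in> J" "p \<le> q" for p q
  proof -
    have pqJ: "{p..q} \<subseteq> J" using J(2) pq by blast
    define d where "d x = indicator {p..q} x *\<^sub>R (g x - c)" for x
    have si: "(\<lambda>x. g x - c) absolutely_integrable_on {a..b}" if "{a..b} \<subseteq> {p..q}" for a b
      using that pqJ by (intro set_integral_diff(1) g absolutely_integrable_continuous_real) auto
    have "AE x in lebesgue. d x = 0"
    proof (rule AE_zero_if_interval_integrals_zero)
      show "integrable lebesgue d" using si[of p q] by (simp add: d_def[abs_def] set_integrable_def)
      fix a b :: real assume ab: "a \<le> b"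
      define s t where "s = max a p" and "t = min b q"
      have "indicator {a..b} x *\<^sub>R d x = indicator {s..t} x *\<^sub>R (g x - c)" for x
        by (auto simp: d_def indicator_def s_def t_def)
      then have "(LINT x:{a..b}|lebesgue. d x) = (LINT x:{s..t}|lebesgue. g x - c)"
        by (simp only: set_lebesgue_integral_def)
      also have "\<dots> = 0"
      proof (cases "s \<le> t")
        case True
        then have st: "{s..t} \<subseteq> {p..q}" "s \<in> J" "t \<in> J" using pqJ by (auto simp: s_def t_def)
        have gi: "g integrable_on {s..t}" using g[of s t] st(1) pqJ set_lebesgue_integral_eq_integral(1) by blast
        have "(LINT x:{s..t}|lebesgue. g x - c) = integral {s..t} (\<lambda>x. g x - c)"
          by (rule set_lebesgue_integral_eq_integral(2)[OF si[OF st(1)]])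
        also have "\<dots> = integral {s..t} g - integral {s..t} (\<lambda>x. c)"
          by (rule integral_diff[OF gi integrable_continuous_real[OF continuous_on_const]])
        also have "\<dots> = 0" using int[OF st(2,3) True] True by (simp add: scaleR_conv_of_real)
        finally show ?thesis .
      qed (simp add: set_lebesgue_integral_def)
      finally show "(LINT x:{a..b}|lebesgue. d x) = 0" .
    qed
    then show ?thesis by eventually_elim (auto simp: d_def)
  qed
  have "AE x in lebesgue. \<forall>p q. p \<in> \<rat> \<longrightarrow> q \<in> \<rat> \<longrightarrow> p \<in> J \<longrightarrow> q \<in> J \<longrightarrow> p \<le> q \<longrightarrow> x \<in> {p..q} \<longrightarrow> g x = c"
  proof -
    have "AE x in lebesgue. \<forall>p\<in>\<rat>. \<forall>q\<in>\<rat>. p \<in> J \<longrightarrow> q \<in> J \<longrightarrow> p \<le> q \<longrightarrow> x \<in> {p..q} \<longrightarrow> g x = c"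
      unfolding AE_ball_countable[OF countable_rat] using ae by auto
    then show ?thesis by eventually_elim blast
  qed
  then have "AE x in lebesgue. x \<in> J \<longrightarrow> g x = c"
  proof eventually_elim
    case (elim x)
    show ?case
    proof
      assume "x \<in> J"
      then obtain e where e: "e > 0" "ball x e \<subseteq> J" using J(1) openE by blast
      obtain p where p: "p \<in> \<rat>" "x - e < p" "p < x" using Rats_dense_in_real[of "x - e" x] e by auto
      obtain q where q: "q \<in> \<rat>" "x < q" "q < x + e" using Rats_dense_in_real[of x "x + e"] e by auto
      have "p \<in> J" "q \<in> J" using e p q by (auto simp: dist_real_def intro!: subsetD[OF e(2)])
      then show "g x = c" using elim p q by auto
    qed
  qed
  then show ?thesis by blast
qed auto

section \<open>Sobolev functions are second-order functions\<close>

lemma sq_int_cong_AE: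
  assumes "f square_integrable_on J" "AE x in lebesgue. x \<in> J \<longrightarrow> f x = h x" "h \<in> borel_measurable lebesgue" "J \<in> sets lebesgue"
  shows "h square_integrable_on J"
proof -
  have m: "(\<lambda>x. indicator J x *\<^sub>R h x) \<in> borel_measurable lebesgue"
    by (rule borel_measurable_scaleR[OF borel_measurable_indicator[OF assms(4)] assms(3)])
  have m2: "(\<lambda>x. indicator J x *\<^sub>R (norm (h x))\<^sup>2) \<in> borel_measurable lebesgue"
    using assms(3) by (intro borel_measurable_scaleR[OF borel_measurable_indicator[OF assms(4)]]) measurable
  have "integrable lebesgue (\<lambda>x. indicator J x *\<^sub>R (norm (h x))\<^sup>2)"
  proof (rule integrable_cong_AE_imp[OF _ m2])
    show "integrable lebesgue (\<lambda>x. indicator J x *\<^sub>R (norm (f x))\<^sup>2)"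
      using assms(1) by (simp add: square_integrable_on_def set_integrable_def)
    show "AE x in lebesgue. indicator J x *\<^sub>R (norm (f x))\<^sup>2 = indicator J x *\<^sub>R (norm (h x))\<^sup>2"
      using assms(2) by eventually_elim (auto simp: indicator_def)
  qed
  then show ?thesis using m by (simp add: square_integrable_on_def set_integrable_def set_borel_measurable_def)
qed

lemma sq_int_mult_bounded:
  assumes f: "f square_integrable_on S" and q: "q \<in> borel_measurable lebesgue" "\<And>x. norm (q x) \<le> M"
  shows "(\<lambda>x. q x * f x) square_integrable_on S"
proof -
  have M: "0 \<le> M" using order_trans[OF norm_ge_zero q(2)] .
  have fm: "(\<lambda>x. indicator S x *\<^sub>R f x) \<in> borel_measurable lebesgue"
    and fi: "integrable lebesgue (\<lambda>x. indicator S x *\<^sub>R (norm (f x))\<^sup>2)"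
    using f by (auto simp: square_integrable_on_def set_borel_measurable_def set_integrable_def)
  have m: "(\<lambda>x. indicator S x *\<^sub>R (q x * f x)) \<in> borel_measurable lebesgue"
    using borel_measurable_times[OF q(1) fm] by (simp add: mult.left_commute)
  have m2: "(\<lambda>x. indicator S x *\<^sub>R (norm (q x * f x))\<^sup>2) \<in> borel_measurable lebesgue"
  proof -
    have "(\<lambda>x. (norm (indicator S x *\<^sub>R (q x * f x)))\<^sup>2) \<in> borel_measurable lebesgue"
      using m by measurable
    moreover have "(norm (indicator S x *\<^sub>R (q x * f x)))\<^sup>2 = indicator S x *\<^sub>R (norm (q x * f x))\<^sup>2" for x
      by (cases "x \<in> S") auto
    ultimately show ?thesis by (simp only:)
  qed
  have "integrable lebesgue (\<lambda>x. indicator S x *\<^sub>R (norm (q x * f x))\<^sup>2)"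
  proof (rule Bochner_Integration.integrable_bound[OF integrable_scaleR_right[OF fi, of "M\<^sup>2"] m2], rule AE_I2)
    fix x
    have "(norm (q x * f x))\<^sup>2 \<le> M\<^sup>2 * (norm (f x))\<^sup>2"
      unfolding norm_mult power_mult_distrib using q(2)[of x] by (intro mult_right_mono power_mono) auto
    then show "norm (indicator S x *\<^sub>R (norm (q x * f x))\<^sup>2) \<le> norm (M\<^sup>2 *\<^sub>R (indicator S x *\<^sub>R (norm (f x))\<^sup>2))"
      by (cases "x \<in> S") (auto simp: abs_mult)
  qed
  then show ?thesis using m by (simp add: square_integrable_on_def set_integrable_def set_borel_measurable_def)
qed

lemma sq_int_add:
  assumes "f square_integrable_on S" "g square_integrable_on S"
  shows "(\<lambda>x. f x + g x) square_integrable_on S"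
  using square_integrable_add[of "\<lambda>x. indicator S x *\<^sub>R f x" "\<lambda>x. indicator S x *\<^sub>R g x"] assms
  unfolding sq_int_indicator[of _ S] by (simp add: scaleR_add_right)

lemma sq_int_cmult: "f square_integrable_on S \<Longrightarrow> (\<lambda>x. c * f x) square_integrable_on S"
  by (rule sq_int_mult_bounded[where M="norm c"]) auto

lemma sq_int_diff:
  assumes "f square_integrable_on S" "g square_integrable_on S"
  shows "(\<lambda>x. f x - g x) square_integrable_on S"
  using sq_int_add[OF assms(1) sq_int_cmult[OF assms(2), of "-1"]] by simp

lemma sq_int_cnj: "f square_integrable_on S \<Longrightarrow> (\<lambda>x. cnj (f x)) square_integrable_on S"
proof -
  assume f: "f square_integrable_on S"
  have "(\<lambda>x. cnj (indicator S x *\<^sub>R f x)) \<in> borel_measurable lebesgue"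
    by (rule measurable_compose[OF _ borel_measurable_continuous_onI[OF continuous_on_cnj[OF continuous_on_id]]])
       (use f in \<open>simp add: square_integrable_on_def set_borel_measurable_def\<close>)
  then show ?thesis using f by (simp add: square_integrable_on_def set_borel_measurable_def)
qed

lemma sq_int_insert:
  fixes f :: "real \<Rightarrow> complex"
  assumes "f square_integrable_on S" "a \<notin> S"
  shows "f square_integrable_on (insert a S)"
proof -
  have ind: "indicator (insert a S) x *\<^sub>R y x = indicator S x *\<^sub>R y x + indicator {a} x *\<^sub>R y a"
    for y :: "real \<Rightarrow> complex" and x
    using assms(2) by (auto simp: indicator_def)
  have "set_borel_measurable lebesgue (insert a S) f"
    unfolding set_borel_measurable_def ind
    by (rule borel_measurable_add[OF _ borel_measurable_scaleR[OF borel_measurable_indicator borel_measurable_const]])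
       (use assms(1) in \<open>auto simp: square_integrable_on_def set_borel_measurable_def\<close>)
  moreover have "set_integrable lebesgue (insert a S) (\<lambda>x. (norm (f x))\<^sup>2)"
  proof -
    have ind2: "indicator (insert a S) x *\<^sub>R (norm (f x))\<^sup>2 = indicator S x *\<^sub>R (norm (f x))\<^sup>2 + indicator {a} x *\<^sub>R (norm (f a))\<^sup>2" for x
      using assms(2) by (auto simp: indicator_def)
    have "integrable lebesgue (\<lambda>x. indicator {a} x *\<^sub>R (norm (f a))\<^sup>2)"
      by (rule integrable_scaleR_left) simp
    with assms(1) show ?thesis unfolding set_integrable_def ind2
      by (intro Bochner_Integration.integrable_add) (auto simp: square_integrable_on_def set_integrable_def)
  qed
  ultimately show ?thesis by (simp add: square_integrable_on_def)
qed

lemma sq_int_half_lines: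
  "f square_integrable_on {0<..} \<longleftrightarrow> f square_integrable_on {0..}"
  "f square_integrable_on {..<0} \<longleftrightarrow> f square_integrable_on {..0}"
proof -
  have "insert 0 {0<..} = {(0::real)..}" "insert 0 {..<0} = {..(0::real)}" by auto
  then show "f square_integrable_on {0<..} \<longleftrightarrow> f square_integrable_on {0..}"
    "f square_integrable_on {..<0} \<longleftrightarrow> f square_integrable_on {..0}"
    using sq_int_insert[of f "{0<..}" 0] sq_int_insert[of f "{..<0}" 0]
      sq_int_subset(1)[of f "{0..}" "{0<..}"] sq_int_subset(1)[of f "{..0}" "{..<0}"] by auto
qed

lemma test_function_sq_int:
  assumes "test_function J \<phi>"
  shows "(\<lambda>x. complex_of_real (\<phi> x)) square_integrable_on UNIV"
    "(\<lambda>x. complex_of_real (deriv \<phi> x)) square_integrable_on UNIV"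
proof -
  obtain N where N: "N > 0" "\<And>x. \<bar>x\<bar> \<ge> N \<Longrightarrow> \<phi> x = 0 \<and> deriv \<phi> x = 0"
    using test_functionD(3)[OF assms] by blast
  have *: "(\<lambda>x. complex_of_real (y x)) square_integrable_on UNIV"
    if c: "continuous_on UNIV y" and z: "\<And>x. \<bar>x\<bar> \<ge> N \<Longrightarrow> y x = 0" for y :: "real \<Rightarrow> real"
  proof -
    have "compact (y ` {-N..N})" by (intro compact_continuous_image continuous_on_subset[OF c]) auto
    then obtain B where "\<forall>x\<in>{-N..N}. norm (y x) \<le> B"
      using compact_imp_bounded[of "y ` {-N..N}"] by (auto simp: bounded_iff simp del: atLeastAtMost_iff)
    then have s: "(\<lambda>x. complex_of_real (y x)) square_integrable_on {-N..N}"
      using N(1) by (intro sq_int_bounded_interval(1)[where B=B] continuous_lebesgue_measurable continuous_intros c) auto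
    have "indicator {-N..N} x *\<^sub>R complex_of_real (y x) = complex_of_real (y x)" for x
      using z[of x] by (cases "x \<in> {-N..N}") auto
    then show ?thesis using s unfolding sq_int_indicator[of _ "{-N..N}"] by (simp only:)
  qed
  have "continuous_on UNIV \<phi>"
    using test_functionD(1)[OF assms] by (meson DERIV_isCont continuous_at_imp_continuous_on)
  then show "(\<lambda>x. complex_of_real (\<phi> x)) square_integrable_on UNIV" by (rule *) (use N in auto)
  show "(\<lambda>x. complex_of_real (deriv \<phi> x)) square_integrable_on UNIV"
    by (rule *[OF test_functionD(2)[OF assms]]) (use N in auto)
qed

text \<open>Let \<open>H\<close> be a primitive of \<open>f2\<close>. By du Bois-Reymond \<open>f1 - H\<close> is constant on \<open>J\<close>, and then \<open>f\<close> minus a primitive of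
  \<open>f1\<close> is constant as well. The second derivative is extended by zero outside \<open>J\<close>, so that the
  representative \<open>h\<close> is defined on the whole line.\<close>

lemma W2_of_W22:
  assumes J: "open J" "\<And>x y. x \<in> J \<Longrightarrow> y \<in> J \<Longrightarrow> {x..y} \<subseteq> J"
    and W: "W22_derivative J f f2"
  shows "\<exists>h h1. W2 h h1 (\<lambda>x. indicator J x *\<^sub>R f2 x) \<and> (AE x in lebesgue. x \<in> J \<longrightarrow> f x = h x) \<and>
     h square_integrable_on J \<and> h1 square_integrable_on J"
proof -
  have Jm: "J \<in> sets lebesgue" using J(1) by simp
  obtain f1 where f: "f square_integrable_on J" "f1 square_integrable_on J" "f2 square_integrable_on J"
    and w1: "weak_derivative J f f1" and w2: "weak_derivative J f1 f2"
    using W by (auto simp: W22_derivative_def)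
  define F2 where "F2 x = indicator J x *\<^sub>R f2 x" for x
  have F2: "F2 square_integrable_on UNIV" using f(3) unfolding sq_int_indicator[of _ J] F2_def .
  have "F2 absolutely_integrable_on {a..b}" for a b by (rule sq_int_abs_integrable(1)[OF F2]) simp
  then obtain H1 where H1: "primitive H1 F2" using primitive_ex by blast
  have parts: "(LINT x:J|lebesgue. deriv \<phi> x *\<^sub>R G x) = - (LINT x:J|lebesgue. \<phi> x *\<^sub>R g x)"
     "set_integrable lebesgue J (\<lambda>x. deriv \<phi> x *\<^sub>R G x)"
    if \<phi>: "test_function J \<phi>" and G: "primitive G g" for \<phi> G g
  proof -
    have u: "test_function UNIV \<phi>" by (rule test_function_mono[OF \<phi>]) simp
    show "(LINT x:J|lebesgue. deriv \<phi> x *\<^sub>R G x) = - (LINT x:J|lebesgue. \<phi> x *\<^sub>R g x)"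
      using test_function_by_parts(1)[OF u G, of UNIV]
        set_integral_supported[of J "\<lambda>x. deriv \<phi> x *\<^sub>R G x"] set_integral_supported[of J "\<lambda>x. \<phi> x *\<^sub>R g x"]
        test_functionD(4,5)[OF \<phi>] by simp
    show "set_integrable lebesgue J (\<lambda>x. deriv \<phi> x *\<^sub>R G x)"
      using test_function_by_parts(2)[OF u G, of UNIV] by (rule set_integrable_subset) (use Jm in auto)
  qed
  have si: "set_integrable lebesgue J (\<lambda>x. deriv \<phi> x *\<^sub>R y x)"
    if \<phi>: "test_function J \<phi>" and y: "y square_integrable_on J" for \<phi> y
  proof -
    have "(\<lambda>x. complex_of_real (deriv \<phi> x)) square_integrable_on J"
      by (rule sq_int_subset(1)[OF test_function_sq_int(2)[OF \<phi>]]) (use Jm in auto)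
    from cauchy_schwarz_integral(1)[OF this y] show ?thesis by (simp add: scaleR_conv_of_real)
  qed
  have ai: "(\<lambda>x. y x - G x) absolutely_integrable_on {a..b}"
    if "y square_integrable_on J" "primitive G g" "{a..b} \<subseteq> J" for y G g a b
    by (intro set_integral_diff(1) sq_int_abs_integrable(1)[OF that(1,3)] absolutely_integrable_continuous_real
        primitive_continuous[OF that(2)])
  have "\<exists>c. AE x in lebesgue. x \<in> J \<longrightarrow> f1 x - H1 x = c"
  proof (rule du_bois_reymond[OF J ai[OF f(2) H1]])
    fix \<phi> assume \<phi>: "test_function J \<phi>"
    have "(LINT x:J|lebesgue. deriv \<phi> x *\<^sub>R (f1 x - H1 x))
      = (LINT x:J|lebesgue. deriv \<phi> x *\<^sub>R f1 x) - (LINT x:J|lebesgue. deriv \<phi> x *\<^sub>R H1 x)"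
      unfolding scaleR_diff_right by (rule set_integral_diff(2)[OF si[OF \<phi> f(2)] parts(2)[OF \<phi> H1]])
    also have "\<dots> = - (LINT x:J|lebesgue. \<phi> x *\<^sub>R f2 x) + (LINT x:J|lebesgue. \<phi> x *\<^sub>R F2 x)"
      using w2 \<phi> parts(1)[OF \<phi> H1] by (simp add: weak_derivative_def)
    also have "(LINT x:J|lebesgue. \<phi> x *\<^sub>R F2 x) = (LINT x:J|lebesgue. \<phi> x *\<^sub>R f2 x)"
      unfolding set_lebesgue_integral_def F2_def by (rule Bochner_Integration.integral_cong) (auto simp: indicator_def)
    finally show "(LINT x:J|lebesgue. deriv \<phi> x *\<^sub>R (f1 x - H1 x)) = 0" by simp
  qed
  then obtain c1 where c1: "AE x in lebesgue. x \<in> J \<longrightarrow> f1 x - H1 x = c1" by blast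
  define h1 where "h1 x = H1 x + c1" for x
  have Ph1: "primitive h1 F2" using H1 by (simp add: primitive_def h1_def)
  have h1ae: "AE x in lebesgue. x \<in> J \<longrightarrow> f1 x = h1 x" using c1 by eventually_elim (auto simp: h1_def algebra_simps)
  have "h1 absolutely_integrable_on {a..b}" for a b
    by (intro absolutely_integrable_continuous_real primitive_continuous[OF Ph1])
  then obtain H where H: "primitive H h1" using primitive_ex by blast
  have "\<exists>c. AE x in lebesgue. x \<in> J \<longrightarrow> f x - H x = c"
  proof (rule du_bois_reymond[OF J ai[OF f(1) H]])
    fix \<phi> assume \<phi>: "test_function J \<phi>"
    have "(LINT x:J|lebesgue. deriv \<phi> x *\<^sub>R (f x - H x))
      = (LINT x:J|lebesgue. deriv \<phi> x *\<^sub>R f x) - (LINT x:J|lebesgue. deriv \<phi> x *\<^sub>R H x)"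
      unfolding scaleR_diff_right by (rule set_integral_diff(2)[OF si[OF \<phi> f(1)] parts(2)[OF \<phi> H]])
    also have "\<dots> = - (LINT x:J|lebesgue. \<phi> x *\<^sub>R f1 x) + (LINT x:J|lebesgue. \<phi> x *\<^sub>R h1 x)"
      using w1 \<phi> parts(1)[OF \<phi> H] by (simp add: weak_derivative_def)
    also have "(LINT x:J|lebesgue. \<phi> x *\<^sub>R f1 x) = (LINT x:J|lebesgue. \<phi> x *\<^sub>R h1 x)"
      unfolding set_lebesgue_integral_def
    proof (rule integral_cong_AE)
      have p: "\<phi> \<in> borel_measurable lebesgue"
        using test_functionD(1)[OF \<phi>] by (intro continuous_lebesgue_measurable) (meson DERIV_isCont continuous_at_imp_continuous_on)
      have "(\<lambda>x. \<phi> x *\<^sub>R (indicator J x *\<^sub>R f1 x)) \<in> borel_measurable lebesgue"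
        by (rule borel_measurable_scaleR[OF p]) (use f(2) in \<open>simp add: square_integrable_on_def set_borel_measurable_def\<close>)
      then show "(\<lambda>x. indicator J x *\<^sub>R \<phi> x *\<^sub>R f1 x) \<in> borel_measurable lebesgue"
        by (simp add: mult.commute)
      show "(\<lambda>x. indicator J x *\<^sub>R \<phi> x *\<^sub>R h1 x) \<in> borel_measurable lebesgue"
        by (intro borel_measurable_scaleR p primitive_measurable[OF Ph1] borel_measurable_indicator Jm)
      show "AE x in lebesgue. indicator J x *\<^sub>R \<phi> x *\<^sub>R f1 x = indicator J x *\<^sub>R \<phi> x *\<^sub>R h1 x"
        using h1ae by eventually_elim (auto simp: indicator_def)
    qed
    finally show "(LINT x:J|lebesgue. deriv \<phi> x *\<^sub>R (f x - H x)) = 0" by simp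
  qed
  then obtain c0 where c0: "AE x in lebesgue. x \<in> J \<longrightarrow> f x - H x = c0" by blast
  define h where "h x = H x + c0" for x
  have Ph: "primitive h h1" using H by (simp add: primitive_def h_def)
  have hae: "AE x in lebesgue. x \<in> J \<longrightarrow> f x = h x" using c0 by eventually_elim (auto simp: h_def algebra_simps)
  have "h square_integrable_on J" by (rule sq_int_cong_AE[OF f(1) hae primitive_measurable[OF Ph] Jm])
  moreover have "h1 square_integrable_on J" by (rule sq_int_cong_AE[OF f(2) h1ae primitive_measurable[OF Ph1] Jm])
  ultimately show ?thesis using W2I[OF Ph Ph1] hae unfolding F2_def by blast
qed

lemma continuous_AE_eq:
  fixes f h :: "real \<Rightarrow> complex"
  assumes "open J" "continuous_on J f" "continuous_on J h" "AE x in lebesgue. x \<in> J \<longrightarrow> f x = h x" "x \<in> J"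
  shows "f x = h x"
proof (rule ccontr)
  assume ne: "f x \<noteq> h x"
  define S where "S = J \<inter> (\<lambda>x. f x - h x) -` (- {0})"
  have "open S" unfolding S_def
    by (rule continuous_open_preimage[OF continuous_on_diff[OF assms(2,3)] assms(1)]) auto
  moreover have "x \<in> S" using ne assms(5) by (simp add: S_def)
  moreover have "negligible S"
  proof -
    obtain N where N: "N \<in> null_sets lebesgue" "{x \<in> space lebesgue. \<not> (x \<in> J \<longrightarrow> f x = h x)} \<subseteq> N"
      using assms(4) unfolding eventually_ae_filter by blast
    then have "negligible N" by (simp add: negligible_iff_null_sets)
    then show ?thesis by (rule negligible_subset) (use N(2) in \<open>auto simp: S_def\<close>)
  qed
  ultimately show False using open_not_negligible by blast
qed

lemma weak_derivative_mono:
  assumes "weak_derivative I f g" "J \<subseteq> I"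
  shows "weak_derivative J f g"
  unfolding weak_derivative_def
proof (intro allI impI)
  fix \<phi> assume \<phi>: "test_function J \<phi>"
  have I: "(LINT x:I|lebesgue. deriv \<phi> x *\<^sub>R f x) = - (LINT x:I|lebesgue. \<phi> x *\<^sub>R g x)"
    using assms(1) test_function_mono[OF \<phi> assms(2)] by (simp add: weak_derivative_def)
  have z: "\<phi> x = 0" "deriv \<phi> x = 0" if "x \<notin> J" for x using test_functionD(4,5)[OF \<phi> that] by auto
  have zI: "\<phi> x = 0" "deriv \<phi> x = 0" if "x \<notin> I" for x using z[of x] that assms(2) by auto
  show "(LINT x:J|lebesgue. deriv \<phi> x *\<^sub>R f x) = - (LINT x:J|lebesgue. \<phi> x *\<^sub>R g x)"
    using I set_integral_supported[of J "\<lambda>x. deriv \<phi> x *\<^sub>R f x"] set_integral_supported[of I "\<lambda>x. deriv \<phi> x *\<^sub>R f x"]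
      set_integral_supported[of J "\<lambda>x. \<phi> x *\<^sub>R g x"] set_integral_supported[of I "\<lambda>x. \<phi> x *\<^sub>R g x"] z zI by simp
qed

text \<open>A test function on the punctured line vanishes near the origin, so the jump of the glued function is
  not seen.\<close>

lemma weak_derivative_glue:
  assumes l: "primitive l lp" and r: "primitive r rp"
  shows "weak_derivative (- {0}) (glue l r) (glue lp rp)"
  unfolding weak_derivative_def
proof (intro allI impI)
  fix \<phi> assume \<phi>: "test_function (- {0}) \<phi>"
  have u: "test_function UNIV \<phi>" by (rule test_function_mono[OF \<phi>]) simp
  have z: "\<phi> 0 = 0" by (rule test_functionD(4)[OF \<phi>]) simp
  have U: "- {0} = {..<0} \<union> {(0::real)<..}" by auto
  note L = test_function_by_parts[OF u l, of "{..<0}"] and R = test_function_by_parts[OF u r, of "{0<..}"]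
  have split: "(LINT x:- {0}|lebesgue. y x *\<^sub>R glue a b x) = (LINT x:{..<0}|lebesgue. y x *\<^sub>R a x) + (LINT x:{0<..}|lebesgue. y x *\<^sub>R b x)"
    if a: "set_integrable lebesgue {..<0} (\<lambda>x. y x *\<^sub>R a x)" and b: "set_integrable lebesgue {0<..} (\<lambda>x. y x *\<^sub>R b x)"
    for y :: "real \<Rightarrow> real" and a b :: "real \<Rightarrow> complex"
  proof -
    have 1: "indicator {..<0} x *\<^sub>R (y x *\<^sub>R glue a b x) = indicator {..<0} x *\<^sub>R (y x *\<^sub>R a x)"
      "indicator {0<..} x *\<^sub>R (y x *\<^sub>R glue a b x) = indicator {0<..} x *\<^sub>R (y x *\<^sub>R b x)" for x
      by (auto simp: indicator_def glue_def)
    have i: "set_integrable lebesgue {..<0} (\<lambda>x. y x *\<^sub>R glue a b x)" "set_integrable lebesgue {0<..} (\<lambda>x. y x *\<^sub>R glue a b x)"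
      using a b by (simp_all only: set_integrable_def 1)
    have "{..<0} \<inter> {(0::real)<..} = {}" by auto
    from set_integral_Un[OF this i] show ?thesis
      unfolding U by (simp only: set_lebesgue_integral_def 1)
  qed
  show "(LINT x:- {0}|lebesgue. deriv \<phi> x *\<^sub>R glue l r x) = - (LINT x:- {0}|lebesgue. \<phi> x *\<^sub>R glue lp rp x)"
    using split[OF L(2) R(2)] split[OF L(3) R(3)] L(1) R(1) z by simp
qed

lemma glue_sq_int:
  assumes "l square_integrable_on {..0}" "r square_integrable_on {0..}"
  shows "glue l r square_integrable_on UNIV"
proof -
  have "glue l r = (\<lambda>x. indicator {..<0} x *\<^sub>R l x + indicator {0<..} x *\<^sub>R r x)"
    by (auto simp: glue_def fun_eq_iff)
  then show ?thesis
    using assms square_integrable_add unfolding sq_int_half_lines[symmetric] sq_int_indicator[of l] sq_int_indicator[of r] by simp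
qed

lemma abs_l2_eq_iff:
  assumes "f square_integrable_on UNIV" "g square_integrable_on UNIV"
  shows "abs_l2 f = abs_l2 g \<longleftrightarrow> (AE x in lebesgue. f x = g x)"
  using Quotient_rel[OF Quotient_l2, of f g] assms by auto

lemma AE_nonzero: "AE x in lebesgue. x \<noteq> (0::real)"
proof -
  have "{0::real} \<in> null_sets lebesgue" by (simp flip: negligible_iff_null_sets)
  from AE_not_in[OF this] show ?thesis by simp
qed

section \<open>Operators glued at the origin\<close>

text \<open>All operators of the theorem in one form. Each half-line carries a function defined on the whole line, of which only
  the restriction to the closed half-line matters; boundary values are then simply values at \<open>0\<close>. The
  relation \<open>B\<close> couples \<open>(\<phi>(-0), \<phi>'(-0))\<close> to \<open>(\<phi>(+0), \<phi>'(+0))\<close>.\<close>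

definition boundary_operator ::
    "(real \<Rightarrow> real) \<Rightarrow> (complex \<Rightarrow> complex \<Rightarrow> complex \<Rightarrow> complex \<Rightarrow> bool) \<Rightarrow> l2 rel" where
  "boundary_operator V B = {(F, G). \<exists>l lp lq r rp rq.
     W2 l lp lq \<and> l square_integrable_on {..0} \<and> lp square_integrable_on {..0} \<and> lq square_integrable_on {..0} \<and>
     W2 r rp rq \<and> r square_integrable_on {0..} \<and> rp square_integrable_on {0..} \<and> rq square_integrable_on {0..} \<and>
     B (l 0) (lp 0) (r 0) (rp 0) \<and> F = abs_l2 (glue l r) \<and>
     G = abs_l2 (glue (\<lambda>x. - lq x + V x *\<^sub>R l x) (\<lambda>x. - rq x + V x *\<^sub>R r x))}"

lemma W22_of_W2:
  assumes "W2 h h1 h2" "open J" "h square_integrable_on J" "h1 square_integrable_on J" "h2 square_integrable_on J"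
  shows "W22_derivative J h h2"
proof -
  have "weak_derivative UNIV G g" if "primitive G g" for G g
    unfolding weak_derivative_def using test_function_by_parts(1)[OF _ that, of _ UNIV] by blast
  then have "weak_derivative J G g" if "primitive G g" for G g
    using weak_derivative_mono[of UNIV G g J] that by simp
  then show ?thesis unfolding W22_derivative_def using assms W2D(2,3)[OF assms(1)] by blast
qed

lemma schroedinger_imp:
  assumes FG: "(F, G) \<in> schroedinger V" and V: "V \<in> borel_measurable lebesgue"
  shows "\<exists>h h1 h2. W2 h h1 h2 \<and> h square_integrable_on UNIV \<and> h1 square_integrable_on UNIV \<and> h2 square_integrable_on UNIV \<and>
    (\<lambda>x. - h2 x + V x *\<^sub>R h x) square_integrable_on UNIV \<and> F = abs_l2 h \<and> G = abs_l2 (\<lambda>x. - h2 x + V x *\<^sub>R h x)"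
proof -
  obtain f f2 where F: "F = abs_l2 f" and G: "G = abs_l2 (\<lambda>x. - f2 x + V x *\<^sub>R f x)"
    and W: "W22_derivative UNIV f f2" and s: "f square_integrable_on UNIV" "(\<lambda>x. - f2 x + V x *\<^sub>R f x) square_integrable_on UNIV"
    using FG unfolding schroedinger_def l2_graph_def by blast
  obtain h h1 where h: "W2 h h1 (\<lambda>x. indicator UNIV x *\<^sub>R f2 x)" and ae: "AE x in lebesgue. x \<in> UNIV \<longrightarrow> f x = h x"
    and hs: "h square_integrable_on UNIV" "h1 square_integrable_on UNIV"
    using W2_of_W22[OF open_UNIV _ W] by blast
  have h': "W2 h h1 f2" using h by simp
  have f2: "f2 square_integrable_on UNIV" using W by (simp add: W22_derivative_def)
  have Fh: "F = abs_l2 h" unfolding F using abs_l2_eq_iff[OF s(1) hs(1)] ae by simp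
  have ae2: "AE x in lebesgue. - f2 x + V x *\<^sub>R f x = - f2 x + V x *\<^sub>R h x"
    using ae by eventually_elim simp
  have "(\<lambda>x. - f2 x + V x *\<^sub>R h x) \<in> borel_measurable lebesgue"
    by (rule borel_measurable_add[OF borel_measurable_uminus borel_measurable_scaleR[OF V W2D(6)[OF h]]])
       (use f2 in \<open>simp add: square_integrable_on_UNIV\<close>)
  then have s2: "(\<lambda>x. - f2 x + V x *\<^sub>R h x) square_integrable_on UNIV"
    using sq_int_cong_AE[OF s(2), of "\<lambda>x. - f2 x + V x *\<^sub>R h x"] ae2 by simp
  have "G = abs_l2 (\<lambda>x. - f2 x + V x *\<^sub>R h x)" unfolding G using abs_l2_eq_iff[OF s(2) s2] ae2 by simp
  then show ?thesis using h' hs f2 s2 Fh by blast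
qed

text \<open>For continuous coupling at the origin, the two halves fit together to a continuously
  differentiable function; conversely a function on the line is cut at the origin.\<close>

lemma schroedinger_eq:
  assumes V: "V \<in> borel_measurable lebesgue" "\<And>x. \<bar>V x\<bar> \<le> M"
  shows "schroedinger V = boundary_operator V (\<lambda>a a' b b'. a = b \<and> a' = b')"
proof (intro set_eqI iffI)
  fix FG assume FG: "FG \<in> schroedinger V"
  obtain F G where [simp]: "FG = (F, G)" by force
  obtain h h1 h2 where h: "W2 h h1 h2" "h square_integrable_on UNIV" "h1 square_integrable_on UNIV" "h2 square_integrable_on UNIV"
    and s: "(\<lambda>x. - h2 x + V x *\<^sub>R h x) square_integrable_on UNIV"
    and F: "F = abs_l2 h" and G: "G = abs_l2 (\<lambda>x. - h2 x + V x *\<^sub>R h x)"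
    using schroedinger_imp[of F G V] FG V(1) by auto
  have sub: "y square_integrable_on {..0}" "y square_integrable_on {0..}" if "y square_integrable_on UNIV" for y
    using sq_int_subset(1)[OF that] by auto
  have gl: "abs_l2 y = abs_l2 (glue y y)" if "y square_integrable_on UNIV" for y
  proof -
    have "AE x in lebesgue. y x = glue y y x" using AE_nonzero by eventually_elim (auto simp: glue_def)
    then show ?thesis using abs_l2_eq_iff[OF that glue_sq_int[OF sub[OF that]]] by simp
  qed
  have "(abs_l2 (glue h h), abs_l2 (glue (\<lambda>x. - h2 x + V x *\<^sub>R h x) (\<lambda>x. - h2 x + V x *\<^sub>R h x)))
      \<in> boundary_operator V (\<lambda>a a' b b'. a = b \<and> a' = b')"
    unfolding boundary_operator_def mem_Collect_eq prod.case
    by (rule exI[of _ h], rule exI[of _ h1], rule exI[of _ h2], rule exI[of _ h], rule exI[of _ h1], rule exI[of _ h2])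
       (intro conjI refl h(1) sub[OF h(2)] sub[OF h(3)] sub[OF h(4)])
  then show "FG \<in> boundary_operator V (\<lambda>a a' b b'. a = b \<and> a' = b')"
    by (simp only: \<open>FG = (F, G)\<close> F G gl[OF h(2)] gl[OF s])
next
  fix FG assume FG: "FG \<in> boundary_operator V (\<lambda>a a' b b'. a = b \<and> a' = b')"
  obtain l lp lq r rp rq where
     l: "W2 l lp lq" "l square_integrable_on {..0}" "lp square_integrable_on {..0}" "lq square_integrable_on {..0}" and
     r: "W2 r rp rq" "r square_integrable_on {0..}" "rp square_integrable_on {0..}" "rq square_integrable_on {0..}" and
     B: "l 0 = r 0" "lp 0 = rp 0" and
     FG: "FG = (abs_l2 (glue l r), abs_l2 (glue (\<lambda>x. - lq x + V x *\<^sub>R l x) (\<lambda>x. - rq x + V x *\<^sub>R r x)))"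
    using FG unfolding boundary_operator_def by auto
  have gq: "glue lq rq square_integrable_on UNIV" by (rule glue_sq_int[OF l(4) r(4)])
  have "glue lq rq absolutely_integrable_on {a..b}" for a b
    by (rule sq_int_abs_integrable(1)[OF gq]) simp
  then obtain h h1 where h: "W2 h h1 (glue lq rq)" "h 0 = l 0" "h1 0 = lp 0"
    using W2_ex[of "glue lq rq" 0 "l 0" "lp 0"] by blast
  have hl: "h x = l x \<and> h1 x = lp x" if "x \<le> 0" for x
    using W2_zero_left[OF W2_diff[OF h(1) l(1)], of 0 x] h that by (simp add: glue_def)
  have hr: "h x = r x \<and> h1 x = rp x" if "x \<ge> 0" for x
    using W2_zero_right[OF W2_diff[OF h(1) r(1)], of 0 x] h B that by (simp add: glue_def)
  have ae: "AE x in lebesgue. glue l r x = h x" "AE x in lebesgue. glue lp rp x = h1 x"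
    using AE_nonzero by (eventually_elim, use hl hr in \<open>auto simp: glue_def\<close>)+
  have hs: "h square_integrable_on UNIV" "h1 square_integrable_on UNIV"
    using sq_int_cong_AE[OF glue_sq_int[OF l(2) r(2)] _ W2D(6)[OF h(1)]] ae(1)
      sq_int_cong_AE[OF glue_sq_int[OF l(3) r(3)] _ W2D(7)[OF h(1)]] ae(2) by simp_all
  have W: "W22_derivative UNIV h (glue lq rq)" by (rule W22_of_W2[OF h(1) open_UNIV hs gq])
  have Vh: "(\<lambda>x. V x *\<^sub>R y x) square_integrable_on S" if "y square_integrable_on S" for y S
    using sq_int_mult_bounded[OF that, of "\<lambda>x. complex_of_real (V x)" M] V by (simp add: scaleR_conv_of_real)
  have s: "(\<lambda>x. - glue lq rq x + V x *\<^sub>R h x) square_integrable_on UNIV"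
    using sq_int_add[OF sq_int_cmult[OF gq, of "-1"] Vh[OF hs(1)]] by simp
  have s2: "glue (\<lambda>x. - lq x + V x *\<^sub>R l x) (\<lambda>x. - rq x + V x *\<^sub>R r x) square_integrable_on UNIV"
    using glue_sq_int[OF sq_int_add[OF sq_int_cmult[OF l(4), of "-1"] Vh[OF l(2)]] sq_int_add[OF sq_int_cmult[OF r(4), of "-1"] Vh[OF r(2)]]] by simp
  have "abs_l2 (glue l r) = abs_l2 h"
    using abs_l2_eq_iff[OF glue_sq_int[OF l(2) r(2)] hs(1)] ae(1) by simp
  moreover have "AE x in lebesgue. glue (\<lambda>x. - lq x + V x *\<^sub>R l x) (\<lambda>x. - rq x + V x *\<^sub>R r x) x = - glue lq rq x + V x *\<^sub>R h x"
    using AE_nonzero by eventually_elim (use hl hr in \<open>auto simp: glue_def\<close>)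
  then have "abs_l2 (glue (\<lambda>x. - lq x + V x *\<^sub>R l x) (\<lambda>x. - rq x + V x *\<^sub>R r x)) = abs_l2 (\<lambda>x. - glue lq rq x + V x *\<^sub>R h x)"
    using abs_l2_eq_iff[OF s2 s] by simp
  ultimately show "FG \<in> schroedinger V"
    unfolding FG schroedinger_def l2_graph_def using W hs(1) s by blast
qed

lemma W2_of_C1:
  assumes J: "open J" "\<And>x y. x \<in> J \<Longrightarrow> y \<in> J \<Longrightarrow> {x..y} \<subseteq> J"
    and W: "W22_derivative J f f2" and C: "f C1_differentiable_on J"
  shows "\<exists>h h1. W2 h h1 (\<lambda>x. indicator J x *\<^sub>R f2 x) \<and> h square_integrable_on J \<and> h1 square_integrable_on J \<and>
     (\<forall>x\<in>J. f x = h x \<and> vector_derivative f (at x) = h1 x)"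
proof -
  obtain h h1 where h: "W2 h h1 (\<lambda>x. indicator J x *\<^sub>R f2 x)" and ae: "AE x in lebesgue. x \<in> J \<longrightarrow> f x = h x"
    and hs: "h square_integrable_on J" "h1 square_integrable_on J"
    using W2_of_W22[OF J W] by blast
  have eq: "f x = h x" if "x \<in> J" for x
    by (rule continuous_AE_eq[OF J(1) C1_differentiable_imp_continuous_on[OF C] W2D(4)[OF h] ae that])
  have "vector_derivative f (at x) = h1 x" if x: "x \<in> J" for x
    by (rule vector_derivative_at)
       (rule has_vector_derivative_transform_within_open[OF W2D(1)[OF h] J(1) x], use eq in auto)
  then show ?thesis using h hs eq by blast
qed

lemma C1_of_W2: "W2 h h1 h2 \<Longrightarrow> h C1_differentiable_on S"
  unfolding C1_differentiable_on_def using W2D(1,5) by blast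

lemma W2_limits:
  assumes "W2 h h1 h2"
  shows "(h \<longlongrightarrow> h x) (at x within S)" "(h1 \<longlongrightarrow> h1 x) (at x within S)"
  using W2D(4,5)[OF assms, of UNIV] by (auto simp: continuous_on_def intro: tendsto_within_subset)

lemma tendsto_unique_on:
  fixes f h :: "real \<Rightarrow> complex"
  assumes "(f \<longlongrightarrow> a) (at x within S)" "(h \<longlongrightarrow> b) (at x within S)" "\<And>y. y \<in> S \<Longrightarrow> f y = h y" "at x within S \<noteq> bot"
  shows "a = b"
proof -
  have "eventually (\<lambda>y. f y = h y) (at x within S)" using assms(3) by (auto simp: eventually_at_filter)
  then have "(h \<longlongrightarrow> a) (at x within S)" by (rule Lim_transform_eventually[OF assms(1)])
  then show ?thesis using tendsto_unique[OF assms(4)] assms(2) by blast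
qed

lemma tendsto_cong_on:
  fixes f h :: "real \<Rightarrow> complex"
  assumes "(h \<longlongrightarrow> b) (at x within S)" "\<And>y. y \<in> S \<Longrightarrow> f y = h y"
  shows "(f \<longlongrightarrow> b) (at x within S)"
  by (rule Lim_transform_eventually[OF assms(1)]) (use assms(2) in \<open>auto simp: eventually_at_filter\<close>)

lemma open_half_lines:
  "open {..<0::real}" "\<And>x y. x \<in> {..<0::real} \<Longrightarrow> y \<in> {..<0} \<Longrightarrow> {x..y} \<subseteq> {..<0}"
  "open {0::real<..}" "\<And>x y. x \<in> {0::real<..} \<Longrightarrow> y \<in> {0<..} \<Longrightarrow> {x..y} \<subseteq> {0<..}"
  by auto

lemma sq_int_uminus: "f square_integrable_on S \<Longrightarrow> (\<lambda>x. - f x) square_integrable_on S"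
  using sq_int_cmult[of f S "-1"] by simp

lemma sq_int_cut:
  assumes "f square_integrable_on J" "J \<in> sets lebesgue" "S \<in> sets lebesgue"
  shows "(\<lambda>x. indicator J x *\<^sub>R f x) square_integrable_on S"
  using sq_int_subset(1)[of "\<lambda>x. indicator J x *\<^sub>R f x" UNIV S] assms(1,3) sq_int_indicator[of f J] by simp

text \<open>A function in the domain of a Dirichlet half-line operator is only constrained on its own half-line. There it agrees
  with a function that is twice differentiable on the whole line, whose value at the origin is
  the limit of the given function.\<close>

lemma direct_sum_eq:
  "direct_sum (dirichlet {..<0}) (dirichlet {0<..}) = boundary_operator (\<lambda>x. 0) (\<lambda>a a' b b'. a = 0 \<and> b = 0)"
proof (intro set_eqI iffI)
  fix FG assume "FG \<in> direct_sum (dirichlet {..<0}) (dirichlet {0<..})"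
  then obtain f1 f2 q1 q2 where
    FG: "FG = (abs_l2 (glue f1 f2), abs_l2 (glue (\<lambda>x. - q1 x) (\<lambda>x. - q2 x)))"
    and 1: "W22_derivative {..<0} f1 q1" "f1 C1_differentiable_on {..<0}" "(f1 \<longlongrightarrow> 0) (at 0 within {..<0})"
    and 2: "W22_derivative {0<..} f2 q2" "f2 C1_differentiable_on {0<..}" "(f2 \<longlongrightarrow> 0) (at 0 within {0<..})"
    unfolding direct_sum_def l2_graph_def dirichlet_def by blast
  obtain l lp where l: "W2 l lp (\<lambda>x. indicator {..<0} x *\<^sub>R q1 x)" "l square_integrable_on {..<0}" "lp square_integrable_on {..<0}"
    and lf: "\<And>x. x < 0 \<Longrightarrow> f1 x = l x"
    using W2_of_C1[OF open_half_lines(1,2) 1(1,2)] by auto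
  obtain r rp where r: "W2 r rp (\<lambda>x. indicator {0<..} x *\<^sub>R q2 x)" "r square_integrable_on {0<..}" "rp square_integrable_on {0<..}"
    and rf: "\<And>x. x > 0 \<Longrightarrow> f2 x = r x"
    using W2_of_C1[OF open_half_lines(3,4) 2(1,2)] by auto
  have q: "(\<lambda>x. indicator {..<0} x *\<^sub>R q1 x) square_integrable_on {..0}" "(\<lambda>x. indicator {0<..} x *\<^sub>R q2 x) square_integrable_on {0..}"
    using 1(1) 2(1) by (auto simp: W22_derivative_def intro!: sq_int_cut)
  have l0: "l 0 = 0" using tendsto_unique_on[OF 1(3) W2_limits(1)[OF l(1)]] lf by simp
  have r0: "r 0 = 0" using tendsto_unique_on[OF 2(3) W2_limits(1)[OF r(1)]] rf by simp
  have g1: "glue f1 f2 = glue l r" using lf rf by (auto simp: glue_def)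
  have g2: "glue (\<lambda>x. - q1 x) (\<lambda>x. - q2 x) =
     glue (\<lambda>x. - (indicator {..<0} x *\<^sub>R q1 x) + 0 *\<^sub>R l x) (\<lambda>x. - (indicator {0<..} x *\<^sub>R q2 x) + 0 *\<^sub>R r x)"
    by (auto simp: glue_def)
  show "FG \<in> boundary_operator (\<lambda>x. 0) (\<lambda>a a' b b'. a = 0 \<and> b = 0)"
    unfolding boundary_operator_def FG g1 g2
    using l r l0 r0 q unfolding sq_int_half_lines by blast
next
  fix FG assume "FG \<in> boundary_operator (\<lambda>x. 0) (\<lambda>a a' b b'. a = 0 \<and> b = 0)"
  then obtain l lp lq r rp rq where
     l: "W2 l lp lq" "l square_integrable_on {..0}" "lp square_integrable_on {..0}" "lq square_integrable_on {..0}" and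
     r: "W2 r rp rq" "r square_integrable_on {0..}" "rp square_integrable_on {0..}" "rq square_integrable_on {0..}" and
     B: "l 0 = 0" "r 0 = 0" and
     FG: "FG = (abs_l2 (glue l r), abs_l2 (glue (\<lambda>x. - lq x) (\<lambda>x. - rq x)))"
    unfolding boundary_operator_def by auto
  have 1: "(l, \<lambda>x. - lq x) \<in> dirichlet {..<0}"
    unfolding dirichlet_def
    using W22_of_W2[OF l(1) open_half_lines(1)] l(2-4) C1_of_W2[OF l(1)] W2_limits(1)[OF l(1), of 0] B(1)
    unfolding sq_int_half_lines[symmetric] by auto
  have 2: "(r, \<lambda>x. - rq x) \<in> dirichlet {0<..}"
    unfolding dirichlet_def
    using W22_of_W2[OF r(1) open_half_lines(3)] r(2-4) C1_of_W2[OF r(1)] W2_limits(1)[OF r(1), of 0] B(2)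
    unfolding sq_int_half_lines[symmetric] by auto
  show "FG \<in> direct_sum (dirichlet {..<0}) (dirichlet {0<..})"
    unfolding FG direct_sum_def l2_graph_def
    using 1 2 glue_sq_int[OF l(2) r(2)] glue_sq_int[OF sq_int_uminus[OF l(4)] sq_int_uminus[OF r(4)]] by blast
qed

lemma l2_graphI:
  "(f, g) \<in> X \<Longrightarrow> f square_integrable_on UNIV \<Longrightarrow> g square_integrable_on UNIV \<Longrightarrow> (abs_l2 f, abs_l2 g) \<in> l2_graph X"
  unfolding l2_graph_def by blast

lemma point_interaction_eq:
  "point_interaction (vector [vector [\<theta>, 0], vector [\<omega>, \<theta>']]) =
    boundary_operator (\<lambda>x. 0) (\<lambda>a a' b b'. b = of_real \<theta> * a \<and> b' = of_real \<omega> * a + of_real \<theta>' * a')"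
proof -
  have M: "vector [b, b'] = map_matrix complex_of_real (vector [vector [\<theta>, 0], vector [\<omega>, \<theta>']] :: real^2^2) *v (vector [a, a'] :: complex ^ 2)
     \<longleftrightarrow> b = of_real \<theta> * a \<and> b' = of_real \<omega> * a + of_real \<theta>' * a'" for a a' b b' :: complex
    by (simp add: vec_eq_iff forall_2 matrix_vector_mult_def map_matrix_def sum_2 vector_2)
  show ?thesis
  proof (intro set_eqI iffI)
    fix FG assume "FG \<in> point_interaction (vector [vector [\<theta>, 0], vector [\<omega>, \<theta>']])"
    then obtain f f2 a a' b b' where
      FG: "FG = (abs_l2 f, abs_l2 (\<lambda>x. - f2 x))" and s: "f square_integrable_on UNIV" "(\<lambda>x. - f2 x) square_integrable_on UNIV"
      and W: "W22_derivative (- {0}) f f2" and C: "f C1_differentiable_on (- {0})"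
      and lim: "(f \<longlongrightarrow> a) (at_left 0)" "((\<lambda>x. vector_derivative f (at x)) \<longlongrightarrow> a') (at_left 0)"
        "(f \<longlongrightarrow> b) (at_right 0)" "((\<lambda>x. vector_derivative f (at x)) \<longlongrightarrow> b') (at_right 0)"
      and B: "b = of_real \<theta> * a \<and> b' = of_real \<omega> * a + of_real \<theta>' * a'"
      unfolding point_interaction_def l2_graph_def M by blast
    have mono: "W22_derivative J f f2" if "J \<subseteq> - {0}" "J \<in> sets lebesgue" for J
      using W that sq_int_subset(1) weak_derivative_mono unfolding W22_derivative_def by meson
    have C': "f C1_differentiable_on J" if "J \<subseteq> - {0}" for J
      using C that C1_differentiable_on_subset by blast
    have sub: "{..<0} \<subseteq> - {0::real}" "{0<..} \<subseteq> - {0::real}" by auto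
    obtain l lp where l: "W2 l lp (\<lambda>x. indicator {..<0} x *\<^sub>R f2 x)" "l square_integrable_on {..<0}" "lp square_integrable_on {..<0}"
      and lf: "\<And>x. x < 0 \<Longrightarrow> f x = l x" "\<And>x. x < 0 \<Longrightarrow> vector_derivative f (at x) = lp x"
      using W2_of_C1[OF open_half_lines(1,2) mono[OF sub(1)] C'[OF sub(1)]] by auto
    obtain r rp where r: "W2 r rp (\<lambda>x. indicator {0<..} x *\<^sub>R f2 x)" "r square_integrable_on {0<..}" "rp square_integrable_on {0<..}"
      and rf: "\<And>x. x > 0 \<Longrightarrow> f x = r x" "\<And>x. x > 0 \<Longrightarrow> vector_derivative f (at x) = rp x"
      using W2_of_C1[OF open_half_lines(3,4) mono[OF sub(2)] C'[OF sub(2)]] by auto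
    have f2J: "f2 square_integrable_on {..<0}" "f2 square_integrable_on {0<..}"
      using mono[OF sub(1)] mono[OF sub(2)] by (auto simp: W22_derivative_def)
    have q: "(\<lambda>x. indicator {..<0} x *\<^sub>R f2 x) square_integrable_on {..0}" "(\<lambda>x. indicator {0<..} x *\<^sub>R f2 x) square_integrable_on {0..}"
      using f2J by (auto intro!: sq_int_cut)
    have l0: "a = l 0" "a' = lp 0"
      using tendsto_unique_on[OF lim(1) W2_limits(1)[OF l(1)]] tendsto_unique_on[OF lim(2) W2_limits(2)[OF l(1)]] lf by simp_all
    have r0: "b = r 0" "b' = rp 0"
      using tendsto_unique_on[OF lim(3) W2_limits(1)[OF r(1)]] tendsto_unique_on[OF lim(4) W2_limits(2)[OF r(1)]] rf by simp_all
    have l': "l square_integrable_on {..0}" "lp square_integrable_on {..0}" and r': "r square_integrable_on {0..}" "rp square_integrable_on {0..}"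
      using l(2,3) r(2,3) unfolding sq_int_half_lines by auto
    have "AE x in lebesgue. f x = glue l r x"
      using AE_nonzero by eventually_elim (use lf rf in \<open>auto simp: glue_def\<close>)
    then have g1: "abs_l2 f = abs_l2 (glue l r)"
      using abs_l2_eq_iff[OF s(1) glue_sq_int[OF l'(1) r'(1)]] by simp
    have s2: "glue (\<lambda>x. - (indicator {..<0} x *\<^sub>R f2 x) + 0 *\<^sub>R l x) (\<lambda>x. - (indicator {0<..} x *\<^sub>R f2 x) + 0 *\<^sub>R r x) square_integrable_on UNIV"
      using glue_sq_int[OF sq_int_uminus[OF q(1)] sq_int_uminus[OF q(2)]] by simp
    have "AE x in lebesgue. - f2 x = glue (\<lambda>x. - (indicator {..<0} x *\<^sub>R f2 x) + 0 *\<^sub>R l x) (\<lambda>x. - (indicator {0<..} x *\<^sub>R f2 x) + 0 *\<^sub>R r x) x"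
      using AE_nonzero by eventually_elim (auto simp: glue_def)
    then have g2: "abs_l2 (\<lambda>x. - f2 x) = abs_l2 (glue (\<lambda>x. - (indicator {..<0} x *\<^sub>R f2 x) + 0 *\<^sub>R l x) (\<lambda>x. - (indicator {0<..} x *\<^sub>R f2 x) + 0 *\<^sub>R r x))"
      using abs_l2_eq_iff[OF s(2) s2] by simp
    show "FG \<in> boundary_operator (\<lambda>x. 0) (\<lambda>a a' b b'. b = of_real \<theta> * a \<and> b' = of_real \<omega> * a + of_real \<theta>' * a')"
      unfolding boundary_operator_def FG g1 g2 
      using l(1) r(1) l' r' q B unfolding l0 r0 by blast
  next
    fix FG assume "FG \<in> boundary_operator (\<lambda>x. 0) (\<lambda>a a' b b'. b = of_real \<theta> * a \<and> b' = of_real \<omega> * a + of_real \<theta>' * a')"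
    then obtain l lp lq r rp rq where
       l: "W2 l lp lq" "l square_integrable_on {..0}" "lp square_integrable_on {..0}" "lq square_integrable_on {..0}" and
       r: "W2 r rp rq" "r square_integrable_on {0..}" "rp square_integrable_on {0..}" "rq square_integrable_on {0..}" and
       B: "r 0 = of_real \<theta> * l 0 \<and> rp 0 = of_real \<omega> * l 0 + of_real \<theta>' * lp 0" and
       FG: "FG = (abs_l2 (glue l r), abs_l2 (glue (\<lambda>x. - lq x) (\<lambda>x. - rq x)))"
      unfolding boundary_operator_def by auto
    define f where "f = glue l r"
    define f1 where "f1 = glue lp rp"
    define f2 where "f2 = glue lq rq"
    have fs: "f square_integrable_on UNIV" "f1 square_integrable_on UNIV" "f2 square_integrable_on UNIV"
      unfolding f_def f1_def f2_def using glue_sq_int l r by auto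
    have g2: "glue (\<lambda>x. - lq x) (\<lambda>x. - rq x) = (\<lambda>x. - f2 x)" by (auto simp: f2_def glue_def)
    have sub: "y square_integrable_on - {0}" if "y square_integrable_on UNIV" for y
      using sq_int_subset(1)[OF that, of "- {0}"] by auto
    have W: "W22_derivative (- {0}) f f2"
      unfolding W22_derivative_def
      using sub[OF fs(1)] sub[OF fs(2)] sub[OF fs(3)] weak_derivative_glue[OF W2D(3)[OF l(1)] W2D(3)[OF r(1)]]
        weak_derivative_glue[OF W2D(2)[OF l(1)] W2D(2)[OF r(1)]] unfolding f_def f1_def f2_def by blast
    have d: "(f has_vector_derivative f1 x) (at x)" if "x \<noteq> 0" for x
    proof (cases "x < 0")
      case True
      have "(f has_vector_derivative lp x) (at x)"
        by (rule has_vector_derivative_transform_within_open[OF W2D(1)[OF l(1)] open_half_lines(1)])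
           (use True in \<open>auto simp: f_def glue_def\<close>)
      then show ?thesis using True by (simp add: f1_def glue_def)
    next
      case False
      have "(f has_vector_derivative rp x) (at x)"
        by (rule has_vector_derivative_transform_within_open[OF W2D(1)[OF r(1)] open_half_lines(3)])
           (use False that in \<open>auto simp: f_def glue_def\<close>)
      then show ?thesis using False that by (simp add: f1_def glue_def)
    qed
    have cf1: "continuous_on (- {0}) f1"
    proof -
      have "continuous_on {..<0} f1" by (rule continuous_on_eq[OF W2D(5)[OF l(1)]]) (auto simp: f1_def glue_def)
      moreover have "continuous_on {0<..} f1" by (rule continuous_on_eq[OF W2D(5)[OF r(1)]]) (auto simp: f1_def glue_def)
      moreover have "- {0} = {..<0} \<union> {(0::real)<..}" by auto
      ultimately show ?thesis using continuous_on_open_Un[OF open_half_lines(1,3)] by metis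
    qed
    have C: "f C1_differentiable_on (- {0})"
      unfolding C1_differentiable_on_def using d cf1 by (intro exI[of _ f1]) auto
    have vd: "vector_derivative f (at x) = f1 x" if "x \<noteq> 0" for x by (rule vector_derivative_at[OF d[OF that]])
    have lims: "(f \<longlongrightarrow> l 0) (at_left 0)" "((\<lambda>x. vector_derivative f (at x)) \<longlongrightarrow> lp 0) (at_left 0)"
      "(f \<longlongrightarrow> r 0) (at_right 0)" "((\<lambda>x. vector_derivative f (at x)) \<longlongrightarrow> rp 0) (at_right 0)"
    proof -
      have L: "f x = l x" "vector_derivative f (at x) = lp x" if "x < 0" for x
        using vd[of x] that by (auto simp: f_def f1_def glue_def)
      have R: "f x = r x" "vector_derivative f (at x) = rp x" if "x > 0" for x
        using vd[of x] that by (auto simp: f_def f1_def glue_def)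
      show "(f \<longlongrightarrow> l 0) (at_left 0)" by (rule tendsto_cong_on[OF W2_limits(1)[OF l(1)]]) (simp add: L)
      show "((\<lambda>x. vector_derivative f (at x)) \<longlongrightarrow> lp 0) (at_left 0)"
        by (rule tendsto_cong_on[OF W2_limits(2)[OF l(1)]]) (simp add: L)
      show "(f \<longlongrightarrow> r 0) (at_right 0)" by (rule tendsto_cong_on[OF W2_limits(1)[OF r(1)]]) (simp add: R)
      show "((\<lambda>x. vector_derivative f (at x)) \<longlongrightarrow> rp 0) (at_right 0)"
        by (rule tendsto_cong_on[OF W2_limits(2)[OF r(1)]]) (simp add: R)
    qed
    have ex: "\<exists>a a' b b'.
        (f \<longlongrightarrow> a) (at_left 0) \<and> ((\<lambda>x. vector_derivative f (at x)) \<longlongrightarrow> a') (at_left 0) \<and>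
        (f \<longlongrightarrow> b) (at_right 0) \<and> ((\<lambda>x. vector_derivative f (at x)) \<longlongrightarrow> b') (at_right 0) \<and>
        vector [b, b'] = map_matrix complex_of_real (vector [vector [\<theta>, 0], vector [\<omega>, \<theta>']] :: real^2^2) *v (vector [a, a'] :: complex ^ 2)"
      by (rule exI[of _ "l 0"], rule exI[of _ "lp 0"], rule exI[of _ "r 0"], rule exI[of _ "rp 0"])
         (intro conjI lims iffD2[OF M B])
    have mem: "(f, \<lambda>x. - f2 x) \<in> {(f, \<lambda>x. - f2 x) | f f2.
     W22_derivative (- {0}) f f2 \<and> f C1_differentiable_on (- {0}) \<and>
     (\<exists>a a' b b'.
        (f \<longlongrightarrow> a) (at_left 0) \<and> ((\<lambda>x. vector_derivative f (at x)) \<longlongrightarrow> a') (at_left 0) \<and>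
        (f \<longlongrightarrow> b) (at_right 0) \<and> ((\<lambda>x. vector_derivative f (at x)) \<longlongrightarrow> b') (at_right 0) \<and>
        vector [b, b'] = map_matrix complex_of_real (vector [vector [\<theta>, 0], vector [\<omega>, \<theta>']] :: real^2^2) *v (vector [a, a'] :: complex ^ 2))}"
      by (rule CollectI, rule exI[of _ f], rule exI[of _ f2]) (intro conjI refl W C ex)
    show "FG \<in> point_interaction (vector [vector [\<theta>, 0], vector [\<omega>, \<theta>']])"
      unfolding FG point_interaction_def g2 f_def[symmetric]
      by (rule l2_graphI[OF mem fs(1) sq_int_uminus[OF fs(3)]])
  qed
qed

section \<open>Resolvents of glued operators\<close>

lemma norm_abs_l2: "f square_integrable_on UNIV \<Longrightarrow> norm (abs_l2 f) = l2norm UNIV f"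
  using norm_l2.abs_eq[of f] by (simp add: l2norm_def set_lebesgue_integral_def)

lemma l2_rep:
  fixes F :: l2 obtains f where "f square_integrable_on UNIV" "F = abs_l2 f"
  by (induction F rule: l2.abs_induct) blast

lemma scaleC_l2_linear:
  "z *\<^sub>C (F + G) = z *\<^sub>C F + z *\<^sub>C G" "z *\<^sub>C (c *\<^sub>R F) = c *\<^sub>R (z *\<^sub>C F)" "z *\<^sub>C (F - G) = z *\<^sub>C F - z *\<^sub>C G"
proof -
  obtain f g where f: "f square_integrable_on UNIV" "F = abs_l2 f" and g: "g square_integrable_on UNIV" "G = abs_l2 g"
    using l2_rep by metis
  note i = square_integrable_add[OF f(1) g(1)] square_integrable_diff[OF f(1) g(1)] square_integrable_mult[OF f(1), of z]
     square_integrable_mult[OF g(1), of z] square_integrable_scaleR[OF f(1), of c] f(1) g(1)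
  show "z *\<^sub>C (F + G) = z *\<^sub>C F + z *\<^sub>C G"
    unfolding f(2) g(2) using i by (simp add: plus_l2.abs_eq scaleC_l2.abs_eq algebra_simps)
  show "z *\<^sub>C (F - G) = z *\<^sub>C F - z *\<^sub>C G"
    unfolding f(2) g(2) using i by (simp add: minus_l2.abs_eq scaleC_l2.abs_eq algebra_simps)
  show "z *\<^sub>C (c *\<^sub>R F) = c *\<^sub>R (z *\<^sub>C F)"
    unfolding f(2) using i by (simp add: scaleR_l2.abs_eq scaleC_l2.abs_eq)
qed

text \<open>A lower bound makes the inverse single-valued and bounded by \<open>1 / m\<close>; surjectivity makes it everywhere
  defined.\<close>

lemma is_resolventI:
  assumes add: "\<And>F G F' G'. (F, G) \<in> A \<Longrightarrow> (F', G') \<in> A \<Longrightarrow> (F + F', G + G') \<in> A"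
    and scale: "\<And>F G c. (F, G) \<in> A \<Longrightarrow> (c *\<^sub>R F, c *\<^sub>R G) \<in> A"
    and bound: "\<And>F G. (F, G) \<in> A \<Longrightarrow> m * norm F \<le> norm (G - z *\<^sub>C F)" and m: "m > 0"
    and surj: "\<And>f. \<exists>F G. (F, G) \<in> A \<and> G - z *\<^sub>C F = f"
  shows "\<exists>R. is_resolvent A z R"
proof -
  have uniq: "F = F'" if "(F, G) \<in> A" "(F', G') \<in> A" "G - z *\<^sub>C F = G' - z *\<^sub>C F'" for F G F' G'
  proof -
    have "(F + (-1) *\<^sub>R F', G + (-1) *\<^sub>R G') \<in> A" by (intro add scale that)
    then have "(F - F', G - G') \<in> A" by simp
    from bound[OF this] have "m * norm (F - F') \<le> norm ((G - z *\<^sub>C F) - (G' - z *\<^sub>C F'))"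
      by (simp add: scaleC_l2_linear algebra_simps)
    then show "F = F'" using that(3) m by (simp add: mult_le_0_iff)
  qed
  define T where "T f = (SOME F. \<exists>G. (F, G) \<in> A \<and> G - z *\<^sub>C F = f)" for f
  have T: "\<exists>G. (T f, G) \<in> A \<and> G - z *\<^sub>C T f = f" for f
    unfolding T_def by (rule someI_ex) (use surj in blast)
  have Teq: "T f = F" if "(F, G) \<in> A" "G - z *\<^sub>C F = f" for f F G
    using T[of f] uniq that by blast
  have "bounded_linear T"
  proof (rule bounded_linear_intro[where K="1 / m"])
    fix f g
    obtain G H where "(T f, G) \<in> A" "G - z *\<^sub>C T f = f" "(T g, H) \<in> A" "H - z *\<^sub>C T g = g" using T by meson
    then show "T (f + g) = T f + T g"
      by (intro Teq[of "T f + T g" "G + H"] add) (auto simp: scaleC_l2_linear algebra_simps)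
  next
    fix c f
    obtain G where "(T f, G) \<in> A" "G - z *\<^sub>C T f = f" using T by meson
    then show "T (c *\<^sub>R f) = c *\<^sub>R T f"
      by (intro Teq[of "c *\<^sub>R T f" "c *\<^sub>R G"] scale) (auto simp: scaleC_l2_linear simp flip: scaleR_diff_right)
  next
    fix f
    obtain G where G: "(T f, G) \<in> A" "G - z *\<^sub>C T f = f" using T by meson
    from bound[OF G(1)] show "norm (T f) \<le> norm f * (1 / m)" using m G(2) by (simp add: field_simps)
  qed
  then have R: "blinfun_apply (Blinfun T) = T" by (rule bounded_linear_Blinfun_apply)
  have "is_resolvent A z (Blinfun T)"
    unfolding is_resolvent_def R using T Teq by blast
  then show ?thesis by blast
qed

subsection \<open>Symmetry\<close>

lemma set_integral_cnj_mult:
  assumes "r square_integrable_on S"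
  shows "(LINT x:S|lebesgue. cnj (r x) * r x) = complex_of_real ((l2norm S r)\<^sup>2)"
proof -
  have eq: "cnj (r x) * r x = complex_of_real ((norm (r x))\<^sup>2)" for x
    using complex_norm_square[of "r x"] by (simp add: mult.commute)
  show ?thesis unfolding eq l2norm_square by (rule set_integral_complex_of_real)
qed

text \<open>Green's formula: multiply the equation by \<open>cnj r\<close>, integrate by parts and take imaginary parts, which
  removes the real terms with \<open>\<bar>r'\<bar>\<^sup>2\<close> and \<open>V \<bar>r\<bar>\<^sup>2\<close>.\<close>

lemma half_line_energy:
  assumes W: "W2 r rp rq" and s: "r square_integrable_on {0..}" "rp square_integrable_on {0..}" "rq square_integrable_on {0..}"
    and V: "V \<in> borel_measurable lebesgue" "\<And>x. \<bar>V x\<bar> \<le> M"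
    and eq: "\<And>x. x > 0 \<Longrightarrow> rq x = (complex_of_real (V x) - z) * r x - \<psi> x" and \<psi>: "\<psi> square_integrable_on {0..}"
  shows "Im (cnj (r 0) * rp 0) = Im (LINT x:{0..}|lebesgue. cnj (r x) * \<psi> x) + Im z * (l2norm {0..} r)\<^sup>2"
proof -
  have cr: "(\<lambda>x. cnj (r x)) square_integrable_on {0..}" "(\<lambda>x. cnj (rp x)) square_integrable_on {0..}"
    using sq_int_cnj s by auto
  have Vr: "(\<lambda>x. complex_of_real (V x) * r x) square_integrable_on {0..}"
    by (rule sq_int_mult_bounded[OF s(1), where M=M]) (use V in auto)
  have i1: "(\<lambda>x. cnj (rp x) * rp x) absolutely_integrable_on {0..}" by (rule cauchy_schwarz_integral(1)[OF cr(2) s(2)])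
  have i2: "(\<lambda>x. cnj (r x) * rq x) absolutely_integrable_on {0..}" by (rule cauchy_schwarz_integral(1)[OF cr(1) s(3)])
  have i3: "(\<lambda>x. cnj (r x) * rp x) absolutely_integrable_on {0..}" by (rule cauchy_schwarz_integral(1)[OF cr(1) s(2)])
  have i4: "(\<lambda>x. cnj (r x) * (complex_of_real (V x) * r x)) absolutely_integrable_on {0..}" by (rule cauchy_schwarz_integral(1)[OF cr(1) Vr])
  have i5: "(\<lambda>x. z * (cnj (r x) * r x)) absolutely_integrable_on {0..}"
    by (rule set_integrable_mult_right) (rule cauchy_schwarz_integral(1)[OF cr(1) s(1)])
  have i6: "(\<lambda>x. cnj (r x) * \<psi> x) absolutely_integrable_on {0..}" by (rule cauchy_schwarz_integral(1)[OF cr(1) \<psi>])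
  have "cnj (r 0) * rp 0 = - (LINT x:{0..}|lebesgue. cnj (rp x) * rp x + cnj (r x) * rq x)"
    by (rule primitive_vanishes_at_top[OF energy_identity[OF W] i3 set_integral_add(1)[OF i1 i2]])
  also have "(LINT x:{0..}|lebesgue. cnj (rp x) * rp x + cnj (r x) * rq x)
     = (LINT x:{0..}|lebesgue. cnj (rp x) * rp x) + (LINT x:{0..}|lebesgue. cnj (r x) * rq x)"
    by (rule set_integral_add(2)[OF i1 i2])
  also have "(LINT x:{0..}|lebesgue. cnj (r x) * rq x)
     = (LINT x:{0..}|lebesgue. (cnj (r x) * (complex_of_real (V x) * r x) - z * (cnj (r x) * r x)) - cnj (r x) * \<psi> x)"
  proof -
    have i7: "(\<lambda>x. (cnj (r x) * (complex_of_real (V x) * r x) - z * (cnj (r x) * r x)) - cnj (r x) * \<psi> x) absolutely_integrable_on {0..}"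
      by (intro set_integral_diff(1) i4 i5 i6)
    show ?thesis
      unfolding set_lebesgue_integral_eq_integral(2)[OF i2] set_lebesgue_integral_eq_integral(2)[OF i7]
      by (rule integral_spike[of "{0}"]) (auto simp: eq algebra_simps)
  qed
  also have "\<dots> = (LINT x:{0..}|lebesgue. cnj (r x) * (complex_of_real (V x) * r x)) - (LINT x:{0..}|lebesgue. z * (cnj (r x) * r x))
      - (LINT x:{0..}|lebesgue. cnj (r x) * \<psi> x)"
    by (simp only: set_integral_diff(2)[OF set_integral_diff(1)[OF i4 i5] i6] set_integral_diff(2)[OF i4 i5])
  also have "(LINT x:{0..}|lebesgue. z * (cnj (r x) * r x)) = z * complex_of_real ((l2norm {0..} r)\<^sup>2)"
    using set_integral_cnj_mult[OF s(1)] by simp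
  also have "(LINT x:{0..}|lebesgue. cnj (rp x) * rp x) = complex_of_real ((l2norm {0..} rp)\<^sup>2)"
    by (rule set_integral_cnj_mult[OF s(2)])
  also have "(LINT x:{0..}|lebesgue. cnj (r x) * (complex_of_real (V x) * r x)) = complex_of_real (LINT x:{0..}|lebesgue. V x * (norm (r x))\<^sup>2)"
  proof -
    have "cnj (r x) * (complex_of_real (V x) * r x) = complex_of_real (V x * (norm (r x))\<^sup>2)" for x
      using complex_norm_square[of "r x"] by (simp add: mult_ac)
    then show ?thesis by (simp only: set_integral_complex_of_real)
  qed
  finally show ?thesis by simp
qed

lemma set_integral_reflect_UNIV:
  fixes f :: "real \<Rightarrow> complex"
  shows "(LINT x:{0..}|lebesgue. f (- x)) = (LINT x:{..0}|lebesgue. f x)"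
  using lebesgue_integral_real_affine[of "-1" "\<lambda>x. indicator {..0} x *\<^sub>R f x" 0]
  by (simp add: set_lebesgue_integral_def indicator_def)

lemma half_line_energy_left:
  assumes W: "W2 l lp lq" and s: "l square_integrable_on {..0}" "lp square_integrable_on {..0}" "lq square_integrable_on {..0}"
    and V: "V \<in> borel_measurable lebesgue" "\<And>x. \<bar>V x\<bar> \<le> M"
    and eq: "\<And>x. x < 0 \<Longrightarrow> lq x = (complex_of_real (V x) - z) * l x - \<psi> x" and \<psi>: "\<psi> square_integrable_on {..0}"
  shows "- Im (cnj (l 0) * lp 0) = Im (LINT x:{..0}|lebesgue. cnj (l x) * \<psi> x) + Im z * (l2norm {..0} l)\<^sup>2"
proof -
  have im: "uminus ` {..0} = {(0::real)..}" by auto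
  have refl: "(\<lambda>x. y (- x)) square_integrable_on {0..}" "l2norm {0..} (\<lambda>x. y (- x)) = l2norm {..0} y"
    if "y square_integrable_on {..0}" for y
    using sq_int_reflect[OF that] unfolding im by auto
  have W': "W2 (\<lambda>x. l (- x)) (\<lambda>x. - lp (- x)) (\<lambda>x. lq (- x))" using W2_affine[OF W, of "-1" 0] by simp
  have "Im (cnj (l (- 0)) * - lp (- 0)) = Im (LINT x:{0..}|lebesgue. cnj (l (- x)) * \<psi> (- x)) + Im z * (l2norm {0..} (\<lambda>x. l (- x)))\<^sup>2"
  proof (rule half_line_energy[OF W' refl(1)[OF s(1)] sq_int_uminus[OF refl(1)[OF s(2)]] refl(1)[OF s(3)] _ _ _ refl(1)[OF \<psi>]])
    show "(\<lambda>x. V (- x)) \<in> borel_measurable lebesgue" using borel_measurable_affine[OF V(1), of "-1" 0] by simp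
    show "\<bar>V (- x)\<bar> \<le> M" for x by (rule V(2))
    show "lq (- x) = (complex_of_real (V (- x)) - z) * l (- x) - \<psi> (- x)" if "x > 0" for x using eq[of "-x"] that by simp
  qed
  then show ?thesis using refl(2)[OF s(1)] set_integral_reflect_UNIV[of "\<lambda>x. cnj (l x) * \<psi> x"] by simp
qed

lemma l2norm_square_glue:
  assumes "l square_integrable_on {..0}" "r square_integrable_on {0..}"
  shows "(l2norm UNIV (glue l r))\<^sup>2 = (l2norm {..0} l)\<^sup>2 + (l2norm {0..} r)\<^sup>2"
proof -
  have il: "integrable lebesgue (\<lambda>x. indicator {..0} x *\<^sub>R (norm (l x))\<^sup>2)" and ir: "integrable lebesgue (\<lambda>x. indicator {0..} x *\<^sub>R (norm (r x))\<^sup>2)"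
    using assms by (auto simp: square_integrable_on_def set_integrable_def)
  have "(LINT x|lebesgue. (norm (glue l r x))\<^sup>2) = (LINT x|lebesgue. indicator {..0} x *\<^sub>R (norm (l x))\<^sup>2 + indicator {0..} x *\<^sub>R (norm (r x))\<^sup>2)"
  proof (rule integral_cong_AE)
    show "(\<lambda>x. (norm (glue l r x))\<^sup>2) \<in> borel_measurable lebesgue"
      using glue_sq_int[OF assms] by (simp add: square_integrable_on_UNIV borel_measurable_integrable)
    show "(\<lambda>x. indicator {..0} x *\<^sub>R (norm (l x))\<^sup>2 + indicator {0..} x *\<^sub>R (norm (r x))\<^sup>2) \<in> borel_measurable lebesgue"
      by (rule borel_measurable_integrable[OF Bochner_Integration.integrable_add[OF il ir]])
    show "AE x in lebesgue. (norm (glue l r x))\<^sup>2 = indicator {..0} x *\<^sub>R (norm (l x))\<^sup>2 + indicator {0..} x *\<^sub>R (norm (r x))\<^sup>2"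
      using AE_nonzero by eventually_elim (auto simp: glue_def indicator_def)
  qed
  also have "\<dots> = (LINT x|lebesgue. indicator {..0} x *\<^sub>R (norm (l x))\<^sup>2) + (LINT x|lebesgue. indicator {0..} x *\<^sub>R (norm (r x))\<^sup>2)"
    by (rule Bochner_Integration.integral_add[OF il ir])
  finally show ?thesis unfolding l2norm_square by (simp add: set_lebesgue_integral_def)
qed

lemma set_integral_cnj_glue:
  assumes "l square_integrable_on {..0}" "r square_integrable_on {0..}" "\<psi> square_integrable_on UNIV"
  shows "(LINT x:UNIV|lebesgue. cnj (glue l r x) * \<psi> x) = (LINT x:{..0}|lebesgue. cnj (l x) * \<psi> x) + (LINT x:{0..}|lebesgue. cnj (r x) * \<psi> x)"
proof -
  have \<psi>: "\<psi> square_integrable_on {..0}" "\<psi> square_integrable_on {0..}" using sq_int_subset(1)[OF assms(3)] by auto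
  have il: "integrable lebesgue (\<lambda>x. indicator {..0} x *\<^sub>R (cnj (l x) * \<psi> x))" and ir: "integrable lebesgue (\<lambda>x. indicator {0..} x *\<^sub>R (cnj (r x) * \<psi> x))"
    using cauchy_schwarz_integral(1)[OF sq_int_cnj[OF assms(1)] \<psi>(1)] cauchy_schwarz_integral(1)[OF sq_int_cnj[OF assms(2)] \<psi>(2)]
    by (auto simp: set_integrable_def)
  have i: "integrable lebesgue (\<lambda>x. cnj (glue l r x) * \<psi> x)"
    using cauchy_schwarz_integral(1)[OF sq_int_cnj[OF glue_sq_int[OF assms(1,2)]] assms(3)] by (simp add: set_integrable_def)
  have "(LINT x|lebesgue. cnj (glue l r x) * \<psi> x) = (LINT x|lebesgue. indicator {..0} x *\<^sub>R (cnj (l x) * \<psi> x) + indicator {0..} x *\<^sub>R (cnj (r x) * \<psi> x))"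
  proof (rule integral_cong_AE)
    show "(\<lambda>x. cnj (glue l r x) * \<psi> x) \<in> borel_measurable lebesgue" by (rule borel_measurable_integrable[OF i])
    show "(\<lambda>x. indicator {..0} x *\<^sub>R (cnj (l x) * \<psi> x) + indicator {0..} x *\<^sub>R (cnj (r x) * \<psi> x)) \<in> borel_measurable lebesgue"
      by (rule borel_measurable_integrable[OF Bochner_Integration.integrable_add[OF il ir]])
    show "AE x in lebesgue. cnj (glue l r x) * \<psi> x = indicator {..0} x *\<^sub>R (cnj (l x) * \<psi> x) + indicator {0..} x *\<^sub>R (cnj (r x) * \<psi> x)"
      using AE_nonzero by eventually_elim (auto simp: glue_def indicator_def)
  qed
  also have "\<dots> = (LINT x|lebesgue. indicator {..0} x *\<^sub>R (cnj (l x) * \<psi> x)) + (LINT x|lebesgue. indicator {0..} x *\<^sub>R (cnj (r x) * \<psi> x))"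
    by (rule Bochner_Integration.integral_add[OF il ir])
  finally show ?thesis by (simp add: set_lebesgue_integral_def)
qed

text \<open>The coupling is symmetric when the boundary terms of the two half-lines cancel. Adding the two Green
  formulas leaves \<open>Im z\<close> times the squared norm of \<open>F\<close>, and the Cauchy-Schwarz inequality concludes.\<close>

lemma boundary_operator_bound:
  assumes V: "V \<in> borel_measurable lebesgue" "\<And>x. \<bar>V x\<bar> \<le> M"
    and sym: "\<And>a a' b b'. B a a' b b' \<Longrightarrow> Im (cnj a * a') = Im (cnj b * b')"
    and FG: "(F, G) \<in> boundary_operator V B"
  shows "\<bar>Im z\<bar> * norm F \<le> norm (G - z *\<^sub>C F)"
proof -
  obtain l lp lq r rp rq where
     l: "W2 l lp lq" "l square_integrable_on {..0}" "lp square_integrable_on {..0}" "lq square_integrable_on {..0}" and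
     r: "W2 r rp rq" "r square_integrable_on {0..}" "rp square_integrable_on {0..}" "rq square_integrable_on {0..}" and
     B: "B (l 0) (lp 0) (r 0) (rp 0)" and
     F: "F = abs_l2 (glue l r)" and G: "G = abs_l2 (glue (\<lambda>x. - lq x + V x *\<^sub>R l x) (\<lambda>x. - rq x + V x *\<^sub>R r x))"
    using FG unfolding boundary_operator_def by blast
  define \<phi> where "\<phi> = glue l r"
  define \<gamma> where "\<gamma> = glue (\<lambda>x. - lq x + V x *\<^sub>R l x) (\<lambda>x. - rq x + V x *\<^sub>R r x)"
  define \<psi> where "\<psi> x = \<gamma> x - z * \<phi> x" for x
  have Vh: "(\<lambda>x. V x *\<^sub>R y x) square_integrable_on S" if "y square_integrable_on S" for y S
    using sq_int_mult_bounded[OF that, of "\<lambda>x. complex_of_real (V x)" M] V by (simp add: scaleR_conv_of_real)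
  have s: "\<phi> square_integrable_on UNIV" "\<gamma> square_integrable_on UNIV"
    unfolding \<phi>_def \<gamma>_def by (intro glue_sq_int l r sq_int_add sq_int_uminus Vh)+
  have \<psi>: "\<psi> square_integrable_on UNIV" unfolding \<psi>_def by (intro sq_int_diff sq_int_cmult s)
  have \<psi>': "\<psi> square_integrable_on {..0}" "\<psi> square_integrable_on {0..}" using sq_int_subset(1)[OF \<psi>] by auto
  have GF: "G - z *\<^sub>C F = abs_l2 \<psi>"
    unfolding F G \<phi>_def[symmetric] \<gamma>_def[symmetric] \<psi>_def
    using s square_integrable_mult[OF s(1), of z] by (simp add: scaleC_l2.abs_eq minus_l2.abs_eq)
  have 1: "Im (cnj (r 0) * rp 0) = Im (LINT x:{0..}|lebesgue. cnj (r x) * \<psi> x) + Im z * (l2norm {0..} r)\<^sup>2"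
    by (rule half_line_energy[OF r V _ \<psi>'(2)]) (simp add: \<psi>_def \<phi>_def \<gamma>_def glue_def scaleR_conv_of_real algebra_simps)
  have 2: "- Im (cnj (l 0) * lp 0) = Im (LINT x:{..0}|lebesgue. cnj (l x) * \<psi> x) + Im z * (l2norm {..0} l)\<^sup>2"
    by (rule half_line_energy_left[OF l V _ \<psi>'(1)]) (simp add: \<psi>_def \<phi>_def \<gamma>_def glue_def scaleR_conv_of_real algebra_simps)
  have "Im z * (l2norm UNIV \<phi>)\<^sup>2 = - Im (LINT x:UNIV|lebesgue. cnj (\<phi> x) * \<psi> x)"
    using 1 2 sym[OF B] unfolding \<phi>_def l2norm_square_glue[OF l(2) r(2)] set_integral_cnj_glue[OF l(2) r(2) \<psi>]
    by (simp add: algebra_simps)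
  then have "\<bar>Im z * (l2norm UNIV \<phi>)\<^sup>2\<bar> \<le> norm (LINT x:UNIV|lebesgue. cnj (\<phi> x) * \<psi> x)"
    using abs_Im_le_cmod[of "LINT x:UNIV|lebesgue. cnj (\<phi> x) * \<psi> x"] by simp
  also have "\<dots> \<le> l2norm UNIV (\<lambda>x. cnj (\<phi> x)) * l2norm UNIV \<psi>"
    by (rule cauchy_schwarz_integral(3)[OF sq_int_cnj[OF s(1)] \<psi>])
  also have "l2norm UNIV (\<lambda>x. cnj (\<phi> x)) = l2norm UNIV \<phi>" by (simp add: l2norm_def)
  finally have "l2norm UNIV \<phi> * (\<bar>Im z\<bar> * l2norm UNIV \<phi>) \<le> l2norm UNIV \<phi> * l2norm UNIV \<psi>"
    by (simp add: abs_mult power2_eq_square mult_ac)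
  then have "\<bar>Im z\<bar> * l2norm UNIV \<phi> \<le> l2norm UNIV \<psi>"
    using l2norm_nonneg[of UNIV \<phi>] l2norm_nonneg[of UNIV \<psi>] by (cases "l2norm UNIV \<phi> = 0") (auto simp: mult_le_cancel_left)
  then show ?thesis unfolding GF norm_abs_l2[OF \<psi>] unfolding F \<phi>_def[symmetric] norm_abs_l2[OF s(1)] .
qed

subsection \<open>Existence\<close>

lemma sq_int_eventually_eq:
  fixes p g :: "real \<Rightarrow> complex"
  assumes c: "continuous_on UNIV p" and g: "g square_integrable_on {0..}" and eq: "\<And>x. x \<ge> a \<Longrightarrow> p x = g x" and a: "a > 0"
  shows "p square_integrable_on {0..}"
proof -
  have "bounded (p ` {0..a})"
    by (intro compact_imp_bounded compact_continuous_image continuous_on_subset[OF c]) auto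
  then obtain B where "\<forall>x\<in>{0..a}. norm (p x) \<le> B" by (auto simp: bounded_iff simp del: atLeastAtMost_iff)
  then have 1: "p square_integrable_on {0..a}"
    using a by (intro sq_int_bounded_interval(1)[where B=B] continuous_lebesgue_measurable c) auto
  have 2: "g square_integrable_on {a<..}" by (rule sq_int_subset(1)[OF g]) (use a in auto)
  have "indicator {0..} x *\<^sub>R p x = indicator {0..a} x *\<^sub>R p x + indicator {a<..} x *\<^sub>R g x" for x
    using eq[of x] a by (auto simp: indicator_def)
  then show ?thesis
    unfolding sq_int_indicator[of p "{0..}"]
    using square_integrable_add 1 2 unfolding sq_int_indicator[of p "{0..a}"] sq_int_indicator[of g "{a<..}"] by simp
qed

text \<open>Decaying solutions for the perturbed equation are obtained from decaying solutions of the free one,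
  since the potential has compact support.\<close>

lemma right_solution:
  fixes V :: "real \<Rightarrow> real"
  assumes V: "V \<in> borel_measurable lebesgue" "\<And>x. \<bar>V x\<bar> \<le> M" "\<And>x. a \<le> \<bar>x\<bar> \<Longrightarrow> V x = 0" "a > 0"
    and g: "W2 g g1 (\<lambda>x. k * g x - f x)" "g square_integrable_on {0..}" "g1 square_integrable_on {0..}" "f square_integrable_on {0..}"
  shows "\<exists>p p1. W2 p p1 (\<lambda>x. (complex_of_real (V x) + k) * p x - f x) \<and> p square_integrable_on {0..} \<and> p1 square_integrable_on {0..}
     \<and> (\<lambda>x. (complex_of_real (V x) + k) * p x - f x) square_integrable_on {0..} \<and> (\<forall>x\<ge>a. p x = g x)"
proof -
  have m: "(\<lambda>x. complex_of_real (V x)) \<in> borel_measurable lebesgue" using V(1) by simp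
  obtain p p1 where p: "W2 p p1 (\<lambda>x. (complex_of_real (V x) + k) * p x - f x)" and pg: "\<And>x. x \<ge> a \<Longrightarrow> p x = g x \<and> p1 x = g1 x"
    using backward_correction[of "\<lambda>x. complex_of_real (V x)" M a g g1 k f] m V g(1) by auto
  have s: "p square_integrable_on {0..}" "p1 square_integrable_on {0..}"
    using sq_int_eventually_eq[OF W2D(4)[OF p] g(2) _ V(4)] sq_int_eventually_eq[OF W2D(5)[OF p] g(3) _ V(4)] pg by auto
  have "(\<lambda>x. (complex_of_real (V x) + k) * p x - f x) square_integrable_on {0..}"
  proof (intro sq_int_diff sq_int_mult_bounded[OF s(1)] g(4))
    show "(\<lambda>x. complex_of_real (V x) + k) \<in> borel_measurable lebesgue" using m by simp
    show "norm (complex_of_real (V x) + k) \<le> M + norm k" for x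
      using norm_triangle_ineq[of "complex_of_real (V x)" k] V(2)[of x] by simp
  qed
  then show ?thesis using p s pg by blast
qed

lemma left_solution:
  fixes V :: "real \<Rightarrow> real"
  assumes V: "V \<in> borel_measurable lebesgue" "\<And>x. \<bar>V x\<bar> \<le> M" "\<And>x. a \<le> \<bar>x\<bar> \<Longrightarrow> V x = 0" "a > 0"
    and g: "W2 g g1 (\<lambda>x. k * g x - f x)" "g square_integrable_on {..0}" "g1 square_integrable_on {..0}" "f square_integrable_on {..0}"
  shows "\<exists>p p1. W2 p p1 (\<lambda>x. (complex_of_real (V x) + k) * p x - f x) \<and> p square_integrable_on {..0} \<and> p1 square_integrable_on {..0}
     \<and> (\<lambda>x. (complex_of_real (V x) + k) * p x - f x) square_integrable_on {..0} \<and> (\<forall>x\<le>-a. p x = g x)"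
proof -
  have im: "uminus ` {..0} = {(0::real)..}" "uminus ` {0..} = {..(0::real)}" by auto
  have R: "(\<lambda>x. y (- x)) square_integrable_on {0..}" if "y square_integrable_on {..0}" for y
    using sq_int_reflect(1)[OF that] unfolding im .
  have L: "(\<lambda>x. y (- x)) square_integrable_on {..0}" if "y square_integrable_on {0..}" for y
    using sq_int_reflect(1)[OF that] unfolding im .
  have Vm: "(\<lambda>x. V (- x)) \<in> borel_measurable lebesgue" using borel_measurable_affine[OF V(1), of "-1" 0] by simp
  have g': "W2 (\<lambda>x. g (- x)) (\<lambda>x. - g1 (- x)) (\<lambda>x. k * g (- x) - f (- x))" using W2_affine[OF g(1), of "-1" 0] by simp
  obtain p p1 where p: "W2 p p1 (\<lambda>x. (complex_of_real (V (- x)) + k) * p x - f (- x))" "p square_integrable_on {0..}" "p1 square_integrable_on {0..}"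
      "(\<lambda>x. (complex_of_real (V (- x)) + k) * p x - f (- x)) square_integrable_on {0..}" "\<And>x. x \<ge> a \<Longrightarrow> p x = g (- x)"
    using right_solution[OF Vm _ _ V(4) g' R[OF g(2)] sq_int_uminus[OF R[OF g(3)]] R[OF g(4)], of M] V(2,3) by auto
  have "W2 (\<lambda>x. p (- x)) (\<lambda>x. - p1 (- x)) (\<lambda>x. (complex_of_real (V x) + k) * p (- x) - f x)"
    using W2_affine[OF p(1), of "-1" 0] by simp
  moreover have "p (- x) = g x" if "x \<le> -a" for x using p(5)[of "-x"] that by simp
  ultimately show ?thesis using L[OF p(2)] sq_int_uminus[OF L[OF p(3)]] L[OF p(4)]
    by (intro exI[of _ "\<lambda>x. p (- x)"] exI[of _ "\<lambda>x. - p1 (- x)"]) auto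
qed

lemma glue_arith:
  "glue (\<lambda>x. l x + l' x) (\<lambda>x. r x + r' x) = (\<lambda>x. glue l r x + glue l' r' x)"
  "glue (\<lambda>x. c *\<^sub>R l x) (\<lambda>x. c *\<^sub>R r x) = (\<lambda>x. c *\<^sub>R glue l r x)"
  by (auto simp: glue_def fun_eq_iff)

text \<open>Two homogeneous linear conditions match the two parameters that the resolvent equation leaves free on
  the two half-lines, so that uniqueness implies solvability.\<close>

definition linear_bc :: "(complex \<Rightarrow> complex \<Rightarrow> complex \<Rightarrow> complex \<Rightarrow> bool) \<Rightarrow> bool" where
  "linear_bc B \<longleftrightarrow> (\<exists>m1 m2 m3 m4 n1 n2 n3 n4. \<forall>a a' b b'. B a a' b b' \<longleftrightarrow>
     m1 * a + m2 * a' + m3 * b + m4 * b' = 0 \<and> n1 * a + n2 * a' + n3 * b + n4 * b' = 0)"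

text \<open>The Fredholm alternative for a \<open>2 \<times> 2\<close> system.\<close>

lemma two_by_two:
  fixes A1 A2 B1 B2 C1 C2 :: complex
  shows "(\<exists>x y. A1 * x + B1 * y = C1 \<and> A2 * x + B2 * y = C2) \<or>
    (\<exists>x y. (x \<noteq> 0 \<or> y \<noteq> 0) \<and> A1 * x + B1 * y = 0 \<and> A2 * x + B2 * y = 0)"
proof (cases "A1 * B2 - A2 * B1 = 0")
  case False
  define D where "D = A1 * B2 - A2 * B1"
  have D: "D \<noteq> 0" using False by (simp add: D_def)
  have "A1 * (C1 * B2 - C2 * B1) + B1 * (A1 * C2 - A2 * C1) = C1 * D" "A2 * (C1 * B2 - C2 * B1) + B2 * (A1 * C2 - A2 * C1) = C2 * D"
    by (simp_all add: D_def algebra_simps)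
  then have "A1 * ((C1 * B2 - C2 * B1) / D) + B1 * ((A1 * C2 - A2 * C1) / D) = C1"
     "A2 * ((C1 * B2 - C2 * B1) / D) + B2 * ((A1 * C2 - A2 * C1) / D) = C2"
    using D by (simp_all add: times_divide_eq_right flip: add_divide_distrib)
  then show ?thesis by blast
next
  case True
  show ?thesis
  proof (cases "A1 = 0 \<and> B1 = 0")
    case False
    have "(B1 \<noteq> 0 \<or> - A1 \<noteq> 0) \<and> A1 * B1 + B1 * (- A1) = 0 \<and> A2 * B1 + B2 * (- A1) = 0"
      using False True by (auto simp: algebra_simps)
    then show ?thesis by blast
  next
    case zero: True
    show ?thesis
    proof (cases "A2 = 0 \<and> B2 = 0")
      case False
      have "(B2 \<noteq> 0 \<or> - A2 \<noteq> 0) \<and> A1 * B2 + B1 * (- A2) = 0 \<and> A2 * B2 + B2 * (- A2) = 0"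
        using False zero by (auto simp: algebra_simps)
      then show ?thesis by blast
    next
      case True
      have "(1 \<noteq> (0::complex) \<or> (1::complex) \<noteq> 0) \<and> A1 * 1 + B1 * 1 = 0 \<and> A2 * 1 + B2 * 1 = 0"
        using True zero by auto
      then show ?thesis by blast
    qed
  qed
qed

lemma csqrt_neg_nonreal:
  assumes "Im z \<noteq> 0"
  shows "Re (csqrt (- z)) > 0" "(csqrt (- z))\<^sup>2 = - z" "Im (csqrt (- z)) \<noteq> 0"
proof -
  show sq: "(csqrt (- z))\<^sup>2 = - z" by simp
  have "Im ((csqrt (- z))\<^sup>2) = 2 * Re (csqrt (- z)) * Im (csqrt (- z))" by (simp add: power2_eq_square)
  then have ne: "Re (csqrt (- z)) * Im (csqrt (- z)) \<noteq> 0" using assms unfolding sq by auto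
  then show "Im (csqrt (- z)) \<noteq> 0" by auto
  show "Re (csqrt (- z)) > 0" using ne csqrt_principal[of "- z"] by auto
qed

lemma linear_bc_closed:
  assumes "linear_bc B"
  shows "B a a' b b' \<Longrightarrow> B c c' d d' \<Longrightarrow> B (a + c) (a' + c') (b + d) (b' + d')"
    "B a a' b b' \<Longrightarrow> B (s * a) (s * a') (s * b) (s * b')"
proof -
  obtain m1 m2 m3 m4 n1 n2 n3 n4 where B: "\<And>a a' b b'. B a a' b b' \<longleftrightarrow>
     m1 * a + m2 * a' + m3 * b + m4 * b' = 0 \<and> n1 * a + n2 * a' + n3 * b + n4 * b' = 0"
    using assms unfolding linear_bc_def by blast
  show "B (a + c) (a' + c') (b + d) (b' + d')" if x: "B a a' b b'" "B c c' d d'"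
  proof -
    have "m1 * (a + c) + m2 * (a' + c') + m3 * (b + d) + m4 * (b' + d') = (m1 * a + m2 * a' + m3 * b + m4 * b') + (m1 * c + m2 * c' + m3 * d + m4 * d')"
      "n1 * (a + c) + n2 * (a' + c') + n3 * (b + d) + n4 * (b' + d') = (n1 * a + n2 * a' + n3 * b + n4 * b') + (n1 * c + n2 * c' + n3 * d + n4 * d')"
      by (simp_all add: algebra_simps)
    then show ?thesis using x unfolding B by simp
  qed
  show "B (s * a) (s * a') (s * b) (s * b')" if x: "B a a' b b'"
  proof -
    have "m1 * (s * a) + m2 * (s * a') + m3 * (s * b) + m4 * (s * b') = s * (m1 * a + m2 * a' + m3 * b + m4 * b')"
      "n1 * (s * a) + n2 * (s * a') + n3 * (s * b) + n4 * (s * b') = s * (n1 * a + n2 * a' + n3 * b + n4 * b')"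
      by (simp_all add: algebra_simps)
    then show ?thesis using x unfolding B by simp
  qed
qed

lemma abs_l2_add:
  "f square_integrable_on UNIV \<Longrightarrow> g square_integrable_on UNIV \<Longrightarrow> abs_l2 f + abs_l2 g = abs_l2 (\<lambda>x. f x + g x)"
  by (rule plus_l2.abs_eq) auto

lemma abs_l2_scaleR:
  "f square_integrable_on UNIV \<Longrightarrow> c *\<^sub>R abs_l2 f = abs_l2 (\<lambda>x. c *\<^sub>R f x)"
  by (rule scaleR_l2.abs_eq) auto

lemma boundary_operatorI:
  assumes "W2 l lp lq" "l square_integrable_on {..0}" "lp square_integrable_on {..0}" "lq square_integrable_on {..0}"
    "W2 r rp rq" "r square_integrable_on {0..}" "rp square_integrable_on {0..}" "rq square_integrable_on {0..}"
    "B (l 0) (lp 0) (r 0) (rp 0)"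
  shows "(abs_l2 (glue l r), abs_l2 (glue (\<lambda>x. - lq x + V x *\<^sub>R l x) (\<lambda>x. - rq x + V x *\<^sub>R r x))) \<in> boundary_operator V B"
  unfolding boundary_operator_def mem_Collect_eq prod.case
  by (rule exI[of _ l], rule exI[of _ lp], rule exI[of _ lq], rule exI[of _ r], rule exI[of _ rp], rule exI[of _ rq])
     (intro conjI refl assms)

lemma boundary_operatorE:
  assumes "(F, G) \<in> boundary_operator V B"
  obtains l lp lq r rp rq where
    "W2 l lp lq" "l square_integrable_on {..0}" "lp square_integrable_on {..0}" "lq square_integrable_on {..0}"
    "W2 r rp rq" "r square_integrable_on {0..}" "rp square_integrable_on {0..}" "rq square_integrable_on {0..}"
    "B (l 0) (lp 0) (r 0) (rp 0)" "F = abs_l2 (glue l r)"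
    "G = abs_l2 (glue (\<lambda>x. - lq x + V x *\<^sub>R l x) (\<lambda>x. - rq x + V x *\<^sub>R r x))"
  using assms unfolding boundary_operator_def by blast

text \<open>On each half-line the square integrable solutions of the inhomogeneous equation form a particular
  solution plus multiples of one decaying solution (\<open>ur\<close>, \<open>ul\<close>). The two coupling conditions are a
  linear system for the two multiples. A nontrivial solution of the homogeneous system would be an
  eigenfunction for the non-real number \<open>z\<close>, contradicting \<open>boundary_operator_bound\<close>.\<close>

lemma boundary_operator_resolvent:
  assumes V: "V \<in> borel_measurable lebesgue" "\<And>x. \<bar>V x\<bar> \<le> M" "\<And>x. a \<le> \<bar>x\<bar> \<Longrightarrow> V x = 0" "a > 0"
    and lin: "linear_bc B"
    and sym: "\<And>a a' b b'. B a a' b b' \<Longrightarrow> Im (cnj a * a') = Im (cnj b * b')"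
    and z: "Im z \<noteq> 0"
  shows "\<exists>R. is_resolvent (boundary_operator V B) z R"
proof (rule is_resolventI[where m="\<bar>Im z\<bar>"])
  have Vh: "(\<lambda>x. V x *\<^sub>R y x) square_integrable_on S" if "y square_integrable_on S" for y S
    using sq_int_mult_bounded[OF that, of "\<lambda>x. complex_of_real (V x)" M] V by (simp add: scaleR_conv_of_real)
  note bound = boundary_operator_bound[OF V(1,2) sym]
  show "\<bar>Im z\<bar> * norm F \<le> norm (G - z *\<^sub>C F)" if "(F, G) \<in> boundary_operator V B" for F G
    using bound[OF _ that] .
  show "0 < \<bar>Im z\<bar>" using z by simp
  show "(F + F', G + G') \<in> boundary_operator V B" if FG: "(F, G) \<in> boundary_operator V B" and FG': "(F', G') \<in> boundary_operator V B" for F G F' G'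
  proof -
    obtain l lp lq r rp rq where 1:
      "W2 l lp lq" "l square_integrable_on {..0}" "lp square_integrable_on {..0}" "lq square_integrable_on {..0}"
      "W2 r rp rq" "r square_integrable_on {0..}" "rp square_integrable_on {0..}" "rq square_integrable_on {0..}"
      "B (l 0) (lp 0) (r 0) (rp 0)" and F: "F = abs_l2 (glue l r)" and G: "G = abs_l2 (glue (\<lambda>x. - lq x + V x *\<^sub>R l x) (\<lambda>x. - rq x + V x *\<^sub>R r x))"
      by (rule boundary_operatorE[OF FG])
    obtain l' lp' lq' r' rp' rq' where 2:
      "W2 l' lp' lq'" "l' square_integrable_on {..0}" "lp' square_integrable_on {..0}" "lq' square_integrable_on {..0}"
      "W2 r' rp' rq'" "r' square_integrable_on {0..}" "rp' square_integrable_on {0..}" "rq' square_integrable_on {0..}"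
      "B (l' 0) (lp' 0) (r' 0) (rp' 0)" and F': "F' = abs_l2 (glue l' r')" and G': "G' = abs_l2 (glue (\<lambda>x. - lq' x + V x *\<^sub>R l' x) (\<lambda>x. - rq' x + V x *\<^sub>R r' x))"
      by (rule boundary_operatorE[OF FG'])
    have m: "(abs_l2 (glue (\<lambda>x. l x + l' x) (\<lambda>x. r x + r' x)),
       abs_l2 (glue (\<lambda>x. - (lq x + lq' x) + V x *\<^sub>R (l x + l' x)) (\<lambda>x. - (rq x + rq' x) + V x *\<^sub>R (r x + r' x)))) \<in> boundary_operator V B"
      by (intro boundary_operatorI[where lp="\<lambda>x. lp x + lp' x" and rp="\<lambda>x. rp x + rp' x"] W2_add[OF 1(1) 2(1)] W2_add[OF 1(5) 2(5)] sq_int_add 1 2 linear_bc_closed(1)[OF lin])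
    have e: "glue (\<lambda>x. - (lq x + lq' x) + V x *\<^sub>R (l x + l' x)) (\<lambda>x. - (rq x + rq' x) + V x *\<^sub>R (r x + r' x))
      = (\<lambda>x. glue (\<lambda>x. - lq x + V x *\<^sub>R l x) (\<lambda>x. - rq x + V x *\<^sub>R r x) x + glue (\<lambda>x. - lq' x + V x *\<^sub>R l' x) (\<lambda>x. - rq' x + V x *\<^sub>R r' x) x)"
      by (auto simp: glue_def fun_eq_iff algebra_simps)
    have s: "glue (\<lambda>x. - lq x + V x *\<^sub>R l x) (\<lambda>x. - rq x + V x *\<^sub>R r x) square_integrable_on UNIV"
      "glue (\<lambda>x. - lq' x + V x *\<^sub>R l' x) (\<lambda>x. - rq' x + V x *\<^sub>R r' x) square_integrable_on UNIV"
      by (intro glue_sq_int sq_int_add sq_int_uminus Vh 1 2)+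
    show ?thesis
      unfolding F G F' G' abs_l2_add[OF glue_sq_int[OF 1(2,6)] glue_sq_int[OF 2(2,6)]] abs_l2_add[OF s]
      using m unfolding e glue_arith(1)[of l l' r r'] .
  qed
  show "(c *\<^sub>R F, c *\<^sub>R G) \<in> boundary_operator V B" if FG: "(F, G) \<in> boundary_operator V B" for F G and c :: real
  proof -
    obtain l lp lq r rp rq where 1:
      "W2 l lp lq" "l square_integrable_on {..0}" "lp square_integrable_on {..0}" "lq square_integrable_on {..0}"
      "W2 r rp rq" "r square_integrable_on {0..}" "rp square_integrable_on {0..}" "rq square_integrable_on {0..}"
      "B (l 0) (lp 0) (r 0) (rp 0)" and F: "F = abs_l2 (glue l r)" and G: "G = abs_l2 (glue (\<lambda>x. - lq x + V x *\<^sub>R l x) (\<lambda>x. - rq x + V x *\<^sub>R r x))"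
      by (rule boundary_operatorE[OF FG])
    have m: "(abs_l2 (glue (\<lambda>x. of_real c * l x) (\<lambda>x. of_real c * r x)),
       abs_l2 (glue (\<lambda>x. - (of_real c * lq x) + V x *\<^sub>R (of_real c * l x)) (\<lambda>x. - (of_real c * rq x) + V x *\<^sub>R (of_real c * r x)))) \<in> boundary_operator V B"
      by (intro boundary_operatorI[where lp="\<lambda>x. of_real c * lp x" and rp="\<lambda>x. of_real c * rp x"] W2_cmult[OF 1(1)] W2_cmult[OF 1(5)] sq_int_cmult 1 linear_bc_closed(2)[OF lin])
    have e: "glue (\<lambda>x. - (of_real c * lq x) + V x *\<^sub>R (of_real c * l x)) (\<lambda>x. - (of_real c * rq x) + V x *\<^sub>R (of_real c * r x))
      = (\<lambda>x. c *\<^sub>R glue (\<lambda>x. - lq x + V x *\<^sub>R l x) (\<lambda>x. - rq x + V x *\<^sub>R r x) x)"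
      "glue (\<lambda>x. of_real c * l x) (\<lambda>x. of_real c * r x) = (\<lambda>x. c *\<^sub>R glue l r x)"
      by (auto simp: glue_def fun_eq_iff algebra_simps scaleR_conv_of_real)
    have s: "glue (\<lambda>x. - lq x + V x *\<^sub>R l x) (\<lambda>x. - rq x + V x *\<^sub>R r x) square_integrable_on UNIV"
      by (intro glue_sq_int sq_int_add sq_int_uminus Vh 1)
    show ?thesis
      unfolding F G abs_l2_scaleR[OF glue_sq_int[OF 1(2,6)]] abs_l2_scaleR[OF s]
      using m unfolding e .
  qed
  fix F0 :: l2
  obtain f where f: "f square_integrable_on UNIV" and F0: "F0 = abs_l2 f" by (rule l2_rep)
  define k where "k = csqrt (- z)"
  have k: "Re k > 0" "k\<^sup>2 = - z" using csqrt_neg_nonreal[OF z] by (auto simp: k_def)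
  obtain g0 g1 where g0: "W2 g0 g1 (\<lambda>x. k\<^sup>2 * g0 x - f x)" "g0 square_integrable_on UNIV" "g1 square_integrable_on UNIV"
    using free_resolvent[OF f k(1)] z k(2) by auto
  have sub: "y square_integrable_on {..0}" "y square_integrable_on {0..}" if "y square_integrable_on UNIV" for y
    using sq_int_subset(1)[OF that] by auto
  have er: "W2 (\<lambda>x. exp (- (k * complex_of_real x))) (\<lambda>x. - k * exp (- (k * complex_of_real x))) (\<lambda>x. k\<^sup>2 * exp (- (k * complex_of_real x)) - 0)"
    using W2_exp[of "-k"] by simp
  have er_sq: "(\<lambda>x. exp (- (k * complex_of_real x))) square_integrable_on {0..}" by (rule exp_sq_int(1)[OF k(1)])
  have el: "W2 (\<lambda>x. exp (k * complex_of_real x)) (\<lambda>x. k * exp (k * complex_of_real x)) (\<lambda>x. k\<^sup>2 * exp (k * complex_of_real x) - 0)"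
    using W2_exp[of k] by simp
  have im: "uminus ` {0..} = {..(0::real)}" by auto
  have el_sq: "(\<lambda>x. exp (k * complex_of_real x)) square_integrable_on {..0}"
    using sq_int_reflect(1)[OF er_sq] unfolding im by simp
  have zero: "(\<lambda>x. 0::complex) square_integrable_on S" for S
    by (simp add: square_integrable_on_def set_borel_measurable_def set_integrable_def)
  define Q where "Q p y x = (complex_of_real (V x) + k\<^sup>2) * p x - y x" for p y :: "real \<Rightarrow> complex" and x
  obtain pr pr1 where pr: "W2 pr pr1 (Q pr f)" "pr square_integrable_on {0..}" "pr1 square_integrable_on {0..}" "Q pr f square_integrable_on {0..}"
    using right_solution[OF V g0(1) sub(2)[OF g0(2)] sub(2)[OF g0(3)] sub(2)[OF f]] unfolding Q_def[abs_def] by blast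
  obtain pl pl1 where pl: "W2 pl pl1 (Q pl f)" "pl square_integrable_on {..0}" "pl1 square_integrable_on {..0}" "Q pl f square_integrable_on {..0}"
    using left_solution[OF V g0(1) sub(1)[OF g0(2)] sub(1)[OF g0(3)] sub(1)[OF f]] unfolding Q_def[abs_def] by blast
  obtain ur ur1 where ur: "W2 ur ur1 (Q ur (\<lambda>x. 0))" "ur square_integrable_on {0..}" "ur1 square_integrable_on {0..}" "Q ur (\<lambda>x. 0) square_integrable_on {0..}"
     and ur_exp: "\<And>x. x \<ge> a \<Longrightarrow> ur x = exp (- (k * complex_of_real x))"
    using right_solution[OF V er er_sq sq_int_cmult[OF er_sq] zero] unfolding Q_def[abs_def] by blast
  obtain ul ul1 where ul: "W2 ul ul1 (Q ul (\<lambda>x. 0))" "ul square_integrable_on {..0}" "ul1 square_integrable_on {..0}" "Q ul (\<lambda>x. 0) square_integrable_on {..0}"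
     and ul_exp: "\<And>x. x \<le> -a \<Longrightarrow> ul x = exp (k * complex_of_real x)"
    using left_solution[OF V el el_sq sq_int_cmult[OF el_sq] zero] unfolding Q_def[abs_def] by blast
  have member: "\<exists>G. (abs_l2 (glue l r), G) \<in> boundary_operator V B \<and> G - z *\<^sub>C abs_l2 (glue l r) = abs_l2 y"
    if "W2 l lp (Q l y)" "l square_integrable_on {..0}" "lp square_integrable_on {..0}" "Q l y square_integrable_on {..0}"
      "W2 r rp (Q r y)" "r square_integrable_on {0..}" "rp square_integrable_on {0..}" "Q r y square_integrable_on {0..}"
      "B (l 0) (lp 0) (r 0) (rp 0)" and y: "y square_integrable_on UNIV" for l lp r rp y
  proof -
    define G where "G = glue (\<lambda>x. - Q l y x + V x *\<^sub>R l x) (\<lambda>x. - Q r y x + V x *\<^sub>R r x)"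
    have 1: "(abs_l2 (glue l r), abs_l2 G) \<in> boundary_operator V B"
      unfolding G_def by (rule boundary_operatorI[where B=B, OF that(1-9)])
    have s: "G square_integrable_on UNIV" "glue l r square_integrable_on UNIV"
      unfolding G_def by (intro glue_sq_int sq_int_add sq_int_uminus Vh that)+
    have s2: "(\<lambda>x. G x - z * glue l r x) square_integrable_on UNIV" by (intro sq_int_diff sq_int_cmult s)
    have "abs_l2 G - z *\<^sub>C abs_l2 (glue l r) = abs_l2 (\<lambda>x. G x - z * glue l r x)"
      using s square_integrable_mult[OF s(2), of z] by (simp add: scaleC_l2.abs_eq minus_l2.abs_eq)
    also have "\<dots> = abs_l2 y"
    proof -
      have "AE x in lebesgue. G x - z * glue l r x = y x"
        using AE_nonzero by eventually_elim (auto simp: G_def glue_def Q_def k(2) scaleR_conv_of_real algebra_simps)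
      then show ?thesis using abs_l2_eq_iff[OF s2 y] by simp
    qed
    finally show ?thesis using 1 by blast
  qed
  obtain m1 m2 m3 m4 n1 n2 n3 n4 where Beq: "\<And>a a' b b'. B a a' b b' \<longleftrightarrow>
     m1 * a + m2 * a' + m3 * b + m4 * b' = 0 \<and> n1 * a + n2 * a' + n3 * b + n4 * b' = 0"
    using lin unfolding linear_bc_def by blast
  define A1 where "A1 = m1 * ul 0 + m2 * ul1 0"
  define B1 where "B1 = m3 * ur 0 + m4 * ur1 0"
  define A2 where "A2 = n1 * ul 0 + n2 * ul1 0"
  define B2 where "B2 = n3 * ur 0 + n4 * ur1 0"
  define C1 where "C1 = - (m1 * pl 0 + m2 * pl1 0 + m3 * pr 0 + m4 * pr1 0)"
  define C2 where "C2 = - (n1 * pl 0 + n2 * pl1 0 + n3 * pr 0 + n4 * pr1 0)"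
  have Qadd: "Q (\<lambda>x. p x + c * u x) y = (\<lambda>x. Q p y x + c * Q u (\<lambda>x. 0) x)" "Q (\<lambda>x. c * u x) (\<lambda>x. 0) = (\<lambda>x. c * Q u (\<lambda>x. 0) x)" for p u y c
    by (auto simp: Q_def fun_eq_iff algebra_simps)
  have "\<not> (\<exists>x y. (x \<noteq> 0 \<or> y \<noteq> 0) \<and> A1 * x + B1 * y = 0 \<and> A2 * x + B2 * y = 0)"
  proof
    assume "\<exists>x y. (x \<noteq> 0 \<or> y \<noteq> 0) \<and> A1 * x + B1 * y = 0 \<and> A2 * x + B2 * y = 0"
    then obtain x y where xy: "x \<noteq> 0 \<or> y \<noteq> 0" "A1 * x + B1 * y = 0" "A2 * x + B2 * y = 0" by blast
    define l where "l t = x * ul t" for t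
    define r where "r t = y * ur t" for t
    have l: "W2 l (\<lambda>t. x * ul1 t) (Q l (\<lambda>x. 0))" "l square_integrable_on {..0}" "(\<lambda>t. x * ul1 t) square_integrable_on {..0}" "Q l (\<lambda>x. 0) square_integrable_on {..0}"
      unfolding l_def[abs_def] Qadd(2) by (intro W2_cmult sq_int_cmult ul)+
    have r: "W2 r (\<lambda>t. y * ur1 t) (Q r (\<lambda>x. 0))" "r square_integrable_on {0..}" "(\<lambda>t. y * ur1 t) square_integrable_on {0..}" "Q r (\<lambda>x. 0) square_integrable_on {0..}"
      unfolding r_def[abs_def] Qadd(2) by (intro W2_cmult sq_int_cmult ur)+
    have "m1 * l 0 + m2 * (x * ul1 0) + m3 * r 0 + m4 * (y * ur1 0) = A1 * x + B1 * y"
      "n1 * l 0 + n2 * (x * ul1 0) + n3 * r 0 + n4 * (y * ur1 0) = A2 * x + B2 * y"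
      by (simp_all add: l_def r_def A1_def A2_def B1_def B2_def algebra_simps)
    then have Bz: "B (l 0) (x * ul1 0) (r 0) (y * ur1 0)" unfolding Beq using xy by simp
    obtain G where G: "(abs_l2 (glue l r), G) \<in> boundary_operator V B" "G - z *\<^sub>C abs_l2 (glue l r) = abs_l2 (\<lambda>x. 0)"
      using member[OF l r Bz zero] by blast
    have "\<bar>Im z\<bar> * norm (abs_l2 (glue l r)) \<le> norm (G - z *\<^sub>C abs_l2 (glue l r))" by (rule bound[OF _ G(1)])
    also have "\<dots> = 0" unfolding G(2) zero_l2.abs_eq[symmetric] by simp
    finally have "norm (abs_l2 (glue l r)) = 0" using z by (simp add: mult_le_0_iff)
    then have "abs_l2 (glue l r) = abs_l2 (\<lambda>x. 0)" unfolding zero_l2.abs_eq[symmetric] by simp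
    then have ae: "AE t in lebesgue. glue l r t = 0"
      using abs_l2_eq_iff[OF glue_sq_int[OF l(2) r(2)] zero] by simp
    have rz: "AE t in lebesgue. t \<in> {0<..} \<longrightarrow> r t = 0" using ae by eventually_elim (auto simp: glue_def)
    have lz: "AE t in lebesgue. t \<in> {..<0} \<longrightarrow> l t = 0" using ae by eventually_elim (auto simp: glue_def)
    have "r a = 0"
      by (rule continuous_AE_eq[OF open_half_lines(3) W2D(4)[OF r(1)] continuous_on_const rz]) (use V(4) in simp)
    moreover have "l (- a) = 0"
      by (rule continuous_AE_eq[OF open_half_lines(1) W2D(4)[OF l(1)] continuous_on_const lz]) (use V(4) in simp)
    ultimately show False using xy(1) ur_exp[of a] ul_exp[of "-a"] by (auto simp: r_def l_def)
  qed
  then obtain x y where xy: "A1 * x + B1 * y = C1" "A2 * x + B2 * y = C2"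
    using two_by_two[of A1 B1 C1 A2 B2 C2] by blast
  define l where "l t = pl t + x * ul t" for t
  define r where "r t = pr t + y * ur t" for t
  have l: "W2 l (\<lambda>t. pl1 t + x * ul1 t) (Q l f)" "l square_integrable_on {..0}" "(\<lambda>t. pl1 t + x * ul1 t) square_integrable_on {..0}" "Q l f square_integrable_on {..0}"
    unfolding l_def[abs_def] Qadd(1) by (intro W2_add W2_cmult sq_int_add sq_int_cmult ul pl)+
  have r: "W2 r (\<lambda>t. pr1 t + y * ur1 t) (Q r f)" "r square_integrable_on {0..}" "(\<lambda>t. pr1 t + y * ur1 t) square_integrable_on {0..}" "Q r f square_integrable_on {0..}"
    unfolding r_def[abs_def] Qadd(1) by (intro W2_add W2_cmult sq_int_add sq_int_cmult ur pr)+
  have "m1 * l 0 + m2 * (pl1 0 + x * ul1 0) + m3 * r 0 + m4 * (pr1 0 + y * ur1 0) = (A1 * x + B1 * y) - C1"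
    "n1 * l 0 + n2 * (pl1 0 + x * ul1 0) + n3 * r 0 + n4 * (pr1 0 + y * ur1 0) = (A2 * x + B2 * y) - C2"
    by (simp_all add: l_def r_def A1_def A2_def B1_def B2_def C1_def C2_def algebra_simps)
  then have "B (l 0) (pl1 0 + x * ul1 0) (r 0) (pr1 0 + y * ur1 0)" unfolding Beq using xy by simp
  from member[OF l r this f] show "\<exists>F G. (F, G) \<in> boundary_operator V B \<and> G - z *\<^sub>C F = F0"
    unfolding F0 by blast
qed

section \<open>Estimates for a short interval\<close>

lemma norm_integral_mult_le:
  fixes r K :: "real \<Rightarrow> complex"
  assumes r: "r absolutely_integrable_on {x..y}" and K: "continuous_on UNIV K" "\<And>s. s \<in> {x..y} \<Longrightarrow> norm (K s) \<le> B"
  shows "norm (integral {x..y} (\<lambda>s. r s * K s)) \<le> B * integral {x..y} (\<lambda>s. norm (r s))"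
proof -
  have i: "(\<lambda>s. K s * r s) absolutely_integrable_on {x..y}" by (rule set_integrable_mult_continuous[OF K(1) r])
  have n: "(\<lambda>s. norm (r s)) integrable_on {x..y}" using r by (simp add: absolutely_integrable_on_def)
  have "norm (integral {x..y} (\<lambda>s. K s * r s)) \<le> integral {x..y} (\<lambda>s. B * norm (r s))"
  proof (rule Henstock_Kurzweil_Integration.integral_norm_bound_integral)
    show "(\<lambda>s. K s * r s) integrable_on {x..y}" by (rule set_lebesgue_integral_eq_integral(1)[OF i])
    show "(\<lambda>s. B * norm (r s)) integrable_on {x..y}" by (rule integrable_on_mult_right[OF n])
    show "norm (K s * r s) \<le> B * norm (r s)" if "s \<in> {x..y}" for s
      unfolding norm_mult by (rule mult_right_mono[OF K(2)[OF that]]) simp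
  qed
  then show ?thesis by (simp add: mult.commute)
qed

lemma integral_norm_mono_interval:
  fixes r :: "real \<Rightarrow> complex"
  assumes "r absolutely_integrable_on {a..b}" "{x..y} \<subseteq> {a..b}"
  shows "r absolutely_integrable_on {x..y}" "integral {x..y} (\<lambda>s. norm (r s)) \<le> integral {a..b} (\<lambda>s. norm (r s))"
proof -
  show i: "r absolutely_integrable_on {x..y}" by (rule set_integrable_subset[OF assms(1) _ assms(2)]) simp
  show "integral {x..y} (\<lambda>s. norm (r s)) \<le> integral {a..b} (\<lambda>s. norm (r s))"
    using i assms by (intro integral_subset_le) (auto simp: absolutely_integrable_on_def)
qed

text \<open>The potential cancels between \<open>h\<close> and a zero-energy solution, so only the remainder \<open>r\<close> is integrated.
  This is what makes estimates uniform in \<open>\<epsilon>\<close>, although \<open>p\<close> is of order \<open>\<epsilon>\<^sup>-\<^sup>2\<close>.\<close>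

lemma lagrange_zero_energy:
  assumes h: "W2 h h1 (\<lambda>x. p x * h x + r x)" and U: "W2 U U1 (\<lambda>x. p x * U x)" and xy: "x \<le> y"
  shows "(h1 y * U y - h y * U1 y) - (h1 x * U x - h x * U1 x) = integral {x..y} (\<lambda>s. r s * U s)"
proof -
  have "primitive (\<lambda>x. h1 x * U x - h x * U1 x) (\<lambda>x. (p x * h x + r x) * U x - h x * (p x * U x))"
    by (rule lagrange_identity[OF h U])
  moreover have "(p x * h x + r x) * U x - h x * (p x * U x) = r x * U x" for x by (simp add: algebra_simps)
  ultimately have "primitive (\<lambda>x. h1 x * U x - h x * U1 x) (\<lambda>x. r x * U x)" by (simp only:)
  from primitiveD(3)[OF this xy] show ?thesis by simp
qed

lemma wronskian_const:
  assumes U: "W2 U U1 (\<lambda>x. p x * U x)" and P: "W2 P P1 (\<lambda>x. p x * P x)"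
  shows "U x * P1 x - U1 x * P x = U y * P1 y - U1 y * P y"
proof -
  have *: "U x * P1 x - U1 x * P x = U y * P1 y - U1 y * P y" if "x \<le> y" for x y
    using lagrange_zero_energy[of P P1 p "\<lambda>x. 0" U U1 x y] P U that by (simp add: algebra_simps)
  show ?thesis
  proof (cases "x \<le> y")
    case True then show ?thesis by (rule *)
  next
    case False then have "y \<le> x" by simp
    then show ?thesis by (rule *[symmetric])
  qed
qed

text \<open>Variation of constants, with \<open>U\<close> constant to the right of \<open>a\<close> and \<open>P\<close> constant to the left of
  \<open>-a\<close>. Such a pair picks out the derivatives \<open>h'(a)\<close> and \<open>h'(-a)\<close> and makes \<open>h\<close> small when the Wronskian
  \<open>U'(-a)\<close> is large. In the products \<open>P x * U y\<close> with \<open>x \<le> y\<close> the growth of the two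
  solutions is never met at the same time.\<close>

lemma interior_bound_nonresonant:
  assumes h: "W2 h h1 (\<lambda>x. p x * h x + r x)" and U: "W2 U U1 (\<lambda>x. p x * U x)" and P: "W2 P P1 (\<lambda>x. p x * P x)"
    and bU: "U a = 1" "U1 a = 0" and bP: "P (- a) = 1" "P1 (- a) = 0"
    and r: "r absolutely_integrable_on {-a..a}" "integral {-a..a} (\<lambda>s. norm (r s)) \<le> E"
    and L: "\<And>x y. - a \<le> x \<Longrightarrow> x \<le> y \<Longrightarrow> y \<le> a \<Longrightarrow> norm (P x * U y) \<le> L"
    and x: "- a \<le> x" "x \<le> a"
  shows "norm (h x) * norm (U1 (- a)) \<le> L * (norm (h1 a) + norm (h1 (- a)) + E)"
proof -
  have rx: "r absolutely_integrable_on {-a..x}" "r absolutely_integrable_on {x..a}"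
    using integral_norm_mono_interval(1)[OF r(1)] x by auto
  have A: "h1 x * U x - h x * U1 x = h1 a - integral {x..a} (\<lambda>s. r s * U s)"
    using lagrange_zero_energy[OF h U x(2)] bU by (simp add: algebra_simps)
  have B: "h1 x * P x - h x * P1 x = h1 (- a) + integral {-a..x} (\<lambda>s. r s * P s)"
    using lagrange_zero_energy[OF h P x(1)] bP by (simp add: algebra_simps)
  have w: "U x * P1 x - U1 x * P x = - U1 (- a)" using wronskian_const[OF U P, of x "-a"] bP by simp
  have "h x * (- U1 (- a)) = P x * (h1 x * U x - h x * U1 x) - U x * (h1 x * P x - h x * P1 x)"
    unfolding w[symmetric] by (simp add: algebra_simps)
  also have "\<dots> = P x * h1 a - integral {x..a} (\<lambda>s. r s * (P x * U s)) - U x * h1 (- a) - integral {-a..x} (\<lambda>s. r s * (U x * P s))"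
    unfolding A B by (simp add: algebra_simps flip: integral_mult_right)
  finally have eq: "h x * (- U1 (- a)) = P x * h1 a - integral {x..a} (\<lambda>s. r s * (P x * U s)) - U x * h1 (- a) - integral {-a..x} (\<lambda>s. r s * (U x * P s))" .
  have "norm (h x) * norm (U1 (- a)) = norm (h x * (- U1 (- a)))" by (simp add: norm_mult)
  also have "\<dots> \<le> norm (P x * h1 a) + norm (integral {x..a} (\<lambda>s. r s * (P x * U s))) + norm (U x * h1 (- a)) + norm (integral {-a..x} (\<lambda>s. r s * (U x * P s)))"
    unfolding eq by (intro order_trans[OF norm_triangle_ineq4] add_mono order_refl)
  also have "\<dots> \<le> L * norm (h1 a) + L * integral {x..a} (\<lambda>s. norm (r s)) + L * norm (h1 (- a)) + L * integral {-a..x} (\<lambda>s. norm (r s))"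
  proof (intro add_mono)
    show "norm (P x * h1 a) \<le> L * norm (h1 a)"
      unfolding norm_mult using L[of x a] x bU by (intro mult_right_mono) auto
    show "norm (U x * h1 (- a)) \<le> L * norm (h1 (- a))"
      unfolding norm_mult using L[of "-a" x] x bP by (intro mult_right_mono) auto
    show "norm (integral {x..a} (\<lambda>s. r s * (P x * U s))) \<le> L * integral {x..a} (\<lambda>s. norm (r s))"
      by (rule norm_integral_mult_le[OF rx(2)]) (use L x W2D(4)[OF U] in \<open>auto intro!: continuous_intros\<close>)
    show "norm (integral {-a..x} (\<lambda>s. r s * (U x * P s))) \<le> L * integral {-a..x} (\<lambda>s. norm (r s))"
      by (rule norm_integral_mult_le[OF rx(1)]) (use L x W2D(4)[OF P] in \<open>auto intro!: continuous_intros simp: mult.commute\<close>)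
  qed
  also have "\<dots> = L * (norm (h1 a) + norm (h1 (- a)) + (integral {-a..x} (\<lambda>s. norm (r s)) + integral {x..a} (\<lambda>s. norm (r s))))"
    by (simp add: algebra_simps)
  also have "integral {-a..x} (\<lambda>s. norm (r s)) + integral {x..a} (\<lambda>s. norm (r s)) = integral {-a..a} (\<lambda>s. norm (r s))"
    using r(1) x by (intro Henstock_Kurzweil_Integration.integral_combine) (auto simp: absolutely_integrable_on_def)
  also have "L * (norm (h1 a) + norm (h1 (- a)) + integral {-a..a} (\<lambda>s. norm (r s))) \<le> L * (norm (h1 a) + norm (h1 (- a)) + E)"
    using r(2) order_trans[OF norm_ge_zero L[of x x]] x by (intro mult_left_mono) auto
  finally show ?thesis .
qed

text \<open>Here \<open>U\<close> is constant on the left and \<open>P\<close> is any second solution, with Wronskian \<open>w\<close>. The multiple of \<open>U\<close> with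
  the same value as \<open>h\<close> at \<open>-a\<close> absorbs the leading term.\<close>

lemma interior_bound_resonant:
  assumes h: "W2 h h1 (\<lambda>x. p x * h x + r x)" and U: "W2 U U1 (\<lambda>x. p x * U x)" and P: "W2 P P1 (\<lambda>x. p x * P x)"
    and bU: "U (- a) = um" "U1 (- a) = 0" and w: "U (- a) * P1 (- a) - U1 (- a) * P (- a) = w" and um: "um \<noteq> 0"
    and r: "r absolutely_integrable_on {-a..a}" "integral {-a..a} (\<lambda>s. norm (r s)) \<le> E"
    and C: "\<And>x. - a \<le> x \<Longrightarrow> x \<le> a \<Longrightarrow> norm (U x) \<le> C" and L: "\<And>x. - a \<le> x \<Longrightarrow> x \<le> a \<Longrightarrow> norm (P x) \<le> L"
    and x: "- a \<le> x" "x \<le> a"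
  shows "norm (h x - U x * (h (- a) / um)) * norm w \<le> 2 * C * L * (norm (h1 (- a)) + E)"
proof -
  have rx: "r absolutely_integrable_on {-a..x}" "integral {-a..x} (\<lambda>s. norm (r s)) \<le> E"
    using integral_norm_mono_interval[OF r(1), of "-a" x] r(2) x by auto
  have C0: "0 \<le> C" using order_trans[OF norm_ge_zero C[OF x]] .
  have L0: "0 \<le> L" using order_trans[OF norm_ge_zero L[OF x]] .
  have A: "h1 x * U x - h x * U1 x = h1 (- a) * um + integral {-a..x} (\<lambda>s. r s * U s)"
    using lagrange_zero_energy[OF h U x(1)] bU by (simp add: algebra_simps)
  have B: "h1 x * P x - h x * P1 x = h1 (- a) * P (- a) - h (- a) * P1 (- a) + integral {-a..x} (\<lambda>s. r s * P s)"
    using lagrange_zero_energy[OF h P x(1)] by (simp add: algebra_simps)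
  have w': "U x * P1 x - U1 x * P x = w" using wronskian_const[OF U P, of x "-a"] w by simp
  have P1w: "P1 (- a) = w / um" using w bU um by (simp add: field_simps)
  have "h x * w = P x * (h1 x * U x - h x * U1 x) - U x * (h1 x * P x - h x * P1 x)"
    unfolding w'[symmetric] by (simp add: algebra_simps)
  also have "\<dots> = U x * (h (- a) / um) * w + (P x * um * h1 (- a) + P x * integral {-a..x} (\<lambda>s. r s * U s)
     - (U x * P (- a) * h1 (- a) + U x * integral {-a..x} (\<lambda>s. r s * P s)))"
    unfolding A B P1w by (simp add: algebra_simps)
  finally have eq: "(h x - U x * (h (- a) / um)) * w = (P x * um * h1 (- a) + P x * integral {-a..x} (\<lambda>s. r s * U s)
     - (U x * P (- a) * h1 (- a) + U x * integral {-a..x} (\<lambda>s. r s * P s)))" by (simp add: algebra_simps)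
  have iU: "norm (integral {-a..x} (\<lambda>s. r s * U s)) \<le> C * E"
    by (rule order_trans[OF norm_integral_mult_le[OF rx(1) W2D(4)[OF U], of C]])
       (use C x rx(2) C0 in \<open>auto intro!: mult_left_mono\<close>)
  have iP: "norm (integral {-a..x} (\<lambda>s. r s * P s)) \<le> L * E"
    by (rule order_trans[OF norm_integral_mult_le[OF rx(1) W2D(4)[OF P], of L]])
       (use L x rx(2) L0 in \<open>auto intro!: mult_left_mono\<close>)
  have umC: "norm um \<le> C" using C[of "-a"] bU x by simp
  have "norm (h x - U x * (h (- a) / um)) * norm w = norm (P x * um * h1 (- a) + P x * integral {-a..x} (\<lambda>s. r s * U s)
     - (U x * P (- a) * h1 (- a) + U x * integral {-a..x} (\<lambda>s. r s * P s)))"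
    unfolding norm_mult[symmetric] eq ..
  also have "\<dots> \<le> (norm (P x) * norm um * norm (h1 (- a)) + norm (P x) * norm (integral {-a..x} (\<lambda>s. r s * U s)))
     + (norm (U x) * norm (P (- a)) * norm (h1 (- a)) + norm (U x) * norm (integral {-a..x} (\<lambda>s. r s * P s)))"
    by (intro order_trans[OF norm_triangle_ineq4] add_mono order_trans[OF norm_triangle_ineq]) (simp_all add: norm_mult)
  also have "\<dots> \<le> (L * C * norm (h1 (- a)) + L * (C * E)) + (C * L * norm (h1 (- a)) + C * (L * E))"
    using x by (intro add_mono mult_mono iU iP C L umC order_refl mult_nonneg_nonneg norm_ge_zero C0 L0) auto
  also have "\<dots> = 2 * C * L * (norm (h1 (- a)) + E)" by (simp add: algebra_simps)
  finally show ?thesis .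
qed

text \<open>For \<open>m\<close> of order \<open>1/\<nu>\<close> and \<open>b\<close> of order \<open>\<nu>\<close> the product \<open>b * m\<close> stays bounded; the remaining terms tend to zero
  with \<open>a\<close>.\<close>

lemma perturbation_integral_bound:
  fixes W :: "real \<Rightarrow> real"
  assumes W: "W \<in> borel_measurable lebesgue" "\<And>x. \<bar>W x\<bar> \<le> m" "\<And>x. b \<le> \<bar>x\<bar> \<Longrightarrow> W x = 0" and b: "0 < b" "b \<le> a"
    and h: "continuous_on UNIV h" "\<And>x. - a \<le> x \<Longrightarrow> x \<le> a \<Longrightarrow> norm (h x) \<le> S" and f: "f square_integrable_on UNIV"
  shows "(\<lambda>x. (complex_of_real (W x) - z) * h x - f x) absolutely_integrable_on {-a..a}" (is ?A)
    "integral {-a..a} (\<lambda>x. norm ((complex_of_real (W x) - z) * h x - f x)) \<le> (2 * b * m + 2 * a * norm z) * S + sqrt (2 * a) * l2norm UNIV f" (is ?B)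
    "(\<lambda>x. complex_of_real (W x)) absolutely_integrable_on {-a..a}"
    "integral {-a..a} (\<lambda>x. norm (complex_of_real (W x))) \<le> 2 * b * m"
proof -
  have S0: "0 \<le> S" using order_trans[OF norm_ge_zero h(2)[of 0]] b by simp
  have Wm: "(\<lambda>x. complex_of_real (W x)) \<in> borel_measurable lebesgue" using W(1) by simp
  show Wi: "(\<lambda>x. complex_of_real (W x)) absolutely_integrable_on {-a..a}"
    by (rule bounded_measurable_abs_integrable[OF Wm, where M=m]) (use W(2) in simp)
  have Wn: "(\<lambda>x. norm (complex_of_real (W x))) integrable_on {-a..a}" using Wi by (simp add: absolutely_integrable_on_def)
  have ind: "((\<lambda>x. if x \<in> {-b..b} then m else 0) has_integral (2 * b * m)) {-a..a}"
  proof -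
    have "((\<lambda>x. m) has_integral (2 * b * m)) {-b..b}"
      using has_integral_const_real[of m "-b" b] b by simp
    then show ?thesis
      using has_integral_restrict[of "{-b..b}" "{-a..a}" "\<lambda>x. m" "2 * b * m"] b by auto
  qed
  show Wb: "integral {-a..a} (\<lambda>x. norm (complex_of_real (W x))) \<le> 2 * b * m"
  proof -
    have "integral {-a..a} (\<lambda>x. norm (complex_of_real (W x))) \<le> integral {-a..a} (\<lambda>x. if x \<in> {-b..b} then m else 0)"
      by (rule integral_le[OF Wn]) (use ind W(2,3) in \<open>auto simp: integrable_on_def\<close>)
    then show ?thesis using integral_unique[OF ind] by simp
  qed
  have fi: "f absolutely_integrable_on {-a..a}" "integral {-a..a} (\<lambda>x. norm (f x)) \<le> sqrt (2 * a) * l2norm UNIV f"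
    using sq_int_abs_integrable[OF f, of "-a" a] b by auto
  have hi: "(\<lambda>x. h x * (complex_of_real (W x) - z)) absolutely_integrable_on {-a..a}"
    by (rule set_integrable_mult_continuous[OF h(1) set_integral_diff(1)[OF Wi]])
       (intro absolutely_integrable_continuous_real continuous_intros)
  have ri: "(\<lambda>x. h x * (complex_of_real (W x) - z) - f x) absolutely_integrable_on {-a..a}"
    by (rule set_integral_diff(1)[OF hi fi(1)])
  then show A: ?A by (simp only: mult.commute[of "complex_of_real (W _) - z"])
  have fn: "(\<lambda>x. norm (f x)) integrable_on {-a..a}" using fi(1) by (simp add: absolutely_integrable_on_def)
  have up: "((\<lambda>x. S * norm (complex_of_real (W x)) + norm z * S + norm (f x)) has_integral
      (S * integral {-a..a} (\<lambda>x. norm (complex_of_real (W x))) + 2 * a * (norm z * S) + integral {-a..a} (\<lambda>x. norm (f x)))) {-a..a}"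
  proof (intro has_integral_add has_integral_mult_right integrable_integral Wn fn)
    show "((\<lambda>x. norm z * S) has_integral 2 * a * (norm z * S)) {-a..a}"
      using has_integral_const_real[of "norm z * S" "-a" a] b by simp
  qed
  have "integral {-a..a} (\<lambda>x. norm ((complex_of_real (W x) - z) * h x - f x)) \<le>
     S * integral {-a..a} (\<lambda>x. norm (complex_of_real (W x))) + 2 * a * (norm z * S) + integral {-a..a} (\<lambda>x. norm (f x))"
  proof (rule has_integral_le[OF integrable_integral up])
    show "(\<lambda>x. norm ((complex_of_real (W x) - z) * h x - f x)) integrable_on {-a..a}"
      using A by (simp add: absolutely_integrable_on_def)
    fix x assume x: "x \<in> {-a..a}"
    have "norm ((complex_of_real (W x) - z) * h x - f x) \<le> norm (complex_of_real (W x) - z) * norm (h x) + norm (f x)"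
      by (rule order_trans[OF norm_triangle_ineq4]) (simp add: norm_mult)
    also have "\<dots> \<le> (norm (complex_of_real (W x)) + norm z) * S + norm (f x)"
      using h(2)[of x] x S0 by (intro add_right_mono mult_mono norm_triangle_ineq4) auto
    finally show "norm ((complex_of_real (W x) - z) * h x - f x) \<le> S * norm (complex_of_real (W x)) + norm z * S + norm (f x)"
      by (simp add: algebra_simps)
  qed
  also have "\<dots> \<le> S * (2 * b * m) + 2 * a * (norm z * S) + sqrt (2 * a) * l2norm UNIV f"
    using Wb fi(2) S0 b by (intro add_mono mult_left_mono) auto
  finally show ?B by (simp add: algebra_simps)
qed

section \<open>Decay away from the interaction\<close>

text \<open>A square integrable solution of \<open>d'' = k\<^sup>2 d\<close> beyond \<open>a\<close> is a multiple of \<open>exp (- k x)\<close>.\<close>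

lemma tail_bound:
  assumes d: "W2 d d1 d2" and eq: "\<And>x. x > a \<Longrightarrow> d2 x = k\<^sup>2 * d x"
    and L2: "d square_integrable_on {a..}" "d1 square_integrable_on {a..}" and k: "Re k > 0"
  shows "d1 a = - k * d a" "l2norm {a..} d \<le> norm (d a) / sqrt (2 * Re k)"
proof -
  have z: "(\<lambda>x. 0::complex) square_integrable_on S" "l2norm S (\<lambda>x. 0) = 0" for S
    by (simp_all add: square_integrable_on_def set_borel_measurable_def set_integrable_def l2norm_def set_lebesgue_integral_def)
  have all: "d1 x + k * d x = 0" if x: "x \<ge> a" for x
  proof -
    have "norm (d1 x + k * d x) \<le> l2norm {x..} (\<lambda>x. 0) / sqrt (2 * Re k)"
    proof (rule half_line_bound[OF d _ _ _ z(1) k])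
      show "d2 y = k\<^sup>2 * d y - 0" if "y > x" for y using eq[of y] that x by simp
      show "d square_integrable_on {x..}" by (rule sq_int_subset(1)[OF L2(1)]) (use x in auto)
      show "d1 square_integrable_on {x..}" by (rule sq_int_subset(1)[OF L2(2)]) (use x in auto)
    qed
    then show ?thesis by (simp add: z)
  qed
  show "d1 a = - k * d a" using all[of a] by (simp add: eq_neg_iff_add_eq_0)
  have P: "primitive (\<lambda>x. exp (k * complex_of_real x) * d x)
     (\<lambda>x. (k * exp (k * complex_of_real x)) * d x + exp (k * complex_of_real x) * d1 x)"
    by (rule primitive_mult_C1[OF has_vector_derivative_exp_linear _ W2D(3)[OF d]]) (intro continuous_intros)
  have e: "d x = (exp (k * complex_of_real a) * d a) * exp (- (k * complex_of_real x))" if "x \<ge> a" for x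
  proof -
    have "exp (k * complex_of_real x) * d x = exp (k * complex_of_real a) * d a"
    proof (rule primitive_zero_const[OF P _ that])
      fix y assume "a < y"
      have "(k * exp (k * complex_of_real y)) * d y + exp (k * complex_of_real y) * d1 y = exp (k * complex_of_real y) * (d1 y + k * d y)"
        by (simp add: algebra_simps)
      then show "(k * exp (k * complex_of_real y)) * d y + exp (k * complex_of_real y) * d1 y = 0" using all[of y] \<open>a < y\<close> by simp
    qed
    then show ?thesis by (simp add: exp_minus field_simps)
  qed
  define c where "c = exp (k * complex_of_real a) * d a"
  have "indicator {a..} x *\<^sub>R (norm (d x))\<^sup>2 = (norm c)\<^sup>2 * (indicator {a..} x *\<^sub>R (norm (exp (- (k * complex_of_real x))))\<^sup>2)" for x
    using e[of x] by (cases "x \<ge> a") (auto simp: c_def[symmetric] norm_mult power_mult_distrib)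
  then have "(LINT x:{a..}|lebesgue. (norm (d x))\<^sup>2) = (norm c)\<^sup>2 * (LINT x:{a..}|lebesgue. (norm (exp (- (k * complex_of_real x))))\<^sup>2)"
    unfolding set_lebesgue_integral_def by (simp only: integral_mult_right_zero)
  then have "l2norm {a..} d = norm c * l2norm {a..} (\<lambda>x. exp (- (k * complex_of_real x)))"
    unfolding l2norm_def by (simp add: real_sqrt_mult)
  also have "\<dots> = norm (d a) / sqrt (2 * Re k)"
    unfolding exp_sq_int(2)[OF k] c_def norm_mult by (simp add: exp_minus field_simps)
  finally show "l2norm {a..} d \<le> norm (d a) / sqrt (2 * Re k)" by simp
qed

lemma tail_bound_left:
  assumes d: "W2 d d1 d2" and eq: "\<And>x. x < - a \<Longrightarrow> d2 x = k\<^sup>2 * d x"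
    and L2: "d square_integrable_on {..-a}" "d1 square_integrable_on {..-a}" and k: "Re k > 0"
  shows "d1 (- a) = k * d (- a)" "l2norm {..-a} d \<le> norm (d (- a)) / sqrt (2 * Re k)"
proof -
  have im: "uminus ` {..-a} = {a..}" by auto
  have R: "(\<lambda>x. y (- x)) square_integrable_on {a..}" "l2norm {a..} (\<lambda>x. y (- x)) = l2norm {..-a} y" if "y square_integrable_on {..-a}" for y
    using sq_int_reflect[OF that] unfolding im by auto
  have d': "W2 (\<lambda>x. d (- x)) (\<lambda>x. - d1 (- x)) (\<lambda>x. d2 (- x))" using W2_affine[OF d, of "-1" 0] by simp
  have eq': "d2 (- x) = k\<^sup>2 * d (- x)" if "x > a" for x using eq[of "-x"] that by simp
  note t = tail_bound[OF d' eq' R(1)[OF L2(1)] sq_int_uminus[OF R(1)[OF L2(2)]] k]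
  show "d1 (- a) = k * d (- a)" using t(1) by simp
  show "l2norm {..-a} d \<le> norm (d (- a)) / sqrt (2 * Re k)" using t(2) R(2)[OF L2(1)] by simp
qed

text \<open>Quantitative continuity of \<open>r\<close> and \<open>r'\<close> at the origin. The equation controls \<open>r' + k r\<close> by \<open>f\<close>, so
  all bounds are in terms of \<open>r(0)\<close> and \<open>f\<close>; the supremum of \<open>\<bar>r\<bar>\<close> occurs on both sides and is absorbed
  for \<open>a \<bar>k\<bar> \<le> 1/2\<close>.\<close>

lemma near_zero_bound:
  assumes r: "W2 r r1 r2" and eq: "\<And>x. x > 0 \<Longrightarrow> r2 x = k\<^sup>2 * r x - f x"
    and L2: "r square_integrable_on {0..}" "r1 square_integrable_on {0..}" "f square_integrable_on {0..}" and k: "Re k > 0"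
    and N: "l2norm {0..} f \<le> N" and c: "c = 1 / sqrt (2 * Re k)" and a: "0 < a" "a * norm k \<le> 1/2"
  shows "norm (r1 0 + k * r 0) \<le> c * N"
    "x \<in> {0..a} \<Longrightarrow> norm (r x) \<le> 2 * norm (r 0) + 2 * a * c * N"
    "x \<in> {0..a} \<Longrightarrow> norm (r x - r 0) \<le> a * (norm k * (2 * norm (r 0) + 2 * a * c * N) + c * N)"
    "norm (r1 a - r1 0) \<le> a * (norm k)\<^sup>2 * (2 * norm (r 0) + 2 * a * c * N) + sqrt a * N"
proof -
  have c0: "c \<ge> 0" using k by (simp add: c)
  have N0: "N \<ge> 0" using order_trans[OF l2norm_nonneg N] .
  have b: "norm (r1 x + k * r x) \<le> c * N" if x: "x \<ge> 0" for x
  proof -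
    have s: "y square_integrable_on {x..}" if "y square_integrable_on {0..}" for y
      by (rule sq_int_subset(1)[OF that]) (use x in auto)
    have "norm (r1 x + k * r x) \<le> l2norm {x..} f / sqrt (2 * Re k)"
      by (rule half_line_bound[OF r _ s[OF L2(1)] s[OF L2(2)] s[OF L2(3)] k]) (use eq x in auto)
    also have "\<dots> \<le> N / sqrt (2 * Re k)"
      using sq_int_subset(2)[OF L2(3), of "{x..}"] x N k by (intro divide_right_mono) auto
    finally show ?thesis by (simp add: c)
  qed
  show "norm (r1 0 + k * r 0) \<le> c * N" by (rule b) simp
  have "compact (r ` {0..a})" by (intro compact_continuous_image W2D(4)[OF r]) auto
  obtain xs where xs: "xs \<in> {0..a}" "\<And>x. x \<in> {0..a} \<Longrightarrow> norm (r x) \<le> norm (r xs)"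
  proof -
    have "continuous_on {0..a} (\<lambda>x. norm (r x))" by (intro continuous_intros W2D(4)[OF r])
    from continuous_attains_sup[OF _ _ this] a(1) show thesis using that by auto
  qed
  define T where "T = norm (r xs)"
  have r1b: "norm (r1 x) \<le> norm k * T + c * N" if "x \<in> {0..a}" for x
  proof -
    have "norm (r1 x) \<le> norm (r1 x + k * r x) + norm (k * r x)"
      using norm_triangle_ineq4[of "r1 x + k * r x" "k * r x"] by simp
    also have "\<dots> \<le> c * N + norm k * T" using b[of x] that xs(2)[OF that] by (intro add_mono) (auto simp: norm_mult T_def mult_left_mono)
    finally show ?thesis by simp
  qed
  have diff: "norm (r x - r 0) \<le> a * (norm k * T + c * N)" if x: "x \<in> {0..a}" for x
  proof -
    have "norm (r x - r 0) = norm (integral {0..x} r1)" using primitiveD(3)[OF W2D(3)[OF r], of 0 x] x by simp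
    also have "\<dots> \<le> integral {0..x} (\<lambda>s. norm k * T + c * N)"
      by (rule Henstock_Kurzweil_Integration.integral_norm_bound_integral[OF primitiveD(2)[OF W2D(3)[OF r]]]) (use r1b x in auto)
    also have "\<dots> = x * (norm k * T + c * N)" using x by simp
    also have "\<dots> \<le> a * (norm k * T + c * N)" using x N0 c0 by (intro mult_right_mono) (auto simp: T_def)
    finally show ?thesis .
  qed
  have "T \<le> norm (r 0) + norm (r xs - r 0)" unfolding T_def using norm_triangle_ineq[of "r 0" "r xs - r 0"] by simp
  also have "\<dots> \<le> norm (r 0) + (a * norm k * T + a * c * N)" using diff[OF xs(1)] by (simp add: algebra_simps)
  also have "a * norm k * T \<le> 1/2 * T" using a(2) by (intro mult_right_mono) (auto simp: T_def)
  finally have T: "T \<le> 2 * norm (r 0) + 2 * a * c * N" by (simp add: algebra_simps)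
  show "x \<in> {0..a} \<Longrightarrow> norm (r x) \<le> 2 * norm (r 0) + 2 * a * c * N" using xs(2) T unfolding T_def by (auto intro: order_trans)
  have "a * (norm k * T + c * N) \<le> a * (norm k * (2 * norm (r 0) + 2 * a * c * N) + c * N)"
    using T a by (intro mult_left_mono add_right_mono) auto
  then show "x \<in> {0..a} \<Longrightarrow> norm (r x - r 0) \<le> a * (norm k * (2 * norm (r 0) + 2 * a * c * N) + c * N)"
    using diff by (auto intro: order_trans)
  have fi: "f absolutely_integrable_on {0..a}" "integral {0..a} (\<lambda>x. norm (f x)) \<le> sqrt a * N"
    using sq_int_abs_integrable[OF L2(3), of 0 a] a(1) order_trans[OF _ mult_left_mono[OF N, of "sqrt a"]] by auto
  have fn: "(\<lambda>x. norm (f x)) integrable_on {0..a}" using fi(1) by (simp add: absolutely_integrable_on_def)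
  have up: "((\<lambda>x. (norm k)\<^sup>2 * T + norm (f x)) has_integral (a * ((norm k)\<^sup>2 * T) + integral {0..a} (\<lambda>x. norm (f x)))) {0..a}"
    using has_integral_add[OF has_integral_const_real[of "(norm k)\<^sup>2 * T" 0 a] integrable_integral[OF fn]] a by simp
  have "norm (r1 a - r1 0) = norm (integral {0..a} (\<lambda>x. k\<^sup>2 * r x - f x))"
  proof -
    have "integral {0..a} r2 = integral {0..a} (\<lambda>x. k\<^sup>2 * r x - f x)"
      by (rule integral_spike[of "{0}"]) (auto simp: eq)
    then show ?thesis using primitiveD(3)[OF W2D(2)[OF r], of 0 a] a by simp
  qed
  also have "\<dots> \<le> a * ((norm k)\<^sup>2 * T) + integral {0..a} (\<lambda>x. norm (f x))"
  proof -
    have "(\<lambda>x. k\<^sup>2 * r x - f x) integrable_on {0..a}"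
      by (intro integrable_diff integrable_on_mult_right integrable_continuous_real W2D(4)[OF r] set_lebesgue_integral_eq_integral(1)[OF fi(1)])
    from Henstock_Kurzweil_Integration.integral_norm_bound_integral[OF this has_integral_integrable[OF up]]
    have "norm (integral {0..a} (\<lambda>x. k\<^sup>2 * r x - f x)) \<le> integral {0..a} (\<lambda>x. (norm k)\<^sup>2 * T + norm (f x))"
    proof -
      assume *: "(\<And>x. x \<in> {0..a} \<Longrightarrow> norm (k\<^sup>2 * r x - f x) \<le> (norm k)\<^sup>2 * T + norm (f x)) \<Longrightarrow> norm (integral {0..a} (\<lambda>x. k\<^sup>2 * r x - f x)) \<le> integral {0..a} (\<lambda>x. (norm k)\<^sup>2 * T + norm (f x))"
      show ?thesis
      proof (rule *)
        fix x assume "x \<in> {0..a}"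
        then have "norm (k\<^sup>2 * r x) \<le> (norm k)\<^sup>2 * T" using xs(2)[of x] by (auto simp: norm_mult norm_power T_def intro!: mult_left_mono)
        then show "norm (k\<^sup>2 * r x - f x) \<le> (norm k)\<^sup>2 * T + norm (f x)"
          using norm_triangle_ineq4[of "k\<^sup>2 * r x" "f x"] by linarith
      qed
    qed
    then show ?thesis using integral_unique[OF up] by simp
  qed
  also have "\<dots> \<le> a * (norm k)\<^sup>2 * (2 * norm (r 0) + 2 * a * c * N) + sqrt a * N"
    unfolding mult.assoc[symmetric] using fi(2) T a by (intro add_mono mult_left_mono) auto
  finally show "norm (r1 a - r1 0) \<le> a * (norm k)\<^sup>2 * (2 * norm (r 0) + 2 * a * c * N) + sqrt a * N" .
qed

section \<open>Zero-energy solutions\<close>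

lemma zero_energy_right:
  fixes \<Phi> :: "real \<Rightarrow> real"
  assumes "\<Phi> \<in> borel_measurable lebesgue" "\<And>x. \<bar>\<Phi> x\<bar> \<le> M" "\<And>x. R \<le> \<bar>x\<bar> \<Longrightarrow> \<Phi> x = 0" "R > 0"
  shows "\<exists>v v1. W2 v v1 (\<lambda>y. complex_of_real (\<Phi> y) * v y) \<and> (\<forall>y\<ge>R. v y = c + d * complex_of_real y \<and> v1 y = d)"
proof -
  have "W2 (\<lambda>y. c + d * complex_of_real y) (\<lambda>y. d) (\<lambda>y. 0 * (c + d * complex_of_real y) - 0)"
    using W2_affine_function[of c d] by simp
  from backward_correction[of "\<lambda>x. complex_of_real (\<Phi> x)" M R, OF _ _ _ _ this] assms
  show ?thesis by auto
qed

lemma zero_energy_left: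
  fixes \<Phi> :: "real \<Rightarrow> real"
  assumes "\<Phi> \<in> borel_measurable lebesgue" "\<And>x. \<bar>\<Phi> x\<bar> \<le> M" "\<And>x. R \<le> \<bar>x\<bar> \<Longrightarrow> \<Phi> x = 0" "R > 0"
  shows "\<exists>v v1. W2 v v1 (\<lambda>y. complex_of_real (\<Phi> y) * v y) \<and> (\<forall>y\<le>-R. v y = c + d * complex_of_real y \<and> v1 y = d)"
proof -
  have "W2 (\<lambda>y. c + d * complex_of_real y) (\<lambda>y. d) (\<lambda>y. 0 * (c + d * complex_of_real y) - 0)"
    using W2_affine_function[of c d] by simp
  from forward_correction[of "\<lambda>x. complex_of_real (\<Phi> x)" M R, OF _ _ _ _ this] assms
  show ?thesis by auto
qed

lemma zero_energy_outside:
  assumes v: "W2 v v1 (\<lambda>y. complex_of_real (\<Phi> y) * v y)" and \<Phi>: "\<And>x. R \<le> \<bar>x\<bar> \<Longrightarrow> \<Phi> x = 0" and R: "R > 0"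
  shows "y \<ge> R \<Longrightarrow> v1 y = v1 R" "y \<ge> R \<Longrightarrow> v y = v R + v1 R * complex_of_real (y - R)"
    "y \<le> -R \<Longrightarrow> v1 y = v1 (- R)" "y \<le> -R \<Longrightarrow> v y = v (- R) + v1 (- R) * complex_of_real (y + R)"
proof -
  have aff: "W2 (\<lambda>y. (b - m * complex_of_real t) + m * complex_of_real y) (\<lambda>y. m) (\<lambda>y. 0)" for b m t by (rule W2_affine_function)
  have r: "v y - ((v R - v1 R * complex_of_real R) + v1 R * complex_of_real y) = 0 \<and> v1 y - v1 R = 0" if "y \<ge> R" for y
    using W2_zero_right[OF W2_diff[OF v aff[of "v R" "v1 R" R]], of R y] \<Phi> that R by auto
  have l: "v y - ((v (-R) - v1 (-R) * complex_of_real (-R)) + v1 (-R) * complex_of_real y) = 0 \<and> v1 y - v1 (-R) = 0" if "y \<le> -R" for y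
    using W2_zero_left[OF W2_diff[OF v aff[of "v (-R)" "v1 (-R)" "-R"]], of "-R" y] \<Phi> that R by auto
  show "v1 y = v1 R" "v y = v R + v1 R * complex_of_real (y - R)" if "y \<ge> R" using r[OF that] by (auto simp: algebra_simps)
  show "v1 y = v1 (-R)" "v y = v (-R) + v1 (-R) * complex_of_real (y + R)" if "y \<le> -R" using l[OF that] by (auto simp: algebra_simps)
qed

text \<open>Outside the support of the potential a zero-energy solution is affine, with slopes \<open>v1 R\<close> and
  \<open>v1 (- R)\<close>. In particular it is bounded exactly when both slopes vanish.\<close>

lemma zero_energy_growth:
  assumes v: "W2 v v1 (\<lambda>y. complex_of_real (\<Phi> y) * v y)" and \<Phi>: "\<And>x. R \<le> \<bar>x\<bar> \<Longrightarrow> \<Phi> x = 0" and R: "R > 0"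
  shows "\<exists>C\<ge>0. \<forall>y. norm (v y) \<le> C + norm (v1 R) * max 0 y + norm (v1 (- R)) * max 0 (- y)"
proof -
  have "compact (v ` {-R..R})" by (intro compact_continuous_image W2D(4)[OF v]) auto
  then obtain C where C: "\<forall>y\<in>{-R..R}. norm (v y) \<le> C"
    using compact_imp_bounded[of "v ` {-R..R}"] by (auto simp: bounded_iff simp del: atLeastAtMost_iff)
  have C0: "C \<ge> 0" using C order_trans[OF norm_ge_zero, of "v 0" C] R by auto
  have "norm (v y) \<le> C + norm (v1 R) * max 0 y + norm (v1 (- R)) * max 0 (- y)" for y
  proof -
    consider "y > R" | "y < -R" | "y \<in> {-R..R}" by fastforce
    then show ?thesis
    proof cases
      case 1
      have "norm (v y) \<le> norm (v R) + norm (v1 R * complex_of_real (y - R))"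
        using zero_energy_outside(2)[OF v \<Phi> R, of y] 1 by (simp add: norm_triangle_ineq)
      also have "norm (v1 R * complex_of_real (y - R)) = norm (v1 R) * (y - R)" using 1 by (simp add: norm_mult del: of_real_diff)
      also have "norm (v R) + norm (v1 R) * (y - R) \<le> C + norm (v1 R) * max 0 y"
        using C R 1 by (intro add_mono mult_left_mono) auto
      finally show ?thesis using 1 R by simp
    next
      case 2
      have "norm (v y) \<le> norm (v (-R)) + norm (v1 (-R) * complex_of_real (y + R))"
        using zero_energy_outside(4)[OF v \<Phi> R, of y] 2 by (simp add: norm_triangle_ineq)
      also have "norm (v1 (-R) * complex_of_real (y + R)) = norm (v1 (-R)) * (-y - R)" using 2 by (simp add: norm_mult del: of_real_add)
      also have "norm (v (-R)) + norm (v1 (-R)) * (-y - R) \<le> C + norm (v1 (-R)) * max 0 (-y)"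
        using C R 2 by (intro add_mono mult_left_mono) auto
      finally show ?thesis using 2 R by simp
    next
      case 3
      have "norm (v y) \<le> C" using C 3 by blast
      also have "\<dots> \<le> C + norm (v1 R) * max 0 y + norm (v1 (- R)) * max 0 (- y)" by simp
      finally show ?thesis .
    qed
  qed
  then show ?thesis using C0 by blast
qed

lemma zero_energy_scaled:
  assumes v: "W2 v v1 (\<lambda>y. complex_of_real (\<Phi> y) * v y)" and e: "\<epsilon> > 0"
  shows "W2 (\<lambda>x. v (x / \<epsilon>)) (\<lambda>x. v1 (x / \<epsilon>) / complex_of_real \<epsilon>) (\<lambda>x. complex_of_real (\<Phi> (x / \<epsilon>) / \<epsilon>\<^sup>2) * v (x / \<epsilon>))"
proof -
  have "W2 (\<lambda>x. v (0 + (1/\<epsilon>) * x)) (\<lambda>x. complex_of_real (1/\<epsilon>) * v1 (0 + (1/\<epsilon>) * x))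
     (\<lambda>x. complex_of_real (1/\<epsilon>)^2 * (complex_of_real (\<Phi> (0 + (1/\<epsilon>) * x)) * v (0 + (1/\<epsilon>) * x)))"
    by (rule W2_affine[OF v]) (use e in simp)
  then show ?thesis by (simp add: power_divide)
qed

lemma zero_energy_solution_W2:
  "zero_energy_solution V u \<longleftrightarrow> (\<exists>u1. W2 u u1 (\<lambda>x. V x *\<^sub>R u x))" for u :: "real \<Rightarrow> complex"
proof -
  have "(\<forall>a b. a \<le> b \<longrightarrow> set_integrable lebesgue {a..b} g \<and> G b - G a = (LINT x:{a..b}|lebesgue. g x)) \<longleftrightarrow> primitive G g"
    for g G :: "real \<Rightarrow> complex"
    unfolding primitive_def using set_lebesgue_integral_eq_integral(2) by metis
  then show ?thesis unfolding zero_energy_solution_def W2_def by simp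
qed

section \<open>Comparison of the resolvents outside the interaction\<close>

lemma l2norm_cong: "(\<And>x. x \<in> S \<Longrightarrow> f x = g x) \<Longrightarrow> l2norm S f = l2norm S g"
  unfolding l2norm_def set_lebesgue_integral_def
  by (rule arg_cong[where f=sqrt], rule Bochner_Integration.integral_cong) (auto simp: indicator_def)

lemma l2norm_UNIV_le:
  assumes d: "d square_integrable_on UNIV"
  shows "l2norm UNIV d \<le> l2norm {..-a} d + l2norm {-a..a} d + l2norm {a..} d"
proof -
  have i: "integrable lebesgue (\<lambda>x. indicator S x *\<^sub>R (norm (d x))\<^sup>2)" if "S \<in> sets lebesgue" for S
    using sq_int_subset(1)[OF d, of S] that by (auto simp: square_integrable_on_def set_integrable_def)
  have "(l2norm UNIV d)\<^sup>2 \<le> (l2norm {..-a} d)\<^sup>2 + (l2norm {-a..a} d)\<^sup>2 + (l2norm {a..} d)\<^sup>2"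
  proof -
    have "(LINT x|lebesgue. (norm (d x))\<^sup>2) \<le> (LINT x|lebesgue. indicator {..-a} x *\<^sub>R (norm (d x))\<^sup>2
       + indicator {-a..a} x *\<^sub>R (norm (d x))\<^sup>2 + indicator {a..} x *\<^sub>R (norm (d x))\<^sup>2)"
    proof (rule integral_mono)
      show "integrable lebesgue (\<lambda>x. (norm (d x))\<^sup>2)" using d by (simp add: square_integrable_on_UNIV)
      show "integrable lebesgue (\<lambda>x. indicator {..-a} x *\<^sub>R (norm (d x))\<^sup>2
       + indicator {-a..a} x *\<^sub>R (norm (d x))\<^sup>2 + indicator {a..} x *\<^sub>R (norm (d x))\<^sup>2)"
        by (intro Bochner_Integration.integrable_add i) auto
      show "(norm (d x))\<^sup>2 \<le> indicator {..-a} x *\<^sub>R (norm (d x))\<^sup>2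
       + indicator {-a..a} x *\<^sub>R (norm (d x))\<^sup>2 + indicator {a..} x *\<^sub>R (norm (d x))\<^sup>2" for x
        by (auto simp: indicator_def)
    qed
    also have "\<dots> = (LINT x|lebesgue. indicator {..-a} x *\<^sub>R (norm (d x))\<^sup>2)
       + (LINT x|lebesgue. indicator {-a..a} x *\<^sub>R (norm (d x))\<^sup>2) + (LINT x|lebesgue. indicator {a..} x *\<^sub>R (norm (d x))\<^sup>2)"
      by (subst Bochner_Integration.integral_add[OF Bochner_Integration.integrable_add[OF i i] i], simp, simp, simp)
         (subst Bochner_Integration.integral_add[OF i i], auto)
    finally show ?thesis unfolding l2norm_square by (simp add: set_lebesgue_integral_def)
  qed
  also have "\<dots> \<le> (l2norm {..-a} d + l2norm {-a..a} d + l2norm {a..} d)\<^sup>2"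
    by (simp add: power2_eq_square algebra_simps)
  finally show ?thesis by (rule power2_le_imp_le) simp
qed

text \<open>The differences \<open>h - r\<close> and \<open>h - l\<close> solve the homogeneous equation beyond \<open>a\<close> and before \<open>-a\<close>, so
  \<open>tail_bound\<close> applies to them. On the interval in between, only suprema are used.\<close>

lemma outer_comparison:
  fixes V :: "real \<Rightarrow> real"
  assumes k: "Re k > 0" "k\<^sup>2 = - z" and c: "c = 1 / sqrt (2 * Re k)"
    and V: "\<And>x. a \<le> \<bar>x\<bar> \<Longrightarrow> V x = 0" and a: "0 < a"
    and f: "f square_integrable_on UNIV"
    and h: "W2 h h1 (\<lambda>x. (complex_of_real (V x) - z) * h x - f x)" "h square_integrable_on UNIV" "h1 square_integrable_on UNIV"
    and l: "W2 l lp lq" "\<And>x. x < 0 \<Longrightarrow> lq x = k\<^sup>2 * l x - f x" "l square_integrable_on {..0}" "lp square_integrable_on {..0}"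
    and r: "W2 r rp rq" "\<And>x. x > 0 \<Longrightarrow> rq x = k\<^sup>2 * r x - f x" "r square_integrable_on {0..}" "rp square_integrable_on {0..}"
    and S: "\<And>x. -a \<le> x \<Longrightarrow> x \<le> a \<Longrightarrow> norm (h x) \<le> S"
    and T: "\<And>x. -a \<le> x \<Longrightarrow> x \<le> 0 \<Longrightarrow> norm (l x) \<le> T" "\<And>x. 0 \<le> x \<Longrightarrow> x \<le> a \<Longrightarrow> norm (r x) \<le> T"
  shows "h1 a - rp a = - k * (h a - r a)" "h1 (- a) - lp (- a) = k * (h (- a) - l (- a))"
    "norm (h1 a + k * h a) \<le> c * l2norm UNIV f" "norm (- h1 (- a) + k * h (- a)) \<le> c * l2norm UNIV f"
    "l2norm UNIV (\<lambda>x. h x - glue l r x) \<le> c * (norm (h (- a) - l (- a)) + norm (h a - r a)) + sqrt (2 * a) * (S + T)"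
proof -
  have sub: "y square_integrable_on A" "l2norm A y \<le> l2norm UNIV y" if "y square_integrable_on UNIV" "A \<in> sets lebesgue" for y A
    using sq_int_subset[OF that(1) _ that(2)] by auto
  have c0: "c \<ge> 0" using k by (simp add: c)
  have "norm (h1 a + k * h a) \<le> l2norm {a..} f / sqrt (2 * Re k)"
    by (rule half_line_bound[OF h(1) _ sub(1)[OF h(2)] sub(1)[OF h(3)] sub(1)[OF f] k(1)]) (use V a k(2) in auto)
  also have "\<dots> = c * l2norm {a..} f" by (simp add: c)
  also have "\<dots> \<le> c * l2norm UNIV f" by (intro mult_left_mono sub(2)[OF f] c0) auto
  finally show "norm (h1 a + k * h a) \<le> c * l2norm UNIV f" .
  have "norm (- h1 (- a) + k * h (- a)) \<le> l2norm {..-a} f / sqrt (2 * Re k)"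
    by (rule half_line_bound_left[OF h(1) _ sub(1)[OF h(2)] sub(1)[OF h(3)] sub(1)[OF f] k(1)]) (use V a k(2) in auto)
  also have "\<dots> = c * l2norm {..-a} f" by (simp add: c)
  also have "\<dots> \<le> c * l2norm UNIV f" by (intro mult_left_mono sub(2)[OF f] c0) auto
  finally show "norm (- h1 (- a) + k * h (- a)) \<le> c * l2norm UNIV f" .
  have rs: "r square_integrable_on {a..}" "rp square_integrable_on {a..}"
    by (rule sq_int_subset(1)[OF r(3)] sq_int_subset(1)[OF r(4)], use a in auto)+
  have ls: "l square_integrable_on {..-a}" "lp square_integrable_on {..-a}"
    by (rule sq_int_subset(1)[OF l(3)] sq_int_subset(1)[OF l(4)], use a in auto)+
  have eqr: "(complex_of_real (V x) - z) * h x - f x - rq x = k\<^sup>2 * (h x - r x)" if "x > a" for x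
    using V[of x] r(2)[of x] that a k(2) by (simp add: algebra_simps)
  have eql: "(complex_of_real (V x) - z) * h x - f x - lq x = k\<^sup>2 * (h x - l x)" if "x < -a" for x
    using V[of x] l(2)[of x] that a k(2) by (simp add: algebra_simps)
  note tr = tail_bound[OF W2_diff[OF h(1) r(1)] eqr sq_int_diff[OF sub(1)[OF h(2)] rs(1)] sq_int_diff[OF sub(1)[OF h(3)] rs(2)] k(1)]
  note tl = tail_bound_left[OF W2_diff[OF h(1) l(1)] eql sq_int_diff[OF sub(1)[OF h(2)] ls(1)] sq_int_diff[OF sub(1)[OF h(3)] ls(2)] k(1)]
  show "h1 a - rp a = - k * (h a - r a)" using tr(1) by simp
  show "h1 (- a) - lp (- a) = k * (h (- a) - l (- a))" using tl(1) by simp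
  have gs: "glue l r square_integrable_on UNIV" by (rule glue_sq_int[OF l(3) r(3)])
  have d: "(\<lambda>x. h x - glue l r x) square_integrable_on UNIV" by (rule sq_int_diff[OF h(2) gs])
  have S0: "0 \<le> S" using order_trans[OF norm_ge_zero S[of 0]] a by simp
  have T0: "0 \<le> T" using order_trans[OF norm_ge_zero T(1)[of 0]] a by simp
  have 1: "l2norm {..-a} (\<lambda>x. h x - glue l r x) \<le> c * norm (h (- a) - l (- a))"
  proof -
    have "l2norm {..-a} (\<lambda>x. h x - glue l r x) = l2norm {..-a} (\<lambda>x. h x - l x)"
      by (rule l2norm_cong) (use a in \<open>auto simp: glue_def\<close>)
    then show ?thesis using tl(2) by (simp add: c)
  qed
  have 2: "l2norm {a..} (\<lambda>x. h x - glue l r x) \<le> c * norm (h a - r a)"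
  proof -
    have "l2norm {a..} (\<lambda>x. h x - glue l r x) = l2norm {a..} (\<lambda>x. h x - r x)"
      by (rule l2norm_cong) (use a in \<open>auto simp: glue_def\<close>)
    then show ?thesis using tr(2) by (simp add: c)
  qed
  have 3: "l2norm {-a..a} (\<lambda>x. h x - glue l r x) \<le> sqrt (a - (- a)) * (S + T)"
  proof (rule sq_int_bounded_interval(2))
    show "(\<lambda>x. h x - glue l r x) \<in> borel_measurable lebesgue" using d by (simp add: square_integrable_on_UNIV)
    show "norm (h x - glue l r x) \<le> S + T" if "-a \<le> x" "x \<le> a" for x
      by (rule order_trans[OF norm_triangle_ineq4], rule add_mono[OF S[OF that]]) (use T that T0 in \<open>auto simp: glue_def\<close>)
  qed (use a in simp)
  show "l2norm UNIV (\<lambda>x. h x - glue l r x) \<le> c * (norm (h (- a) - l (- a)) + norm (h a - r a)) + sqrt (2 * a) * (S + T)"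
    using l2norm_UNIV_le[OF d, of a] 1 2 3 by (simp add: algebra_simps)
qed

lemma near_zero_bound_left:
  assumes l: "W2 l lp lq" and eq: "\<And>x. x < 0 \<Longrightarrow> lq x = k\<^sup>2 * l x - f x"
    and L2: "l square_integrable_on {..0}" "lp square_integrable_on {..0}" "f square_integrable_on {..0}" and k: "Re k > 0"
    and N: "l2norm {..0} f \<le> N" and c: "c = 1 / sqrt (2 * Re k)" and a: "0 < a" "a * norm k \<le> 1/2"
  shows "norm (- lp 0 + k * l 0) \<le> c * N"
    "x \<in> {-a..0} \<Longrightarrow> norm (l x) \<le> 2 * norm (l 0) + 2 * a * c * N"
    "x \<in> {-a..0} \<Longrightarrow> norm (l x - l 0) \<le> a * (norm k * (2 * norm (l 0) + 2 * a * c * N) + c * N)"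
    "norm (lp (- a) - lp 0) \<le> a * (norm k)\<^sup>2 * (2 * norm (l 0) + 2 * a * c * N) + sqrt a * N"
proof -
  have im: "uminus ` {..0} = {(0::real)..}" by auto
  have R: "(\<lambda>x. y (- x)) square_integrable_on {0..}" "l2norm {0..} (\<lambda>x. y (- x)) = l2norm {..0} y" if "y square_integrable_on {..0}" for y
    using sq_int_reflect[OF that] unfolding im by auto
  have l': "W2 (\<lambda>x. l (- x)) (\<lambda>x. - lp (- x)) (\<lambda>x. lq (- x))" using W2_affine[OF l, of "-1" 0] by simp
  have eq': "lq (- x) = k\<^sup>2 * l (- x) - f (- x)" if "x > 0" for x using eq[of "-x"] that by simp
  have N': "l2norm {0..} (\<lambda>x. f (- x)) \<le> N" using R(2)[OF L2(3)] N by simp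
  note t = near_zero_bound[OF l' eq' R(1)[OF L2(1)] sq_int_uminus[OF R(1)[OF L2(2)]] R(1)[OF L2(3)] k N' c a]
  show "norm (- lp 0 + k * l 0) \<le> c * N" using t(1) by simp
  show "x \<in> {-a..0} \<Longrightarrow> norm (l x) \<le> 2 * norm (l 0) + 2 * a * c * N" using t(2)[of "-x"] by simp
  show "x \<in> {-a..0} \<Longrightarrow> norm (l x - l 0) \<le> a * (norm k * (2 * norm (l 0) + 2 * a * c * N) + c * N)" using t(3)[of "-x"] by simp
  show "norm (lp (- a) - lp 0) \<le> a * (norm k)\<^sup>2 * (2 * norm (l 0) + 2 * a * c * N) + sqrt a * N"
    using t(4) by (simp add: norm_minus_commute)
qed

section \<open>The non-resonant case\<close>

text \<open>The estimate \<open>\<parallel>(S\<^sub>V - z)\<^sup>-\<^sup>1 f - (S\<^sub>B - z)\<^sup>-\<^sup>1 f\<parallel> \<le> \<kappa> \<parallel>f\<parallel>\<close> in terms of representatives: \<open>h\<close> is the first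
  resolvent applied to \<open>f\<close>, and \<open>l\<close>, \<open>r\<close> are the two halves of the second one.\<close>

definition resolvent_estimate ::
    "(real \<Rightarrow> real) \<Rightarrow> (complex \<Rightarrow> complex \<Rightarrow> complex \<Rightarrow> complex \<Rightarrow> bool) \<Rightarrow> complex \<Rightarrow> real \<Rightarrow> bool" where
  "resolvent_estimate V B z \<kappa> \<longleftrightarrow> (\<forall>f h h1 l lp lq r rp rq. f square_integrable_on UNIV \<longrightarrow>
    W2 h h1 (\<lambda>x. (complex_of_real (V x) - z) * h x - f x) \<longrightarrow> h square_integrable_on UNIV \<longrightarrow> h1 square_integrable_on UNIV \<longrightarrow>
    W2 l lp lq \<longrightarrow> (\<forall>x<0. lq x = - z * l x - f x) \<longrightarrow> l square_integrable_on {..0} \<longrightarrow> lp square_integrable_on {..0} \<longrightarrow>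
    W2 r rp rq \<longrightarrow> (\<forall>x>0. rq x = - z * r x - f x) \<longrightarrow> r square_integrable_on {0..} \<longrightarrow> rp square_integrable_on {0..} \<longrightarrow>
    B (l 0) (lp 0) (r 0) (rp 0) \<longrightarrow> l2norm UNIV (\<lambda>x. h x - glue l r x) \<le> \<kappa> * l2norm UNIV f)"

text \<open>The solution \<open>v\<close> equal to \<open>1\<close> on the right has a nonzero slope \<open>s\<close> on the left, because otherwise it
  would be a half-bound state. In \<open>interior_bound_nonresonant\<close> this becomes the factor
  \<open>s / \<epsilon>\<close>. The products \<open>w(x/\<epsilon>) v(y/\<epsilon>)\<close> grow like \<open>(1 + R (\<epsilon> + \<nu>) / \<epsilon>)\<close>, as
  \<open>\<nu> / \<epsilon>\<close> may be unbounded; the quotient is \<open>O(\<epsilon> + \<nu>)\<close>. The derivatives of \<open>h\<close> at the end points are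
  \<open>O(sup \<bar>h\<bar> + \<parallel>f\<parallel>)\<close> by \<open>outer_comparison\<close>, and the supremum is absorbed for small \<open>\<epsilon> + \<nu>\<close>.\<close>

lemma nonresonant_estimate:
  fixes \<Phi> \<Psi> :: "real \<Rightarrow> real"
  assumes \<Phi>: "\<Phi> \<in> borel_measurable lebesgue" "\<And>x. \<bar>\<Phi> x\<bar> \<le> M" "\<And>x. R \<le> \<bar>x\<bar> \<Longrightarrow> \<Phi> x = 0"
    and \<Psi>: "\<Psi> \<in> borel_measurable lebesgue" "\<And>x. \<bar>\<Psi> x\<bar> \<le> M" "\<And>x. R \<le> \<bar>x\<bar> \<Longrightarrow> \<Psi> x = 0"
    and R: "R > 0" and nres: "\<not> resonant \<Phi>" and k: "Re k > 0" "k\<^sup>2 = - z"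
  shows "\<exists>K>0. \<forall>\<epsilon> \<nu>. 0 < \<epsilon> \<longrightarrow> 0 < \<nu> \<longrightarrow> K * (\<epsilon> + \<nu>) < 1 \<longrightarrow>
    resolvent_estimate (\<lambda>x. \<Phi> (x / \<epsilon>) / \<epsilon>\<^sup>2 + \<Psi> (x / \<nu>) / \<nu>) (\<lambda>a a' b b'. a = 0 \<and> b = 0) z (K * sqrt (\<epsilon> + \<nu>))"
proof -
  obtain v v1 where v: "W2 v v1 (\<lambda>y. complex_of_real (\<Phi> y) * v y)" and vR: "\<And>y. y \<ge> R \<Longrightarrow> v y = 1 \<and> v1 y = 0"
    using zero_energy_right[OF \<Phi> R, of 1 0] by auto
  obtain w w1 where w: "W2 w w1 (\<lambda>y. complex_of_real (\<Phi> y) * w y)" and wR: "\<And>y. y \<le> -R \<Longrightarrow> w y = 1 \<and> w1 y = 0"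
    using zero_energy_left[OF \<Phi> R, of 1 0] by auto
  obtain Cv where Cv: "Cv \<ge> 0" "\<And>y. norm (v y) \<le> Cv + norm (v1 (- R)) * max 0 (- y)"
    using zero_energy_growth[OF v \<Phi>(3) R] vR[of R] by auto
  obtain Cw where Cw: "Cw \<ge> 0" "\<And>y. norm (w y) \<le> Cw + norm (w1 R) * max 0 y"
    using zero_energy_growth[OF w \<Phi>(3) R] wR[of "-R"] by auto
  define s where "s = v1 (- R)"
  have s0: "s \<noteq> 0"
  proof
    assume "s = 0"
    then have b: "norm (v y) \<le> Cv" for y using Cv(2)[of y] by (simp add: s_def)
    have "half_bound_state \<Phi> v"
      unfolding half_bound_state_def zero_energy_solution_W2
    proof (intro conjI)
      show "\<exists>u1. W2 v u1 (\<lambda>x. \<Phi> x *\<^sub>R v x)" using v by (auto simp: scaleR_conv_of_real)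
      show "bounded (range v)" using b by (auto simp: bounded_iff)
      show "\<exists>x. v x \<noteq> 0" using vR[of R] by (intro exI[of _ R]) auto
    qed
    then show False using nres by (auto simp: resonant_def)
  qed
  define C where "C = max (Cv + norm s) (Cw + norm (w1 R))"
  have C: "C \<ge> 0" "norm (v y) \<le> C * (1 + max 0 (- y))" "norm (w y) \<le> C * (1 + max 0 y)" for y
  proof -
    have gen: "X \<le> (A + B) * (1 + m)" if "X \<le> A + B * m" "A \<ge> 0" "B \<ge> 0" "m \<ge> 0" for X A B m :: real
    proof -
      have "(A + B) * (1 + m) = (A + B * m) + (A * m + B)" by (simp add: algebra_simps)
      moreover have "0 \<le> A * m" using that by simp
      ultimately show ?thesis using that by linarith
    qed
    show C0: "C \<ge> 0" using Cv(1) by (simp add: C_def le_max_iff_disj)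
    have "norm (v y) \<le> (Cv + norm s) * (1 + max 0 (- y))"
      unfolding s_def by (rule gen[OF Cv(2) Cv(1)]) auto
    also have "\<dots> \<le> C * (1 + max 0 (- y))" by (intro mult_right_mono) (auto simp: C_def)
    finally show "norm (v y) \<le> C * (1 + max 0 (- y))" .
    have "norm (w y) \<le> (Cw + norm (w1 R)) * (1 + max 0 y)"
      by (rule gen[OF Cw(2) Cw(1)]) auto
    also have "\<dots> \<le> C * (1 + max 0 y)" by (intro mult_right_mono) (auto simp: C_def)
    finally show "norm (w y) \<le> C * (1 + max 0 y)" .
  qed
  have M0: "M \<ge> 0" using order_trans[OF abs_ge_zero \<Phi>(2)] .
  define c where "c = 1 / sqrt (2 * Re k)"
  have c0: "c \<ge> 0" using k by (simp add: c_def)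
  define C1 where "C1 = 2 * R * M + 2 * R * norm z"
  define C2 where "C2 = sqrt (2 * R)"
  define C3 where "C3 = C\<^sup>2 / norm s * (1 + R)"
  define C4 where "C4 = 2 * norm k + C1"
  define C5 where "C5 = 2 * c + C2"
  define C6 where "C6 = 2 * C3 * C5"
  define C7 where "C7 = 2 * R * c * (1 + norm k)"
  define C8 where "C8 = R * (norm k * C7 + c)"
  define K where "K = 1 + 2 * R * norm k + 2 * C3 * C4 + (c * (2 * C6 + 2 * C8) + C2 * (C6 + C7))"
  have pos: "0 \<le> C1" "0 \<le> C2" "0 \<le> C3" "0 \<le> C4" "0 \<le> C5" "0 \<le> C6" "0 \<le> C7" "0 \<le> C8"
    using R M0 c0 C(1) by (auto simp: C1_def C2_def C3_def C4_def C5_def C6_def C7_def C8_def intro!: mult_nonneg_nonneg add_nonneg_nonneg)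
  have K: "K \<ge> 1" "2 * R * norm k \<le> K" "2 * C3 * C4 \<le> K" "c * (2 * C6 + 2 * C8) + C2 * (C6 + C7) \<le> K"
  proof -
    have 1: "0 \<le> 2 * R * norm k" "0 \<le> 2 * C3 * C4" "0 \<le> c * (2 * C6 + 2 * C8) + C2 * (C6 + C7)" using R pos c0 by auto
    then show "K \<ge> 1" "2 * R * norm k \<le> K" "2 * C3 * C4 \<le> K" "c * (2 * C6 + 2 * C8) + C2 * (C6 + C7) \<le> K"
      unfolding K_def by linarith+
  qed
  have main: "l2norm UNIV (\<lambda>x. h x - glue l r x) \<le> K * sqrt (\<epsilon> + \<nu>) * l2norm UNIV f"
    if en: "0 < \<epsilon>" "0 < \<nu>" "K * (\<epsilon> + \<nu>) < 1" and f: "f square_integrable_on UNIV"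
    and h: "W2 h h1 (\<lambda>x. (complex_of_real (\<Phi> (x / \<epsilon>) / \<epsilon>\<^sup>2 + \<Psi> (x / \<nu>) / \<nu>) - z) * h x - f x)" "h square_integrable_on UNIV" "h1 square_integrable_on UNIV"
    and l: "W2 l lp lq" "\<forall>x<0. lq x = k\<^sup>2 * l x - f x" "l square_integrable_on {..0}" "lp square_integrable_on {..0}"
    and r: "W2 r rp rq" "\<forall>x>0. rq x = k\<^sup>2 * r x - f x" "r square_integrable_on {0..}" "rp square_integrable_on {0..}"
    and bc: "l 0 = 0" "r 0 = 0" for \<epsilon> \<nu> f h h1 l lp lq r rp rq
  proof -
    define \<rho> where "\<rho> = \<epsilon> + \<nu>"
    define a where "a = R * \<rho>"
    define N where "N = l2norm UNIV f"
    have N0: "N \<ge> 0" by (simp add: N_def)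
    have \<rho>: "0 < \<rho>" "\<rho> < 1"
    proof -
      show "0 < \<rho>" using en by (simp add: \<rho>_def)
      have "1 * \<rho> \<le> K * \<rho>" using K(1) \<open>0 < \<rho>\<close> by (intro mult_right_mono) auto
      then show "\<rho> < 1" using en(3) by (simp add: \<rho>_def)
    qed
    have a: "0 < a" "a \<le> R" "R * \<epsilon> \<le> a" "R * \<nu> \<le> a" using R \<rho> en by (auto simp: a_def \<rho>_def intro: mult_left_le)
    have small: "X * \<rho> \<le> 1" if "X \<le> K" for X
      using mult_right_mono[OF that, of \<rho>] \<rho>(1) en(3) unfolding \<rho>_def by linarith
    have ak: "a * norm k \<le> 1/2" using small[OF K(2)] by (simp add: a_def algebra_simps)
    define V where "V x = \<Phi> (x / \<epsilon>) / \<epsilon>\<^sup>2 + \<Psi> (x / \<nu>) / \<nu>" for x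
    have big: "R \<le> \<bar>x / t\<bar>" if "0 < t" "R * t \<le> \<bar>x\<bar>" for x t using that by (simp add: abs_div pos_le_divide_eq)
    have V: "V x = 0" if "a \<le> \<bar>x\<bar>" for x
      using \<Phi>(3)[OF big[OF en(1), of x]] \<Psi>(3)[OF big[OF en(2), of x]] that a by (simp add: V_def)
    define W where "W x = \<Psi> (x / \<nu>) / \<nu>" for x
    have Wm: "W \<in> borel_measurable lebesgue"
      unfolding W_def[abs_def] using borel_measurable_affine[OF \<Psi>(1), of "1/\<nu>" 0] en(2) by simp
    have Wb: "\<bar>W x\<bar> \<le> M / \<nu>" for x unfolding W_def using \<Psi>(2)[of "x / \<nu>"] en(2) by (simp add: divide_right_mono)
    have W0: "W x = 0" if "R * \<nu> \<le> \<bar>x\<bar>" for x using \<Psi>(3)[OF big[OF en(2) that]] by (simp add: W_def)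
    define p where "p x = complex_of_real (\<Phi> (x / \<epsilon>) / \<epsilon>\<^sup>2)" for x
    define rr where "rr x = (complex_of_real (W x) - z) * h x - f x" for x
    have "(complex_of_real (\<Phi> (x / \<epsilon>) / \<epsilon>\<^sup>2 + \<Psi> (x / \<nu>) / \<nu>) - z) * h x - f x = p x * h x + rr x" for x
      by (simp add: p_def rr_def W_def algebra_simps)
    then have hp: "W2 h h1 (\<lambda>x. p x * h x + rr x)" using h(1) by (simp only:)
    have U: "W2 (\<lambda>x. v (x / \<epsilon>)) (\<lambda>x. v1 (x / \<epsilon>) / complex_of_real \<epsilon>) (\<lambda>x. p x * v (x / \<epsilon>))"
      unfolding p_def by (rule zero_energy_scaled[OF v en(1)])
    have P: "W2 (\<lambda>x. w (x / \<epsilon>)) (\<lambda>x. w1 (x / \<epsilon>) / complex_of_real \<epsilon>) (\<lambda>x. p x * w (x / \<epsilon>))"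
      unfolding p_def by (rule zero_energy_scaled[OF w en(1)])
    have ae: "R \<le> a / \<epsilon>" using a(3) en(1) by (simp add: pos_le_divide_eq)
    obtain xs where xs: "xs \<in> {-a..a}" "\<And>x. x \<in> {-a..a} \<Longrightarrow> norm (h x) \<le> norm (h xs)"
    proof -
      have "continuous_on {-a..a} (\<lambda>x. norm (h x))" by (intro continuous_intros W2D(4)[OF h(1)])
      from continuous_attains_sup[OF _ _ this] a(1) show thesis using that by auto
    qed
    define S where "S = norm (h xs)"
    have S: "norm (h x) \<le> S" if "-a \<le> x" "x \<le> a" for x using xs(2)[of x] that by (simp add: S_def)
    have S0: "S \<ge> 0" by (simp add: S_def)
    note rb = perturbation_integral_bound(1,2)[OF Wm Wb W0 _ a(4) W2D(4)[OF h(1)] S f, where z=z, folded rr_def N_def]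
    have E: "integral {-a..a} (\<lambda>s. norm (rr s)) \<le> C1 * S + C2 * N"
    proof -
      have "integral {-a..a} (\<lambda>s. norm (rr s)) \<le> (2 * (R * \<nu>) * (M / \<nu>) + 2 * a * norm z) * S + sqrt (2 * a) * N"
        by (rule rb(2)) (use R en in auto)
      also have "\<dots> \<le> C1 * S + C2 * N"
      proof (intro add_mono mult_right_mono S0 N0)
        show "2 * (R * \<nu>) * (M / \<nu>) + 2 * a * norm z \<le> C1" using en(2) a(2) by (simp add: C1_def mult_right_mono)
        show "sqrt (2 * a) \<le> C2" using a(2) by (simp add: C2_def)
      qed
      finally show ?thesis .
    qed
    have H: "norm (h1 a) \<le> norm k * S + c * N" "norm (h1 (- a)) \<le> norm k * S + c * N"
    proof -
      have "\<exists>T. (\<forall>x. -a \<le> x \<and> x \<le> 0 \<longrightarrow> norm (l x) \<le> T) \<and> (\<forall>x. 0 \<le> x \<and> x \<le> a \<longrightarrow> norm (r x) \<le> T)"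
      proof -
        have "bounded (l ` {-a..0})" "bounded (r ` {0..a})"
          by (intro compact_imp_bounded compact_continuous_image W2D(4)[OF l(1)] W2D(4)[OF r(1)]; simp)+
        then obtain T1 T2 where "\<forall>x\<in>{-a..0}. norm (l x) \<le> T1" "\<forall>x\<in>{0..a}. norm (r x) \<le> T2"
          by (auto simp: bounded_iff simp del: atLeastAtMost_iff)
        then show ?thesis by (intro exI[of _ "max T1 T2"]) (auto simp: le_max_iff_disj)
      qed
      then obtain T where T: "\<And>x. -a \<le> x \<Longrightarrow> x \<le> 0 \<Longrightarrow> norm (l x) \<le> T" "\<And>x. 0 \<le> x \<Longrightarrow> x \<le> a \<Longrightarrow> norm (r x) \<le> T" by blast
      have 1: "norm (h1 a + k * h a) \<le> c * N" "norm (- h1 (- a) + k * h (- a)) \<le> c * N"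
        unfolding N_def
        by (rule outer_comparison(3)[where V=V and S=S and T=T, OF k c_def _ a(1) f h[folded V_def] l(1) _ l(3,4) r(1) _ r(3,4)]
            outer_comparison(4)[where V=V and S=S and T=T, OF k c_def _ a(1) f h[folded V_def] l(1) _ l(3,4) r(1) _ r(3,4)];
            use V S T l(2) r(2) in blast)+
      have "norm (h1 a) \<le> norm (h1 a + k * h a) + norm (k * h a)" using norm_triangle_ineq4[of "h1 a + k * h a" "k * h a"] by simp
      also have "\<dots> \<le> c * N + norm k * S" using 1(1) S[of a] a(1) by (intro add_mono) (auto simp: norm_mult intro!: mult_left_mono)
      finally show "norm (h1 a) \<le> norm k * S + c * N" by simp
      have "norm (h1 (- a)) \<le> norm (- h1 (- a) + k * h (- a)) + norm (k * h (- a))"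
        using norm_triangle_ineq4[of "- h1 (- a) + k * h (- a)" "k * h (- a)"] by simp
      also have "\<dots> \<le> c * N + norm k * S" using 1(2) S[of "-a"] a(1) by (intro add_mono) (auto simp: norm_mult intro!: mult_left_mono)
      finally show "norm (h1 (- a)) \<le> norm k * S + c * N" by simp
    qed
    have L: "norm (w (x / \<epsilon>) * v (y / \<epsilon>)) \<le> C\<^sup>2 * (1 + a / \<epsilon>)" if xy: "- a \<le> x" "x \<le> y" "y \<le> a" for x y
    proof -
      have 1: "x / \<epsilon> \<le> a / \<epsilon>" "- (y / \<epsilon>) \<le> a / \<epsilon>" "x / \<epsilon> \<le> y / \<epsilon>" "0 \<le> a / \<epsilon>" using xy en(1) a(1) by (auto simp: field_simps)
      have "norm (w (x / \<epsilon>) * v (y / \<epsilon>)) \<le> (C * (1 + max 0 (x / \<epsilon>))) * (C * (1 + max 0 (- (y / \<epsilon>))))"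
        unfolding norm_mult using C by (intro mult_mono C) auto
      also have "\<dots> = C\<^sup>2 * ((1 + max 0 (x / \<epsilon>)) * (1 + max 0 (- (y / \<epsilon>))))" by (simp add: power2_eq_square)
      also have "(1 + max 0 (x / \<epsilon>)) * (1 + max 0 (- (y / \<epsilon>))) \<le> 1 + a / \<epsilon>"
        using 1 by (cases "x / \<epsilon> > 0") (auto simp: max_def)
      finally show ?thesis by (simp add: mult_left_mono)
    qed
    have key: "S * (norm s / \<epsilon>) \<le> C\<^sup>2 * (1 + a / \<epsilon>) * (norm (h1 a) + norm (h1 (- a)) + (C1 * S + C2 * N))"
    proof -
      have xs': "- a \<le> xs" "xs \<le> a" using xs(1) by auto
      have "norm (h xs) * norm (v1 (- a / \<epsilon>) / complex_of_real \<epsilon>) \<le> C\<^sup>2 * (1 + a / \<epsilon>) * (norm (h1 a) + norm (h1 (- a)) + (C1 * S + C2 * N))"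
        by (rule interior_bound_nonresonant[OF hp U P _ _ _ _ _ E L xs'])
           (use vR[OF ae] wR[of "- a / \<epsilon>"] ae rb(1) R en in auto)
      moreover have "v1 (- a / \<epsilon>) = s" unfolding s_def using zero_energy_outside(3)[OF v \<Phi>(3) R, of "- a / \<epsilon>"] ae by simp
      ultimately show ?thesis using en(1) by (simp add: S_def norm_divide)
    qed
    have "S \<le> C3 * \<rho> * (C4 * S + C5 * N)"
    proof -
      have "S = (S * (norm s / \<epsilon>)) * (\<epsilon> / norm s)" using s0 en(1) by simp
      also have "\<dots> \<le> (C\<^sup>2 * (1 + a / \<epsilon>) * (norm (h1 a) + norm (h1 (- a)) + (C1 * S + C2 * N))) * (\<epsilon> / norm s)"
        by (rule mult_right_mono[OF key]) (use en in simp)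
      also have "\<dots> = C\<^sup>2 / norm s * ((1 + a / \<epsilon>) * \<epsilon>) * (norm (h1 a) + norm (h1 (- a)) + (C1 * S + C2 * N))"
        by (simp only: times_divide_eq_right times_divide_eq_left mult_ac)
      also have "(1 + a / \<epsilon>) * \<epsilon> = \<epsilon> + a" using en(1) by (simp add: distrib_right)
      also have "C\<^sup>2 / norm s * (\<epsilon> + a) * (norm (h1 a) + norm (h1 (- a)) + (C1 * S + C2 * N))
          \<le> C\<^sup>2 / norm s * ((1 + R) * \<rho>) * (C4 * S + C5 * N)"
      proof (intro mult_mono)
        show "\<epsilon> + a \<le> (1 + R) * \<rho>" using en by (simp add: a_def \<rho>_def algebra_simps)
        show "norm (h1 a) + norm (h1 (- a)) + (C1 * S + C2 * N) \<le> C4 * S + C5 * N"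
          using H by (simp add: C4_def C5_def algebra_simps)
        show "0 \<le> norm (h1 a) + norm (h1 (- a)) + (C1 * S + C2 * N)" using pos S0 N0 by simp
      qed (use R \<rho> en a(1) in auto)
      finally show ?thesis by (simp add: C3_def mult_ac)
    qed
    also have "\<dots> = (C3 * C4 * \<rho>) * S + C3 * C5 * \<rho> * N" by (simp add: algebra_simps)
    also have "\<dots> \<le> 1/2 * S + C3 * C5 * \<rho> * N"
      using small[OF K(3)] S0 by (intro add_right_mono mult_right_mono) (auto simp: algebra_simps)
    finally have SN: "S \<le> C6 * \<rho> * N" by (simp add: C6_def algebra_simps)
    have subf: "f square_integrable_on {0..}" "f square_integrable_on {..0}" "l2norm {0..} f \<le> N" "l2norm {..0} f \<le> N"
      using sq_int_subset[OF f] by (auto simp: N_def)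
    note nr = near_zero_bound[OF r(1) _ r(3,4) subf(1) k(1) subf(3) c_def a(1) ak]
    note nl = near_zero_bound_left[OF l(1) _ l(3,4) subf(2) k(1) subf(4) c_def a(1) ak]
    define T where "T = 2 * a * c * N"
    have T: "T \<le> C7 * \<rho> * N" using R c0 N0 \<rho> by (simp add: T_def C7_def a_def algebra_simps)
    have Tl: "norm (l x) \<le> T" if "-a \<le> x" "x \<le> 0" for x using nl(2)[of x] l(2) that bc by (simp add: T_def)
    have Tr: "norm (r x) \<le> T" if "0 \<le> x" "x \<le> a" for x using nr(2)[of x] r(2) that bc by (simp add: T_def)
    have lr: "norm (l (- a)) \<le> C8 * \<rho> * N" "norm (r a) \<le> C8 * \<rho> * N"
    proof -
      have "a * (norm k * T + c * N) \<le> C8 * \<rho> * N"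
      proof -
        have "T \<le> C7 * N" using T mult_right_mono[of "C7 * \<rho>" "C7 * 1" N] \<rho> N0 pos(7) mult_left_mono[of \<rho> 1 C7] by linarith
        then have "norm k * T + c * N \<le> norm k * (C7 * N) + c * N" by (intro add_right_mono mult_left_mono) auto
        then have "a * (norm k * T + c * N) \<le> a * (norm k * (C7 * N) + c * N)" using a(1) by (intro mult_left_mono) auto
        also have "\<dots> = C8 * \<rho> * N" by (simp add: a_def C8_def algebra_simps)
        finally show ?thesis .
      qed
      then show "norm (l (- a)) \<le> C8 * \<rho> * N" "norm (r a) \<le> C8 * \<rho> * N"
        using nl(3)[of "-a"] nr(3)[of a] l(2) r(2) a(1) bc by (auto simp: T_def)
    qed
    have "l2norm UNIV (\<lambda>x. h x - glue l r x) \<le> c * (norm (h (- a) - l (- a)) + norm (h a - r a)) + sqrt (2 * a) * (S + T)"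
      by (rule outer_comparison(5)[where V=V, OF k c_def _ a(1) f h[folded V_def] l(1) _ l(3,4) r(1) _ r(3,4)];
          use V S Tl Tr l(2) r(2) in blast)
    also have "\<dots> \<le> c * ((C6 * \<rho> * N + C8 * \<rho> * N) + (C6 * \<rho> * N + C8 * \<rho> * N)) + (C2 * sqrt \<rho>) * (C6 * \<rho> * N + C7 * \<rho> * N)"
    proof (intro add_mono mult_left_mono mult_mono c0)
      show "norm (h (- a) - l (- a)) \<le> C6 * \<rho> * N + C8 * \<rho> * N"
        by (rule order_trans[OF norm_triangle_ineq4], rule add_mono[OF order_trans[OF S SN] lr(1)]) (use a in auto)
      show "norm (h a - r a) \<le> C6 * \<rho> * N + C8 * \<rho> * N"
        by (rule order_trans[OF norm_triangle_ineq4], rule add_mono[OF order_trans[OF S SN] lr(2)]) (use a in auto)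
      show "sqrt (2 * a) \<le> C2 * sqrt \<rho>" by (simp add: a_def C2_def real_sqrt_mult)
      show "0 \<le> C2 * sqrt \<rho>" using pos \<rho> by simp
      show "0 \<le> S + T" using S0 a c0 N0 by (simp add: T_def)
    qed (use SN T in auto)
    also have "\<dots> = (c * (2 * C6 + 2 * C8) + C2 * (C6 + C7) * sqrt \<rho>) * (\<rho> * N)" by (simp add: algebra_simps)
    also have "\<dots> \<le> (c * (2 * C6 + 2 * C8) + C2 * (C6 + C7)) * (\<rho> * N)"
      using pos \<rho> N0 by (intro mult_right_mono add_left_mono mult_left_le) auto
    also have "\<dots> \<le> K * (\<rho> * N)" using K(4) \<rho> N0 by (intro mult_right_mono) auto
    also have "\<dots> \<le> K * (sqrt \<rho> * N)"
    proof -
      have "\<rho> * \<rho> \<le> \<rho> * 1" using \<rho> by (intro mult_left_mono) auto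
      then have "\<rho> \<le> sqrt \<rho>" using \<rho> by (intro real_le_rsqrt) (simp add: power2_eq_square)
      then show ?thesis using K(1) N0 by (intro mult_left_mono mult_right_mono) auto
    qed
    finally show ?thesis by (simp add: \<rho>_def N_def mult.assoc)
  qed
  show ?thesis
  proof (intro exI[of _ K] conjI allI impI)
    fix \<epsilon> \<nu> :: real
    assume e: "0 < \<epsilon>" "0 < \<nu>" "K * (\<epsilon> + \<nu>) < 1"
    show "resolvent_estimate (\<lambda>x. \<Phi> (x / \<epsilon>) / \<epsilon>\<^sup>2 + \<Psi> (x / \<nu>) / \<nu>) (\<lambda>a a' b b'. a = 0 \<and> b = 0) z (K * sqrt (\<epsilon> + \<nu>))"
      unfolding resolvent_estimate_def k(2)[symmetric]
      by (intro allI impI, elim conjE, rule main[OF e]; assumption)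
  qed (use K(1) in simp)
qed

section \<open>The resonant case\<close>

text \<open>The arithmetic of absorbing the supremum \<open>S\<close> of \<open>\<bar>h\<bar>\<close>, which occurs on both sides of the a priori estimate; \<open>Dm\<close> is the deviation of \<open>h\<close>
  from the multiple of the half-bound state.\<close>

lemma absorb_bound:
  fixes S X N :: real
  assumes H: "H1 \<le> kk * X + c * N" and D: "Dm = C3 * \<rho> * (H1 + (C1 * S + C2 * N))" and S: "S \<le> C4 * X + Dm"
    and small: "2 * C3 * C1 * \<rho> \<le> 1" and \<rho>: "0 \<le> \<rho>" "\<rho> \<le> 1"
    and pos: "0 \<le> kk" "0 \<le> c" "0 \<le> C1" "0 \<le> C2" "0 \<le> C3" "0 \<le> C4" "0 \<le> X" "0 \<le> N" "0 \<le> S"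
    and C5: "C5 = 2 * C4 + 2 * C3 * (kk + c + C2)" and C6: "C6 = C3 * (kk + c + C1 * C5 + C2)"
  shows "S \<le> C5 * (X + N)" "Dm \<le> C6 * \<rho> * (X + N)"
proof -
  have Y: "kk * X + c * N + C2 * N \<le> (kk + c + C2) * (X + N)"
    using pos by (simp add: algebra_simps)
  have "Dm = C3 * \<rho> * (H1 + C2 * N) + (C3 * C1 * \<rho>) * S" unfolding D by (simp add: algebra_simps)
  also have "\<dots> \<le> C3 * \<rho> * ((kk + c + C2) * (X + N)) + 1/2 * S"
    using H Y small pos \<rho> by (intro add_mono mult_left_mono mult_right_mono) auto
  also have "C3 * \<rho> * ((kk + c + C2) * (X + N)) \<le> C3 * 1 * ((kk + c + C2) * (X + N))"
    using pos \<rho> by (intro mult_right_mono mult_left_mono) auto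
  finally have "S \<le> C4 * X + C3 * ((kk + c + C2) * (X + N)) + 1/2 * S" using S by linarith
  then have "S \<le> 2 * (C4 * X) + 2 * C3 * ((kk + c + C2) * (X + N))" by simp
  also have "\<dots> \<le> 2 * (C4 * (X + N)) + 2 * C3 * ((kk + c + C2) * (X + N))"
    using pos by (intro add_mono mult_left_mono) auto
  finally show S5: "S \<le> C5 * (X + N)" by (simp add: C5 algebra_simps)
  have "H1 + (C1 * S + C2 * N) \<le> (kk + c + C2) * (X + N) + C1 * (C5 * (X + N))"
    using H Y mult_left_mono[OF S5 pos(3)] by linarith
  then have "C3 * \<rho> * (H1 + (C1 * S + C2 * N)) \<le> C3 * \<rho> * ((kk + c + C2) * (X + N) + C1 * (C5 * (X + N)))"
    using pos \<rho> by (intro mult_left_mono) auto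
  then show "Dm \<le> C6 * \<rho> * (X + N)" unfolding D C6 by (simp add: algebra_simps)
qed

text \<open>The substitution \<open>x = \<nu> t\<close>: this is where the ratio \<open>\<nu> / \<epsilon>\<close> enters.\<close>

lemma scaled_square_integral:
  fixes \<Psi> :: "real \<Rightarrow> real" and u :: "real \<Rightarrow> complex"
  assumes \<Psi>: "\<Psi> \<in> borel_measurable lebesgue" "\<And>x. \<bar>\<Psi> x\<bar> \<le> M" "\<And>x. R \<le> \<bar>x\<bar> \<Longrightarrow> \<Psi> x = 0"
    and u: "continuous_on UNIV u" and en: "0 < \<epsilon>" "0 < \<nu>" "R * \<nu> \<le> a"
  shows "integral {-a..a} (\<lambda>x. complex_of_real (\<Psi> (x / \<nu>) / \<nu>) * (u (x / \<epsilon>) * u (x / \<epsilon>)))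
     = (LINT t|lebesgue. complex_of_real (\<Psi> t) * (u (\<nu> / \<epsilon> * t))\<^sup>2)"
proof -
  define F where "F x = complex_of_real (\<Psi> (x / \<nu>) / \<nu>) * (u (x / \<epsilon>) * u (x / \<epsilon>))" for x
  have m: "(\<lambda>x. complex_of_real (\<Psi> (x / \<nu>) / \<nu>)) \<in> borel_measurable lebesgue"
    using borel_measurable_affine[OF \<Psi>(1), of "1/\<nu>" 0] en(2) by simp
  have b: "norm (complex_of_real (\<Psi> (x / \<nu>) / \<nu>)) \<le> M / \<nu>" for x
    using \<Psi>(2)[of "x / \<nu>"] en(2) by (simp add: norm_divide divide_right_mono)
  have "(\<lambda>x. (u (x / \<epsilon>) * u (x / \<epsilon>)) * complex_of_real (\<Psi> (x / \<nu>) / \<nu>)) absolutely_integrable_on {-a..a}"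
  proof (rule set_integrable_mult_continuous[OF _ bounded_measurable_abs_integrable[OF m b]])
    show "continuous_on UNIV (\<lambda>x. u (x / \<epsilon>) * u (x / \<epsilon>))"
      using en by (intro continuous_intros continuous_on_compose2[OF u]) auto
  qed
  then have i: "F absolutely_integrable_on {-a..a}" unfolding F_def[abs_def] by (simp only: mult.commute)
  have z: "F x = 0" if "x \<notin> {-a..a}" for x
  proof -
    have "R * \<nu> \<le> \<bar>x\<bar>" using that en(3) by auto
    then have "R \<le> \<bar>x / \<nu>\<bar>" using en(2) by (simp add: abs_div pos_le_divide_eq)
    then show ?thesis using \<Psi>(3) by (simp add: F_def)
  qed
  have "integral {-a..a} F = (LINT x:{-a..a}|lebesgue. F x)" by (rule set_lebesgue_integral_eq_integral(2)[OF i, symmetric])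
  also have "\<dots> = (LINT x|lebesgue. F x)"
    using set_integral_supported[of "{-a..a}" F] z by (simp add: set_lebesgue_integral_def)
  also have "\<dots> = \<bar>\<nu>\<bar> *\<^sub>R (LINT x|lebesgue. F (0 + \<nu> * x))"
    by (rule lebesgue_integral_real_affine) (use en in simp)
  also have "\<dots> = (LINT x|lebesgue. \<bar>\<nu>\<bar> *\<^sub>R F (0 + \<nu> * x))" by simp
  also have "\<dots> = (LINT t|lebesgue. complex_of_real (\<Psi> t) * (u (\<nu> / \<epsilon> * t))\<^sup>2)"
    using en by (intro Bochner_Integration.integral_cong) (auto simp: F_def scaleR_conv_of_real power2_eq_square)
  finally show ?thesis unfolding F_def .
qed

text \<open>The second solution \<open>\<psi>\<close> grows at most linearly, so \<open>\<epsilon> \<psi>(x/\<epsilon>)\<close> is \<open>O(\<epsilon> + \<nu>)\<close> on the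
  interval while its Wronskian with \<open>u(x/\<epsilon>)\<close> is the constant \<open>up\<close>. Hence \<open>h\<close> is
  \<open>(h(-a) / um) u(x/\<epsilon>)\<close> up to \<open>O(\<epsilon> + \<nu>)\<close>, which gives the first transmission
  condition. In Lagrange's identity with \<open>u(x/\<epsilon>)\<close> the potential \<open>\<Psi>\<close> acts on that multiple
  and produces \<open>J\<close>, and everything else is small. The constants are passed as parameters since
  they have to be chosen before \<open>\<epsilon>\<close> and \<open>\<nu>\<close>.\<close>

lemma resonant_interior:
  fixes \<Phi> \<Psi> :: "real \<Rightarrow> real"
  assumes \<Phi>: "\<Phi> \<in> borel_measurable lebesgue" "\<And>x. \<bar>\<Phi> x\<bar> \<le> M" "\<And>x. R \<le> \<bar>x\<bar> \<Longrightarrow> \<Phi> x = 0"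
    and \<Psi>: "\<Psi> \<in> borel_measurable lebesgue" "\<And>x. \<bar>\<Psi> x\<bar> \<le> M" "\<And>x. R \<le> \<bar>x\<bar> \<Longrightarrow> \<Psi> x = 0" and R: "R > 0"
    and u: "W2 u u1 (\<lambda>y. complex_of_real (\<Phi> y) * u y)" "\<And>y. y \<ge> R \<Longrightarrow> u y = up \<and> u1 y = 0" "\<And>y. y \<le> -R \<Longrightarrow> u y = um \<and> u1 y = 0"
      "um \<noteq> 0" "up \<noteq> 0" "\<And>y. norm (u y) \<le> C" and \<theta>: "up = complex_of_real \<theta> * um"
    and \<psi>: "W2 \<psi> \<psi>1 (\<lambda>y. complex_of_real (\<Phi> y) * \<psi> y)" "\<psi>1 R = 1" "\<And>y. norm (\<psi> y) \<le> Cp * (1 + \<bar>y\<bar>)"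
    and J: "J = (LINT t|lebesgue. complex_of_real (\<Psi> t) * (u (\<nu> / \<epsilon> * t))\<^sup>2)" and \<omega>: "\<omega> * (um * up) = Jlim"
    and en: "0 < \<epsilon>" "0 < \<nu>" and \<rho>: "\<rho> = \<epsilon> + \<nu>" "\<rho> \<le> 1" and a: "a = R * \<rho>" and \<tau>: "\<tau> = sqrt \<rho> + norm (J - Jlim)"
    and f: "f square_integrable_on UNIV" "N = l2norm UNIV f"
    and h: "W2 h h1 (\<lambda>x. (complex_of_real (\<Phi> (x / \<epsilon>) / \<epsilon>\<^sup>2 + \<Psi> (x / \<nu>) / \<nu>) - z) * h x - f x)"
    and X: "X = norm (h (- a))" and H1: "norm (h1 (- a)) \<le> kk * X + c * N" and kc: "0 \<le> kk" "0 \<le> c"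
    and C1: "C1 = 2 * R * M + 2 * R * norm z" and C2: "C2 = sqrt (2 * R)" and C3: "C3 = 2 * C * (Cp * (1 + R)) / norm up"
    and C4: "C4 = C / norm um" and small: "2 * C3 * C1 * \<rho> \<le> 1"
    and C5: "C5 = 2 * C4 + 2 * C3 * (kk + c + C2)" and C6: "C6 = C3 * (kk + c + C1 * C5 + C2)"
    and C7: "C7 = (C * (2 * R * M * C6) + C * (2 * R * norm z * C5 + C2) + 1 / norm um) / norm up"
  shows "\<exists>S\<le>C5 * (X + N). \<forall>x. -a \<le> x \<and> x \<le> a \<longrightarrow> norm (h x) \<le> S"
    "norm (h a - complex_of_real \<theta> * h (- a)) \<le> C6 * \<rho> * (X + N)"
    "norm (h1 a - h1 (- a) / complex_of_real \<theta> - \<omega> * h (- a)) \<le> C7 * \<tau> * (X + N)"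
proof -
  have \<rho>0: "0 < \<rho>" using en \<rho> by simp
  have N0: "N \<ge> 0" by (simp add: f)
  have X0: "X \<ge> 0" by (simp add: X)
  have C0: "C \<ge> 0" using order_trans[OF norm_ge_zero u(6)] .
  have Cp0: "Cp \<ge> 0" using order_trans[OF norm_ge_zero \<psi>(3)[of 0]] by simp
  have M0: "M \<ge> 0" using order_trans[OF abs_ge_zero \<Phi>(2)] .
  have \<theta>0: "\<theta> \<noteq> 0" using \<theta> u(5) by auto
  have a': "0 < a" "a \<le> R" "R * \<epsilon> \<le> a" "R * \<nu> \<le> a" using R \<rho> en \<rho>0 by (auto simp: a intro: mult_left_le)
  have big: "R \<le> \<bar>x / t\<bar>" if "0 < t" "R * t \<le> \<bar>x\<bar>" for x t using that by (simp add: abs_div pos_le_divide_eq)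
  define W where "W x = \<Psi> (x / \<nu>) / \<nu>" for x
  have Wm: "W \<in> borel_measurable lebesgue"
    unfolding W_def[abs_def] using borel_measurable_affine[OF \<Psi>(1), of "1/\<nu>" 0] en(2) by simp
  have Wb: "\<bar>W x\<bar> \<le> M / \<nu>" for x unfolding W_def using \<Psi>(2)[of "x / \<nu>"] en(2) by (simp add: divide_right_mono)
  have W0: "W x = 0" if "R * \<nu> \<le> \<bar>x\<bar>" for x using \<Psi>(3)[OF big[OF en(2) that]] by (simp add: W_def)
  define p where "p x = complex_of_real (\<Phi> (x / \<epsilon>) / \<epsilon>\<^sup>2)" for x
  define rr where "rr x = (complex_of_real (W x) - z) * h x - f x" for x
  have "(complex_of_real (\<Phi> (x / \<epsilon>) / \<epsilon>\<^sup>2 + \<Psi> (x / \<nu>) / \<nu>) - z) * h x - f x = p x * h x + rr x" for x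
    by (simp add: p_def rr_def W_def algebra_simps)
  then have hp: "W2 h h1 (\<lambda>x. p x * h x + rr x)" using h by (simp only:)
  define U where "U x = u (x / \<epsilon>)" for x
  define U1 where "U1 x = u1 (x / \<epsilon>) / complex_of_real \<epsilon>" for x
  define P where "P x = complex_of_real \<epsilon> * \<psi> (x / \<epsilon>)" for x
  define P1 where "P1 x = complex_of_real \<epsilon> * (\<psi>1 (x / \<epsilon>) / complex_of_real \<epsilon>)" for x
  have U: "W2 U U1 (\<lambda>x. p x * U x)"
    unfolding p_def U_def U1_def by (rule zero_energy_scaled[OF u(1) en(1)])
  have P: "W2 P P1 (\<lambda>x. p x * P x)"
    using W2_cmult[OF zero_energy_scaled[OF \<psi>(1) en(1)], of "complex_of_real \<epsilon>"]
    unfolding p_def P_def[abs_def] P1_def[abs_def] by (simp only: mult.left_commute)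
  have ae: "R \<le> a / \<epsilon>" using a'(3) en(1) by (simp add: pos_le_divide_eq)
  have Ua: "U (- a) = um" "U1 (- a) = 0" "U a = up" "U1 a = 0"
    using u(2)[OF ae] u(3)[of "- a / \<epsilon>"] ae by (auto simp: U_def U1_def)
  have w: "U (- a) * P1 (- a) - U1 (- a) * P (- a) = up"
  proof -
    have "u (- a / \<epsilon>) * \<psi>1 (- a / \<epsilon>) - u1 (- a / \<epsilon>) * \<psi> (- a / \<epsilon>) = u R * \<psi>1 R - u1 R * \<psi> R"
      by (rule wronskian_const[OF u(1) \<psi>(1)])
    then show ?thesis using u(2)[of R] \<psi>(2) en(1) by (simp add: U_def U1_def P_def P1_def)
  qed
  have PL: "norm (P x) \<le> Cp * (1 + R) * \<rho>" if "-a \<le> x" "x \<le> a" for x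
  proof -
    have "norm (P x) \<le> \<epsilon> * (Cp * (1 + \<bar>x / \<epsilon>\<bar>))"
      unfolding P_def norm_mult using en(1) \<psi>(3)[of "x / \<epsilon>"] by (simp add: mult_left_mono)
    also have "\<dots> = Cp * (\<epsilon> + \<bar>x\<bar>)" using en(1) by (simp add: abs_div distrib_left)
    also have "\<dots> \<le> Cp * ((1 + R) * \<rho>)"
    proof (rule mult_left_mono[OF _ Cp0])
      have "\<bar>x\<bar> \<le> R * \<rho>" using that a by (simp add: abs_le_iff)
      moreover have "\<epsilon> \<le> \<rho>" using en \<rho> by simp
      ultimately show "\<epsilon> + \<bar>x\<bar> \<le> (1 + R) * \<rho>" by (simp add: distrib_right)
    qed
    finally show ?thesis by (simp add: mult.assoc)
  qed
  obtain xs where xs: "xs \<in> {-a..a}" "\<And>x. x \<in> {-a..a} \<Longrightarrow> norm (h x) \<le> norm (h xs)"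
  proof -
    have "continuous_on {-a..a} (\<lambda>x. norm (h x))" by (intro continuous_intros W2D(4)[OF h])
    from continuous_attains_sup[OF _ _ this] a'(1) show thesis using that by auto
  qed
  define S where "S = norm (h xs)"
  have S: "norm (h x) \<le> S" if "-a \<le> x" "x \<le> a" for x using xs(2)[of x] that by (simp add: S_def)
  have S0: "S \<ge> 0" by (simp add: S_def)
  have sq: "sqrt (2 * a) = C2 * sqrt \<rho>" by (simp add: a C2 real_sqrt_mult)
  have s1: "sqrt \<rho> \<le> 1" "\<rho> \<le> sqrt \<rho>"
  proof -
    show "sqrt \<rho> \<le> 1" using \<rho>(2) by simp
    have "\<rho> * \<rho> \<le> \<rho> * 1" using \<rho> \<rho>0 by (intro mult_left_mono) auto
    then show "\<rho> \<le> sqrt \<rho>" using \<rho>0 by (intro real_le_rsqrt) (simp add: power2_eq_square)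
  qed
  have C20: "C2 \<ge> 0" using R by (simp add: C2)
  have Rnu: "0 < R * \<nu>" using R en by simp
  note rb = perturbation_integral_bound(1,2)[OF Wm Wb W0 Rnu a'(4) W2D(4)[OF h] S f(1), where z=z, folded rr_def f(2)]
  have E: "integral {-a..a} (\<lambda>s. norm (rr s)) \<le> C1 * S + C2 * N"
  proof -
    have "integral {-a..a} (\<lambda>s. norm (rr s)) \<le> (2 * (R * \<nu>) * (M / \<nu>) + 2 * a * norm z) * S + sqrt (2 * a) * N"
      by (rule rb(2)) auto
    also have "\<dots> \<le> C1 * S + C2 * N"
    proof (intro add_mono mult_right_mono S0 N0)
      show "2 * (R * \<nu>) * (M / \<nu>) + 2 * a * norm z \<le> C1" using en(2) a'(2) by (simp add: C1 mult_right_mono)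
      show "sqrt (2 * a) \<le> C2" using a'(2) by (simp add: C2)
    qed
    finally show ?thesis .
  qed
  have rri: "rr absolutely_integrable_on {-a..a}" by (rule rb(1)) auto
  define Dm where "Dm = C3 * \<rho> * (norm (h1 (- a)) + (C1 * S + C2 * N))"
  have Dx: "norm (h x - U x * (h (- a) / um)) \<le> Dm" if x: "-a \<le> x" "x \<le> a" for x
  proof -
    have "norm (h x - U x * (h (- a) / um)) * norm up \<le> 2 * C * (Cp * (1 + R) * \<rho>) * (norm (h1 (- a)) + (C1 * S + C2 * N))"
      by (rule interior_bound_resonant[OF hp U P Ua(1,2) w u(4) rri E _ PL x]) (auto simp: U_def u(6))
    then have "norm (h x - U x * (h (- a) / um)) \<le> 2 * C * (Cp * (1 + R) * \<rho>) * (norm (h1 (- a)) + (C1 * S + C2 * N)) / norm up"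
      using u(5) by (simp add: pos_le_divide_eq)
    then show ?thesis by (simp add: Dm_def C3 mult_ac)
  qed
  have pos: "0 \<le> C1" "0 \<le> C3" "0 \<le> C4" using R M0 C0 Cp0 by (auto simp: C1 C3 C4)
  have SX: "S \<le> C4 * X + Dm"
  proof -
    have xs': "-a \<le> xs" "xs \<le> a" using xs(1) by auto
    have "S \<le> norm (U xs * (h (- a) / um)) + norm (h xs - U xs * (h (- a) / um))"
      unfolding S_def using norm_triangle_ineq[of "U xs * (h (- a) / um)" "h xs - U xs * (h (- a) / um)"] by simp
    also have "norm (U xs * (h (- a) / um)) \<le> C * (X / norm um)"
      unfolding norm_mult norm_divide X by (intro mult_right_mono) (auto simp: U_def u(6))
    finally show ?thesis using Dx[OF xs'] by (simp add: C4)
  qed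
  note ab = absorb_bound[OF H1 Dm_def SX small order_less_imp_le[OF \<rho>0] \<rho>(2) kc pos(1) C20 pos(2,3) X0 N0 S0 C5 C6]
  show "\<exists>S\<le>C5 * (X + N). \<forall>x. -a \<le> x \<and> x \<le> a \<longrightarrow> norm (h x) \<le> S" using ab(1) S by blast
  have e1: "h a - U a * (h (- a) / um) = h a - complex_of_real \<theta> * h (- a)" using u(4) Ua(3) \<theta> by simp
  show "norm (h a - complex_of_real \<theta> * h (- a)) \<le> C6 * \<rho> * (X + N)"
    using Dx[of a] ab(2) a'(1) unfolding e1 by simp
  define c0 where "c0 = h (- a) / um"
  have lag: "h1 a * up - h1 (- a) * um = integral {-a..a} (\<lambda>s. rr s * U s)"
    using lagrange_zero_energy[OF hp U, of "-a" a] a'(1) Ua by simp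
  define g1 where "g1 x = (complex_of_real (W x) - 0) * (h x - U x * c0) - 0" for x
  define g2 where "g2 x = (complex_of_real 0 - z) * h x - f x" for x
  have cU: "continuous_on UNIV U" by (rule W2D(4)[OF U])
  have zf: "(\<lambda>x. 0) square_integrable_on UNIV" by (rule square_integrable_zero)
  have nz: "l2norm UNIV (\<lambda>x. 0) = 0" by (simp add: l2norm_def set_lebesgue_integral_def)
  have g1i: "g1 absolutely_integrable_on {-a..a}" "integral {-a..a} (\<lambda>x. norm (g1 x)) \<le> 2 * R * M * Dm"
  proof -
    have cont: "continuous_on UNIV (\<lambda>x. h x - U x * c0)" by (intro continuous_intros cU W2D(4)[OF h])
    note q = perturbation_integral_bound(1,2)[OF Wm Wb W0 Rnu a'(4) cont Dx[folded c0_def] zf, where z=0, folded g1_def]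
    show "g1 absolutely_integrable_on {-a..a}" by (rule q(1)) auto
    have "integral {-a..a} (\<lambda>x. norm (g1 x)) \<le> (2 * (R * \<nu>) * (M / \<nu>) + 2 * a * norm (0::complex)) * Dm + sqrt (2 * a) * l2norm UNIV (\<lambda>x. 0)"
      by (rule q(2)) auto
    then show "integral {-a..a} (\<lambda>x. norm (g1 x)) \<le> 2 * R * M * Dm" using en(2) by (simp add: nz)
  qed
  have g2i: "g2 absolutely_integrable_on {-a..a}" "integral {-a..a} (\<lambda>x. norm (g2 x)) \<le> 2 * a * norm z * S + sqrt (2 * a) * N"
  proof -
    note q = perturbation_integral_bound(1,2)[of "\<lambda>x. 0" 0 a a h S f z, OF _ _ _ a'(1) order_refl W2D(4)[OF h] S f(1), folded g2_def f(2)]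
    show "g2 absolutely_integrable_on {-a..a}" by (rule q(1)) auto
    have "integral {-a..a} (\<lambda>x. norm (g2 x)) \<le> (2 * a * 0 + 2 * a * norm z) * S + sqrt (2 * a) * N" by (rule q(2)) auto
    then show "integral {-a..a} (\<lambda>x. norm (g2 x)) \<le> 2 * a * norm z * S + sqrt (2 * a) * N" by simp
  qed
  have Uc: "norm (U s) \<le> C" for s by (simp add: U_def u(6))
  have i1: "norm (integral {-a..a} (\<lambda>s. g1 s * U s)) \<le> C * (2 * R * M * Dm)"
    by (rule order_trans[OF norm_integral_mult_le[OF g1i(1) cU Uc] mult_left_mono[OF g1i(2) C0]])
  have i2: "norm (integral {-a..a} (\<lambda>s. g2 s * U s)) \<le> C * (2 * a * norm z * S + sqrt (2 * a) * N)"
    by (rule order_trans[OF norm_integral_mult_le[OF g2i(1) cU Uc] mult_left_mono[OF g2i(2) C0]])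
  have JW: "integral {-a..a} (\<lambda>x. complex_of_real (W x) * (U x * U x)) = J"
    unfolding J W_def U_def by (rule scaled_square_integral[OF \<Psi> W2D(4)[OF u(1)] en a'(4)])
  have ai: "(\<lambda>s. g s * U s) integrable_on {-a..a}" if "g absolutely_integrable_on {-a..a}" for g
    using set_lebesgue_integral_eq_integral(1)[OF set_integrable_mult_continuous[OF cU that]] by (simp add: mult.commute)
  have WUi: "(\<lambda>x. complex_of_real (W x) * (U x * U x)) integrable_on {-a..a}"
  proof -
    have Wc: "(\<lambda>x. complex_of_real (W x)) absolutely_integrable_on {-a..a}"
      by (rule bounded_measurable_abs_integrable[where M="M/\<nu>"]) (use Wm Wb in auto)
    have "(\<lambda>x. (U x * U x) * complex_of_real (W x)) absolutely_integrable_on {-a..a}"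
      by (rule set_integrable_mult_continuous[OF continuous_on_mult[OF cU cU] Wc])
    from set_lebesgue_integral_eq_integral(1)[OF this] show ?thesis by (simp add: mult.commute)
  qed
  have split: "integral {-a..a} (\<lambda>s. rr s * U s) = c0 * J + (integral {-a..a} (\<lambda>s. g1 s * U s) + integral {-a..a} (\<lambda>s. g2 s * U s))"
  proof -
    have "(\<lambda>s. rr s * U s) = (\<lambda>s. c0 * (complex_of_real (W s) * (U s * U s)) + (g1 s * U s + g2 s * U s))"
      by (simp add: fun_eq_iff rr_def g1_def g2_def algebra_simps)
    moreover have "((\<lambda>s. c0 * (complex_of_real (W s) * (U s * U s)) + (g1 s * U s + g2 s * U s)) has_integral
       (c0 * J + (integral {-a..a} (\<lambda>s. g1 s * U s) + integral {-a..a} (\<lambda>s. g2 s * U s)))) {-a..a}"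
      unfolding JW[symmetric]
      by (intro has_integral_add has_integral_mult_right integrable_integral WUi ai g1i g2i)
    ultimately show ?thesis by (simp only: integral_unique)
  qed
  define e2 where "e2 = h1 a - h1 (- a) / complex_of_real \<theta> - \<omega> * h (- a)"
  have "up * e2 = (h1 a * up - h1 (- a) * um) - Jlim * c0"
    using \<theta>0 u(4) \<omega>[symmetric] \<theta> by (simp add: e2_def c0_def field_simps)
  also have "\<dots> = c0 * (J - Jlim) + (integral {-a..a} (\<lambda>s. g1 s * U s) + integral {-a..a} (\<lambda>s. g2 s * U s))"
    unfolding lag split by (simp add: algebra_simps)
  finally have "norm up * norm e2 = norm (c0 * (J - Jlim) + (integral {-a..a} (\<lambda>s. g1 s * U s) + integral {-a..a} (\<lambda>s. g2 s * U s)))"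
    by (simp flip: norm_mult)
  also have "\<dots> \<le> norm (c0 * (J - Jlim)) + (norm (integral {-a..a} (\<lambda>s. g1 s * U s)) + norm (integral {-a..a} (\<lambda>s. g2 s * U s)))"
    by (intro order_trans[OF norm_triangle_ineq] add_mono order_refl norm_triangle_ineq)
  also have "\<dots> \<le> (X / norm um) * norm (J - Jlim) + (C * (2 * R * M * Dm) + C * (2 * a * norm z * S + sqrt (2 * a) * N))"
    using i1 i2 by (intro add_mono) (auto simp: norm_mult norm_divide c0_def X)
  also have "\<dots> \<le> (1 / norm um * \<tau> * (X + N)) + (C * (2 * R * M * (C6 * \<tau> * (X + N))) + C * (2 * R * norm z * C5 * \<tau> * (X + N) + C2 * \<tau> * (X + N)))"
  proof (intro add_mono mult_left_mono C0)
    have \<tau>': "\<rho> \<le> \<tau>" "sqrt \<rho> \<le> \<tau>" "norm (J - Jlim) \<le> \<tau>" "0 \<le> \<tau>" proof -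
      show 1: "sqrt \<rho> \<le> \<tau>" and 2: "norm (J - Jlim) \<le> \<tau>" using \<rho>0 unfolding \<tau> by auto
      show "\<rho> \<le> \<tau>" using s1(2) 1 by linarith
      show "0 \<le> \<tau>" using order_trans[OF norm_ge_zero 2] .
    qed
    have C60: "0 \<le> C6" and C50: "0 \<le> C5"
      unfolding C5 C6 using pos kc C20 by (auto intro!: mult_nonneg_nonneg add_nonneg_nonneg)
    show "X / norm um * norm (J - Jlim) \<le> 1 / norm um * \<tau> * (X + N)"
    proof -
      have "X * norm (J - Jlim) \<le> (X + N) * \<tau>" using \<tau>' X0 N0 by (intro mult_mono) auto
      then show ?thesis by (simp add: divide_right_mono mult.commute)
    qed
    show "Dm \<le> C6 * \<tau> * (X + N)"
      by (rule order_trans[OF ab(2)]) (use \<tau>' C60 X0 N0 in \<open>intro mult_right_mono mult_left_mono; simp\<close>)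
    show "0 \<le> 2 * R * M" using R M0 by simp
    show "2 * a * norm z * S \<le> 2 * R * norm z * C5 * \<tau> * (X + N)"
    proof -
      have "2 * a * norm z * S = (2 * R * norm z) * (\<rho> * S)" by (simp add: a)
      also have "\<dots> \<le> (2 * R * norm z) * (\<tau> * (C5 * (X + N)))"
        using ab(1) \<tau>' S0 R by (intro mult_left_mono mult_mono) auto
      finally show ?thesis by (simp add: mult_ac)
    qed
    show "sqrt (2 * a) * N \<le> C2 * \<tau> * (X + N)"
      unfolding sq using \<tau>' X0 N0 C20 \<rho>0 by (intro mult_mono mult_left_mono) auto
  qed
  also have "\<dots> = norm up * (C7 * \<tau> * (X + N))" using u(5) by (simp add: C7 field_simps)
  finally have "norm e2 \<le> C7 * \<tau> * (X + N)" using u(5) by simp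
  then show "norm (h1 a - h1 (- a) / complex_of_real \<theta> - \<omega> * h (- a)) \<le> C7 * \<tau> * (X + N)" by (simp add: e2_def)
qed

text \<open>The deviations \<open>dm = h(-a) - l(-a)\<close> and \<open>dp = h(a) - r(a)\<close> satisfy the two transmission conditions up
  to errors, and their derivatives are \<open>k dm\<close> and \<open>- k dp\<close> by \<open>outer_comparison\<close>. Eliminating \<open>dp\<close> leaves
  \<open>D dm\<close> equal to an error. The error still contains \<open>\<bar>h(-a)\<bar>\<close>, hence \<open>dm\<close>, with a small factor,
  and is absorbed.\<close>

lemma resonant_estimate:
  fixes \<Phi> \<Psi> :: "real \<Rightarrow> real"
  assumes \<Phi>: "\<Phi> \<in> borel_measurable lebesgue" "\<And>x. \<bar>\<Phi> x\<bar> \<le> M" "\<And>x. R \<le> \<bar>x\<bar> \<Longrightarrow> \<Phi> x = 0"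
    and \<Psi>: "\<Psi> \<in> borel_measurable lebesgue" "\<And>x. \<bar>\<Psi> x\<bar> \<le> M" "\<And>x. R \<le> \<bar>x\<bar> \<Longrightarrow> \<Psi> x = 0" and R: "R > 0"
    and u: "W2 u u1 (\<lambda>y. complex_of_real (\<Phi> y) * u y)" "\<And>y. y \<ge> R \<Longrightarrow> u y = up \<and> u1 y = 0" "\<And>y. y \<le> -R \<Longrightarrow> u y = um \<and> u1 y = 0"
      "um \<noteq> 0" "up \<noteq> 0" "\<And>y. norm (u y) \<le> C" and \<theta>: "up = complex_of_real \<theta> * um"
    and \<omega>: "complex_of_real \<omega> * (um * up) = Jlim"
    and k: "Re k > 0" "k\<^sup>2 = - z" "Im k \<noteq> 0"
  shows "\<exists>K>0. \<forall>\<epsilon> \<nu> \<tau>. 0 < \<epsilon> \<longrightarrow> 0 < \<nu> \<longrightarrow>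
    \<tau> = sqrt (\<epsilon> + \<nu>) + norm ((LINT t|lebesgue. complex_of_real (\<Psi> t) * (u (\<nu> / \<epsilon> * t))\<^sup>2) - Jlim) \<longrightarrow> K * \<tau> < 1 \<longrightarrow>
    resolvent_estimate (\<lambda>x. \<Phi> (x / \<epsilon>) / \<epsilon>\<^sup>2 + \<Psi> (x / \<nu>) / \<nu>)
      (\<lambda>a a' b b'. b = complex_of_real \<theta> * a \<and> b' = complex_of_real \<omega> * a + a' / complex_of_real \<theta>) z (K * \<tau>)"
proof -
  obtain \<psi> \<psi>1 where \<psi>: "W2 \<psi> \<psi>1 (\<lambda>y. complex_of_real (\<Phi> y) * \<psi> y)" and \<psi>R: "\<And>y. y \<ge> R \<Longrightarrow> \<psi> y = 0 + 1 * complex_of_real y \<and> \<psi>1 y = 1"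
    using zero_energy_right[OF \<Phi> R, of 0 1] by blast
  obtain C0 where C0: "C0 \<ge> 0" "\<And>y. norm (\<psi> y) \<le> C0 + norm (\<psi>1 R) * max 0 y + norm (\<psi>1 (- R)) * max 0 (- y)"
    using zero_energy_growth[OF \<psi> \<Phi>(3) R] by blast
  define Cp where "Cp = C0 + norm (\<psi>1 R) + norm (\<psi>1 (- R))"
  have Cp: "norm (\<psi> y) \<le> Cp * (1 + \<bar>y\<bar>)" for y
  proof -
    have "norm (\<psi> y) \<le> C0 + norm (\<psi>1 R) * \<bar>y\<bar> + norm (\<psi>1 (- R)) * \<bar>y\<bar>"
      by (rule order_trans[OF C0(2)]) (intro add_mono mult_left_mono; simp)
    also have "\<dots> \<le> C0 * (1 + \<bar>y\<bar>) + norm (\<psi>1 R) * (1 + \<bar>y\<bar>) + norm (\<psi>1 (- R)) * (1 + \<bar>y\<bar>)"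
      using C0(1) by (intro add_mono mult_left_mono) (auto simp: algebra_simps)
    finally show ?thesis by (simp add: Cp_def algebra_simps)
  qed
  have \<theta>0: "\<theta> \<noteq> 0" using \<theta> u(5) by auto
  \<comment> \<open>The determinant of the transmission problem. The same number controls \<open>l(0)\<close> below.\<close>
  define D where "D = k * complex_of_real \<theta> + k / complex_of_real \<theta> + complex_of_real \<omega>"
  have D0: "D \<noteq> 0"
  proof
    assume "D = 0"
    have "Im D = Im k * (\<theta> + 1 / \<theta>)" using \<theta>0 by (simp add: D_def algebra_simps)
    then have "\<theta> + 1 / \<theta> = 0" using \<open>D = 0\<close> k(3) by simp
    then have "\<theta>\<^sup>2 + 1 = 0" using \<theta>0 by (simp add: field_simps power2_eq_square)
    then show False using zero_le_power2[of \<theta>] by linarith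
  qed
  have M0: "M \<ge> 0" using order_trans[OF abs_ge_zero \<Phi>(2)] .
  have CC0: "C \<ge> 0" using order_trans[OF norm_ge_zero u(6)] .
  have Cp0: "Cp \<ge> 0" using order_trans[OF norm_ge_zero Cp[of 0]] by simp
  define c where "c = 1 / sqrt (2 * Re k)"
  have c0: "c \<ge> 0" using k by (simp add: c_def)
  define kk where "kk = norm k"
  define C1 where "C1 = 2 * R * M + 2 * R * norm z"
  define C2 where "C2 = sqrt (2 * R)"
  define C3 where "C3 = 2 * C * (Cp * (1 + R)) / norm up"
  define C4 where "C4 = C / norm um"
  define C5 where "C5 = 2 * C4 + 2 * C3 * (kk + c + C2)"
  define C6 where "C6 = C3 * (kk + c + C1 * C5 + C2)"
  define C7 where "C7 = (C * (2 * R * M * C6) + C * (2 * R * norm z * C5 + C2) + 1 / norm um) / norm up"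
  define C8 where "C8 = (c + c / \<bar>\<theta>\<bar>) / norm D"
  define C9 where "C9 = C8 * (1 + \<bar>\<theta>\<bar>)"
  define C10 where "C10 = 2 * C9 + 2 * R * c"
  define C11 where "C11 = R * (kk * C10 + c)"
  define C12 where "C12 = R * kk\<^sup>2 * C10 + sqrt R"
  define G1 where "G1 = (1 + \<bar>\<theta>\<bar>) * C11"
  define G2 where "G2 = C12 + C12 / \<bar>\<theta>\<bar> + \<bar>\<omega>\<bar> * C11"
  define C13 where "C13 = (kk * (C6 + G1) + (C7 + G2)) / norm D"
  define C14 where "C14 = 2 * C13 * (C10 + 1)"
  define C15 where "C15 = C14 + C10 + 1"
  define C16 where "C16 = \<bar>\<theta>\<bar> * C14 + C6 * C15 + G1"
  define K0 where "K0 = c * (C14 + C16) + C2 * (C5 * C15 + C10)"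
  define K where "K = 1 + 2 * R * kk + 2 * C3 * C1 + 2 * C13 + K0"
  have kk0: "0 \<le> kk" by (simp add: kk_def)
  have pos: "0 \<le> C1" "0 \<le> C2" "0 \<le> C3" "0 \<le> C4" using R M0 c0 CC0 Cp0 by (auto simp: C1_def C2_def C3_def C4_def)
  have pos2: "0 \<le> C5" using pos kk0 c0 by (simp add: C5_def)
  have pos3: "0 \<le> C6" using pos pos2 kk0 c0 by (simp add: C6_def)
  have pos4: "0 \<le> C7" using pos pos2 pos3 R M0 CC0 by (simp add: C7_def)
  have pos5: "0 \<le> C8" using c0 by (simp add: C8_def)
  have pos6: "0 \<le> C9" using pos5 by (simp add: C9_def)
  have pos7: "0 \<le> C10" using pos6 R c0 by (simp add: C10_def)
  have pos8: "0 \<le> C11" "0 \<le> C12" using pos7 R c0 kk0 by (simp_all add: C11_def C12_def)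
  have pos9: "0 \<le> G1" "0 \<le> G2" using pos8 by (simp_all add: G1_def G2_def)
  have pos10: "0 \<le> C13" using pos3 pos4 pos9 kk0 by (simp add: C13_def)
  have pos11: "0 \<le> C14" using pos10 pos7 by (simp add: C14_def)
  have pos12: "0 \<le> C15" using pos11 pos7 by (simp add: C15_def)
  have pos13: "0 \<le> C16" using pos11 pos3 pos12 pos9 by (simp add: C16_def)
  have pos14: "0 \<le> K0" using c0 pos11 pos13 pos pos2 pos12 pos7 by (simp add: K0_def)
  have K: "1 \<le> K" "2 * R * kk \<le> K" "2 * C3 * C1 \<le> K" "2 * C13 \<le> K" "K0 \<le> K"
  proof -
    have "0 \<le> 2 * R * kk" "0 \<le> 2 * C3 * C1" using R kk0 pos by auto
    then show "1 \<le> K" "2 * R * kk \<le> K" "2 * C3 * C1 \<le> K" "2 * C13 \<le> K" "K0 \<le> K"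
      unfolding K_def using pos10 pos14 by linarith+
  qed
  have main: "l2norm UNIV (\<lambda>x. h x - glue l r x) \<le> K * \<tau> * l2norm UNIV f"
    if en: "0 < \<epsilon>" "0 < \<nu>" and \<tau>: "\<tau> = sqrt (\<epsilon> + \<nu>) + norm ((LINT t|lebesgue. complex_of_real (\<Psi> t) * (u (\<nu> / \<epsilon> * t))\<^sup>2) - Jlim)"
    and K\<tau>: "K * \<tau> < 1" and f: "f square_integrable_on UNIV"
    and h: "W2 h h1 (\<lambda>x. (complex_of_real (\<Phi> (x / \<epsilon>) / \<epsilon>\<^sup>2 + \<Psi> (x / \<nu>) / \<nu>) - z) * h x - f x)" "h square_integrable_on UNIV" "h1 square_integrable_on UNIV"
    and l: "W2 l lp lq" "\<forall>x<0. lq x = k\<^sup>2 * l x - f x" "l square_integrable_on {..0}" "lp square_integrable_on {..0}"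
    and r: "W2 r rp rq" "\<forall>x>0. rq x = k\<^sup>2 * r x - f x" "r square_integrable_on {0..}" "rp square_integrable_on {0..}"
    and bc: "r 0 = complex_of_real \<theta> * l 0" "rp 0 = complex_of_real \<omega> * l 0 + lp 0 / complex_of_real \<theta>" for \<epsilon> \<nu> \<tau> f h h1 l lp lq r rp rq
  proof -
    define \<rho> where "\<rho> = \<epsilon> + \<nu>"
    define J where "J = (LINT t|lebesgue. complex_of_real (\<Psi> t) * (u (\<nu> / \<epsilon> * t))\<^sup>2)"
    have \<tau>': "\<tau> = sqrt \<rho> + norm (J - Jlim)" unfolding \<rho>_def J_def by (rule \<tau>)
    have \<rho>0: "0 < \<rho>" using en by (simp add: \<rho>_def)
    have s\<tau>: "sqrt \<rho> \<le> \<tau>" unfolding \<tau>' by simp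
    have \<tau>0: "0 \<le> \<tau>" by (rule order_trans[OF _ s\<tau>]) (use \<rho>0 in simp)
    have small: "Y * \<tau> \<le> 1" if "Y \<le> K" for Y using mult_right_mono[OF that \<tau>0] K\<tau> by linarith
    have \<tau>1: "\<tau> \<le> 1" using small[OF K(1)] by simp
    have "sqrt \<rho> \<le> 1" using s\<tau> \<tau>1 by linarith
    then have \<rho>1: "\<rho> \<le> 1" by simp
    have \<rho>s: "\<rho> \<le> sqrt \<rho>"
    proof -
      have "\<rho> * \<rho> \<le> \<rho> * 1" using \<rho>0 \<rho>1 by (intro mult_left_mono) auto
      then show ?thesis using \<rho>0 by (intro real_le_rsqrt) (simp add: power2_eq_square)
    qed
    have \<rho>\<tau>: "\<rho> \<le> \<tau>" using \<rho>s s\<tau> by linarith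
    have small\<rho>: "Y * \<rho> \<le> 1" if "Y \<le> K" "0 \<le> Y" for Y using mult_left_mono[OF \<rho>\<tau> that(2)] small[OF that(1)] by linarith
    define a where "a = R * \<rho>"
    define N where "N = l2norm UNIV f"
    have N0: "N \<ge> 0" by (simp add: N_def)
    have a: "0 < a" "a \<le> R" "R * \<epsilon> \<le> a" "R * \<nu> \<le> a" using R \<rho>0 \<rho>1 en by (auto simp: a_def \<rho>_def intro: mult_left_le)
    have ak: "a * norm k \<le> 1/2" using small\<rho>[OF K(2)] R by (simp add: a_def kk_def algebra_simps)
    define V where "V x = \<Phi> (x / \<epsilon>) / \<epsilon>\<^sup>2 + \<Psi> (x / \<nu>) / \<nu>" for x
    have big: "R \<le> \<bar>x / t\<bar>" if "0 < t" "R * t \<le> \<bar>x\<bar>" for x t using that by (simp add: abs_div pos_le_divide_eq)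
    have V: "V x = 0" if "a \<le> \<bar>x\<bar>" for x
      using \<Phi>(3)[OF big[OF en(1), of x]] \<Psi>(3)[OF big[OF en(2), of x]] that a by (simp add: V_def)
    have subf: "f square_integrable_on {0..}" "f square_integrable_on {..0}" "l2norm {0..} f \<le> N" "l2norm {..0} f \<le> N"
      using sq_int_subset[OF f] by (auto simp: N_def)
    note nr = near_zero_bound[OF r(1) _ r(3,4) subf(1) k(1) subf(3) c_def a(1) ak]
    note nl = near_zero_bound_left[OF l(1) _ l(3,4) subf(2) k(1) subf(4) c_def a(1) ak]
    have l0: "norm (l 0) \<le> C8 * N"
    proof -
      have "D * l 0 = (rp 0 + k * r 0) + (- lp 0 + k * l 0) / complex_of_real \<theta>"
        using \<theta>0 unfolding bc D_def by (simp add: field_simps)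
      then have "norm D * norm (l 0) \<le> norm (rp 0 + k * r 0) + norm (- lp 0 + k * l 0) / \<bar>\<theta>\<bar>"
        by (metis norm_mult norm_triangle_ineq norm_divide norm_of_real)
      also have "\<dots> \<le> c * N + c * N / \<bar>\<theta>\<bar>"
        using nr(1) nl(1) l(2) r(2) by (intro add_mono divide_right_mono) auto
      finally have "norm (l 0) \<le> (c * N + c * N / \<bar>\<theta>\<bar>) / norm D" using D0 by (simp add: pos_le_divide_eq mult.commute)
      also have "\<dots> = C8 * N" by (simp add: C8_def algebra_simps add_divide_distrib)
      finally show ?thesis .
    qed
    have lr0: "norm (l 0) \<le> C9 * N" "norm (r 0) \<le> C9 * N"
    proof -
      have "C8 * N * 1 \<le> C8 * N * (1 + \<bar>\<theta>\<bar>)" using pos5 N0 by (intro mult_left_mono) auto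
      then show "norm (l 0) \<le> C9 * N" using l0 by (simp add: C9_def mult_ac)
      have "norm (r 0) \<le> \<bar>\<theta>\<bar> * (C8 * N)" unfolding bc norm_mult using l0 by (simp add: mult_left_mono)
      also have "\<dots> \<le> C9 * N" using pos5 N0 by (simp add: C9_def algebra_simps)
      finally show "norm (r 0) \<le> C9 * N" .
    qed
    have T: "2 * norm (l 0) + 2 * a * c * N \<le> C10 * N" "2 * norm (r 0) + 2 * a * c * N \<le> C10 * N"
    proof -
      have "2 * a * c * N \<le> 2 * R * c * N" using a c0 N0 by (intro mult_right_mono mult_left_mono) auto
      then show "2 * norm (l 0) + 2 * a * c * N \<le> C10 * N" "2 * norm (r 0) + 2 * a * c * N \<le> C10 * N"
        using lr0 by (simp_all add: C10_def distrib_right)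
    qed
    have Tl: "norm (l x) \<le> C10 * N" if "-a \<le> x" "x \<le> 0" for x
      by (rule order_trans[OF nl(2) T(1)]) (use l(2) that in auto)
    have Tr: "norm (r x) \<le> C10 * N" if "0 \<le> x" "x \<le> a" for x
      by (rule order_trans[OF nr(2) T(2)]) (use r(2) that in auto)
    have b3: "a * (norm k * Y + c * N) \<le> C11 * \<tau> * N" if "Y \<le> C10 * N" for Y
    proof -
      have "a * (norm k * Y + c * N) \<le> a * (norm k * (C10 * N) + c * N)" using that a(1) by (intro mult_left_mono add_right_mono) auto
      also have "\<dots> = C11 * \<rho> * N" by (simp add: a_def C11_def kk_def algebra_simps)
      also have "\<dots> \<le> C11 * \<tau> * N" using pos8 \<rho>\<tau> N0 by (intro mult_right_mono mult_left_mono) auto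
      finally show ?thesis .
    qed
    have b4: "a * (norm k)\<^sup>2 * Y + sqrt a * N \<le> C12 * \<tau> * N" if "Y \<le> C10 * N" for Y
    proof -
      have "a * (norm k)\<^sup>2 * Y \<le> a * (norm k)\<^sup>2 * (C10 * N)" using that a(1) by (intro mult_left_mono) auto
      also have "\<dots> = (R * kk\<^sup>2 * C10 * N) * \<rho>" by (simp add: a_def kk_def mult_ac)
      also have "\<dots> \<le> (R * kk\<^sup>2 * C10 * N) * \<tau>" using R pos7 N0 \<rho>\<tau> by (intro mult_left_mono) auto
      finally have 1: "a * (norm k)\<^sup>2 * Y \<le> (R * kk\<^sup>2 * C10 * N) * \<tau>" .
      have "sqrt a * N = (sqrt R * N) * sqrt \<rho>" by (simp add: a_def real_sqrt_mult mult_ac)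
      also have "\<dots> \<le> (sqrt R * N) * \<tau>" using R N0 s\<tau> by (intro mult_left_mono) auto
      finally show ?thesis using 1 by (simp add: C12_def algebra_simps)
    qed
    have dl: "norm (l (- a) - l 0) \<le> C11 * \<tau> * N" "norm (lp (- a) - lp 0) \<le> C12 * \<tau> * N"
      by (rule order_trans[OF nl(3) b3[OF T(1)]]; use l(2) a(1) in simp)
         (rule order_trans[OF nl(4) b4[OF T(1)]]; use l(2) in simp)
    have dr: "norm (r a - r 0) \<le> C11 * \<tau> * N" "norm (rp a - rp 0) \<le> C12 * \<tau> * N"
      by (rule order_trans[OF nr(3) b3[OF T(2)]]; use r(2) a(1) in simp)
         (rule order_trans[OF nr(4) b4[OF T(2)]]; use r(2) in simp)
    define g1 where "g1 = r a - complex_of_real \<theta> * l (- a)"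
    define g2 where "g2 = rp a - lp (- a) / complex_of_real \<theta> - complex_of_real \<omega> * l (- a)"
    have g1b: "norm g1 \<le> G1 * \<tau> * N"
    proof -
      have "g1 = (r a - r 0) - complex_of_real \<theta> * (l (- a) - l 0)" unfolding g1_def bc by (simp add: algebra_simps)
      then have "norm g1 \<le> norm (r a - r 0) + \<bar>\<theta>\<bar> * norm (l (- a) - l 0)"
        using norm_triangle_ineq4[of "r a - r 0" "complex_of_real \<theta> * (l (- a) - l 0)"] by (simp add: norm_mult)
      also have "\<dots> \<le> C11 * \<tau> * N + \<bar>\<theta>\<bar> * (C11 * \<tau> * N)" by (intro add_mono mult_left_mono dl dr) auto
      finally show ?thesis by (simp add: G1_def algebra_simps)
    qed
    have g2b: "norm g2 \<le> G2 * \<tau> * N"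
    proof -
      have "g2 = (rp a - rp 0) - (lp (- a) - lp 0) / complex_of_real \<theta> - complex_of_real \<omega> * (l (- a) - l 0)"
        unfolding g2_def bc by (simp add: algebra_simps diff_divide_distrib)
      then have "norm g2 \<le> norm (rp a - rp 0) + norm (lp (- a) - lp 0) / \<bar>\<theta>\<bar> + \<bar>\<omega>\<bar> * norm (l (- a) - l 0)"
        using norm_triangle_ineq4[of "(rp a - rp 0) - (lp (- a) - lp 0) / complex_of_real \<theta>" "complex_of_real \<omega> * (l (- a) - l 0)"]
          norm_triangle_ineq4[of "rp a - rp 0" "(lp (- a) - lp 0) / complex_of_real \<theta>"] by (simp add: norm_mult norm_divide)
      also have "\<dots> \<le> C12 * \<tau> * N + C12 * \<tau> * N / \<bar>\<theta>\<bar> + \<bar>\<omega>\<bar> * (C11 * \<tau> * N)"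
        by (intro add_mono mult_left_mono divide_right_mono dl dr) auto
      finally show ?thesis by (simp add: G2_def algebra_simps)
    qed
    have ex_S: "\<exists>S. \<forall>x. -a \<le> x \<and> x \<le> a \<longrightarrow> norm (h x) \<le> S"
    proof -
      have "bounded (h ` {-a..a})" by (intro compact_imp_bounded compact_continuous_image W2D(4)[OF h(1)]) auto
      then obtain S where "\<forall>x\<in>{-a..a}. norm (h x) \<le> S" by (auto simp: bounded_iff simp del: atLeastAtMost_iff)
      then show ?thesis by (intro exI[of _ S]) (metis atLeastAtMost_iff)
    qed
    then obtain S0 where S0: "\<And>x. -a \<le> x \<Longrightarrow> x \<le> a \<Longrightarrow> norm (h x) \<le> S0" by blast
    note oc = outer_comparison[where V=V and T="C10 * N", OF k(1,2) c_def _ a(1) f h[folded V_def] l(1) _ l(3,4) r(1) _ r(3,4)]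
    have jump: "h1 a - rp a = - k * (h a - r a)" "h1 (- a) - lp (- a) = k * (h (- a) - l (- a))"
      by (rule oc(1)[where S=S0] oc(2)[where S=S0]; use V S0 Tl Tr l(2) r(2) in blast)+
    have hb: "norm (- h1 (- a) + k * h (- a)) \<le> c * N"
      unfolding N_def by (rule oc(4)[where S=S0]; use V S0 Tl Tr l(2) r(2) in blast)
    define X where "X = norm (h (- a))"
    have X0: "0 \<le> X" by (simp add: X_def)
    have H1: "norm (h1 (- a)) \<le> kk * X + c * N"
      using norm_triangle_ineq4[of "- h1 (- a) + k * h (- a)" "k * h (- a)"] hb by (simp add: X_def kk_def norm_mult)
    have sm: "2 * C3 * C1 * \<rho> \<le> 1" by (rule small\<rho>[OF K(3)]) (use pos in simp)
    note ri = resonant_interior[OF \<Phi> \<Psi> R u \<theta> \<psi> _ Cp J_def \<omega> en \<rho>_def \<rho>1 a_def \<tau>' f N_def h(1) X_def H1 kk0 c0 C1_def C2_def C3_def C4_def sm C5_def C6_def C7_def]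
    have \<psi>1R: "\<psi>1 R = 1" using \<psi>R[of R] by simp
    obtain S where S: "S \<le> C5 * (X + N)" "\<And>x. -a \<le> x \<Longrightarrow> x \<le> a \<Longrightarrow> norm (h x) \<le> S" using ri(1)[OF _ _ _ _ \<psi>1R] by blast
    define e1 where "e1 = h a - complex_of_real \<theta> * h (- a)"
    define e2 where "e2 = h1 a - h1 (- a) / complex_of_real \<theta> - complex_of_real \<omega> * h (- a)"
    have ri2: "norm (h a - complex_of_real \<theta> * h (- a)) \<le> C6 * \<rho> * (X + N)" by (rule ri(2)[OF _ _ _ _ \<psi>1R])
    have e1b: "norm e1 \<le> C6 * \<tau> * (X + N)"
      unfolding e1_def by (rule order_trans[OF ri2]) (use \<rho>\<tau> pos3 X0 N0 in \<open>intro mult_right_mono mult_left_mono; simp\<close>)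
    have e2b: "norm e2 \<le> C7 * \<tau> * (X + N)" unfolding e2_def by (rule ri(3)[OF _ _ _ _ \<psi>1R])
    define dm where "dm = h (- a) - l (- a)"
    define dp where "dp = h a - r a"
    have dp: "dp = complex_of_real \<theta> * dm + (e1 - g1)" by (simp add: dp_def dm_def e1_def g1_def algebra_simps)
    have "D * dm = - (k * (e1 - g1) + (e2 - g2))"
    proof -
      have "- k * dp = (h1 (- a) - lp (- a)) / complex_of_real \<theta> + complex_of_real \<omega> * dm + (e2 - g2)"
        using jump(1) by (simp add: dp_def dm_def e2_def g2_def algebra_simps diff_divide_distrib)
      also have "h1 (- a) - lp (- a) = k * dm" using jump(2) by (simp add: dm_def)
      finally show ?thesis unfolding dp D_def by (simp add: algebra_simps)
    qed
    then have "norm D * norm dm = norm (k * (e1 - g1) + (e2 - g2))" by (metis norm_minus_cancel norm_mult)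
    also have "\<dots> \<le> kk * (norm e1 + norm g1) + (norm e2 + norm g2)"
      unfolding kk_def by (intro order_trans[OF norm_triangle_ineq] add_mono) (auto simp: norm_mult intro!: mult_left_mono norm_triangle_ineq4)
    also have "\<dots> \<le> kk * (C6 * \<tau> * (X + N) + G1 * \<tau> * (X + N)) + (C7 * \<tau> * (X + N) + G2 * \<tau> * (X + N))"
    proof -
      have "G1 * \<tau> * N \<le> G1 * \<tau> * (X + N)" "G2 * \<tau> * N \<le> G2 * \<tau> * (X + N)"
        using pos9 \<tau>0 X0 by (intro mult_left_mono mult_nonneg_nonneg; simp)+
      then show ?thesis using g1b g2b e1b e2b kk0 by (intro add_mono mult_left_mono) auto
    qed
    also have "\<dots> = norm D * (C13 * \<tau> * (X + N))" using D0 by (simp add: C13_def field_simps)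
    finally have dmX: "norm dm \<le> C13 * \<tau> * (X + N)" using D0 by simp
    have "X \<le> norm dm + norm (l (- a))" unfolding X_def dm_def using norm_triangle_ineq[of "h (- a) - l (- a)" "l (- a)"] by simp
    then have Xdm: "X \<le> norm dm + C10 * N" using Tl[of "-a"] a(1) by simp
    have "norm dm \<le> C13 * \<tau> * norm dm + C13 * \<tau> * ((C10 + 1) * N)"
    proof -
      have "C13 * \<tau> * (X + N) \<le> C13 * \<tau> * (norm dm + (C10 + 1) * N)"
        using Xdm pos10 \<tau>0 by (intro mult_left_mono) (auto simp: algebra_simps)
      then show ?thesis using dmX by (simp add: algebra_simps)
    qed
    moreover have "C13 * \<tau> * norm dm \<le> 1/2 * norm dm" using small[OF K(4)] by (intro mult_right_mono) auto
    ultimately have dmN: "norm dm \<le> C14 * \<tau> * N" by (simp add: C14_def algebra_simps)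
    have XN: "X + N \<le> C15 * N"
    proof -
      have "C14 * \<tau> * N \<le> C14 * 1 * N" using pos11 \<tau>1 N0 by (intro mult_right_mono mult_left_mono) auto
      then show ?thesis using Xdm dmN by (simp add: C15_def algebra_simps)
    qed
    have dpN: "norm dp \<le> C16 * \<tau> * N"
    proof -
      have "norm dp \<le> \<bar>\<theta>\<bar> * norm dm + (norm e1 + norm g1)"
        unfolding dp by (intro order_trans[OF norm_triangle_ineq] add_mono norm_triangle_ineq4) (simp add: norm_mult)
      also have "\<dots> \<le> \<bar>\<theta>\<bar> * (C14 * \<tau> * N) + (C6 * \<tau> * (C15 * N) + G1 * \<tau> * N)"
      proof (intro add_mono mult_left_mono dmN g1b)
        show "norm e1 \<le> C6 * \<tau> * (C15 * N)"
          by (rule order_trans[OF e1b]) (use XN pos3 \<tau>0 in \<open>intro mult_left_mono mult_nonneg_nonneg; simp\<close>)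
      qed simp
      finally show ?thesis by (simp add: C16_def algebra_simps)
    qed
    have SN: "S \<le> C5 * C15 * N" using S(1) mult_left_mono[OF XN pos2] by (simp add: mult_ac)
    have "l2norm UNIV (\<lambda>x. h x - glue l r x) \<le> c * (norm (h (- a) - l (- a)) + norm (h a - r a)) + sqrt (2 * a) * (S + C10 * N)"
      by (rule oc(5)[where S=S]; use V S(2) Tl Tr l(2) r(2) in blast)
    also have "\<dots> \<le> c * (C14 * \<tau> * N + C16 * \<tau> * N) + (C2 * \<tau>) * (C5 * C15 * N + C10 * N)"
    proof (intro add_mono mult_left_mono mult_mono c0)
      show "norm (h (- a) - l (- a)) \<le> C14 * \<tau> * N" using dmN by (simp add: dm_def)
      show "norm (h a - r a) \<le> C16 * \<tau> * N" using dpN by (simp add: dp_def)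
      have "sqrt (2 * a) = C2 * sqrt \<rho>" by (simp add: a_def C2_def real_sqrt_mult)
      also have "\<dots> \<le> C2 * \<tau>" using pos s\<tau> by (intro mult_left_mono) auto
      finally show "sqrt (2 * a) \<le> C2 * \<tau>" .
      show "0 \<le> C2 * \<tau>" using pos \<tau>0 by simp
      show "0 \<le> S + C10 * N" using order_trans[OF norm_ge_zero S(2)[of 0]] a(1) pos7 N0 by simp
    qed (use SN pos7 N0 in auto)
    also have "\<dots> = K0 * \<tau> * N" by (simp add: K0_def algebra_simps)
    also have "\<dots> \<le> K * \<tau> * N" using K(5) \<tau>0 N0 by (intro mult_right_mono) auto
    finally show ?thesis by (simp add: N_def)
  qed
  show ?thesis
  proof (intro exI[of _ K] conjI allI impI)
    show "K > 0" using K(1) by simp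
    fix \<epsilon> \<nu> \<tau> :: real
    assume e: "0 < \<epsilon>" "0 < \<nu>" "\<tau> = sqrt (\<epsilon> + \<nu>) + norm ((LINT t|lebesgue. complex_of_real (\<Psi> t) * (u (\<nu> / \<epsilon> * t))\<^sup>2) - Jlim)" "K * \<tau> < 1"
    show "resolvent_estimate (\<lambda>x. \<Phi> (x / \<epsilon>) / \<epsilon>\<^sup>2 + \<Psi> (x / \<nu>) / \<nu>)
      (\<lambda>a a' b b'. b = complex_of_real \<theta> * a \<and> b' = complex_of_real \<omega> * a + a' / complex_of_real \<theta>) z (K * \<tau>)"
      unfolding resolvent_estimate_def k(2)[symmetric]
      by (intro allI impI, elim conjE, rule main[OF e]; assumption)
  qed
qed

section \<open>Half-bound states and the coupling constant\<close>

text \<open>Bounded affine functions are constant, so \<open>u\<close> is constant with zero derivative on both sides of the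
  support of the potential. A zero limit would mean zero Cauchy data, hence \<open>u = 0\<close>.\<close>

lemma half_bound_state_limits:
  fixes \<Phi> u :: "real \<Rightarrow> real"
  assumes \<Phi>: "\<Phi> \<in> borel_measurable lebesgue" "\<And>x. \<bar>\<Phi> x\<bar> \<le> M" "\<And>x. R \<le> \<bar>x\<bar> \<Longrightarrow> \<Phi> x = 0" "R > 0"
    and hb: "half_bound_state \<Phi> u"
  obtains u1 where "W2 (\<lambda>x. complex_of_real (u x)) u1 (\<lambda>x. complex_of_real (\<Phi> x) * complex_of_real (u x))"
    "\<And>y. y \<ge> R \<Longrightarrow> u y = lim_plus u \<and> u1 y = 0" "\<And>y. y \<le> - R \<Longrightarrow> u y = lim_minus u \<and> u1 y = 0"
    "lim_plus u \<noteq> 0" "lim_minus u \<noteq> 0"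
proof -
  define U where "U x = complex_of_real (u x)" for x
  obtain u' where u': "\<And>x. (u has_vector_derivative u' x) (at x)"
    and int: "\<And>a b. a \<le> b \<Longrightarrow> set_integrable lebesgue {a..b} (\<lambda>x. \<Phi> x *\<^sub>R u x)"
      "\<And>a b. a \<le> b \<Longrightarrow> u' b - u' a = (LINT x:{a..b}|lebesgue. \<Phi> x *\<^sub>R u x)"
    using hb unfolding half_bound_state_def zero_energy_solution_def by blast
  obtain C where C: "\<And>x. \<bar>u x\<bar> \<le> C" using hb unfolding half_bound_state_def bounded_iff by auto
  obtain x0 where x0: "u x0 \<noteq> 0" using hb unfolding half_bound_state_def by blast
  have eq: "(\<lambda>x. indicator A x *\<^sub>R (\<Phi> x *\<^sub>R U x)) = (\<lambda>x. complex_of_real (indicator A x *\<^sub>R (\<Phi> x *\<^sub>R u x)))" for A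
    by (simp add: U_def scaleR_conv_of_real fun_eq_iff)
  have "zero_energy_solution \<Phi> U"
    unfolding zero_energy_solution_def
  proof (intro exI[of _ "\<lambda>x. complex_of_real (u' x)"] conjI allI impI)
    show "(U has_vector_derivative complex_of_real (u' x)) (at x)" for x
      unfolding U_def[abs_def] by (rule bounded_linear.has_vector_derivative[OF bounded_linear_of_real u'])
    fix a b :: real assume ab: "a \<le> b"
    show "set_integrable lebesgue {a..b} (\<lambda>x. \<Phi> x *\<^sub>R U x)"
      using int(1)[OF ab] unfolding set_integrable_def eq complex_of_real_integrable_eq .
    show "complex_of_real (u' b) - complex_of_real (u' a) = (LINT x:{a..b}|lebesgue. \<Phi> x *\<^sub>R U x)"
      using int(2)[OF ab] unfolding set_lebesgue_integral_def eq integral_complex_of_real by (metis of_real_diff)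
  qed
  then obtain u1 where W: "W2 U u1 (\<lambda>x. complex_of_real (\<Phi> x) * U x)"
    unfolding zero_energy_solution_W2 by (auto simp: scaleR_conv_of_real)
  note out = zero_energy_outside[OF W \<Phi>(3,4)]
  have NU: "norm (U x) \<le> C" for x using C by (simp add: U_def)
  have flat: "w = 0" if w: "\<And>t. t \<ge> 0 \<Longrightarrow> norm (w * complex_of_real t) \<le> 2 * C" for w
  proof (rule ccontr)
    assume w0: "w \<noteq> 0"
    have C0: "0 \<le> C" using order_trans[OF norm_ge_zero NU] .
    have t0: "0 \<le> (2 * C + 1) / norm w" using C0 by simp
    have "norm w * ((2 * C + 1) / norm w) \<le> 2 * C"
      using w[OF t0] unfolding norm_mult norm_of_real abs_of_nonneg[OF t0] .
    then show False using w0 by simp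
  qed
  have p0: "u1 R = 0"
  proof (rule flat)
    fix t :: real assume "t \<ge> 0"
    then have "u1 R * complex_of_real t = U (R + t) - U R" using out(2)[of "R + t"] by simp
    then show "norm (u1 R * complex_of_real t) \<le> 2 * C" using norm_triangle_ineq4[of "U (R + t)" "U R"] NU[of R] NU[of "R + t"] by simp
  qed
  have m0: "u1 (- R) = 0"
  proof (rule flat)
    fix t :: real assume "t \<ge> 0"
    then have "u1 (- R) * complex_of_real t = U (- R) - U (- R - t)" using out(4)[of "- R - t"] by simp
    then show "norm (u1 (- R) * complex_of_real t) \<le> 2 * C" using norm_triangle_ineq4[of "U (- R)" "U (- R - t)"] NU[of "- R"] NU[of "- R - t"] by simp
  qed
  have P: "u y = u R \<and> u1 y = 0" if "y \<ge> R" for y using out(1,2)[OF _ that] that p0 out(1)[of y] out(2)[of y] by (simp add: U_def)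
  have N: "u y = u (- R) \<and> u1 y = 0" if "y \<le> - R" for y using that m0 out(3)[of y] out(4)[of y] by (simp add: U_def)
  \<comment> \<open>A solution with zero data at a point is a combination of two independent solutions with both
    Wronskians equal to zero.\<close>
  have zero: False if y: "U y = 0" "u1 y = 0" and v: "W2 v v1 (\<lambda>x. complex_of_real (\<Phi> x) * v x)"
    and s: "W2 s s1 (\<lambda>x. complex_of_real (\<Phi> x) * s x)" and vs: "v y * s1 y - v1 y * s y = 1" for y v v1 s s1
  proof -
    have 1: "U x0 * v1 x0 - u1 x0 * v x0 = 0" "U x0 * s1 x0 - u1 x0 * s x0 = 0" "v x0 * s1 x0 - v1 x0 * s x0 = 1"
      using wronskian_const[OF W v, of x0 y] wronskian_const[OF W s, of x0 y] wronskian_const[OF v s, of x0 y] y vs by auto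
    have "U x0 = U x0 * (v x0 * s1 x0 - v1 x0 * s x0)" using 1(3) by simp
    also have "\<dots> = v x0 * (U x0 * s1 x0 - u1 x0 * s x0) - s x0 * (U x0 * v1 x0 - u1 x0 * v x0)" by (simp add: algebra_simps)
    finally have "U x0 = 0" unfolding 1(1,2) by simp
    then show False using x0 by (simp add: U_def)
  qed
  have p1: "u R \<noteq> 0"
  proof
    assume "u R = 0"
    obtain v v1 where v: "W2 v v1 (\<lambda>y. complex_of_real (\<Phi> y) * v y)" "\<forall>y\<ge>R. v y = 1 + 0 * complex_of_real y \<and> v1 y = 0"
      using zero_energy_right[OF \<Phi>, of 1 0] by blast
    obtain s s1 where s: "W2 s s1 (\<lambda>y. complex_of_real (\<Phi> y) * s y)" "\<forall>y\<ge>R. s y = 0 + 1 * complex_of_real y \<and> s1 y = 1"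
      using zero_energy_right[OF \<Phi>, of 0 1] by blast
    show False by (rule zero[of R, OF _ p0 v(1) s(1)]) (use v(2) s(2) \<open>u R = 0\<close> in \<open>auto simp: U_def\<close>)
  qed
  have m1: "u (- R) \<noteq> 0"
  proof
    assume "u (- R) = 0"
    obtain v v1 where v: "W2 v v1 (\<lambda>y. complex_of_real (\<Phi> y) * v y)" "\<forall>y\<le>-R. v y = 1 + 0 * complex_of_real y \<and> v1 y = 0"
      using zero_energy_left[OF \<Phi>, of 1 0] by blast
    obtain s s1 where s: "W2 s s1 (\<lambda>y. complex_of_real (\<Phi> y) * s y)" "\<forall>y\<le>-R. s y = 0 + 1 * complex_of_real y \<and> s1 y = 1"
      using zero_energy_left[OF \<Phi>, of 0 1] by blast
    show False by (rule zero[of "- R", OF _ m0 v(1) s(1)]) (use v(2) s(2) \<open>u (- R) = 0\<close> in \<open>auto simp: U_def\<close>)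
  qed
  have "(u \<longlongrightarrow> u R) at_top"
    by (rule tendsto_eventually[OF eventually_mono[OF eventually_ge_at_top[of R] P[THEN conjunct1]]])
  then have L: "lim_plus u = u R" by (rule tendsto_Lim[rotated]) simp
  have "(u \<longlongrightarrow> u (- R)) at_bot"
    by (rule tendsto_eventually[OF eventually_mono[OF eventually_le_at_bot[of "- R"] N[THEN conjunct1]]])
  then have L': "lim_minus u = u (- R)" by (rule tendsto_Lim[rotated]) simp
  show thesis
    by (rule that[OF W[unfolded U_def[abs_def]]]; unfold L L') (rule P N p1 m1; assumption?)+
qed

lemma half_bound_state_bounded:
  "half_bound_state V (u :: real \<Rightarrow> real) \<Longrightarrow> \<exists>C. \<forall>x. \<bar>u x\<bar> \<le> C"
  unfolding half_bound_state_def bounded_iff by auto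

text \<open>For large \<open>s\<close> only the limits of \<open>u\<close> are seen, apart from \<open>t = 0\<close>. The integrand is dominated by a
  constant on the support of \<open>\<Psi>\<close>.\<close>

lemma
  fixes \<Psi> u :: "real \<Rightarrow> real"
  assumes \<Psi>: "\<Psi> \<in> borel_measurable lebesgue" "\<And>x. \<bar>\<Psi> x\<bar> \<le> M" "\<And>x. R \<le> \<bar>x\<bar> \<Longrightarrow> \<Psi> x = 0" and R: "R > 0"
    and u: "continuous_on UNIV u" "\<And>x. \<bar>u x\<bar> \<le> C"
  shows weighted_square_isCont: "isCont (\<lambda>s. LINT t|lebesgue. \<Psi> t * (u (s * t))\<^sup>2) s0"
    and weighted_square_at_top: "(\<And>y. y \<ge> R \<Longrightarrow> u y = up) \<Longrightarrow> (\<And>y. y \<le> - R \<Longrightarrow> u y = um) \<Longrightarrow>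
      ((\<lambda>s. LINT t|lebesgue. \<Psi> t * (u (s * t))\<^sup>2) \<longlongrightarrow>
        up\<^sup>2 * (LINT t:{0<..}|lebesgue. \<Psi> t) + um\<^sup>2 * (LINT t:{..<0}|lebesgue. \<Psi> t)) at_top"
proof -
  define w where "w t = indicator {-R..R} t *\<^sub>R (M * C\<^sup>2)" for t :: real
  have w: "integrable lebesgue w" unfolding w_def[abs_def]
    by (rule integrable_scaleR_left, rule integrable_real_indicator) (simp_all add: emeasure_lborel_Icc_eq)
  have M0: "0 \<le> M" using order_trans[OF abs_ge_zero \<Psi>(2)] .
  have bound: "norm (\<Psi> t * (u y)\<^sup>2) \<le> w t" for t y
  proof (cases "t \<in> {-R..R}")
    case True
    have "(u y)\<^sup>2 \<le> C\<^sup>2" using u(2) abs_le_square_iff[of "u y" C] by (metis abs_ge_self order_trans)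
    then have "\<bar>\<Psi> t\<bar> * (u y)\<^sup>2 \<le> M * C\<^sup>2" using \<Psi>(2) M0 by (intro mult_mono) auto
    then show ?thesis using True by (simp add: w_def abs_mult)
  next
    case False
    then have "R \<le> \<bar>t\<bar>" using R by auto
    then show ?thesis using \<Psi>(3) False by (simp add: w_def)
  qed
  have meas: "(\<lambda>t. \<Psi> t * (u (s * t))\<^sup>2) \<in> borel_measurable lebesgue" for s
  proof -
    have "continuous_on UNIV (\<lambda>t. (u (s * t))\<^sup>2)"
      by (intro continuous_intros continuous_on_compose2[OF u(1)]) auto
    then have "(\<lambda>t. (u (s * t))\<^sup>2) \<in> borel_measurable lebesgue" by (rule continuous_lebesgue_measurable)
    then show ?thesis using \<Psi>(1) by simp
  qed
  show "isCont (\<lambda>s. LINT t|lebesgue. \<Psi> t * (u (s * t))\<^sup>2) s0"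
  proof (rule continuous_at_sequentiallyI)
    fix X assume X: "X \<longlonglongrightarrow> s0"
    show "(\<lambda>n. LINT t|lebesgue. \<Psi> t * (u (X n * t))\<^sup>2) \<longlonglongrightarrow> (LINT t|lebesgue. \<Psi> t * (u (s0 * t))\<^sup>2)"
    proof (rule integral_dominated_convergence[OF meas meas w])
      show "AE t in lebesgue. (\<lambda>n. \<Psi> t * (u (X n * t))\<^sup>2) \<longlonglongrightarrow> \<Psi> t * (u (s0 * t))\<^sup>2"
      proof (rule AE_I2)
        fix t
        have "isCont u (s0 * t)" using u(1) by (simp add: continuous_on_eq_continuous_at)
        then have "(\<lambda>n. u (X n * t)) \<longlonglongrightarrow> u (s0 * t)"
          by (rule isCont_tendsto_compose) (intro tendsto_intros X)
        then show "(\<lambda>n. \<Psi> t * (u (X n * t))\<^sup>2) \<longlonglongrightarrow> \<Psi> t * (u (s0 * t))\<^sup>2" by (intro tendsto_intros)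
      qed
    qed (rule AE_I2, rule bound)
  qed
  assume up: "\<And>y. y \<ge> R \<Longrightarrow> u y = up" and um: "\<And>y. y \<le> - R \<Longrightarrow> u y = um"
  define g where "g t = up\<^sup>2 * (indicator {0<..} t *\<^sub>R \<Psi> t) + um\<^sup>2 * (indicator {..<0} t *\<^sub>R \<Psi> t)" for t :: real
  have i\<Psi>: "integrable lebesgue \<Psi>"
  proof (rule Bochner_Integration.integrable_bound[OF _ \<Psi>(1)])
    show "integrable lebesgue (\<lambda>t. indicator {-R..R} t *\<^sub>R M)"
      by (rule integrable_scaleR_left, rule integrable_real_indicator) (simp_all add: emeasure_lborel_Icc_eq)
    show "AE t in lebesgue. norm (\<Psi> t) \<le> norm (indicator {-R..R} t *\<^sub>R M)"
    proof (rule AE_I2)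
      fix t show "norm (\<Psi> t) \<le> norm (indicator {-R..R} t *\<^sub>R M)"
        using \<Psi>(2)[of t] \<Psi>(3)[of t] R by (cases "t \<in> {-R..R}") auto
    qed
  qed
  have i1: "integrable lebesgue (\<lambda>t. indicator {0<..} t *\<^sub>R \<Psi> t)" "integrable lebesgue (\<lambda>t. indicator {..<0} t *\<^sub>R \<Psi> t)"
    by (rule integrable_mult_indicator[OF _ i\<Psi>]; simp)+
  have Lg: "(LINT t|lebesgue. g t) = up\<^sup>2 * (LINT t:{0<..}|lebesgue. \<Psi> t) + um\<^sup>2 * (LINT t:{..<0}|lebesgue. \<Psi> t)"
    unfolding g_def set_lebesgue_integral_def
    by (simp only: Bochner_Integration.integral_add[OF integrable_mult_right[OF i1(1)] integrable_mult_right[OF i1(2)]] integral_mult_right_zero)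
  have gm: "g \<in> borel_measurable lebesgue" unfolding g_def[abs_def]
    by (intro borel_measurable_add borel_measurable_times borel_measurable_const borel_measurable_integrable i1)
  show "((\<lambda>s. LINT t|lebesgue. \<Psi> t * (u (s * t))\<^sup>2) \<longlongrightarrow>
        up\<^sup>2 * (LINT t:{0<..}|lebesgue. \<Psi> t) + um\<^sup>2 * (LINT t:{..<0}|lebesgue. \<Psi> t)) at_top"
    unfolding Lg[symmetric]
  proof (rule tendsto_at_topI_sequentially)
    fix X :: "nat \<Rightarrow> real" assume X: "filterlim X at_top sequentially"
    show "(\<lambda>n. LINT t|lebesgue. \<Psi> t * (u (X n * t))\<^sup>2) \<longlonglongrightarrow> (LINT t|lebesgue. g t)"
    proof (rule integral_dominated_convergence[OF gm meas w])
      show "AE t in lebesgue. (\<lambda>n. \<Psi> t * (u (X n * t))\<^sup>2) \<longlonglongrightarrow> g t"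
        using AE_nonzero
      proof eventually_elim
        fix t :: real assume t: "t \<noteq> 0"
        have "eventually (\<lambda>n. R / \<bar>t\<bar> \<le> X n) sequentially" using X by (simp add: filterlim_at_top)
        then have "eventually (\<lambda>n. \<Psi> t * (u (X n * t))\<^sup>2 = g t) sequentially"
        proof eventually_elim
          fix n assume n: "R / \<bar>t\<bar> \<le> X n"
          then have "R \<le> X n * \<bar>t\<bar>" using t by (simp add: pos_divide_le_eq)
          then show "\<Psi> t * (u (X n * t))\<^sup>2 = g t"
            using up[of "X n * t"] um[of "X n * t"] t by (cases "t > 0") (auto simp: g_def)
        qed
        then show "(\<lambda>n. \<Psi> t * (u (X n * t))\<^sup>2) \<longlonglongrightarrow> g t" by (rule tendsto_eventually)
      qed
    qed (rule AE_I2, rule bound)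
  qed
qed

text \<open>The distinction between \<open>l = 0\<close> and positive \<open>l\<close> disappears here: the formula for \<open>l = 0\<close> is the one
  for positive \<open>l\<close> evaluated at zero, and the integral is continuous in the ratio. A proper
  filter admits only nonnegative limits of the positive numbers \<open>s i\<close>.\<close>

lemma omega_limit:
  fixes \<Psi> u :: "real \<Rightarrow> real" and F :: "'i filter"
  assumes \<Psi>: "\<Psi> \<in> borel_measurable lebesgue" "\<And>x. \<bar>\<Psi> x\<bar> \<le> M" "\<And>x. R \<le> \<bar>x\<bar> \<Longrightarrow> \<Psi> x = 0" and R: "R > 0"
    and u: "continuous_on UNIV u" "\<And>x. \<bar>u x\<bar> \<le> C"
    and up: "\<And>y. y \<ge> R \<Longrightarrow> u y = lim_plus u" and um: "\<And>y. y \<le> - R \<Longrightarrow> u y = lim_minus u"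
    and nz: "lim_plus u \<noteq> 0" "lim_minus u \<noteq> 0"
    and pos: "eventually (\<lambda>i. 0 < s i) F" and l: "((\<lambda>i. ereal (s i)) \<longlongrightarrow> l) F"
  shows "((\<lambda>i. LINT t|lebesgue. \<Psi> t * (u (s i * t))\<^sup>2) \<longlongrightarrow> omega l u \<Psi> * (lim_minus u * lim_plus u)) F"
proof (cases "F = bot")
  case False
  note J = weighted_square_isCont[OF \<Psi> R u] weighted_square_at_top[OF \<Psi> R u up um]
  have "0 \<le> l"
    by (rule tendsto_lowerbound[OF l _ False]) (use pos in \<open>auto elim: eventually_mono\<close>)
  then consider "l = \<infinity>" | r where "l = ereal r" by (cases l) auto
  then show ?thesis
  proof cases
    case 1
    have "filterlim s at_top F" using l unfolding 1 tendsto_PInfty_eq_at_top .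
    moreover have "omega l u \<Psi> * (lim_minus u * lim_plus u) =
      (lim_plus u)\<^sup>2 * (LINT t:{0<..}|lebesgue. \<Psi> t) + (lim_minus u)\<^sup>2 * (LINT t:{..<0}|lebesgue. \<Psi> t)"
      using nz by (simp add: 1 omega_def field_simps power2_eq_square)
    ultimately show ?thesis using filterlim_compose[OF J(2)] by simp
  next
    case 2
    have "(s \<longlongrightarrow> r) F" using l unfolding 2 by simp
    moreover have "omega l u \<Psi> * (lim_minus u * lim_plus u) = (LINT t|lebesgue. \<Psi> t * (u (r * t))\<^sup>2)"
      using nz by (simp add: 2 omega_def zero_ereal_def mult.commute)
    ultimately show ?thesis using isCont_tendsto_compose[OF J(1)] by simp
  qed
qed simp

section \<open>Norm resolvent convergence\<close>

text \<open>The equation \<open>(S\<^sub>V - z) F1 = (S\<^sub>B - z) F2\<close> holds between classes. One representative \<open>f\<close> of the right-hand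
  side is chosen so that the equation for \<open>F1\<close> holds everywhere, and the second derivatives of the two halves of
  \<open>F2\<close> are then redefined on null sets to match it.\<close>

lemma resolvent_difference_bound:
  assumes est: "resolvent_estimate V B z \<kappa>" and V: "V \<in> borel_measurable lebesgue"
    and 1: "(F1, G1) \<in> schroedinger V" and 2: "(F2, G2) \<in> boundary_operator (\<lambda>x. 0) B"
    and eq: "G1 - z *\<^sub>C F1 = G2 - z *\<^sub>C F2"
  shows "norm (F1 - F2) \<le> \<kappa> * norm (G1 - z *\<^sub>C F1)"
proof -
  obtain h h1 h2 where h: "W2 h h1 h2" "h square_integrable_on UNIV" "h1 square_integrable_on UNIV"
    and g: "(\<lambda>x. - h2 x + V x *\<^sub>R h x) square_integrable_on UNIV" and F1: "F1 = abs_l2 h" and G1: "G1 = abs_l2 (\<lambda>x. - h2 x + V x *\<^sub>R h x)"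
    using schroedinger_imp[OF 1 V] by blast
  obtain l lp lq r rp rq where
    l: "W2 l lp lq" "l square_integrable_on {..0}" "lp square_integrable_on {..0}" "lq square_integrable_on {..0}" and
    r: "W2 r rp rq" "r square_integrable_on {0..}" "rp square_integrable_on {0..}" "rq square_integrable_on {0..}" and
    B: "B (l 0) (lp 0) (r 0) (rp 0)" and F2: "F2 = abs_l2 (glue l r)" and
    G2: "G2 = abs_l2 (glue (\<lambda>x. - lq x + 0 *\<^sub>R l x) (\<lambda>x. - rq x + 0 *\<^sub>R r x))"
    by (rule boundary_operatorE[OF 2])
  define f where "f x = (- h2 x + V x *\<^sub>R h x) - z * h x" for x
  define p where "p = glue (\<lambda>x. - lq x) (\<lambda>x. - rq x)"
  have f: "f square_integrable_on UNIV" unfolding f_def[abs_def] by (intro square_integrable_diff g square_integrable_mult h)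
  have p: "p square_integrable_on UNIV" unfolding p_def by (intro glue_sq_int sq_int_uminus l r)
  have q: "glue l r square_integrable_on UNIV" by (intro glue_sq_int l r)
  have pq: "(\<lambda>x. p x - z * glue l r x) square_integrable_on UNIV" by (intro square_integrable_diff p square_integrable_mult q)
  have Y1: "G1 - z *\<^sub>C F1 = abs_l2 f"
    unfolding G1 F1 f_def[abs_def] using g h(2) square_integrable_mult[OF h(2), of z] by (simp add: scaleC_l2.abs_eq minus_l2.abs_eq)
  have "G2 - z *\<^sub>C F2 = abs_l2 (\<lambda>x. p x - z * glue l r x)"
    unfolding G2 F2 using p q square_integrable_mult[OF q, of z] by (simp add: scaleC_l2.abs_eq minus_l2.abs_eq p_def)
  then have ae: "AE x in lebesgue. f x = p x - z * glue l r x"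
    using eq Y1 abs_l2_eq_iff[OF f pq] by simp
  define lq' where "lq' x = (if x < 0 then - z * l x - f x else lq x)" for x
  define rq' where "rq' x = (if x > 0 then - z * r x - f x else rq x)" for x
  have "AE x in lebesgue. lq x = lq' x" using ae by eventually_elim (simp add: lq'_def p_def glue_def)
  then have l': "W2 l lp lq'" by (rule W2_cong_AE[OF l(1)])
  have "AE x in lebesgue. rq x = rq' x" using ae by eventually_elim (simp add: rq'_def p_def glue_def)
  then have r': "W2 r rp rq'" by (rule W2_cong_AE[OF r(1)])
  have h': "W2 h h1 (\<lambda>x. (complex_of_real (V x) - z) * h x - f x)"
    using h(1) by (simp add: f_def scaleR_conv_of_real algebra_simps)
  have "l2norm UNIV (\<lambda>x. h x - glue l r x) \<le> \<kappa> * l2norm UNIV f"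
    using est[unfolded resolvent_estimate_def, rule_format, OF f h' h(2,3) l' _ l(2,3) r' _ r(2,3) B]
    by (simp add: lq'_def rq'_def)
  moreover have "F1 - F2 = abs_l2 (\<lambda>x. h x - glue l r x)" unfolding F1 F2 using h(2) q by (simp add: minus_l2.abs_eq)
  ultimately show ?thesis unfolding Y1 norm_abs_l2[OF f] using norm_abs_l2[OF square_integrable_diff[OF h(2) q]] by simp
qed

lemma resolvent_tendsto:
  assumes S: "is_resolvent S z R" and A: "eventually (\<lambda>i. \<exists>R. is_resolvent (A i) z R) F"
    and bound: "eventually (\<lambda>i. 0 \<le> \<kappa> i \<and> (\<forall>F1 G1 F2 G2. (F1, G1) \<in> A i \<longrightarrow> (F2, G2) \<in> S \<longrightarrow>
      G1 - z *\<^sub>C F1 = G2 - z *\<^sub>C F2 \<longrightarrow> norm (F1 - F2) \<le> \<kappa> i * norm (G1 - z *\<^sub>C F1))) F"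
    and \<kappa>: "(\<kappa> \<longlongrightarrow> 0) F"
  shows "((\<lambda>i. resolvent (A i) z) \<longlongrightarrow> resolvent S z) F"
proof (rule LIM_zero_cancel, rule Lim_null_comparison[OF _ \<kappa>])
  show "eventually (\<lambda>i. norm (resolvent (A i) z - resolvent S z) \<le> \<kappa> i) F"
    using A bound
  proof eventually_elim
    case (elim i)
    obtain Ri where Ri: "is_resolvent (A i) z Ri" using elim(1) by blast
    show ?case unfolding resolvent_eq[OF S] resolvent_eq[OF Ri]
    proof (rule norm_blinfun_bound)
      fix y
      obtain g1 where 1: "(blinfun_apply Ri y, g1) \<in> A i" "g1 - z *\<^sub>C blinfun_apply Ri y = y" using Ri unfolding is_resolvent_def by blast
      obtain g2 where 2: "(blinfun_apply R y, g2) \<in> S" "g2 - z *\<^sub>C blinfun_apply R y = y" using S unfolding is_resolvent_def by blast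
      have "norm (blinfun_apply Ri y - blinfun_apply R y) \<le> \<kappa> i * norm (g1 - z *\<^sub>C blinfun_apply Ri y)"
        using elim(2) 1 2 by metis
      then show "norm (blinfun_apply (Ri - R) y) \<le> \<kappa> i * norm y" unfolding 1(2) by (simp add: blinfun.diff_left)
    qed (use elim in blast)
  qed
qed

lemma scaled_potential:
  fixes \<Phi> \<Psi> :: "real \<Rightarrow> real"
  assumes \<Phi>: "\<Phi> \<in> borel_measurable lebesgue" "\<And>x. \<bar>\<Phi> x\<bar> \<le> M" "\<And>x. R \<le> \<bar>x\<bar> \<Longrightarrow> \<Phi> x = 0"
    and \<Psi>: "\<Psi> \<in> borel_measurable lebesgue" "\<And>x. \<bar>\<Psi> x\<bar> \<le> M" "\<And>x. R \<le> \<bar>x\<bar> \<Longrightarrow> \<Psi> x = 0"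
    and R: "R > 0" and en: "0 < \<epsilon>" "0 < \<nu>" and V: "V = (\<lambda>x. \<Phi> (x / \<epsilon>) / \<epsilon>\<^sup>2 + \<Psi> (x / \<nu>) / \<nu>)"
  shows "V \<in> borel_measurable lebesgue" "\<bar>V x\<bar> \<le> M / \<epsilon>\<^sup>2 + M / \<nu>" "R * (\<epsilon> + \<nu>) \<le> \<bar>x\<bar> \<Longrightarrow> V x = 0"
proof -
  have m: "(\<lambda>x. Q (x / s)) \<in> borel_measurable lebesgue" if "0 < s" "Q \<in> borel_measurable lebesgue" for Q :: "real \<Rightarrow> real" and s
    using borel_measurable_affine[OF that(2), of "1 / s" 0] that(1) by (simp add: divide_inverse mult.commute)
  have "(\<lambda>x. \<Phi> (x / \<epsilon>)) \<in> borel_measurable lebesgue" "(\<lambda>x. \<Psi> (x / \<nu>)) \<in> borel_measurable lebesgue"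
    using m en \<Phi>(1) \<Psi>(1) by blast+
  then show "V \<in> borel_measurable lebesgue" unfolding V by measurable
  have "\<bar>V x\<bar> \<le> \<bar>\<Phi> (x / \<epsilon>) / \<epsilon>\<^sup>2\<bar> + \<bar>\<Psi> (x / \<nu>) / \<nu>\<bar>" unfolding V by (rule abs_triangle_ineq)
  also have "\<dots> \<le> M / \<epsilon>\<^sup>2 + M / \<nu>" using \<Phi>(2) \<Psi>(2) en by (intro add_mono) (auto simp: abs_div intro!: divide_right_mono)
  finally show "\<bar>V x\<bar> \<le> M / \<epsilon>\<^sup>2 + M / \<nu>" .
  assume x: "R * (\<epsilon> + \<nu>) \<le> \<bar>x\<bar>"
  have "R * \<epsilon> \<le> \<bar>x\<bar>" "R * \<nu> \<le> \<bar>x\<bar>"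
    by (rule order_trans[OF _ x]; use R en in \<open>simp add: mult_left_mono\<close>)+
  then have "R \<le> \<bar>x / \<epsilon>\<bar>" "R \<le> \<bar>x / \<nu>\<bar>" using en by (simp_all add: abs_div pos_le_divide_eq)
  then show "V x = 0" using \<Phi>(3) \<Psi>(3) by (simp add: V)
qed

lemma linear_bcI:
  "(\<And>a a' b b'. B a a' b b' \<longleftrightarrow> m1 * a + m2 * a' + m3 * b + m4 * b' = 0 \<and> n1 * a + n2 * a' + n3 * b + n4 * b' = 0) \<Longrightarrow> linear_bc B"
  unfolding linear_bc_def by blast

text \<open>Symmetry and linearity of the coupling provide the resolvents; the estimate then compares them.\<close>

lemma norm_resolvent_convergence_of_estimate:
  fixes \<Phi> \<Psi> :: "real \<Rightarrow> real" and F :: "'i filter"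
  assumes \<Phi>: "\<Phi> \<in> borel_measurable lebesgue" "\<And>x. \<bar>\<Phi> x\<bar> \<le> M" "\<And>x. R \<le> \<bar>x\<bar> \<Longrightarrow> \<Phi> x = 0"
    and \<Psi>: "\<Psi> \<in> borel_measurable lebesgue" "\<And>x. \<bar>\<Psi> x\<bar> \<le> M" "\<And>x. R \<le> \<bar>x\<bar> \<Longrightarrow> \<Psi> x = 0" and R: "R > 0"
    and pos: "eventually (\<lambda>i. 0 < \<epsilon> i) F" "eventually (\<lambda>i. 0 < \<nu> i) F"
    and lin: "linear_bc B" and sym: "\<And>a a' b b'. B a a' b b' \<Longrightarrow> Im (cnj a * a') = Im (cnj b * b')"
    and est: "\<And>z. Im z \<noteq> 0 \<Longrightarrow> \<exists>\<kappa>. (\<kappa> \<longlongrightarrow> 0) F \<and> eventually (\<lambda>i. 0 \<le> \<kappa> i \<and>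
      resolvent_estimate (\<lambda>x. \<Phi> (x / \<epsilon> i) / (\<epsilon> i)\<^sup>2 + \<Psi> (x / \<nu> i) / \<nu> i) B z (\<kappa> i)) F"
  shows "norm_resolvent_convergence (\<lambda>i. schroedinger (\<lambda>x. \<Phi> (x / \<epsilon> i) / (\<epsilon> i)\<^sup>2 + \<Psi> (x / \<nu> i) / \<nu> i)) (boundary_operator (\<lambda>x. 0) B) F"
    (is "norm_resolvent_convergence ?A ?S F")
  unfolding norm_resolvent_convergence_def
proof (intro allI impI)
  fix z :: complex assume "z \<notin> \<real>"
  then have z: "Im z \<noteq> 0" by (simp add: complex_is_Real_iff)
  have "\<exists>R. is_resolvent ?S z R"
    by (rule boundary_operator_resolvent[where M=0 and a=1, OF _ _ _ _ lin sym z]) auto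
  then obtain R0 where R0: "is_resolvent ?S z R0" by blast
  have ex: "eventually (\<lambda>i. \<exists>R. is_resolvent (?A i) z R) F"
    using pos
  proof eventually_elim
    case (elim i)
    define V where "V = (\<lambda>x. \<Phi> (x / \<epsilon> i) / (\<epsilon> i)\<^sup>2 + \<Psi> (x / \<nu> i) / \<nu> i)"
    have V: "V \<in> borel_measurable lebesgue" "\<And>x. \<bar>V x\<bar> \<le> M / (\<epsilon> i)\<^sup>2 + M / \<nu> i" "\<And>x. R * (\<epsilon> i + \<nu> i) \<le> \<bar>x\<bar> \<Longrightarrow> V x = 0"
      by (rule scaled_potential[OF \<Phi> \<Psi> R elim V_def]; assumption)+
    have Rp: "0 < R * (\<epsilon> i + \<nu> i)" using R elim by simp
    have lin': "linear_bc (\<lambda>a a' b b'. a = b \<and> a' = b')"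
      by (rule linear_bcI[of _ 1 0 "-1" 0 0 1 0 "-1"]) simp
    show ?case unfolding V_def[symmetric] schroedinger_eq[OF V(1,2)]
      by (rule boundary_operator_resolvent[OF V(1,2) _ Rp lin' _ z]) (use V(3) in auto)
  qed
  obtain \<kappa> where \<kappa>: "(\<kappa> \<longlongrightarrow> 0) F" and ev: "eventually (\<lambda>i. 0 \<le> \<kappa> i \<and>
      resolvent_estimate (\<lambda>x. \<Phi> (x / \<epsilon> i) / (\<epsilon> i)\<^sup>2 + \<Psi> (x / \<nu> i) / \<nu> i) B z (\<kappa> i)) F"
    using est[OF z] by blast
  have bd: "eventually (\<lambda>i. 0 \<le> \<kappa> i \<and> (\<forall>F1 G1 F2 G2. (F1, G1) \<in> ?A i \<longrightarrow> (F2, G2) \<in> ?S \<longrightarrow>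
      G1 - z *\<^sub>C F1 = G2 - z *\<^sub>C F2 \<longrightarrow> norm (F1 - F2) \<le> \<kappa> i * norm (G1 - z *\<^sub>C F1))) F"
    using pos ev
  proof eventually_elim
    case (elim i)
    note V = scaled_potential[OF \<Phi> \<Psi> R elim(1,2) refl]
    show ?case
    proof (intro conjI allI impI)
      show "0 \<le> \<kappa> i" using elim(3) by blast
      fix F1 G1 F2 G2
      assume "(F1, G1) \<in> ?A i" "(F2, G2) \<in> ?S" "G1 - z *\<^sub>C F1 = G2 - z *\<^sub>C F2"
      then show "norm (F1 - F2) \<le> \<kappa> i * norm (G1 - z *\<^sub>C F1)"
        using resolvent_difference_bound[OF elim(3)[THEN conjunct2] V(1)] by blast
    qed
  qed
  show "z \<in> resolvent_set ?S \<and> (\<forall>\<^sub>F i in F. z \<in> resolvent_set (?A i)) \<and> ((\<lambda>i. resolvent (?A i) z) \<longlongrightarrow> resolvent ?S z) F"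
    using R0 ex resolvent_tendsto[OF R0 ex bd \<kappa>] by (auto simp: resolvent_set_def)
qed

lemma compactly_supported_bound:
  assumes "bounded (range Q)" "Q compactly_supported_in UNIV"
  obtains M R where "\<And>x. \<bar>Q x\<bar> \<le> M" "\<And>x. R \<le> \<bar>x\<bar> \<Longrightarrow> Q x = 0"
proof -
  obtain M where M: "\<And>x. \<bar>Q x\<bar> \<le> M" using assms(1) unfolding bounded_iff by auto
  have "bounded {x. Q x \<noteq> 0}" using assms(2) unfolding compactly_supported_in_def
    by (meson bounded_subset closure_subset compact_imp_bounded)
  then obtain a where a: "\<And>x. Q x \<noteq> 0 \<Longrightarrow> \<bar>x\<bar> \<le> a" unfolding bounded_iff by auto
  have "Q x = 0" if "a + 1 \<le> \<bar>x\<bar>" for x using a[of x] that by linarith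
  with M that show thesis by blast
qed

theorem mainTheorem1:
  fixes \<Phi> \<Psi> :: "real \<Rightarrow> real" and \<alpha> \<beta> :: real
    and \<epsilon> \<nu> :: "'i \<Rightarrow> real" and F :: "'i filter" and l :: ereal
  assumes "\<Phi> \<in> borel_measurable lebesgue" "bounded (range \<Phi>)" "\<Phi> compactly_supported_in UNIV"
    and "\<Psi> \<in> borel_measurable lebesgue" "bounded (range \<Psi>)" "\<Psi> compactly_supported_in UNIV"
    and "filterlim \<epsilon> (at_right 0) F" "filterlim \<nu> (at_right 0) F"
    and "((\<lambda>i. ereal (\<nu> i / \<epsilon> i)) \<longlongrightarrow> l) F"
  shows
    "(\<not> resonant (\<lambda>x. \<alpha> * \<Phi> x) \<longrightarrow>
       norm_resolvent_convergence (\<lambda>i. scaled_operator \<Phi> \<Psi> \<alpha> \<beta> (\<epsilon> i) (\<nu> i))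
         (direct_sum (dirichlet {..<0}) (dirichlet {0<..})) F) \<and>
     (\<forall>u :: real \<Rightarrow> real. half_bound_state (\<lambda>x. \<alpha> * \<Phi> x) u \<longrightarrow>
       norm_resolvent_convergence (\<lambda>i. scaled_operator \<Phi> \<Psi> \<alpha> \<beta> (\<epsilon> i) (\<nu> i))
         (point_interaction (vector [vector [theta u, 0],
                                     vector [\<beta> * omega l u \<Psi>, inverse (theta u)]])) F)"
proof -
  obtain M1 R1 where 1: "\<And>x. \<bar>\<Phi> x\<bar> \<le> M1" "\<And>x. R1 \<le> \<bar>x\<bar> \<Longrightarrow> \<Phi> x = 0"
    using compactly_supported_bound[OF assms(2,3)] by blast
  obtain M2 R2 where 2: "\<And>x. \<bar>\<Psi> x\<bar> \<le> M2" "\<And>x. R2 \<le> \<bar>x\<bar> \<Longrightarrow> \<Psi> x = 0"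
    using compactly_supported_bound[OF assms(5,6)] by blast
  define R where "R = max 1 (max R1 R2)"
  define M where "M = max (\<bar>\<alpha>\<bar> * M1) (\<bar>\<beta>\<bar> * M2)"
  define \<Phi>0 where "\<Phi>0 x = \<alpha> * \<Phi> x" for x
  define \<Psi>0 where "\<Psi>0 x = \<beta> * \<Psi> x" for x
  have R: "R > 0" by (simp add: R_def)
  have \<Phi>0: "\<Phi>0 \<in> borel_measurable lebesgue" "\<And>x. \<bar>\<Phi>0 x\<bar> \<le> M" "\<And>x. R \<le> \<bar>x\<bar> \<Longrightarrow> \<Phi>0 x = 0"
  proof -
    show "\<Phi>0 \<in> borel_measurable lebesgue" unfolding \<Phi>0_def[abs_def] using assms(1) by measurable
    show "\<bar>\<Phi>0 x\<bar> \<le> M" for x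
      unfolding \<Phi>0_def abs_mult M_def by (rule max.coboundedI1) (intro mult_left_mono 1, simp)
    show "\<Phi>0 x = 0" if "R \<le> \<bar>x\<bar>" for x using 1(2)[of x] that by (simp add: \<Phi>0_def R_def)
  qed
  have \<Psi>0: "\<Psi>0 \<in> borel_measurable lebesgue" "\<And>x. \<bar>\<Psi>0 x\<bar> \<le> M" "\<And>x. R \<le> \<bar>x\<bar> \<Longrightarrow> \<Psi>0 x = 0"
  proof -
    show "\<Psi>0 \<in> borel_measurable lebesgue" unfolding \<Psi>0_def[abs_def] using assms(4) by measurable
    show "\<bar>\<Psi>0 x\<bar> \<le> M" for x
      unfolding \<Psi>0_def abs_mult M_def by (rule max.coboundedI2) (intro mult_left_mono 2, simp)
    show "\<Psi>0 x = 0" if "R \<le> \<bar>x\<bar>" for x using 2(2)[of x] that by (simp add: \<Psi>0_def R_def)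
  qed
  have op: "scaled_operator \<Phi> \<Psi> \<alpha> \<beta> \<epsilon>' \<nu>' = schroedinger (\<lambda>x. \<Phi>0 (x / \<epsilon>') / \<epsilon>'\<^sup>2 + \<Psi>0 (x / \<nu>') / \<nu>')" for \<epsilon>' \<nu>'
    by (simp add: scaled_operator_def \<Phi>0_def \<Psi>0_def)
  have \<Phi>0_eq: "(\<lambda>x. \<alpha> * \<Phi> x) = \<Phi>0" by (simp add: \<Phi>0_def fun_eq_iff)
  have pos: "eventually (\<lambda>i. 0 < \<epsilon> i) F" "eventually (\<lambda>i. 0 < \<nu> i) F"
    using assms(7,8) by (auto simp: filterlim_at elim: eventually_mono)
  have lim: "(\<epsilon> \<longlongrightarrow> 0) F" "(\<nu> \<longlongrightarrow> 0) F" using assms(7,8) by (simp_all add: filterlim_at)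
  have lim': "((\<lambda>i. sqrt (\<epsilon> i + \<nu> i)) \<longlongrightarrow> 0) F" "((\<lambda>i. \<epsilon> i + \<nu> i) \<longlongrightarrow> 0) F"
    using tendsto_real_sqrt[OF tendsto_add[OF lim]] tendsto_add[OF lim] by simp_all
  note conv = norm_resolvent_convergence_of_estimate[OF \<Phi>0 \<Psi>0 R pos]
  show ?thesis
    unfolding op \<Phi>0_eq
  proof (intro conjI impI allI)
    assume nres: "\<not> resonant \<Phi>0"
    show "norm_resolvent_convergence (\<lambda>i. schroedinger (\<lambda>x. \<Phi>0 (x / \<epsilon> i) / (\<epsilon> i)\<^sup>2 + \<Psi>0 (x / \<nu> i) / \<nu> i))
      (direct_sum (dirichlet {..<0}) (dirichlet {0<..})) F"
      unfolding direct_sum_eq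
    proof (rule conv)
      show "linear_bc (\<lambda>a a' b b'. a = 0 \<and> b = 0)" by (rule linear_bcI[of _ 1 0 0 0 0 0 1 0]) simp
      show "Im (cnj a * a') = Im (cnj b * b')" if "a = 0 \<and> b = 0" for a a' b b' using that by simp
      fix z :: complex assume "Im z \<noteq> 0"
      note k = csqrt_neg_nonreal[OF this]
      have "\<exists>K>0. \<forall>\<epsilon> \<nu>. 0 < \<epsilon> \<longrightarrow> 0 < \<nu> \<longrightarrow> K * (\<epsilon> + \<nu>) < 1 \<longrightarrow>
          resolvent_estimate (\<lambda>x. \<Phi>0 (x / \<epsilon>) / \<epsilon>\<^sup>2 + \<Psi>0 (x / \<nu>) / \<nu>) (\<lambda>a a' b b'. a = 0 \<and> b = 0) z (K * sqrt (\<epsilon> + \<nu>))"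
        by (rule nonresonant_estimate[OF \<Phi>0 \<Psi>0 R nres k(1,2)])
      then obtain K where K: "K > 0" and est: "\<And>\<epsilon> \<nu>. 0 < \<epsilon> \<Longrightarrow> 0 < \<nu> \<Longrightarrow> K * (\<epsilon> + \<nu>) < 1 \<Longrightarrow>
          resolvent_estimate (\<lambda>x. \<Phi>0 (x / \<epsilon>) / \<epsilon>\<^sup>2 + \<Psi>0 (x / \<nu>) / \<nu>) (\<lambda>a a' b b'. a = 0 \<and> b = 0) z (K * sqrt (\<epsilon> + \<nu>))"
        by blast
      have "((\<lambda>i. K * (\<epsilon> i + \<nu> i)) \<longlongrightarrow> 0) F" by (rule tendsto_mult_right_zero[OF lim'(2)])
      then have sm: "eventually (\<lambda>i. K * (\<epsilon> i + \<nu> i) < 1) F" by (rule order_tendstoD(2)) simp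
      show "\<exists>\<kappa>. (\<kappa> \<longlongrightarrow> 0) F \<and> (\<forall>\<^sub>F i in F. 0 \<le> \<kappa> i \<and>
        resolvent_estimate (\<lambda>x. \<Phi>0 (x / \<epsilon> i) / (\<epsilon> i)\<^sup>2 + \<Psi>0 (x / \<nu> i) / \<nu> i) (\<lambda>a a' b b'. a = 0 \<and> b = 0) z (\<kappa> i))"
      proof (intro exI[of _ "\<lambda>i. K * sqrt (\<epsilon> i + \<nu> i)"] conjI)
        show "((\<lambda>i. K * sqrt (\<epsilon> i + \<nu> i)) \<longlongrightarrow> 0) F" by (rule tendsto_mult_right_zero[OF lim'(1)])
        show "\<forall>\<^sub>F i in F. 0 \<le> K * sqrt (\<epsilon> i + \<nu> i) \<and>
          resolvent_estimate (\<lambda>x. \<Phi>0 (x / \<epsilon> i) / (\<epsilon> i)\<^sup>2 + \<Psi>0 (x / \<nu> i) / \<nu> i) (\<lambda>a a' b b'. a = 0 \<and> b = 0) z (K * sqrt (\<epsilon> i + \<nu> i))"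
          using pos sm by eventually_elim (use K est in auto)
      qed
    qed
  next
    fix u :: "real \<Rightarrow> real" assume hb: "half_bound_state \<Phi>0 u"
    define \<theta> where "\<theta> = theta u"
    define \<omega> where "\<omega> = \<beta> * omega l u \<Psi>"
    obtain C where C: "\<And>x. \<bar>u x\<bar> \<le> C" using hb half_bound_state_bounded by blast
    obtain u1 where W: "W2 (\<lambda>x. complex_of_real (u x)) u1 (\<lambda>x. complex_of_real (\<Phi>0 x) * complex_of_real (u x))"
      and up: "\<And>y. y \<ge> R \<Longrightarrow> u y = lim_plus u \<and> u1 y = 0" and um: "\<And>y. y \<le> - R \<Longrightarrow> u y = lim_minus u \<and> u1 y = 0"
      and nz: "lim_plus u \<noteq> 0" "lim_minus u \<noteq> 0"
      by (rule half_bound_state_limits[OF \<Phi>0 R hb]) blast+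
    have \<theta>0: "\<theta> \<noteq> 0" using nz by (simp add: \<theta>_def theta_def)
    have "continuous_on UNIV (\<lambda>x. Re (complex_of_real (u x)))"
      by (intro continuous_on_Re W2D(4)[OF W])
    then have cont: "continuous_on UNIV u" by simp
    define J where "J s = (LINT t|lebesgue. \<Psi>0 t * (u (s * t))\<^sup>2)" for s
    define Jlim where "Jlim = \<omega> * (lim_minus u * lim_plus u)"
    have "((\<lambda>i. LINT t|lebesgue. \<Psi> t * (u (\<nu> i / \<epsilon> i * t))\<^sup>2) \<longlongrightarrow> omega l u \<Psi> * (lim_minus u * lim_plus u)) F"
    proof (rule omega_limit[where M=M2 and R=R, OF assms(4) 2(1) _ R cont C _ _ nz _ assms(9)])
      show "\<Psi> x = 0" if "R \<le> \<bar>x\<bar>" for x using 2(2)[of x] that by (simp add: R_def)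
      show "eventually (\<lambda>i. 0 < \<nu> i / \<epsilon> i) F" using pos by eventually_elim simp
    qed (use up um in blast)+
    then have "((\<lambda>i. \<beta> * (LINT t|lebesgue. \<Psi> t * (u (\<nu> i / \<epsilon> i * t))\<^sup>2)) \<longlongrightarrow> \<beta> * (omega l u \<Psi> * (lim_minus u * lim_plus u))) F"
      by (rule tendsto_mult_left)
    then have "((\<lambda>i. J (\<nu> i / \<epsilon> i)) \<longlongrightarrow> Jlim) F"
      by (simp add: J_def Jlim_def \<omega>_def \<Psi>0_def mult.assoc)
    then have limJ: "((\<lambda>i. \<bar>J (\<nu> i / \<epsilon> i) - Jlim\<bar>) \<longlongrightarrow> 0) F"
      by (intro tendsto_rabs_zero LIM_zero)
    have Jc: "(LINT t|lebesgue. complex_of_real (\<Psi>0 t) * (complex_of_real (u (s * t)))\<^sup>2) = complex_of_real (J s)" for s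
      unfolding J_def integral_complex_of_real[symmetric] by simp
    define B where "B a a' b b' \<longleftrightarrow> b = complex_of_real \<theta> * a \<and> b' = complex_of_real \<omega> * a + complex_of_real (inverse \<theta>) * a'" for a a' b b'
    have B_eq: "B = (\<lambda>a a' b b'. b = complex_of_real \<theta> * a \<and> b' = complex_of_real \<omega> * a + a' / complex_of_real \<theta>)"
      by (simp add: B_def fun_eq_iff divide_inverse mult.commute)
    have "norm_resolvent_convergence (\<lambda>i. schroedinger (\<lambda>x. \<Phi>0 (x / \<epsilon> i) / (\<epsilon> i)\<^sup>2 + \<Psi>0 (x / \<nu> i) / \<nu> i)) (boundary_operator (\<lambda>x. 0) B) F"
    proof (rule conv)
      show "linear_bc B" unfolding B_def[abs_def]
        by (rule linear_bcI[of _ "complex_of_real \<theta>" 0 "-1" 0 "complex_of_real \<omega>" "complex_of_real (inverse \<theta>)" 0 "-1"]) auto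
      show "Im (cnj a * a') = Im (cnj b * b')" if "B a a' b b'" for a a' b b'
      proof -
        have "cnj b * b' = complex_of_real (\<theta> * \<omega>) * (cnj a * a) + cnj a * a'"
          using that \<theta>0 unfolding B_def by (simp add: algebra_simps)
        moreover have "Im (cnj a * a) = 0" by simp
        ultimately show ?thesis by (simp only: plus_complex.sel Im_complex_of_real times_complex.sel Re_complex_of_real)
      qed
      fix z :: complex assume "Im z \<noteq> 0"
      note k = csqrt_neg_nonreal[OF this]
      define \<tau> where "\<tau> i = sqrt (\<epsilon> i + \<nu> i) + \<bar>J (\<nu> i / \<epsilon> i) - Jlim\<bar>" for i
      have "\<exists>K>0. \<forall>\<epsilon> \<nu> \<tau>. 0 < \<epsilon> \<longrightarrow> 0 < \<nu> \<longrightarrow> \<tau> = sqrt (\<epsilon> + \<nu>) + norm (complex_of_real (J (\<nu> / \<epsilon>)) - complex_of_real Jlim) \<longrightarrow>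
          K * \<tau> < 1 \<longrightarrow> resolvent_estimate (\<lambda>x. \<Phi>0 (x / \<epsilon>) / \<epsilon>\<^sup>2 + \<Psi>0 (x / \<nu>) / \<nu>) B z (K * \<tau>)"
      proof -
        have \<omega>': "complex_of_real \<omega> * (complex_of_real (lim_minus u) * complex_of_real (lim_plus u)) = complex_of_real Jlim"
          by (simp add: Jlim_def)
        have \<theta>': "complex_of_real (lim_plus u) = complex_of_real \<theta> * complex_of_real (lim_minus u)"
          using nz by (simp add: \<theta>_def theta_def)
        show ?thesis
          unfolding B_eq Jc[symmetric] by (rule resonant_estimate[OF \<Phi>0 \<Psi>0 R W _ _ _ _ _ \<theta>' \<omega>' k]) (use up um nz C in auto)
      qed
      then obtain K where K: "K > 0" and est: "\<And>i. 0 < \<epsilon> i \<Longrightarrow> 0 < \<nu> i \<Longrightarrow> K * \<tau> i < 1 \<Longrightarrow>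
          resolvent_estimate (\<lambda>x. \<Phi>0 (x / \<epsilon> i) / (\<epsilon> i)\<^sup>2 + \<Psi>0 (x / \<nu> i) / \<nu> i) B z (K * \<tau> i)"
        unfolding \<tau>_def of_real_diff[symmetric] norm_of_real by blast
      have \<tau>: "((\<lambda>i. K * \<tau> i) \<longlongrightarrow> 0) F"
        unfolding \<tau>_def using tendsto_mult_right_zero[OF tendsto_add_zero[OF lim'(1) limJ]] .
      then have sm: "eventually (\<lambda>i. K * \<tau> i < 1) F" by (rule order_tendstoD(2)) simp
      show "\<exists>\<kappa>. (\<kappa> \<longlongrightarrow> 0) F \<and> (\<forall>\<^sub>F i in F. 0 \<le> \<kappa> i \<and>
        resolvent_estimate (\<lambda>x. \<Phi>0 (x / \<epsilon> i) / (\<epsilon> i)\<^sup>2 + \<Psi>0 (x / \<nu> i) / \<nu> i) B z (\<kappa> i))"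
      proof (intro exI[of _ "\<lambda>i. K * \<tau> i"] conjI \<tau>)
        show "\<forall>\<^sub>F i in F. 0 \<le> K * \<tau> i \<and> resolvent_estimate (\<lambda>x. \<Phi>0 (x / \<epsilon> i) / (\<epsilon> i)\<^sup>2 + \<Psi>0 (x / \<nu> i) / \<nu> i) B z (K * \<tau> i)"
          using pos sm by eventually_elim (use K est in \<open>auto simp: \<tau>_def\<close>)
      qed
    qed
    then show "norm_resolvent_convergence (\<lambda>i. schroedinger (\<lambda>x. \<Phi>0 (x / \<epsilon> i) / (\<epsilon> i)\<^sup>2 + \<Psi>0 (x / \<nu> i) / \<nu> i))
        (point_interaction (vector [vector [theta u, 0], vector [\<beta> * omega l u \<Psi>, inverse (theta u)]])) F"
      unfolding point_interaction_eq B_def[abs_def] \<theta>_def \<omega>_def .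
  qed
qed

end
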